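(* Let $d=3$, $k\ge2$, with discrete spaces and bilinear forms as in the context. Suppose $(u,\sigma,p)$ is the exact solution of the Stokes problem $\nu^{-1}\operatorname{dev}\sigma-\nabla u=0$, $\operatorname{div}(\sigma)-\nabla p=-f$, $\operatorname{div}(u)=0$ in $\Omega$, $u=0$ on $\partial\Omega$, with $u\in H^1(\Omega,\mathbb{R}^3)$, $\sigma\in H^1(\Omega,\mathbb{R}^{3\times3})$, $p\in L^2_0(\Omega)$, and let $\psi\in\Psi$ be the exact stream function with $\operatorname{curl}(\psi)=u$. Then \[a(\sigma,\tau_h)+b(\tau_h,\operatorname{curl}(\psi))+b(\sigma,\operatorname{curl}(\phi_h))=-\int_\Omega f\cdot\operatorname{curl}(\phi_h)\,dx\] for all $\tau_h\in\Sigma_h^{k-1}$ and all $\phi_h\in W_h^k$.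
   Context: $\Omega\subset\mathbb{R}^3$ bounded simply connected Lipschitz domain, $\nu>0$ constant, $f\in L^2(\Omega,\mathbb{R}^3)$; $\operatorname{dev}\tau:=\tau-\frac13(\operatorname{tr}\tau)\mathrm{Id}$; $L^2_0(\Omega)$ the mean-zero $L^2$ functions. $\Psi:=\{\phi\in L^2(\Omega,\mathbb{R}^3):\operatorname{div}\phi\in H^1(\Omega),\ \operatorname{curl}\phi\in H_0^1(\Omega,\mathbb{R}^3),\ \phi\times n=0 \text{ on }\partial\Omega\}$. $\mathcal{T}$ shape-regular quasi-uniform tetrahedral triangulation with mesh size $h$, $\mathcal{F}$ its facets (interior and boundary); on facets $n$ is a unit normal (outward on $\partial\Omega$), $[\![\cdot]\!]$ the jump (the trace on boundary facets). For vectors $v_t:=v-(v\cdot n)n$; for matrices $\tau_{nn}:=n^T\tau n$, $\tau_{nt}:=\tau n-\tau_{nn}n$. $W_h^k:=\mathcal{P}^k(\mathcal{T},\mathbb{R}^3)\cap H_0(\operatorname{curl},\Omega)$; $\Sigma_h^k:=\{\sigma_h\in\mathcal{P}^k(\mathcal{T},\mathbb{R}^{3\times3}):\operatorname{tr}\sigma_h=0,\ [\![(\sigma_h)_{nt}]\!]=0 \text{ and } (\sigma_h)_{nt}|_F\in\mathcal{P}^{k-1}(F,\mathbb{R}^3)\ \forall F\}$, where $\mathcal{P}^k$ denotes (piecewise) polynomials of degree $\le k$. Forms (for $\tau$ piecewise $H^1$ with single-valued $\tau_{nt}$ on facets and $v$ piecewise $H^1$): $a(\sigma,\tau):=\frac1\nu\int_\Omega\sigma:\tau\,dx$,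 $b(\tau,v):=-\sum_{T}\int_T\tau:\nabla v\,dx+\sum_{F}\int_F\tau_{nt}\cdot[\![v_t]\!]\,ds$. *)

theory Defs
  imports "HOL-Analysis.Analysis"
begin

type_synonym pt = "real^3"
type_synonym mat3 = "real^3^3"

definition cpartial :: "3 \<Rightarrow> (pt \<Rightarrow> real) \<Rightarrow> pt \<Rightarrow> real" where
  "cpartial i g x = frechet_derivative g (at x) (axis i 1)"

fun iter_partial :: "3 list \<Rightarrow> (pt \<Rightarrow> real) \<Rightarrow> pt \<Rightarrow> real" where
  "iter_partial [] g = g"
| "iter_partial (i # is) g = cpartial i (iter_partial is g)"

definition smooth :: "(pt \<Rightarrow> real) \<Rightarrow> bool" where
  "smooth g \<longleftrightarrow> (\<forall>is x. iter_partial is g differentiable (at x))"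

definition smoothvec :: "(pt \<Rightarrow> real^3) \<Rightarrow> bool" where
  "smoothvec w \<longleftrightarrow> (\<forall>i. smooth (\<lambda>x. w x $ i))"

definition test_fun :: "pt set \<Rightarrow> (pt \<Rightarrow> real) \<Rightarrow> bool" where
  "test_fun U g \<longleftrightarrow> smooth g \<and> compact (closure {x. g x \<noteq> 0}) \<and> closure {x. g x \<noteq> 0} \<subseteq> U"

definition testvec :: "pt set \<Rightarrow> (pt \<Rightarrow> real^3) \<Rightarrow> bool" where
  "testvec U w \<longleftrightarrow> (\<forall>i. test_fun U (\<lambda>x. w x $ i))"

definition cgrad :: "(pt \<Rightarrow> real) \<Rightarrow> pt \<Rightarrow> real^3" where
  "cgrad g x = (\<chi> i. cpartial i g x)"

definition ccurl :: "(pt \<Rightarrow> real^3) \<Rightarrow> pt \<Rightarrow> real^3" where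
  "ccurl w x = vector
     [cpartial 2 (\<lambda>y. w y $ 3) x - cpartial 3 (\<lambda>y. w y $ 2) x,
      cpartial 3 (\<lambda>y. w y $ 1) x - cpartial 1 (\<lambda>y. w y $ 3) x,
      cpartial 1 (\<lambda>y. w y $ 2) x - cpartial 2 (\<lambda>y. w y $ 1) x]"

definition L2 :: "pt set \<Rightarrow> (pt \<Rightarrow> 'b::real_normed_vector) \<Rightarrow> bool" where
  "L2 U f \<longleftrightarrow> set_borel_measurable lebesgue U f \<and> set_integrable lebesgue U (\<lambda>x. (norm (f x))\<^sup>2)"

definition is_wpartial :: "pt set \<Rightarrow> 3 \<Rightarrow> (pt \<Rightarrow> real) \<Rightarrow> (pt \<Rightarrow> real) \<Rightarrow> bool" where
  "is_wpartial U i w d \<longleftrightarrow> L2 U d \<and>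
     (\<forall>\<phi>. test_fun U \<phi> \<longrightarrow>
        (LINT x:U|lebesgue. w x * cpartial i \<phi> x) = - (LINT x:U|lebesgue. d x * \<phi> x))"

definition wpartial :: "pt set \<Rightarrow> 3 \<Rightarrow> (pt \<Rightarrow> real) \<Rightarrow> pt \<Rightarrow> real" where
  "wpartial U i w = (SOME d. is_wpartial U i w d)"

definition wgrad :: "pt set \<Rightarrow> (pt \<Rightarrow> real^3) \<Rightarrow> pt \<Rightarrow> mat3" where
  "wgrad U v = (SOME G. \<forall>i j. is_wpartial U j (\<lambda>x. v x $ i) (\<lambda>x. G x $ i $ j))"

definition is_wcurl :: "pt set \<Rightarrow> (pt \<Rightarrow> real^3) \<Rightarrow> (pt \<Rightarrow> real^3) \<Rightarrow> bool" where
  "is_wcurl U \<phi> c \<longleftrightarrow> L2 U c \<and>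
     (\<forall>w. testvec U w \<longrightarrow>
        (LINT x:U|lebesgue. \<phi> x \<bullet> ccurl w x) = (LINT x:U|lebesgue. c x \<bullet> w x))"

definition wcurl :: "pt set \<Rightarrow> (pt \<Rightarrow> real^3) \<Rightarrow> pt \<Rightarrow> real^3" where
  "wcurl U \<phi> = (SOME c. is_wcurl U \<phi> c)"

definition is_wdiv :: "pt set \<Rightarrow> (pt \<Rightarrow> real^3) \<Rightarrow> (pt \<Rightarrow> real) \<Rightarrow> bool" where
  "is_wdiv U \<phi> d \<longleftrightarrow> L2 U d \<and>
     (\<forall>g. test_fun U g \<longrightarrow>
        (LINT x:U|lebesgue. \<phi> x \<bullet> cgrad g x) = - (LINT x:U|lebesgue. d x * g x))"

definition H1 :: "pt set \<Rightarrow> (pt \<Rightarrow> real) \<Rightarrow> bool" where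
  "H1 U w \<longleftrightarrow> L2 U w \<and> (\<forall>i. \<exists>d. is_wpartial U i w d)"

definition H1vec :: "pt set \<Rightarrow> (pt \<Rightarrow> real^3) \<Rightarrow> bool" where
  "H1vec U v \<longleftrightarrow> (\<forall>i. H1 U (\<lambda>x. v x $ i))"

definition H1mat :: "pt set \<Rightarrow> (pt \<Rightarrow> mat3) \<Rightarrow> bool" where
  "H1mat U s \<longleftrightarrow> (\<forall>i j. H1 U (\<lambda>x. s x $ i $ j))"

definition H10 :: "pt set \<Rightarrow> (pt \<Rightarrow> real) \<Rightarrow> bool" where
  "H10 U w \<longleftrightarrow> H1 U w \<and>
    (\<exists>s. (\<forall>n. test_fun U (s n)) \<and>
       (\<lambda>n. LINT x:U|lebesgue. (s n x - w x)\<^sup>2) \<longlonglongrightarrow> 0 \<and>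
       (\<forall>i. (\<lambda>n. LINT x:U|lebesgue. (cpartial i (s n) x - wpartial U i w x)\<^sup>2) \<longlonglongrightarrow> 0))"

definition H10vec :: "pt set \<Rightarrow> (pt \<Rightarrow> real^3) \<Rightarrow> bool" where
  "H10vec U v \<longleftrightarrow> (\<forall>i. H10 U (\<lambda>x. v x $ i))"

text \<open>H_0(curl,U): L2 fields with L2 curl and vanishing tangential trace
  (phi x n = 0), expressed by the Green formula against all smooth fields.\<close>
definition H0curl :: "pt set \<Rightarrow> (pt \<Rightarrow> real^3) \<Rightarrow> bool" where
  "H0curl U \<phi> \<longleftrightarrow> L2 U \<phi> \<and>
     (\<exists>c. L2 U c \<and> (\<forall>w. smoothvec w \<longrightarrow>
        (LINT x:U|lebesgue. \<phi> x \<bullet> ccurl w x) = (LINT x:U|lebesgue. c x \<bullet> w x)))"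

definition Psi :: "pt set \<Rightarrow> (pt \<Rightarrow> real^3) \<Rightarrow> bool" where
  "Psi U \<phi> \<longleftrightarrow> L2 U \<phi> \<and> (\<exists>d. is_wdiv U \<phi> d \<and> H1 U d)
      \<and> (\<exists>c. is_wcurl U \<phi> c \<and> H10vec U c) \<and> H0curl U \<phi>"

definition lipschitz_domain :: "pt set \<Rightarrow> bool" where
  "lipschitz_domain \<Omega> \<longleftrightarrow> open \<Omega> \<and> bounded \<Omega> \<and> connected \<Omega> \<and> \<Omega> \<noteq> {} \<and>
    (\<forall>x0\<in>frontier \<Omega>. \<exists>(R :: real^3 \<Rightarrow> real^3) (L :: real) (g :: real \<times> real \<Rightarrow> real) (r :: real) (h :: real).
        orthogonal_transformation R \<and> r > 0 \<and> h > 0 \<and> L-lipschitz_on UNIV g \<and> g (0, 0) = 0 \<and>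
        (\<forall>x. let y = R (x - x0) in
             ((y $ 1)\<^sup>2 + (y $ 2)\<^sup>2 < r\<^sup>2 \<and> \<bar>y $ 3\<bar> < h) \<longrightarrow>
             (x \<in> \<Omega> \<longleftrightarrow> y $ 3 < g (y $ 1, y $ 2))))"

definition tetra :: "pt set \<Rightarrow> bool" where
  "tetra T \<longleftrightarrow> (\<exists>V. card V = 4 \<and> \<not> affine_dependent V \<and> T = convex hull V)"

definition verts :: "pt set \<Rightarrow> pt set" where
  "verts T = {x. x extreme_point_of T}"

definition facets :: "pt set \<Rightarrow> pt set set" where
  "facets T = {convex hull W | W. W \<subseteq> verts T \<and> card W = 3}"

definition mesh :: "pt set set \<Rightarrow> pt set \<Rightarrow> bool" where
  "mesh \<T> \<Omega> \<longleftrightarrow> finite \<T> \<and> (\<forall>T\<in>\<T>. tetra T) \<and> \<Union>\<T> = closure \<Omega> \<and>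
     (\<forall>T1\<in>\<T>. \<forall>T2\<in>\<T>. T1 \<noteq> T2 \<longrightarrow> T1 \<inter> T2 = convex hull (verts T1 \<inter> verts T2))"

definition mfacets :: "pt set set \<Rightarrow> pt set set" where
  "mfacets \<T> = (\<Union>T\<in>\<T>. facets T)"

definition fvtx :: "pt set \<Rightarrow> pt \<times> pt \<times> pt" where
  "fvtx F = (SOME (a, b, c). F = convex hull {a, b, c} \<and> \<not> collinear {a, b, c})"

definition reftri :: "(real \<times> real) set" where
  "reftri = {(s, t). 0 \<le> s \<and> 0 \<le> t \<and> s + t \<le> 1}"

definition fparam :: "pt set \<Rightarrow> real \<times> real \<Rightarrow> pt" where
  "fparam F st = (case fvtx F of (a, b, c) \<Rightarrow> a + fst st *\<^sub>R (b - a) + snd st *\<^sub>R (c - a))"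

definition facet_integral :: "pt set \<Rightarrow> (pt \<Rightarrow> real) \<Rightarrow> real" where
  "facet_integral F g = (case fvtx F of (a, b, c) \<Rightarrow>
      norm (cross3 (b - a) (c - a)) * (LINT st:reftri|lborel. g (fparam F st)))"

definition facet_L2 :: "pt set \<Rightarrow> (pt \<Rightarrow> real) \<Rightarrow> bool" where
  "facet_L2 F g \<longleftrightarrow> set_borel_measurable lborel reftri (\<lambda>st. g (fparam F st)) \<and>
     set_integrable lborel reftri (\<lambda>st. (g (fparam F st))\<^sup>2)"

definition onormal :: "pt set \<Rightarrow> pt set \<Rightarrow> real^3" where
  "onormal T F = (case fvtx F of (a, b, c) \<Rightarrow>
     (let m = cross3 (b - a) (c - a); d = (SOME d. d \<in> verts T \<and> d \<notin> F) in
      if m \<bullet> (d - a) > 0 then - ((1 / norm m) *\<^sub>R m) else (1 / norm m) *\<^sub>R m))"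

text \<open>g is the trace on the boundary of T of w (with w in H^1(int T)),
  characterised by the Green formula.\<close>
definition is_trace :: "pt set \<Rightarrow> (pt \<Rightarrow> real) \<Rightarrow> (pt \<Rightarrow> real) \<Rightarrow> bool" where
  "is_trace T w g \<longleftrightarrow> (\<forall>F\<in>facets T. facet_L2 F g) \<and>
     (\<forall>\<phi> i. smooth \<phi> \<longrightarrow>
        (LINT x:T|lebesgue. wpartial (interior T) i w x * \<phi> x + w x * cpartial i \<phi> x)
        = (\<Sum>F\<in>facets T. facet_integral F (\<lambda>x. g x * \<phi> x * onormal T F $ i)))"

definition trace_s :: "pt set \<Rightarrow> (pt \<Rightarrow> real) \<Rightarrow> pt \<Rightarrow> real" where
  "trace_s T w = (SOME g. is_trace T w g)"

definition trvec :: "pt set \<Rightarrow> (pt \<Rightarrow> real^3) \<Rightarrow> pt \<Rightarrow> real^3" where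
  "trvec T v x = (\<chi> i. trace_s T (\<lambda>y. v y $ i) x)"

definition trmat :: "pt set \<Rightarrow> (pt \<Rightarrow> mat3) \<Rightarrow> pt \<Rightarrow> mat3" where
  "trmat T s x = (\<chi> i j. trace_s T (\<lambda>y. s y $ i $ j) x)"

definition tang :: "real^3 \<Rightarrow> real^3 \<Rightarrow> real^3" where
  "tang n v = v - (v \<bullet> n) *\<^sub>R n"

definition ntc :: "real^3 \<Rightarrow> mat3 \<Rightarrow> real^3" where
  "ntc n A = A *v n - (n \<bullet> (A *v n)) *\<^sub>R n"

definition mtr :: "mat3 \<Rightarrow> real" where
  "mtr A = (\<Sum>i\<in>UNIV. A $ i $ i)"

definition dev :: "mat3 \<Rightarrow> mat3" where
  "dev A = A - (mtr A / 3) *\<^sub>R mat 1"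

definition fT1 :: "pt set set \<Rightarrow> pt set \<Rightarrow> pt set" where
  "fT1 \<T> F = (SOME T. T \<in> \<T> \<and> F \<in> facets T)"

definition fnormal :: "pt set set \<Rightarrow> pt set \<Rightarrow> real^3" where
  "fnormal \<T> F = onormal (fT1 \<T> F) F"

definition fjump :: "pt set set \<Rightarrow> (pt \<Rightarrow> real^3) \<Rightarrow> pt set \<Rightarrow> pt \<Rightarrow> real^3" where
  "fjump \<T> v F x =
     (if \<exists>T. T \<in> \<T> \<and> F \<in> facets T \<and> T \<noteq> fT1 \<T> F
      then trvec (fT1 \<T> F) v x - trvec (SOME T. T \<in> \<T> \<and> F \<in> facets T \<and> T \<noteq> fT1 \<T> F) v x
      else trvec (fT1 \<T> F) v x)"

definition aform :: "real \<Rightarrow> pt set \<Rightarrow> (pt \<Rightarrow> mat3) \<Rightarrow> (pt \<Rightarrow> mat3) \<Rightarrow> real" where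
  "aform \<nu> \<Omega> s t = (1 / \<nu>) * (LINT x:\<Omega>|lebesgue. s x \<bullet> t x)"

definition bform :: "pt set set \<Rightarrow> (pt \<Rightarrow> mat3) \<Rightarrow> (pt \<Rightarrow> real^3) \<Rightarrow> real" where
  "bform \<T> t v =
     - (\<Sum>T\<in>\<T>. LINT x:T|lebesgue. t x \<bullet> wgrad (interior T) v x)
     + (\<Sum>F\<in>mfacets \<T>. facet_integral F
          (\<lambda>x. ntc (fnormal \<T> F) (trmat (fT1 \<T> F) t x) \<bullet> tang (fnormal \<T> F) (fjump \<T> v F x)))"

definition poly3 :: "nat \<Rightarrow> (pt \<Rightarrow> real) \<Rightarrow> bool" where
  "poly3 k p \<longleftrightarrow> (\<exists>c :: nat \<Rightarrow> nat \<Rightarrow> nat \<Rightarrow> real.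
     p = (\<lambda>x. \<Sum>(i, j, l) \<in> {(i, j, l). i + j + l \<le> k}.
              c i j l * (x $ 1) ^ i * (x $ 2) ^ j * (x $ 3) ^ l))"

definition polyvec :: "nat \<Rightarrow> (pt \<Rightarrow> real^3) \<Rightarrow> bool" where
  "polyvec k p \<longleftrightarrow> (\<forall>i. poly3 k (\<lambda>x. p x $ i))"

definition polymat :: "nat \<Rightarrow> (pt \<Rightarrow> mat3) \<Rightarrow> bool" where
  "polymat k p \<longleftrightarrow> (\<forall>i j. poly3 k (\<lambda>x. p x $ i $ j))"

definition Wh :: "pt set set \<Rightarrow> pt set \<Rightarrow> nat \<Rightarrow> (pt \<Rightarrow> real^3) \<Rightarrow> bool" where
  "Wh \<T> \<Omega> k \<phi> \<longleftrightarrow>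
     (\<exists>P. \<forall>T\<in>\<T>. polyvec k (P T) \<and> (\<forall>x\<in>interior T. \<phi> x = P T x)) \<and> H0curl \<Omega> \<phi>"

text \<open>Sigma_h^m (used with m = k - 1 >= 1).\<close>
definition Sigmah :: "pt set set \<Rightarrow> nat \<Rightarrow> (pt \<Rightarrow> mat3) \<Rightarrow> bool" where
  "Sigmah \<T> m \<tau> \<longleftrightarrow>
     (\<exists>P. (\<forall>T\<in>\<T>. polymat m (P T) \<and> (\<forall>x\<in>interior T. \<tau> x = P T x) \<and> (\<forall>x. mtr (P T x) = 0))
       \<and> (\<forall>T1\<in>\<T>. \<forall>T2\<in>\<T>. \<forall>F. F \<in> facets T1 \<and> F \<in> facets T2 \<longrightarrow>
            (\<forall>x\<in>F. ntc (onormal T1 F) (P T1 x) = ntc (onormal T1 F) (P T2 x)))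
       \<and> (\<forall>T\<in>\<T>. \<forall>F\<in>facets T. \<exists>q. polyvec (m - 1) q \<and>
            (\<forall>x\<in>F. ntc (onormal T F) (P T x) = q x)))"

end

theory Submission
  imports Defs
begin

text \<open>
  Since \<open>dev \<sigma> = \<nu> \<nabla>u\<close> and \<open>\<tau>\<^sub>h\<close> is trace free, the volume terms of \<open>a(\<sigma>, \<tau>\<^sub>h)\<close> and
  \<open>b(\<tau>\<^sub>h, u)\<close> cancel, and the facet terms vanish because the traces of \<open>u \<in> H\<^sup>1\<^sub>0\<close> have no jumps.
  The momentum equation puts \<open>p\<close> into \<open>H\<^sup>1\<close> with \<open>\<nabla>p = div \<sigma> + f\<close>. Summing Green's formula for
  \<open>\<sigma>\<close> and \<open>p\<close> against the piecewise polynomial, divergence free \<open>curl \<phi>\<^sub>h\<close> over all tetrahedra leaves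
  facet terms. There the normal component of \<open>curl \<phi>\<^sub>h\<close> is continuous and vanishes on the boundary,
  being weakly orthogonal to all gradients, so only \<open>\<sigma>\<^sub>n\<^sub>t\<close> paired with the tangential jump survives.

  Traces are constructed by radial integration. If \<open>y\<close> runs through the facet of a tetrahedron
  opposite to the vertex \<open>v\<close>, then a smooth \<open>w\<close> satisfies
  \<open>w(y) = \<integral>\<^sub>0\<^sup>1 r\<^sup>2 (\<nabla>w \<bullet> (x - v) + 3 w) dr\<close> with \<open>x = v + r (y - v)\<close>, and the right-hand side makes
  sense for \<open>w \<in> H\<^sup>1\<close>. Green's formula carries over from smooth functions by approximation: if \<open>S\<close> is a
  bump function inside the tetrahedron \<open>T\<close> and \<open>x \<in> T\<close>, then by convexity \<open>y \<mapsto> S (l y - (l - 1) x)\<close>, \<open>l > 1\<close>,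
  is a test function on \<open>T\<close>, so the averages of \<open>w\<close> against it depend smoothly on \<open>x\<close>, and their gradients
  are averages of the weak gradient. Traces from two sides are compared by testing with bump functions
  centred on one facet of the mesh.
\<close>

subsection \<open>Calculus of smooth functions\<close>

text \<open>Traces, weak derivatives and weak curls are all Hilbert choices: each needs an existence
  proof before it can be used, and uniqueness almost everywhere before the choice stops mattering.
  For derivatives and curls existence comes with the function spaces. For traces it is the main
  work, because a trace is specified only by Green's formula against smooth functions on one closed
  tetrahedron, together with square integrability on the facets. Radial integration makes the trace
  linear in \<open>w\<close> and its weak gradient, and turns its facet integrals into volume
  integrals. Green's formula becomes one identity
  \<open>\<integral> (w \<Psi>0 + \<Sum> W i \<Psi> i) = 0\<close> with fixed coefficients, which
  for smooth functions is the divergence theorem. Hence weak approximation is enough: by Fubini the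
  averaging moves from \<open>w\<close> to the coefficients, and no norm convergence of approximants
  enters. The price is that the coefficients may jump at the vertices, so they are only bounded on
  the tetrahedron and continuous in its interior.\<close>

lemma cpartial_eqI: "(g has_derivative g') (at x) \<Longrightarrow> cpartial i g x = g' (axis i 1)"
  unfolding cpartial_def using frechet_derivative_at by force

lemma iter_partial_append: "iter_partial (is @ [i]) g = iter_partial is (cpartial i g)"
  by (induction "is") auto

lemma smooth_differentiable: "smooth g \<Longrightarrow> g differentiable (at x)"
  unfolding smooth_def by (metis iter_partial.simps(1))

lemma smooth_cpartial: "smooth g \<Longrightarrow> smooth (cpartial i g)"
  unfolding smooth_def by (metis iter_partial_append)

text \<open>Smoothness only asks that iterated partials be differentiable, so any class of
  differentiable functions that is closed under partials consists of smooth functions. The closure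
  properties below each choose such a class instead of computing iterated partials.\<close>

lemma smooth_coinduct:
  assumes "C g" and d: "\<And>g x. C g \<Longrightarrow> g differentiable (at x)"
    and c: "\<And>g i. C g \<Longrightarrow> C (cpartial i g)"
  shows "smooth g"
proof -
  have "C (iter_partial is g)" for "is"
    by (induction "is") (auto simp: assms)
  then show ?thesis
    unfolding smooth_def using d by blast
qed

lemma vec_eq_sum_axis: "(h :: real^'n) = (\<Sum>i\<in>UNIV. h $ i *\<^sub>R axis i 1)"
  using basis_expansion[of h] by (simp add: scalar_mult_eq_scaleR)

lemma smooth_has_derivative:
  assumes "smooth g"
  shows "(g has_derivative (\<lambda>h. \<Sum>i\<in>UNIV. cpartial i g x * h $ i)) (at x)"
proof -
  let ?D = "frechet_derivative g (at x)"
  have D: "(g has_derivative ?D) (at x)"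
    using smooth_differentiable[OF assms] by (simp add: frechet_derivative_works[symmetric])
  then interpret linear ?D
    by (rule has_derivative_linear)
  have "?D h = (\<Sum>i\<in>UNIV. cpartial i g x * h $ i)" for h
  proof -
    have "?D h = ?D (\<Sum>i\<in>UNIV. h $ i *\<^sub>R axis i 1)"
      by (simp only: vec_eq_sum_axis[symmetric])
    then show ?thesis
      by (simp add: sum scale cpartial_def mult.commute)
  qed
  then have "?D = (\<lambda>h. \<Sum>i\<in>UNIV. cpartial i g x * h $ i)"
    by auto
  with D show ?thesis by simp
qed

lemma smooth_continuous: "smooth g \<Longrightarrow> continuous_on S g"
  by (meson continuous_at_imp_continuous_on differentiable_imp_continuous_within smooth_differentiable)

lemma smooth_measurable: "smooth g \<Longrightarrow> g \<in> borel_measurable borel"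
  by (intro borel_measurable_continuous_onI smooth_continuous)

lemma cpartial_const [simp]: "cpartial i (\<lambda>x. c) = (\<lambda>x. 0)"
  by (rule ext, rule cpartial_eqI) (rule has_derivative_const)

lemma cpartial_coord: "cpartial i (\<lambda>x. x $ j) x = (if i = j then 1 else 0)"
proof -
  have "((\<lambda>x::pt. x $ j) has_derivative (\<lambda>h. h $ j)) (at x)"
    by (intro bounded_linear_imp_has_derivative bounded_linear_vec_nth)
  then show ?thesis
    by (auto simp: cpartial_eqI axis_def)
qed

lemma smooth_const [simp]: "smooth (\<lambda>x. c)"
  by (rule smooth_coinduct[where C = "\<lambda>g. \<exists>c. g = (\<lambda>x. c)"]) auto

lemma smooth_coord [simp]: "smooth (\<lambda>x. x $ j)"
proof (rule smooth_coinduct[where C = "\<lambda>g. g = (\<lambda>x. x $ j) \<or> smooth g"])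
  fix g :: "pt \<Rightarrow> real" and i x
  assume g: "g = (\<lambda>x. x $ j) \<or> smooth g"
  then show "g differentiable (at x)"
    by (auto simp: smooth_differentiable bounded_linear_imp_differentiable bounded_linear_vec_nth)
  show "cpartial i g = (\<lambda>x. x $ j) \<or> smooth (cpartial i g)"
    using g
  proof
    assume "g = (\<lambda>x. x $ j)"
    then have "cpartial i g = (\<lambda>x. if i = j then 1 else 0)"
      by (auto simp: cpartial_coord)
    then show ?thesis by simp
  qed (auto simp: smooth_cpartial)
qed auto

lemma cpartial_add_at:
  assumes "f differentiable (at x)" "g differentiable (at x)"
  shows "cpartial i (\<lambda>x. f x + g x) x = cpartial i f x + cpartial i g x"
  using assms[unfolded frechet_derivative_works]
  by (auto simp: cpartial_def intro!: trans[OF cpartial_eqI[unfolded cpartial_def]] has_derivative_add)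

lemma cpartial_mult_at:
  assumes "f differentiable (at x)" "g differentiable (at x)"
  shows "cpartial i (\<lambda>x. f x * g x) x = f x * cpartial i g x + cpartial i f x * g x"
  using has_derivative_mult[OF assms[unfolded frechet_derivative_works]]
  by (auto simp: cpartial_def dest: cpartial_eqI[unfolded cpartial_def])

lemma cpartial_add:
  "smooth f \<Longrightarrow> smooth g \<Longrightarrow> cpartial i (\<lambda>x. f x + g x) = (\<lambda>x. cpartial i f x + cpartial i g x)"
  by (rule ext) (simp add: cpartial_add_at smooth_differentiable)

lemma cpartial_mult:
  "smooth f \<Longrightarrow> smooth g \<Longrightarrow>
    cpartial i (\<lambda>x. f x * g x) = (\<lambda>x. f x * cpartial i g x + cpartial i f x * g x)"
  by (rule ext) (simp add: cpartial_mult_at smooth_differentiable)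

lemma smooth_add [intro]:
  assumes "smooth f" "smooth g"
  shows "smooth (\<lambda>x. f x + g x)"
proof (rule smooth_coinduct[where C = "\<lambda>h. \<exists>f g. smooth f \<and> smooth g \<and> h = (\<lambda>x. f x + g x)"])
  fix h i x
  assume "\<exists>f g. smooth f \<and> smooth g \<and> h = (\<lambda>x. f x + g x)"
  then obtain f g where *: "smooth f" "smooth g" "h = (\<lambda>x. f x + g x)" by auto
  then show "h differentiable (at x)"
    by (auto intro: smooth_differentiable derivative_intros)
  show "\<exists>f g. smooth f \<and> smooth g \<and> cpartial i h = (\<lambda>x. f x + g x)"
    using * by (metis cpartial_add smooth_cpartial)
qed (use assms in auto)

text \<open>Invariant for \<open>smooth_coinduct\<close>: differentiating a product yields a sum of
  two products, so products alone are not closed under partials, but their sums are.\<close>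

inductive sum_of_products :: "(pt \<Rightarrow> real) \<Rightarrow> bool" where
  product: "smooth f \<Longrightarrow> smooth g \<Longrightarrow> sum_of_products (\<lambda>x. f x * g x)"
| plus: "sum_of_products f \<Longrightarrow> sum_of_products g \<Longrightarrow> sum_of_products (\<lambda>x. f x + g x)"

lemma smooth_mult [intro]:
  assumes "smooth f" "smooth g"
  shows "smooth (\<lambda>x. f x * g x)"
proof (rule smooth_coinduct[where C = sum_of_products])
  show d: "h differentiable (at x)" if "sum_of_products h" for h x
    using that by induction (auto intro: smooth_differentiable derivative_intros)
  show "sum_of_products (cpartial i h)" if "sum_of_products h" for h i
    using that
  proof induction
    case (product f g)
    then show ?case
      by (auto simp: cpartial_mult intro!: sum_of_products.intros smooth_cpartial)
  next
    case (plus f g)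
    then have "cpartial i (\<lambda>x. f x + g x) = (\<lambda>x. cpartial i f x + cpartial i g x)"
      by (intro ext cpartial_add_at d)
    with plus show ?case by (simp add: sum_of_products.plus)
  qed
qed (use assms in \<open>auto intro: sum_of_products.intros\<close>)

lemma smooth_cmult [intro]: "smooth f \<Longrightarrow> smooth (\<lambda>x. c * f x)"
  by (rule smooth_mult) auto

lemma smooth_minus [intro]: "smooth f \<Longrightarrow> smooth (\<lambda>x. - f x)"
  using smooth_cmult[of f "-1"] by simp

lemma smooth_diff [intro]: "smooth f \<Longrightarrow> smooth g \<Longrightarrow> smooth (\<lambda>x. f x - g x)"
  using smooth_add[of f "\<lambda>x. - g x"] by auto

lemma smooth_sum [intro]: "(\<And>i. i \<in> I \<Longrightarrow> smooth (f i)) \<Longrightarrow> smooth (\<lambda>x. \<Sum>i\<in>I. f i x)"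
  by (induction I rule: infinite_finite_induct) auto

lemma smooth_prod [intro]: "(\<And>i. i \<in> I \<Longrightarrow> smooth (f i)) \<Longrightarrow> smooth (\<lambda>x. \<Prod>i\<in>I. f i x)"
  by (induction I rule: infinite_finite_induct) auto

lemma smooth_power [intro]: "smooth f \<Longrightarrow> smooth (\<lambda>x. f x ^ n)"
  by (induction n) auto

lemma cpartial_diff:
  assumes "smooth f" "smooth g"
  shows "cpartial i (\<lambda>x. f x - g x) = (\<lambda>x. cpartial i f x - cpartial i g x)"
proof
  fix x
  show "cpartial i (\<lambda>x. f x - g x) x = cpartial i f x - cpartial i g x"
    unfolding cpartial_eqI[OF has_derivative_diff[OF assms[THEN smooth_has_derivative]]]
    by (simp add: axis_def if_distrib cong: if_cong)
qed

lemma cpartial_chain_at: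
  assumes "(h has_real_derivative h') (at (g x))" "g differentiable (at x)"
  shows "cpartial i (\<lambda>x. h (g x)) x = h' * cpartial i g x"
proof -
  have "((\<lambda>x. h (g x)) has_derivative (\<lambda>y. h' * frechet_derivative g (at x) y)) (at x)"
    using has_derivative_compose[OF assms(2)[unfolded frechet_derivative_works]
        assms(1)[unfolded has_field_derivative_def]] by simp
  then show ?thesis
    by (simp add: cpartial_eqI) (simp add: cpartial_def)
qed

text \<open>Invariant for the chain rule. Here \<open>hs n\<close> stands for the n-th derivative of
  the outer function, and differentiating a term with index \<open>n\<close> yields terms with
  indices \<open>n\<close> and \<open>Suc n\<close>, each with a smooth prefactor.\<close>

inductive chain_class :: "(nat \<Rightarrow> real \<Rightarrow> real) \<Rightarrow> (pt \<Rightarrow> real) \<Rightarrow> (pt \<Rightarrow> real) \<Rightarrow> bool" for hs g where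
  single: "smooth p \<Longrightarrow> chain_class hs g (\<lambda>x. p x * hs n (g x))"
| plus: "chain_class hs g f \<Longrightarrow> chain_class hs g f' \<Longrightarrow> chain_class hs g (\<lambda>x. f x + f' x)"

lemma smooth_compose:
  assumes hs: "\<And>n y. (hs n has_real_derivative hs (Suc n) y) (at y)" and g: "smooth g"
  shows "smooth (\<lambda>x. hs n (g x))"
proof -
  have dh: "(\<lambda>x. hs n (g x)) differentiable (at x)" for n x
    using has_derivative_compose[OF smooth_has_derivative[OF g] hs[unfolded has_field_derivative_def]]
    unfolding differentiable_def by blast
  have d: "f differentiable (at x)" if "chain_class hs g f" for f x
    using that by induction (auto intro: smooth_differentiable derivative_intros dh)
  have "smooth (\<lambda>x. 1 * hs n (g x))"
  proof (rule smooth_coinduct[where C = "chain_class hs g"])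
    show "chain_class hs g (cpartial i f)" if "chain_class hs g f" for f i
      using that
    proof induction
      case (single p n)
      have "cpartial i (\<lambda>x. p x * hs n (g x))
          = (\<lambda>x. (p x * cpartial i g x) * hs (Suc n) (g x) + cpartial i p x * hs n (g x))"
        by (rule ext) (simp add: cpartial_mult_at[OF smooth_differentiable[OF single] dh]
            cpartial_chain_at[OF hs smooth_differentiable[OF g]])
      with single g show ?case
        by (auto intro!: chain_class.intros smooth_cpartial)
    next
      case (plus f f')
      then have "cpartial i (\<lambda>x. f x + f' x) = (\<lambda>x. cpartial i f x + cpartial i f' x)"
        by (intro ext cpartial_add_at d)
      with plus show ?case by (simp add: chain_class.plus)
    qed
    show "chain_class hs g (\<lambda>x. 1 * hs n (g x))"
      by (rule chain_class.single) simp
  qed (rule d)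
  then show ?thesis by simp
qed

lemma cpartial_affine:
  assumes "smooth g"
  shows "cpartial i (\<lambda>x. g (c *\<^sub>R x + y)) x = c * cpartial i g (c *\<^sub>R x + y)"
proof -
  have "((\<lambda>x. c *\<^sub>R x + y) has_derivative (\<lambda>h. c *\<^sub>R h)) (at x)"
    by (auto intro!: derivative_eq_intros)
  from has_derivative_compose[OF this smooth_has_derivative[OF assms]]
  show ?thesis
    by (simp add: cpartial_eqI axis_def if_distrib cong: if_cong)
qed

lemma smooth_affine:
  assumes "smooth g"
  shows "smooth (\<lambda>x. g (c *\<^sub>R x + y))"
proof -
  let ?C = "\<lambda>f. \<exists>k g. smooth g \<and> f = (\<lambda>x. k * g (c *\<^sub>R x + y))"
  have dg: "(\<lambda>x. g (c *\<^sub>R x + y)) differentiable (at x)" if "smooth g" for g x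
  proof -
    have "((\<lambda>x. c *\<^sub>R x + y) has_derivative (\<lambda>h. c *\<^sub>R h)) (at x)"
      by (auto intro!: derivative_eq_intros)
    from has_derivative_compose[OF this smooth_has_derivative[OF that]]
    show ?thesis unfolding differentiable_def by blast
  qed
  show ?thesis
  proof (rule smooth_coinduct[where C = ?C])
    fix f i x
    assume "?C f"
    then obtain k g where *: "smooth g" "f = (\<lambda>x. k * g (c *\<^sub>R x + y))" by auto
    show "f differentiable (at x)"
      using * dg[of g] by (auto intro: derivative_intros)
    have "cpartial i f = (\<lambda>x. (k * c) * cpartial i g (c *\<^sub>R x + y))"
      unfolding * by (rule ext) (simp add: cpartial_mult_at dg[OF *(1)] cpartial_affine[OF *(1)])
    then show "?C (cpartial i f)"
      using smooth_cpartial[OF *(1)] by blast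
  next
    show "?C (\<lambda>x. g (c *\<^sub>R x + y))"
      using assms by (intro exI[of _ 1] exI[of _ g]) auto
  qed
qed

lemma smooth_line_derivative:
  assumes "smooth g"
  shows "((\<lambda>t. g (x + t *\<^sub>R v)) has_real_derivative (\<Sum>i\<in>UNIV. cpartial i g (x + t *\<^sub>R v) * v $ i)) (at t)"
proof -
  have "((\<lambda>t. x + t *\<^sub>R v) has_derivative (\<lambda>h. h *\<^sub>R v)) (at t)"
    by (auto intro!: derivative_eq_intros)
  from has_derivative_compose[OF this smooth_has_derivative[OF assms]]
  show ?thesis
    unfolding has_field_derivative_def
    by (rule has_derivative_eq_rhs) (simp add: fun_eq_iff sum_distrib_left mult_ac)
qed

lemma smooth_axis_derivative:
  assumes "smooth g"
  shows "((\<lambda>t. g (x + t *\<^sub>R axis i 1)) has_real_derivative cpartial i g (x + t *\<^sub>R axis i 1)) (at t)"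
proof -
  have "(\<Sum>j\<in>UNIV. cpartial j g y * axis i 1 $ j) = cpartial i g y" for y
    by (simp add: axis_def if_distrib cong: if_cong)
  then show ?thesis
    using smooth_line_derivative[OF assms, of x "axis i 1" t] by simp
qed

text \<open>The mean value theorem is applied once in direction \<open>i\<close> and once in
  direction \<open>j\<close>. The left-hand side is symmetric in \<open>i\<close> and
  \<open>j\<close>, so both orders can be compared.\<close>

lemma second_difference_mvt:
  assumes g: "smooth g" and h: "h > 0"
  shows "\<exists>s\<in>{0..h}. \<exists>t\<in>{0..h}.
     g (x + h *\<^sub>R axis i 1 + h *\<^sub>R axis j 1) - g (x + h *\<^sub>R axis i 1) - g (x + h *\<^sub>R axis j 1) + g x
     = h\<^sup>2 * cpartial j (cpartial i g) (x + s *\<^sub>R axis i 1 + t *\<^sub>R axis j 1)"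
proof -
  define G where "G s = g (x + h *\<^sub>R axis j 1 + s *\<^sub>R axis i 1) - g (x + s *\<^sub>R axis i 1)" for s
  have "(G has_real_derivative cpartial i g (x + h *\<^sub>R axis j 1 + s *\<^sub>R axis i 1)
        - cpartial i g (x + s *\<^sub>R axis i 1)) (at s)" for s
    unfolding G_def by (intro DERIV_diff smooth_axis_derivative g)
  from MVT2[OF h this]
  obtain s where s: "0 < s" "s < h"
    "G h - G 0 = h * (cpartial i g (x + h *\<^sub>R axis j 1 + s *\<^sub>R axis i 1) - cpartial i g (x + s *\<^sub>R axis i 1))"
    by auto
  have "((\<lambda>t. cpartial i g (x + s *\<^sub>R axis i 1 + t *\<^sub>R axis j 1)) has_real_derivative
      cpartial j (cpartial i g) (x + s *\<^sub>R axis i 1 + t *\<^sub>R axis j 1)) (at t)" for t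
    by (intro smooth_axis_derivative smooth_cpartial g)
  from MVT2[OF h this] obtain t where t: "0 < t" "t < h"
    "cpartial i g (x + s *\<^sub>R axis i 1 + h *\<^sub>R axis j 1) - cpartial i g (x + s *\<^sub>R axis i 1)
      = h * cpartial j (cpartial i g) (x + s *\<^sub>R axis i 1 + t *\<^sub>R axis j 1)"
    by auto
  show ?thesis
    using s t by (intro bexI[of _ s] bexI[of _ t])
      (auto simp: G_def algebra_simps power2_eq_square)
qed

text \<open>Schwarz's theorem: by the symmetry of the second difference, for each \<open>h\<close>
  the two mixed partials take a common value at points that tend to \<open>x\<close> with
  \<open>h\<close>, and both are continuous.\<close>

lemma cpartial_commute:
  assumes g: "smooth g"
  shows "cpartial i (cpartial j g) = cpartial j (cpartial i g)"
proof
  fix x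
  define A where "A = cpartial j (cpartial i g)"
  define B where "B = cpartial i (cpartial j g)"
  have c: "isCont A x" "isCont B x"
    using smooth_continuous[of A UNIV] smooth_continuous[of B UNIV] g
    by (auto simp: A_def B_def smooth_cpartial continuous_on_eq_continuous_at)
  have "\<forall>h>0. \<exists>s\<in>{0..h}. \<exists>t\<in>{0..h}. \<exists>s'\<in>{0..h}. \<exists>t'\<in>{0..h}.
    A (x + s *\<^sub>R axis i 1 + t *\<^sub>R axis j 1) = B (x + s' *\<^sub>R axis j 1 + t' *\<^sub>R axis i 1)"
  proof (intro allI impI)
    fix h :: real assume h: "h > 0"
    from second_difference_mvt[OF g h, of x i j] second_difference_mvt[OF g h, of x j i] h
    show "\<exists>s\<in>{0..h}. \<exists>t\<in>{0..h}. \<exists>s'\<in>{0..h}. \<exists>t'\<in>{0..h}.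
      A (x + s *\<^sub>R axis i 1 + t *\<^sub>R axis j 1) = B (x + s' *\<^sub>R axis j 1 + t' *\<^sub>R axis i 1)"
      unfolding A_def B_def by (fastforce simp: algebra_simps)
  qed
  then obtain s t s' t' where st: "\<And>h. h > 0 \<Longrightarrow> s h \<in> {0..h} \<and> t h \<in> {0..h} \<and> s' h \<in> {0..h} \<and> t' h \<in> {0..h} \<and>
    A (x + s h *\<^sub>R axis i 1 + t h *\<^sub>R axis j 1) = B (x + s' h *\<^sub>R axis j 1 + t' h *\<^sub>R axis i 1)"
    by metis
  have l: "(r \<longlongrightarrow> 0) (at_right (0::real))" if "\<And>h. h > 0 \<Longrightarrow> r h \<in> {0..h}" for r :: "real \<Rightarrow> real"
    using that by (intro tendsto_sandwich[of "\<lambda>_. 0" r _ "\<lambda>h. h"])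
      (auto simp: eventually_at_right_less intro!: eventually_at_rightI[of 0 1])
  have l1: "((\<lambda>h. x + p h *\<^sub>R (u::pt) + q h *\<^sub>R w) \<longlongrightarrow> x) (at_right 0)"
    if "\<And>h. h > 0 \<Longrightarrow> p h \<in> {0..h}" "\<And>h. h > 0 \<Longrightarrow> q h \<in> {0..h}" for p q :: "real \<Rightarrow> real" and u w
  proof -
    have "((\<lambda>h. x + p h *\<^sub>R u + q h *\<^sub>R w) \<longlongrightarrow> x + 0 *\<^sub>R u + 0 *\<^sub>R w) (at_right 0)"
      by (intro tendsto_intros l that)
    then show ?thesis by simp
  qed
  have "((\<lambda>h. A (x + s h *\<^sub>R axis i 1 + t h *\<^sub>R axis j 1)) \<longlongrightarrow> A x) (at_right 0)"
    using st by (intro isCont_tendsto_compose[OF c(1)] l1) auto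
  moreover have "((\<lambda>h. B (x + s' h *\<^sub>R axis j 1 + t' h *\<^sub>R axis i 1)) \<longlongrightarrow> B x) (at_right 0)"
    using st by (intro isCont_tendsto_compose[OF c(2)] l1) auto
  moreover have "\<forall>\<^sub>F h in at_right 0. B (x + s' h *\<^sub>R axis j 1 + t' h *\<^sub>R axis i 1)
      = A (x + s h *\<^sub>R axis i 1 + t h *\<^sub>R axis j 1)"
    using st by (intro eventually_at_rightI[of 0 1]) auto
  ultimately have "((\<lambda>h. A (x + s h *\<^sub>R axis i 1 + t h *\<^sub>R axis j 1)) \<longlongrightarrow> B x) (at_right 0)"
    using tendsto_cong by force
  with \<open>((\<lambda>h. A (x + s h *\<^sub>R axis i 1 + t h *\<^sub>R axis j 1)) \<longlongrightarrow> A x) (at_right 0)\<close>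
  have "A x = B x"
    using tendsto_unique trivial_limit_at_right_real by blast
  then show "cpartial i (cpartial j g) x = cpartial j (cpartial i g) x"
    by (simp add: A_def B_def)
qed

lemma poly3_smooth: "poly3 k p \<Longrightarrow> smooth p"
  unfolding poly3_def by (auto intro!: smooth_sum smooth_mult simp: split_def)

lemma ccurl_nth:
  "ccurl w x $ 1 = cpartial 2 (\<lambda>y. w y $ 3) x - cpartial 3 (\<lambda>y. w y $ 2) x"
  "ccurl w x $ 2 = cpartial 3 (\<lambda>y. w y $ 1) x - cpartial 1 (\<lambda>y. w y $ 3) x"
  "ccurl w x $ 3 = cpartial 1 (\<lambda>y. w y $ 2) x - cpartial 2 (\<lambda>y. w y $ 1) x"
  by (simp_all add: ccurl_def)

lemma smoothvec_ccurl:
  assumes "smoothvec w"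
  shows "smoothvec (ccurl w)"
  using assms by (auto simp: smoothvec_def forall_3 ccurl_nth intro!: smooth_diff smooth_cpartial)

lemma div_ccurl:
  assumes "smoothvec w"
  shows "(\<Sum>i\<in>UNIV. cpartial i (\<lambda>x. ccurl w x $ i) x) = 0"
  using assms
  by (simp add: sum_3 ccurl_nth smoothvec_def cpartial_diff smooth_cpartial
      cpartial_commute[of _ 1 2] cpartial_commute[of _ 1 3] cpartial_commute[of _ 2 3])

lemma smoothvec_cgrad: "smooth g \<Longrightarrow> smoothvec (cgrad g)"
  by (auto simp: smoothvec_def cgrad_def smooth_cpartial)

lemma ccurl_cgrad:
  assumes "smooth g"
  shows "ccurl (cgrad g) x = 0"
  using assms
  by (simp add: vec_eq_iff forall_3 ccurl_nth cgrad_def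
      cpartial_commute[of _ 1 2] cpartial_commute[of _ 1 3] cpartial_commute[of _ 2 3])

subsection \<open>Bump functions and the fundamental lemma\<close>

text \<open>\<open>flat 1\<close> is the classical cutoff exp(-1/x), extended by zero. The
  polynomial prefactor in 1/x makes the family closed under differentiation.\<close>

definition flat :: "real poly \<Rightarrow> real \<Rightarrow> real" where
  "flat p x = (if x > 0 then poly p (inverse x) * exp (- inverse x) else 0)"

lemma poly_exp_tendsto_0: "((\<lambda>t. poly p t * exp (- t)) \<longlongrightarrow> (0::real)) at_top"
proof -
  have "((\<lambda>t. \<Sum>i\<le>degree p. coeff p i * (t ^ i / exp t)) \<longlongrightarrow> (\<Sum>i\<le>degree p. coeff p i * (0::real))) at_top"
    by (intro tendsto_sum tendsto_mult tendsto_const tendsto_power_div_exp_0)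
  moreover have "(\<Sum>i\<le>degree p. coeff p i * (t ^ i / exp t)) = poly p t * exp (- t)" for t :: real
    by (simp add: poly_altdef sum_distrib_right exp_minus divide_inverse mult.assoc)
  ultimately show ?thesis by simp
qed

text \<open>With t = 1/x the chain rule contributes a factor t^2, so the prefactor p becomes t^2 (p
  - p'). At the origin the right difference quotient is t p(t) exp(-t), which tends to 0 as t
  grows.\<close>

lemma flat_has_derivative:
  "(flat p has_real_derivative flat (monom 1 2 * (p - pderiv p)) x) (at x)"
proof -
  consider "x < 0" | "x > 0" | "x = 0" by linarith
  then show ?thesis
  proof cases
    case 1
    have "((\<lambda>_. 0) has_real_derivative 0) (at x)" by simp
    then have "(flat p has_real_derivative 0) (at x)"
      by (rule has_field_derivative_transform_within_open[where S = "{..<0}"])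
         (use 1 in \<open>auto simp: flat_def\<close>)
    with 1 show ?thesis by (simp add: flat_def)
  next
    case 2
    have "((\<lambda>x. poly p (inverse x) * exp (- inverse x)) has_real_derivative
        flat (monom 1 2 * (p - pderiv p)) x) (at x)"
      using 2 by (auto intro!: derivative_eq_intros simp: flat_def poly_monom field_simps power2_eq_square)
    then show ?thesis
      by (rule has_field_derivative_transform_within_open[where S = "{0<..}"])
         (use 2 in \<open>auto simp: flat_def\<close>)
  next
    case 3
    have "((\<lambda>h. flat p h / h) \<longlongrightarrow> 0) (at_right 0)"
    proof -
      have "((\<lambda>t. poly (pCons 0 p) t * exp (- t)) \<longlongrightarrow> 0) at_top"
        by (rule poly_exp_tendsto_0)
      then have "((\<lambda>h. poly (pCons 0 p) (inverse h) * exp (- inverse h)) \<longlongrightarrow> 0) (at_right 0)"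
        by (rule filterlim_compose) (rule filterlim_inverse_at_top_right)
      then show ?thesis
        by (rule Lim_transform_eventually)
          (auto simp: flat_def field_simps intro!: eventually_at_rightI[of 0 1])
    qed
    moreover have "((\<lambda>h. flat p h / h) \<longlongrightarrow> 0) (at_left 0)"
      by (rule Lim_transform_eventually[OF tendsto_const])
        (auto simp: flat_def intro!: eventually_at_leftI[of "-1" 0])
    ultimately have "((\<lambda>h. flat p h / h) \<longlongrightarrow> 0) (at 0)"
      by (simp add: filterlim_split_at)
    with 3 show ?thesis
      by (simp add: DERIV_def flat_def)
  qed
qed

lemma flat_1_pos_iff: "flat 1 x > 0 \<longleftrightarrow> x > 0"
  by (simp add: flat_def)

lemma flat_1_nonneg: "flat 1 x \<ge> 0"
  by (simp add: flat_def)

lemma smooth_flat: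
  assumes "smooth g"
  shows "smooth (\<lambda>x. flat 1 (g x))"
proof -
  define hs where "hs n = flat (((\<lambda>p. monom 1 2 * (p - pderiv p)) ^^ n) 1)" for n
  have "smooth (\<lambda>x. hs 0 (g x))"
    by (rule smooth_compose) (auto simp: hs_def flat_has_derivative assms)
  then show ?thesis by (simp add: hs_def)
qed

lemma smooth_exp:
  assumes "smooth g"
  shows "smooth (\<lambda>x. exp (g x))"
  using smooth_compose[of "\<lambda>_. exp" g 0] assms by auto

lemma smooth_bump_exists:
  fixes c :: pt
  assumes "r > 0"
  shows "\<exists>\<beta>. smooth \<beta> \<and> (\<forall>x. \<beta> x \<ge> 0) \<and> \<beta> c > 0 \<and> {x. \<beta> x \<noteq> 0} \<subseteq> ball c r"
proof -
  \<comment> \<open>The bump is a product over the coordinates and lives on a cube; three coordinate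
    differences below r/3 have l1 norm below \<open>r\<close>, which puts the cube into the
    ball.\<close>
  define \<delta> where "\<delta> = r / 3"
  define \<beta> where "\<beta> x = (\<Prod>i\<in>UNIV. flat 1 (\<delta> + (x $ i - c $ i)) * flat 1 (\<delta> - (x $ i - c $ i)))" for x :: pt
  have "smooth \<beta>"
    unfolding \<beta>_def by (intro smooth_prod smooth_mult smooth_flat smooth_add smooth_diff smooth_const smooth_coord)
  moreover have "\<beta> x \<ge> 0" for x
    unfolding \<beta>_def by (intro prod_nonneg) (simp add: flat_1_nonneg)
  moreover have "\<beta> c > 0"
    unfolding \<beta>_def by (intro prod_pos) (use assms in \<open>simp add: flat_1_pos_iff \<delta>_def\<close>)
  moreover have "x \<in> ball c r" if "\<beta> x \<noteq> 0" for x
  proof -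
    have "\<bar>(x - c) $ i\<bar> < \<delta>" for i
    proof -
      have "flat 1 (\<delta> + (x $ i - c $ i)) \<noteq> 0" "flat 1 (\<delta> - (x $ i - c $ i)) \<noteq> 0"
        using that by (auto simp: \<beta>_def)
      then show ?thesis
        by (auto simp: flat_def split: if_splits)
    qed
    then have "(\<Sum>i\<in>UNIV. \<bar>(x - c) $ i\<bar>) < (\<Sum>i\<in>(UNIV :: 3 set). \<delta>)"
      by (intro sum_strict_mono) auto
    then have "norm (x - c) < r"
      using norm_le_l1_cart[of "x - c"] by (simp add: \<delta>_def)
    then show ?thesis by (simp add: dist_norm norm_minus_commute)
  qed
  ultimately show ?thesis by blast
qed

lemma test_funI:
  assumes "smooth g" "{x. g x \<noteq> 0} \<subseteq> C" "compact C" "C \<subseteq> U"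
  shows "test_fun U g"
proof -
  have "closure {x. g x \<noteq> 0} \<subseteq> C"
    using assms by (simp add: closure_minimal compact_imp_closed)
  then show ?thesis
    using assms unfolding test_fun_def
    by (meson closed_closure order_trans compact_eq_bounded_closed bounded_subset)
qed

lemma test_fun_outside:
  assumes "test_fun U g" "x \<notin> U"
  shows "g x = 0"
proof (rule ccontr)
  assume "g x \<noteq> 0"
  then have "x \<in> closure {x. g x \<noteq> 0}"
    using closure_subset by fastforce
  with assms show False
    by (auto simp: test_fun_def)
qed

lemma test_fun_mono: "test_fun U g \<Longrightarrow> U \<subseteq> U' \<Longrightarrow> test_fun U' g"
  unfolding test_fun_def by blast

lemma test_fun_smooth: "test_fun U g \<Longrightarrow> smooth g"
  unfolding test_fun_def by blast

lemma test_fun_positive_on_compact: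
  fixes K :: "pt set"
  assumes K: "compact K" and U: "open U" "K \<subseteq> U"
  shows "\<exists>S. test_fun U S \<and> (\<forall>x. S x \<ge> 0) \<and> (\<forall>x\<in>K. S x > 0)"
proof -
  have "\<exists>\<beta> r. r > 0 \<and> cball c r \<subseteq> U \<and> smooth \<beta> \<and> (\<forall>x. \<beta> x \<ge> 0) \<and> \<beta> c > 0 \<and> {x. \<beta> x \<noteq> 0} \<subseteq> ball c r"
    if "c \<in> K" for c
    using smooth_bump_exists[of _ c] that U by (metis open_contains_cball subsetD)
  then obtain \<beta> r where b: "\<And>c. c \<in> K \<Longrightarrow> r c > 0 \<and> cball c (r c) \<subseteq> U \<and> smooth (\<beta> c) \<and> (\<forall>x. \<beta> c x \<ge> 0)
      \<and> \<beta> c c > 0 \<and> {x. \<beta> c x \<noteq> 0} \<subseteq> ball c (r c)"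
    by metis
  have "open {x. \<beta> c x > 0}" if "c \<in> K" for c
    using b[OF that] by (intro open_Collect_less continuous_on_const smooth_continuous) auto
  moreover have "K \<subseteq> (\<Union>c\<in>K. {x. \<beta> c x > 0})"
    using b by auto
  ultimately obtain I where I: "I \<subseteq> K" "finite I" "K \<subseteq> (\<Union>c\<in>I. {x. \<beta> c x > 0})"
    by (rule compactE_image[OF K])
  define S where "S x = (\<Sum>c\<in>I. \<beta> c x)" for x
  have "test_fun U S"
  proof (rule test_funI)
    show "smooth S"
      unfolding S_def using b I by (intro smooth_sum) auto
    show "{x. S x \<noteq> 0} \<subseteq> (\<Union>c\<in>I. cball c (r c))"
    proof
      fix x assume "x \<in> {x. S x \<noteq> 0}"
      then obtain c where "c \<in> I" "\<beta> c x \<noteq> 0"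
        unfolding S_def by (auto elim: sum.not_neutral_contains_not_neutral)
      moreover have "{x. \<beta> c x \<noteq> 0} \<subseteq> ball c (r c)"
        using b[of c] \<open>c \<in> I\<close> I(1) by auto
      ultimately have "x \<in> cball c (r c)" by auto
      with \<open>c \<in> I\<close> show "x \<in> (\<Union>c\<in>I. cball c (r c))"
        by auto
    qed
    show "(\<Union>c\<in>I. cball c (r c)) \<subseteq> U"
      using I(1) b by blast
  qed (use I in \<open>auto intro!: compact_UN\<close>)
  moreover have "S x \<ge> 0" for x
    unfolding S_def using b I by (intro sum_nonneg) auto
  moreover have "S x > 0" if x: "x \<in> K" for x
  proof -
    obtain c where "c \<in> I" "\<beta> c x > 0" using x I by auto
    moreover have "\<beta> c' x \<ge> 0" if "c' \<in> I" for c'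
      using b[of c'] that I(1) by auto
    ultimately show ?thesis
      unfolding S_def by (rule sum_pos2[OF I(2)])
  qed
  ultimately show ?thesis by blast
qed

lemma test_fun_indicator_limit:
  fixes K :: "pt set"
  assumes K: "compact K" and U: "open U" "K \<subseteq> U"
  shows "\<exists>\<phi>::nat \<Rightarrow> pt \<Rightarrow> real. (\<forall>n. test_fun U (\<phi> n)) \<and> (\<forall>n x. 0 \<le> \<phi> n x \<and> \<phi> n x \<le> 1)
     \<and> (\<forall>x. (\<lambda>n. \<phi> n x) \<longlonglongrightarrow> indicator K x)"
proof (cases "K = {}")
  case True
  then show ?thesis
    by (intro exI[of _ "\<lambda>n x. 0"]) (auto intro!: test_funI[where C = "{}"])
next
  case False
  \<comment> \<open>The supports shrink to \<open>K\<close>, so that at each point outside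
    \<open>K\<close> the sequence is eventually 0.\<close>
  define V where "V n = U \<inter> {x. infdist x K < 1 / real (Suc n)}" for n
  have V: "open (V n)" "K \<subseteq> V n" for n
    using U False unfolding V_def
    by (auto intro!: open_Int open_Collect_less continuous_intros)
  have "\<exists>S. test_fun (V n) S \<and> (\<forall>x. S x \<ge> 0) \<and> (\<forall>x\<in>K. S x > 0)" for n
    by (rule test_fun_positive_on_compact[OF K V])
  then obtain S where S: "\<And>n. test_fun (V n) (S n)" "\<And>n x. S n x \<ge> 0" "\<And>n x. x \<in> K \<Longrightarrow> S n x > 0"
    by metis
  have "\<exists>c>0. \<forall>x\<in>K. c \<le> S n x" for n
  proof -
    have "continuous_on K (S n)"
      using S(1) by (intro smooth_continuous) (auto simp: test_fun_def)
    from continuous_attains_inf[OF K False this] show ?thesis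
      using S(3) by meson
  qed
  then obtain c where c: "\<And>n. c n > 0" "\<And>n x. x \<in> K \<Longrightarrow> c n \<le> S n x"
    by metis
  \<comment> \<open>This form keeps the values in [0,1], vanishes where \<open>S n\<close> does, and
    on \<open>K\<close>, where \<open>S n \<ge> c n\<close>, is at least 1 - exp(-n).\<close>
  define \<phi> where "\<phi> n x = 1 - exp (- (real n / c n) * S n x)" for n x
  have "test_fun U (\<phi> n)" for n
  proof (rule test_funI)
    show "smooth (\<phi> n)"
      unfolding \<phi>_def using S(1)
      by (intro smooth_diff smooth_const smooth_exp smooth_cmult) (auto simp: test_fun_def)
    have "{x. \<phi> n x \<noteq> 0} \<subseteq> {x. S n x \<noteq> 0}"
      by (auto simp: \<phi>_def)
    then show "{x. \<phi> n x \<noteq> 0} \<subseteq> closure {x. S n x \<noteq> 0}"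
      using closure_subset by (rule order_trans)
    show "compact (closure {x. S n x \<noteq> 0})" "closure {x. S n x \<noteq> 0} \<subseteq> U"
      using S(1)[of n] by (auto simp: test_fun_def V_def)
  qed
  moreover have "0 \<le> \<phi> n x \<and> \<phi> n x \<le> 1" for n x
    using S(2)[of n x] c(1)[of n] by (simp add: \<phi>_def)
  moreover have "(\<lambda>n. \<phi> n x) \<longlonglongrightarrow> indicator K x" for x
  proof (cases "x \<in> K")
    case True
    have "(\<lambda>n. 1 - exp (- real n)) \<longlonglongrightarrow> 1 - 0"
      by (intro tendsto_intros filterlim_compose[OF exp_at_bot]
          filterlim_compose[OF filterlim_uminus_at_bot_at_top] filterlim_real_sequentially)
    then have lim: "(\<lambda>n. 1 - exp (- real n)) \<longlonglongrightarrow> 1" by simp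
    have "1 - exp (- real n) \<le> \<phi> n x" for n
    proof -
      have "real n \<le> real n / c n * S n x"
        using c(1)[of n] c(2)[OF True, of n] by (simp add: field_simps mult_left_mono)
      then show ?thesis by (simp add: \<phi>_def)
    qed
    moreover have "\<phi> n x \<le> 1" for n by (simp add: \<phi>_def)
    ultimately have "(\<lambda>n. \<phi> n x) \<longlonglongrightarrow> 1"
      by (intro tendsto_sandwich[OF _ _ lim tendsto_const]) auto
    then show ?thesis using True by simp
  next
    case False
    then have "infdist x K > 0"
      using K \<open>K \<noteq> {}\<close> by (simp add: compact_imp_closed infdist_pos_not_in_closed)
    then obtain N where N: "1 / real (Suc N) < infdist x K"
      using nat_approx_posE by blast
    have "\<phi> n x = 0" if "n \<ge> N" for n
    proof -
      have "1 / real (Suc n) \<le> 1 / real (Suc N)"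
        using that by (simp add: frac_le)
      then have "x \<notin> V n" using N by (simp add: V_def)
      then show ?thesis using test_fun_outside[OF S(1)] by (simp add: \<phi>_def)
    qed
    then have "(\<lambda>n. \<phi> n x) \<longlonglongrightarrow> 0"
      by (intro tendsto_eventually) (auto simp: eventually_sequentially)
    then show ?thesis using False by simp
  qed
  ultimately show ?thesis by blast
qed

text \<open>Up to a null set, the set where \<open>f\<close> is positive is a countable union of
  compact sets. On each of them a positive function has integral zero, so each is null.\<close>

lemma AE_nonpos_if_compact_integrals_zero:
  fixes f :: "'a::euclidean_space \<Rightarrow> real"
  assumes O: "open S" and f: "set_integrable lebesgue S f"
    and z: "\<And>K. compact K \<Longrightarrow> K \<subseteq> S \<Longrightarrow> (LINT x:K|lebesgue. f x) = 0"
  shows "AE x in lebesgue. x \<in> S \<longrightarrow> f x \<le> 0"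
proof -
  define A where "A = {x. indicator S x *\<^sub>R f x > 0}"
  have "A \<in> sets lebesgue"
    using borel_measurable_integrable[OF f[unfolded set_integrable_def]]
    unfolding A_def by (simp add: borel_measurable_iff_greater)
  from lebesgue_set_almost_fsigma[OF this]
  obtain C N where CN: "fsigma C" "negligible N" "C \<union> N = A"
    unfolding negligible_iff_null_sets by blast
  obtain F :: "nat \<Rightarrow> 'a set" where F: "range F \<subseteq> Collect compact" "C = \<Union>(range F)"
    using CN(1) by (auto simp: fsigma_Union_compact)
  have "negligible (F n)" for n
  proof -
    have K: "compact (F n)" using F by auto
    have sub: "F n \<subseteq> A" using F CN by auto
    have "A \<subseteq> S" by (auto simp: A_def indicator_def split: if_splits)
    with sub have subS: "F n \<subseteq> S" by (rule order_trans)
    have "f x > 0" if "x \<in> A" for x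
      using that by (cases "x \<in> S") (auto simp: A_def)
    with sub have pos: "f x > 0" if "x \<in> F n" for x
      using that by auto
    have m: "F n \<in> sets lebesgue" using K by (simp add: borel_compact)
    have i: "integrable lebesgue (\<lambda>x. indicator (F n) x *\<^sub>R f x)"
      using set_integrable_subset[OF f m subS] by (simp add: set_integrable_def)
    have "(LINT x|lebesgue. indicator (F n) x *\<^sub>R f x) = 0"
      using z[OF K subS] by (simp add: set_lebesgue_integral_def)
    then have "AE x in lebesgue. indicator (F n) x *\<^sub>R f x = 0"
      by (subst (asm) integral_nonneg_eq_0_iff_AE[OF i]) (auto simp: indicator_def less_imp_le pos)
    then have "AE x in lebesgue. x \<notin> F n"
      by eventually_elim (use pos in force)
    then show ?thesis
      using m by (simp add: AE_iff_null_sets negligible_iff_null_sets)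
  qed
  then have "negligible C"
    unfolding F by (intro negligible_countable_Union) auto
  then have "negligible A" using CN by (metis negligible_Un)
  then have "AE x in lebesgue. x \<notin> A"
    by (simp add: AE_not_in negligible_iff_null_sets)
  then show ?thesis
    by eventually_elim (auto simp: A_def indicator_def)
qed

lemma AE_zero_if_compact_integrals_zero:
  fixes f :: "'a::euclidean_space \<Rightarrow> real"
  assumes O: "open S" and f: "set_integrable lebesgue S f"
    and z: "\<And>K. compact K \<Longrightarrow> K \<subseteq> S \<Longrightarrow> (LINT x:K|lebesgue. f x) = 0"
  shows "AE x in lebesgue. x \<in> S \<longrightarrow> f x = 0"
proof -
  have "AE x in lebesgue. x \<in> S \<longrightarrow> - f x \<le> 0"
    by (rule AE_nonpos_if_compact_integrals_zero[OF O])
      (use f z in \<open>auto simp: set_integrable_def set_lebesgue_integral_def\<close>)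
  moreover have "AE x in lebesgue. x \<in> S \<longrightarrow> f x \<le> 0"
    by (rule AE_nonpos_if_compact_integrals_zero[OF O f z])
  ultimately show ?thesis
    by eventually_elim auto
qed

text \<open>Test functions tend boundedly to the indicator of any compact subset, so dominated
  convergence turns the hypothesis into vanishing integrals over compact sets.\<close>

lemma fundamental_lemma:
  fixes f :: "pt \<Rightarrow> real"
  assumes U: "open U" and f: "set_integrable lebesgue U f"
    and z: "\<And>\<phi>. test_fun U \<phi> \<Longrightarrow> (LINT x:U|lebesgue. f x * \<phi> x) = 0"
  shows "AE x in lebesgue. x \<in> U \<longrightarrow> f x = 0"
proof (rule AE_zero_if_compact_integrals_zero[OF U f])
  fix K assume K: "compact K" "K \<subseteq> U"
  obtain \<phi> :: "nat \<Rightarrow> pt \<Rightarrow> real" where p: "\<And>n. test_fun U (\<phi> n)" "\<And>n x. 0 \<le> \<phi> n x \<and> \<phi> n x \<le> 1"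
    "\<And>x. (\<lambda>n. \<phi> n x) \<longlonglongrightarrow> indicator K x"
    using test_fun_indicator_limit[OF K(1) U K(2)] by auto
  have fi: "integrable lebesgue (\<lambda>x. indicator U x *\<^sub>R f x)"
    using f by (simp add: set_integrable_def)
  have [measurable]: "\<phi> n \<in> borel_measurable lebesgue" for n
    using smooth_measurable[OF test_fun_smooth[OF p(1)]] by (intro measurable_completion) simp
  have "(\<lambda>n. LINT x|lebesgue. indicator U x *\<^sub>R (f x * \<phi> n x)) \<longlonglongrightarrow> (LINT x|lebesgue. indicator K x *\<^sub>R f x)"
  proof (rule integral_dominated_convergence[where w = "\<lambda>x. norm (indicator U x *\<^sub>R f x)"])
    have "(\<lambda>x. (indicator U x *\<^sub>R f x) * \<phi> n x) \<in> borel_measurable lebesgue" for n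
      using fi by (intro borel_measurable_times) auto
    then show "(\<lambda>x. indicator U x *\<^sub>R (f x * \<phi> n x)) \<in> borel_measurable lebesgue" for n
      by (simp add: mult.assoc)
    show "(\<lambda>x. indicator K x *\<^sub>R f x) \<in> borel_measurable lebesgue"
      using set_integrable_subset[OF f _ K(2)] K(1)
      by (auto simp: set_integrable_def borel_compact)
    show "AE x in lebesgue. (\<lambda>n. indicator U x *\<^sub>R (f x * \<phi> n x)) \<longlonglongrightarrow> indicator K x *\<^sub>R f x"
    proof (intro AE_I2)
      fix x
      have "(\<lambda>n. indicator U x *\<^sub>R (f x * \<phi> n x)) \<longlonglongrightarrow> indicator U x *\<^sub>R (f x * indicator K x)"
        by (intro tendsto_intros p)
      then show "(\<lambda>n. indicator U x *\<^sub>R (f x * \<phi> n x)) \<longlonglongrightarrow> indicator K x *\<^sub>R f x"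
        using K(2) by (cases "x \<in> K") auto
    qed
    show "AE x in lebesgue. norm (indicator U x *\<^sub>R (f x * \<phi> n x)) \<le> norm (indicator U x *\<^sub>R f x)" for n
      using p(2)[of n] by (auto simp: abs_mult mult_left_le indicator_def)
    show "integrable lebesgue (\<lambda>x. norm (indicator U x *\<^sub>R f x))"
      using fi by (rule integrable_norm)
  qed
  moreover have "(LINT x|lebesgue. indicator U x *\<^sub>R (f x * \<phi> n x)) = 0" for n
    using z[OF p(1)] by (simp add: set_lebesgue_integral_def)
  ultimately show "(LINT x:K|lebesgue. f x) = 0"
    by (simp add: set_lebesgue_integral_def LIMSEQ_const_iff)
qed

subsection \<open>Integration over simplices\<close>

text \<open>Coordinates are kept in a nested product because Fubini's theorem lives there; this map
  identifies it with \<open>real^3\<close>, measure included.\<close>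

definition vec3 :: "(real \<times> real) \<times> real \<Rightarrow> pt" where
  "vec3 e = vector [fst (fst e), snd (fst e), snd e]"

lemma vec3_nth [simp]:
  "vec3 e $ 1 = fst (fst e)" "vec3 e $ 2 = snd (fst e)" "vec3 e $ 3 = snd e"
  by (simp_all add: vec3_def)

lemma vec3_measurable [measurable]: "vec3 \<in> borel_measurable borel"
proof -
  have "continuous_on UNIV vec3"
    unfolding continuous_on_componentwise[of UNIV vec3]
    by (auto simp: Basis_vec_def inner_axis forall_3 intro!: continuous_intros)
  then show ?thesis by (rule borel_measurable_continuous_onI)
qed

lemma distr_vec3: "distr lborel borel vec3 = lborel"
proof (rule lborel_eqI[symmetric])
  fix l u :: pt
  assume le: "\<And>b. b \<in> Basis \<Longrightarrow> l \<bullet> b \<le> u \<bullet> b"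
  have le': "l $ i \<le> u $ i" for i
    using le[of "axis i 1"] by (simp add: axis_in_Basis_iff inner_axis)
  have "vec3 -` box l u = box ((l $ 1, l $ 2), l $ 3) ((u $ 1, u $ 2), u $ 3)"
    by (auto simp: mem_box_cart forall_3 box_prod)
  moreover have "emeasure lborel (box ((l $ 1, l $ 2), l $ 3) ((u $ 1, u $ 2), u $ 3))
      = ennreal ((u $ 1 - l $ 1) * (u $ 2 - l $ 2) * (u $ 3 - l $ 3))"
    using le' by (simp add: box_prod lborel_prod[symmetric] lborel.emeasure_pair_measure_Times ennreal_mult')
  moreover have "(\<Prod>b\<in>Basis. (u - l) \<bullet> b) = (u $ 1 - l $ 1) * (u $ 2 - l $ 2) * (u $ 3 - l $ 3)"
  proof -
    have B: "(Basis :: pt set) = (\<lambda>i. axis i 1) ` UNIV"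
      by (auto simp: Basis_vec_def)
    have inj: "inj (\<lambda>i. axis i (1::real) :: pt)"
      by (auto simp: inj_on_def axis_eq_axis)
    have "(\<Prod>b\<in>Basis. (u - l) \<bullet> b) = (\<Prod>i\<in>UNIV. (u - l) $ i)"
      unfolding B prod.reindex[OF inj] by (simp add: inner_axis)
    also have "\<dots> = (u $ 1 - l $ 1) * (u $ 2 - l $ 2) * (u $ 3 - l $ 3)"
      unfolding UNIV_3 by (simp add: mult.assoc)
    finally show ?thesis .
  qed
  ultimately show "emeasure (distr lborel borel vec3) (box l u) = (\<Prod>b\<in>Basis. (u - l) \<bullet> b)"
    by (simp add: emeasure_distr)
qed simp

abbreviation det3 :: "pt \<Rightarrow> pt \<Rightarrow> pt \<Rightarrow> real" where
  "det3 u v w \<equiv> cross3 u v \<bullet> w"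

definition comb3 :: "pt \<Rightarrow> pt \<Rightarrow> pt \<Rightarrow> pt \<Rightarrow> (real \<times> real) \<times> real \<Rightarrow> pt" where
  "comb3 q u v w e = q + fst (fst e) *\<^sub>R u + snd (fst e) *\<^sub>R v + snd e *\<^sub>R w"

lemma comb3_continuous: "continuous_on S (comb3 q u v w)"
  unfolding comb3_def by (intro continuous_intros)

lemma comb3_measurable [measurable]: "comb3 q u v w \<in> borel_measurable borel"
  by (intro borel_measurable_continuous_onI comb3_continuous)

text \<open>Cramer's rule: the coordinates of \<open>x\<close> in the basis \<open>u\<close>,
  \<open>v\<close>, \<open>w\<close> are quotients of determinants.\<close>

lemma det3_expand:
  "det3 u v w *\<^sub>R x = (x \<bullet> cross3 v w) *\<^sub>R u + (x \<bullet> cross3 w u) *\<^sub>R v + (x \<bullet> cross3 u v) *\<^sub>R w"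
  by (simp add: vec_eq_iff forall_3 cross3_def inner_vec_def sum_3 algebra_simps)

text \<open>Cramer's rule for the reciprocal basis, whose coordinates are the inner products with
  \<open>u\<close>, \<open>v\<close>, \<open>w\<close>.\<close>

lemma det3_expand_dual:
  "det3 u v w *\<^sub>R x = (x \<bullet> u) *\<^sub>R cross3 v w + (x \<bullet> v) *\<^sub>R cross3 w u + (x \<bullet> w) *\<^sub>R cross3 u v"
  by (simp add: vec_eq_iff forall_3 cross3_def inner_vec_def sum_3 algebra_simps)

lemma det3_orthogonal_zero:
  assumes "det3 u v w \<noteq> 0" "x \<bullet> u = 0" "x \<bullet> v = 0" "x \<bullet> w = 0"
  shows "x = 0"
  using det3_expand_dual[of u v w x] assms by simp

lemma det3_combination_zero:
  assumes "det3 u v w \<noteq> 0" "a *\<^sub>R u + b *\<^sub>R v + c *\<^sub>R w = 0"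
  shows "a = 0 \<and> b = 0 \<and> c = 0"
proof -
  have "(a *\<^sub>R u + b *\<^sub>R v + c *\<^sub>R w) \<bullet> cross3 v w = a * det3 u v w"
    "(a *\<^sub>R u + b *\<^sub>R v + c *\<^sub>R w) \<bullet> cross3 w u = b * det3 u v w"
    "(a *\<^sub>R u + b *\<^sub>R v + c *\<^sub>R w) \<bullet> cross3 u v = c * det3 u v w"
    by (simp_all add: cross3_def inner_vec_def sum_3 algebra_simps)
  then have "a * det3 u v w = 0" "b * det3 u v w = 0" "c * det3 u v w = 0"
    unfolding assms(2) by simp_all
  with assms(1) show ?thesis by simp
qed

lemma comb3_inj:
  assumes "det3 u v w \<noteq> 0" "comb3 q u v w e = comb3 q u v w e'"
  shows "e = e'"
proof -
  have "(fst (fst e) - fst (fst e')) *\<^sub>R u + (snd (fst e) - snd (fst e')) *\<^sub>R v + (snd e - snd e') *\<^sub>R w = 0"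
    using assms(2) by (simp add: comb3_def algebra_simps)
  from det3_combination_zero[OF assms(1) this] show ?thesis
    by (simp add: prod_eq_iff)
qed

text \<open>Boxes determine \<open>lborel\<close>. After a translation by \<open>q\<close> only the
  linear map with columns \<open>u\<close>, \<open>v\<close>, \<open>w\<close> remains, and it
  scales volume by its determinant.\<close>

lemma lborel_comb3:
  assumes D: "det3 u v w \<noteq> 0"
  shows "lborel = density (distr lborel borel (comb3 q u v w)) (\<lambda>_. ennreal \<bar>det3 u v w\<bar>)"
proof (rule lborel_eqI)
  define L where "L x = x $ 1 *\<^sub>R u + x $ 2 *\<^sub>R v + x $ 3 *\<^sub>R w" for x :: pt
  have L: "linear L"
    unfolding L_def by (intro linearI) (auto simp: algebra_simps)
  have det: "det (matrix L) = det3 u v w"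
    by (simp add: det_3 matrix_def L_def axis_def cross3_def inner_vec_def sum_3 algebra_simps)
  have injL: "inj L"
    unfolding linear_injective_0[OF L]
  proof (intro allI impI)
    fix x assume "L x = 0"
    then have "x $ 1 = 0 \<and> x $ 2 = 0 \<and> x $ 3 = 0"
      unfolding L_def by (rule det3_combination_zero[OF D])
    then show "x = 0" by (simp add: vec_eq_iff forall_3)
  qed
  have surjL: "surj L"
    using linear_injective_imp_surjective[OF L injL] by simp
  obtain g where g: "linear g" "g \<circ> L = id" "L \<circ> g = id"
    using linear_injective_isomorphism[OF L injL] by (auto simp: fun_eq_iff)
  fix l b :: pt
  assume le: "\<And>i. i \<in> Basis \<Longrightarrow> l \<bullet> i \<le> b \<bullet> i"
  define S where "S = box (l - q) (b - q)"
  have pre: "comb3 q u v w -` box l b = vec3 -` (L -` S)"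
    by (auto simp: comb3_def L_def S_def mem_box algebra_simps)
  have LS: "L -` S = g ` S"
  proof -
    have "g (L x) = x" "L (g x) = x" for x
      using g(2,3) by (simp_all add: fun_eq_iff)
    then show ?thesis
      unfolding set_eq_iff vimage_def image_iff mem_Collect_eq by metis
  qed
  have gm: "g ` S \<in> lmeasurable"
    using measurable_linear_image[OF g(1), of S] by (simp add: S_def)
  have LLS: "L ` (L -` S) = S" using surjL by (rule surj_image_vimage_eq)
  have "measure lebesgue S = \<bar>det3 u v w\<bar> * measure lebesgue (L -` S)"
    using measure_linear_image[OF L gm] LLS unfolding LS det by simp
  moreover have oL: "open (L -` S)"
    using L by (intro open_vimage) (auto simp: S_def linear_continuous_on linear_conv_bounded_linear)
  ultimately have m: "ennreal \<bar>det3 u v w\<bar> * emeasure lborel (L -` S) = emeasure lborel S"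
    using gm LS emeasure_eq_measure2[of "L -` S" lebesgue] emeasure_eq_measure2[of S lebesgue]
    by (simp add: S_def ennreal_mult'[symmetric] borel_open)
  have "emeasure lborel (comb3 q u v w -` box l b) = emeasure lborel (L -` S)"
  proof -
    have "emeasure lborel (L -` S) = emeasure (distr lborel borel vec3) (L -` S)"
      by (simp add: distr_vec3)
    also have "\<dots> = emeasure lborel (vec3 -` (L -` S))"
      using oL by (subst emeasure_distr) auto
    finally show ?thesis unfolding pre by simp
  qed
  then have "emeasure (density (distr lborel borel (comb3 q u v w)) (\<lambda>_. ennreal \<bar>det3 u v w\<bar>)) (box l b)
      = ennreal \<bar>det3 u v w\<bar> * emeasure lborel (L -` S)"
    by (simp add: emeasure_density nn_integral_cmult emeasure_distr)
  also have "\<dots> = (\<Prod>i\<in>Basis. (b - l) \<bullet> i)"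
    unfolding m using le by (simp add: S_def inner_simps)
  finally show "emeasure (density (distr lborel borel (comb3 q u v w)) (\<lambda>_. ennreal \<bar>det3 u v w\<bar>)) (box l b)
      = (\<Prod>i\<in>Basis. (b - l) \<bullet> i)" .
qed simp

lemma
  fixes f :: "pt \<Rightarrow> real"
  assumes D: "det3 u v w \<noteq> 0" and [measurable]: "f \<in> borel_measurable borel"
  shows integrable_comb3: "integrable lborel f \<longleftrightarrow> integrable lborel (\<lambda>e. f (comb3 q u v w e))"
    and integral_comb3: "integral\<^sup>L lborel f = \<bar>det3 u v w\<bar> * integral\<^sup>L lborel (\<lambda>e. f (comb3 q u v w e))"
proof -
  have "integrable lborel f \<longleftrightarrow> integrable (density (distr lborel borel (comb3 q u v w)) (\<lambda>_. ennreal \<bar>det3 u v w\<bar>)) f"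
    by (subst lborel_comb3[OF D, of q]) simp
  also have "\<dots> \<longleftrightarrow> integrable lborel (\<lambda>e. f (comb3 q u v w e))"
    using D by (subst integrable_density) (auto simp: integrable_distr_eq)
  finally show "integrable lborel f \<longleftrightarrow> integrable lborel (\<lambda>e. f (comb3 q u v w e))" .
  have "integral\<^sup>L lborel f = integral\<^sup>L (density (distr lborel borel (comb3 q u v w)) (\<lambda>_. ennreal \<bar>det3 u v w\<bar>)) f"
    by (subst lborel_comb3[OF D, of q]) simp
  also have "\<dots> = \<bar>det3 u v w\<bar> * integral\<^sup>L lborel (\<lambda>e. f (comb3 q u v w e))"
    by (subst integral_density) (auto simp: integral_distr)
  finally show "integral\<^sup>L lborel f = \<bar>det3 u v w\<bar> * integral\<^sup>L lborel (\<lambda>e. f (comb3 q u v w e))" .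
qed

section \<open>The reference triangle and barycentric coordinates\<close>

definition tri :: "pt \<Rightarrow> pt \<Rightarrow> pt \<Rightarrow> real \<times> real \<Rightarrow> pt" where
  "tri a b c st = a + fst st *\<^sub>R (b - a) + snd st *\<^sub>R (c - a)"

lemma tri_continuous: "continuous_on S (tri a b c)"
  unfolding tri_def by (intro continuous_intros)

lemma tri_measurable [measurable]: "tri a b c \<in> borel_measurable borel"
  by (intro borel_measurable_continuous_onI tri_continuous)

lemma reftri_eq: "reftri = convex hull {(0, 0), (1, 0), (0, 1)}"
  unfolding convex_hull_3_alt by (auto simp: reftri_def)

lemma compact_reftri: "compact reftri"
  unfolding reftri_eq by (intro finite_imp_compact_convex_hull) auto

lemma reftri_measurable [measurable]: "reftri \<in> sets borel"
  by (intro borel_compact compact_reftri)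

lemma convex_hull_tri: "convex hull {a, b, c} = tri a b c ` reftri"
  unfolding convex_hull_3_alt by (auto simp: reftri_def tri_def image_iff) blast+

lemma mem_convex_hull_4:
  "x \<in> convex hull {q, a, b, p} \<longleftrightarrow>
    (\<exists>s t r. 0 \<le> s \<and> 0 \<le> t \<and> 0 \<le> r \<and> s + t + r \<le> 1 \<and> x = comb3 q (a - q) (b - q) (p - q) ((s, t), r))"
proof
  assume "x \<in> convex hull {q, a, b, p}"
  then have "x \<in> convex hull (insert q {a, b, p})" by simp
  then obtain u v y where u: "0 \<le> u" "0 \<le> v" "u + v = 1" "y \<in> convex hull {a, b, p}" "x = u *\<^sub>R q + v *\<^sub>R y"
    by (subst (asm) convex_hull_insert) auto
  then obtain s t where st: "0 \<le> s" "0 \<le> t" "s + t \<le> 1" "y = a + s *\<^sub>R (b - a) + t *\<^sub>R (p - a)"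
    unfolding convex_hull_3_alt by auto
  have u': "u = 1 - v" using u by simp
  have "x = comb3 q (a - q) (b - q) (p - q) ((v * (1 - s - t), v * s), v * t)"
    unfolding u(5) u' st(4) by (simp add: comb3_def algebra_simps)
  moreover have "v * (1 - s - t) + v * s + v * t \<le> 1"
    using u by (simp add: algebra_simps)
  ultimately show "\<exists>s t r. 0 \<le> s \<and> 0 \<le> t \<and> 0 \<le> r \<and> s + t + r \<le> 1 \<and> x = comb3 q (a - q) (b - q) (p - q) ((s, t), r)"
    using u st by (intro exI[of _ "v * (1 - s - t)"] exI[of _ "v * s"] exI[of _ "v * t"]) simp
next
  assume "\<exists>s t r. 0 \<le> s \<and> 0 \<le> t \<and> 0 \<le> r \<and> s + t + r \<le> 1 \<and> x = comb3 q (a - q) (b - q) (p - q) ((s, t), r)"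
  then obtain s t r where e: "0 \<le> s" "0 \<le> t" "0 \<le> r" "s + t + r \<le> 1" "x = comb3 q (a - q) (b - q) (p - q) ((s, t), r)"
    by blast
  show "x \<in> convex hull {q, a, b, p}"
  proof (cases "s + t + r = 0")
    case True
    with e have "s = 0" "t = 0" "r = 0" by linarith+
    with e have "x = q" by (simp add: comb3_def)
    then show ?thesis by (simp add: hull_inc)
  next
    case False
    define v where "v = s + t + r"
    define y where "y = (s / v) *\<^sub>R a + (t / v) *\<^sub>R b + (r / v) *\<^sub>R p"
    have "v \<noteq> 0" using False by (simp add: v_def)
    then have "0 \<le> s / v" "0 \<le> t / v" "0 \<le> r / v" "s / v + t / v + r / v = 1"
      using e by (auto simp: v_def add_divide_distrib[symmetric])
    then have "y \<in> convex hull {a, b, p}"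
      unfolding convex_hull_3 y_def by blast
    moreover have "x = (1 - v) *\<^sub>R q + v *\<^sub>R y"
    proof -
      have "v *\<^sub>R y = s *\<^sub>R a + t *\<^sub>R b + r *\<^sub>R p"
        using \<open>v \<noteq> 0\<close> by (simp add: y_def scaleR_add_right)
      then show ?thesis
        unfolding e by (simp add: comb3_def v_def algebra_simps)
    qed
    moreover have "convex hull {a, b, p} \<subseteq> convex hull {q, a, b, p}"
      by (rule hull_mono) auto
    moreover have "q \<in> convex hull {q, a, b, p}"
      by (simp add: hull_inc)
    ultimately show ?thesis
      using e convexD[OF convex_convex_hull, of q "{q, a, b, p}" y "1 - v" v] by (auto simp: v_def)
  qed
qed

lemma comb3_mem_simplex_iff:
  assumes "det3 (a - q) (b - q) (p - q) \<noteq> 0"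
  shows "comb3 q (a - q) (b - q) (p - q) ((s, t), r) \<in> convex hull {q, a, b, p} \<longleftrightarrow>
    0 \<le> s \<and> 0 \<le> t \<and> 0 \<le> r \<and> s + t + r \<le> 1"
  unfolding mem_convex_hull_4 using comb3_inj[OF assms] by blast

lemma compact_convex_hull_4: "compact (convex hull {q, a, b, p :: pt})"
  by (intro finite_imp_compact_convex_hull) auto

lemma continuous_reftri_integrable:
  fixes f :: "real \<times> real \<Rightarrow> real"
  assumes "continuous_on reftri f"
  shows "set_integrable lborel reftri f"
  unfolding set_integrable_def by (rule borel_integrable_compact[OF compact_reftri assms])

text \<open>The fundamental theorem of calculus on segments parallel to the edge from
  \<open>q\<close> to \<open>p\<close>: over \<open>(s, t)\<close> such a segment starts on the
  facet \<open>q a b\<close>, has length parameter 1 - s - t, and ends on the facet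
  \<open>p a b\<close> at the point with the same parameters.\<close>

lemma simplex_edge_integral:
  assumes D: "det3 (a - q) (b - q) (p - q) \<noteq> 0" and h: "smooth h"
  shows "(LINT x:convex hull {q, a, b, p}|lborel. \<Sum>i\<in>UNIV. cpartial i h x * (p - q) $ i)
    = \<bar>det3 (a - q) (b - q) (p - q)\<bar> *
      ((LINT st:reftri|lborel. h (tri p a b st)) - (LINT st:reftri|lborel. h (tri q a b st)))"
    (is "?L = ?D * _")
proof -
  let ?T = "convex hull {q, a, b, p}"
  let ?A = "comb3 q (a - q) (b - q) (p - q)"
  define g where "g x = (\<Sum>i\<in>UNIV. cpartial i h x * (p - q) $ i)" for x
  define f where "f x = indicator ?T x *\<^sub>R g x" for x
  have gc: "continuous_on S g" for S
    unfolding g_def by (intro continuous_intros smooth_continuous smooth_cpartial h)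
  have fi: "integrable lborel f"
    unfolding f_def by (rule borel_integrable_compact[OF compact_convex_hull_4 gc])
  have fm: "f \<in> borel_measurable borel" using borel_measurable_integrable[OF fi] by simp
  have fA: "f (?A (st, r)) = indicator reftri st * (g (?A (st, r)) * indicator {0..1 - fst st - snd st} r)" for st r
    unfolding f_def by (cases st) (auto simp: comb3_mem_simplex_iff[OF D] indicator_def reftri_def)
  have inner: "(LINT r|lborel. g (?A (st, r)) * indicator {0..1 - fst st - snd st} r)
     = h (tri p a b st) - h (tri q a b st)" if "st \<in> reftri" for st
  proof -
    let ?F = "\<lambda>r. h (?A (st, r))"
    have line: "?A (st, r) = tri q a b st + r *\<^sub>R (p - q)" for r
      by (simp add: comb3_def tri_def)
    have "(LINT r|lborel. g (?A (st, r)) * indicator {0..1 - fst st - snd st} r)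
        = ?F (1 - fst st - snd st) - ?F 0"
    proof (rule integral_FTC_Icc_real)
      show "0 \<le> 1 - fst st - snd st" using that by (auto simp: reftri_def)
      show "(?F has_real_derivative g (?A (st, x))) (at x)" for x
        unfolding line g_def by (rule smooth_line_derivative[OF h])
      show "isCont (\<lambda>r. g (?A (st, r))) x" for x
      proof -
        have "continuous_on UNIV (\<lambda>r. g (?A (st, r)))"
          unfolding line by (rule continuous_on_compose2[OF gc[of UNIV]]) (auto intro!: continuous_intros)
        then show ?thesis by (simp add: continuous_on_eq_continuous_at)
      qed
    qed
    moreover have "?A (st, 1 - fst st - snd st) = tri p a b st" "?A (st, 0) = tri q a b st"
      by (simp_all add: comb3_def tri_def algebra_simps)
    ultimately show ?thesis by simp
  qed
  have "?L = integral\<^sup>L lborel f"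
    unfolding set_lebesgue_integral_def
    by (rule Bochner_Integration.integral_cong) (simp_all add: f_def g_def)
  also have "\<dots> = ?D * integral\<^sup>L lborel (\<lambda>e. f (?A e))"
    by (rule integral_comb3[OF D fm])
  also have "integral\<^sup>L lborel (\<lambda>e. f (?A e)) = (LINT st|lborel. LINT r|lborel. f (?A (st, r)))"
    using integrable_comb3[OF D fm, of q] fi
    by (subst lborel_pair.integral_fst') (simp_all add: lborel_prod)
  also have "\<dots> = (LINT st|lborel. indicator reftri st * (h (tri p a b st) - h (tri q a b st)))"
    unfolding fA
  proof (intro Bochner_Integration.integral_cong refl)
    show "(LINT r|lborel. indicator reftri st * (g (?A (st, r)) * indicator {0..1 - fst st - snd st} r))
        = indicator reftri st * (h (tri p a b st) - h (tri q a b st))" for st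
      using inner[of st] by (cases "st \<in> reftri") simp_all
  qed
  also have "\<dots> = (LINT st:reftri|lborel. h (tri p a b st) - h (tri q a b st))"
    by (simp add: set_lebesgue_integral_def)
  also have "\<dots> = (LINT st:reftri|lborel. h (tri p a b st)) - (LINT st:reftri|lborel. h (tri q a b st))"
    by (intro set_integral_diff continuous_reftri_integrable)
      (auto intro!: continuous_on_compose2[OF smooth_continuous[OF h] tri_continuous])
  finally show ?thesis .
qed

section \<open>Conical coordinates with apex at a vertex\<close>

definition cone :: "pt \<Rightarrow> pt \<Rightarrow> pt \<Rightarrow> pt \<Rightarrow> real \<times> real \<Rightarrow> real \<Rightarrow> pt" where
  "cone d a b c st r = d + r *\<^sub>R (tri a b c st - d)"

definition dilate :: "(real \<times> real) \<times> real \<Rightarrow> (real \<times> real) \<times> real" where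
  "dilate e = (snd e *\<^sub>R fst e, snd e)"

text \<open>The Jacobian r^2 of \<open>dilate\<close>, cut off to r > 0, where \<open>dilate\<close>
  is injective.\<close>

definition cone_weight :: "(real \<times> real) \<times> real \<Rightarrow> real" where
  "cone_weight e = indicator {0<..} (snd e) * (snd e)\<^sup>2"

lemma dilate_measurable [measurable]: "dilate \<in> borel_measurable borel"
  unfolding dilate_def by (intro borel_measurable_continuous_onI continuous_intros)

lemma cone_weight_measurable [measurable]: "cone_weight \<in> borel_measurable borel"
  unfolding cone_weight_def by (simp add: borel_prod[symmetric])

text \<open>At fixed \<open>r\<close> the map scales the plane by \<open>r\<close>, hence its
  measure by r^2; Tonelli's theorem assembles the slices.\<close>

lemma lborel_dilate:
  "density lborel (\<lambda>e. ennreal (indicator {0<..} (snd e)))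
     = distr (density lborel (\<lambda>e. ennreal (cone_weight e))) borel dilate" (is "?M = ?N")
proof (rule measure_eqI)
  fix A assume "A \<in> sets ?M"
  then have [measurable]: "A \<in> sets borel" by simp
  have [measurable]: "(\<lambda>e::(real \<times> real) \<times> real. indicator {0<..} (snd e) :: real) \<in> borel_measurable borel"
    by (simp add: borel_prod[symmetric])
  have [measurable]: "(\<lambda>st::real \<times> real. (st, r)) \<in> borel \<rightarrow>\<^sub>M borel" for r :: real
    by (intro borel_measurable_continuous_onI continuous_intros)
  have pos: "(\<integral>\<^sup>+st. ennreal (indicator {0<..} r) * indicator A (st, r) \<partial>lborel)
      = (\<integral>\<^sup>+st. ennreal (cone_weight (st, r)) * indicator A (dilate (st, r)) \<partial>lborel)" for r
  proof (cases "r > 0")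
    case True
    have "(\<integral>\<^sup>+st. indicator A (st, r) \<partial>lborel)
        = (\<integral>\<^sup>+st. indicator A (st, r) \<partial>density (distr lborel borel (\<lambda>x. 0 + r *\<^sub>R x)) (\<lambda>_. \<bar>r\<bar> ^ DIM(real \<times> real)))"
      using True by (subst lborel_affine[of r 0]) auto
    also have "\<dots> = (\<integral>\<^sup>+st. ennreal (r\<^sup>2) * indicator A (r *\<^sub>R st, r) \<partial>lborel)"
      using True by (simp add: nn_integral_density nn_integral_distr ennreal_power power2_eq_square)
    finally show ?thesis
      using True by (simp add: cone_weight_def dilate_def)
  qed (simp add: cone_weight_def)
  have "emeasure ?M A = (\<integral>\<^sup>+e. ennreal (indicator {0<..} (snd e)) * indicator A e \<partial>(lborel \<Otimes>\<^sub>M lborel))"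
    by (subst emeasure_density) (auto simp: lborel_prod)
  also have "\<dots> = (\<integral>\<^sup>+r. \<integral>\<^sup>+st. ennreal (indicator {0<..} r) * indicator A (st, r) \<partial>lborel \<partial>lborel)"
    by (subst lborel_pair.nn_integral_snd[symmetric]) (auto simp: lborel_prod)
  also have "\<dots> = (\<integral>\<^sup>+r. \<integral>\<^sup>+st. ennreal (cone_weight (st, r)) * indicator A (dilate (st, r)) \<partial>lborel \<partial>lborel)"
    unfolding pos ..
  also have "\<dots> = (\<integral>\<^sup>+e. ennreal (cone_weight e) * indicator A (dilate e) \<partial>(lborel \<Otimes>\<^sub>M lborel))"
    by (subst lborel_pair.nn_integral_snd[symmetric]) (auto simp: lborel_prod)
  also have "\<dots> = emeasure ?N A"
    using measurable_sets_borel[OF dilate_measurable \<open>A \<in> sets borel\<close>]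
    by (subst emeasure_distr) (auto simp: lborel_prod emeasure_density intro!: nn_integral_cong split: split_indicator)
  finally show "emeasure ?M A = emeasure ?N A" .
qed simp

lemma
  fixes f :: "(real \<times> real) \<times> real \<Rightarrow> real"
  assumes [measurable]: "f \<in> borel_measurable borel"
  shows integrable_dilate: "integrable lborel (\<lambda>e. indicator {0<..} (snd e) * f e) \<longleftrightarrow>
      integrable lborel (\<lambda>e. cone_weight e * f (dilate e))"
    and integral_dilate: "(LINT e|lborel. indicator {0<..} (snd e) * f e) = (LINT e|lborel. cone_weight e * f (dilate e))"
proof -
  have [measurable]: "(\<lambda>e::(real \<times> real) \<times> real. indicator {0<..} (snd e) :: real) \<in> borel_measurable borel"
    by (simp add: borel_prod[symmetric])
  have nn: "cone_weight e \<ge> 0" for e by (simp add: cone_weight_def)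
  have "integrable lborel (\<lambda>e. indicator {0<..} (snd e) * f e) \<longleftrightarrow>
      integrable (density lborel (\<lambda>e. ennreal (indicator {0<..} (snd e)))) f"
    by (subst integrable_density) auto
  also have "\<dots> \<longleftrightarrow> integrable lborel (\<lambda>e. cone_weight e * f (dilate e))"
    unfolding lborel_dilate by (subst integrable_distr_eq) (auto simp: integrable_density nn)
  finally show "integrable lborel (\<lambda>e. indicator {0<..} (snd e) * f e) \<longleftrightarrow>
      integrable lborel (\<lambda>e. cone_weight e * f (dilate e))" .
  have "(LINT e|lborel. indicator {0<..} (snd e) * f e) =
      integral\<^sup>L (density lborel (\<lambda>e. ennreal (indicator {0<..} (snd e)))) f"
    by (subst integral_density) auto
  also have "\<dots> = (LINT e|lborel. cone_weight e * f (dilate e))"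
    unfolding lborel_dilate by (subst integral_distr) (auto simp: integral_density nn)
  finally show "(LINT e|lborel. indicator {0<..} (snd e) * f e) = (LINT e|lborel. cone_weight e * f (dilate e))" .
qed

subsection \<open>Radial integration from a vertex\<close>

lemma comb3_dilate: "comb3 d (b - a) (c - a) (a - d) (dilate (st, r)) = cone d a b c st r"
  by (simp add: comb3_def dilate_def cone_def tri_def algebra_simps)

lemma cone_continuous: "continuous_on S (cone d a b c st)"
  unfolding cone_def by (intro continuous_intros)

lemma comb3_mem_cone_iff:
  assumes "det3 (b - a) (c - a) (a - d) \<noteq> 0"
  shows "comb3 d (b - a) (c - a) (a - d) ((s, t), r) \<in> convex hull {d, a, b, c} \<longleftrightarrow>
    0 \<le> s \<and> 0 \<le> t \<and> s + t \<le> r \<and> r \<le> 1"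
proof -
  have eq: "comb3 d (b - a) (c - a) (a - d) ((s, t), r) = comb3 d (a - d) (b - d) (c - d) ((r - s - t, s), t)"
    by (simp add: comb3_def algebra_simps)
  have "det3 (a - d) (b - d) (c - d) = det3 (b - a) (c - a) (a - d)"
    by (simp add: cross3_def inner_vec_def sum_3 algebra_simps)
  then show ?thesis
    unfolding eq using assms by (subst comb3_mem_simplex_iff) auto
qed

lemma cone_mem_iff:
  assumes D: "det3 (b - a) (c - a) (a - d) \<noteq> 0" and r: "r > 0"
  shows "cone d a b c st r \<in> convex hull {d, a, b, c} \<longleftrightarrow> st \<in> reftri \<and> r \<le> 1"
proof -
  obtain s t where st: "st = (s, t)" by fastforce
  have "r * s + r * t \<le> r \<longleftrightarrow> s + t \<le> 1"
    using r by (metis distrib_left mult.right_neutral mult_le_cancel_left_pos)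
  then show ?thesis
    using r unfolding comb3_dilate[symmetric] st dilate_def
    by (simp add: comb3_mem_cone_iff[OF D] reftri_def zero_le_mult_iff)
qed

definition cone_integrand :: "pt \<Rightarrow> pt \<Rightarrow> pt \<Rightarrow> pt \<Rightarrow> (pt \<Rightarrow> real) \<Rightarrow> real \<times> real \<Rightarrow> real \<Rightarrow> real" where
  "cone_integrand d a b c k st r = indicator {0<..1} r * (r\<^sup>2 * k (cone d a b c st r))"

definition cone_mean :: "pt \<Rightarrow> pt \<Rightarrow> pt \<Rightarrow> pt \<Rightarrow> (pt \<Rightarrow> real) \<Rightarrow> real \<times> real \<Rightarrow> real" where
  "cone_mean d a b c k st = (LINT r|lborel. cone_integrand d a b c k st r)"

lemma
  assumes D: "det3 (b - a) (c - a) (a - d) \<noteq> 0"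
    and [measurable]: "k \<in> borel_measurable borel"
    and k: "set_integrable lborel (convex hull {d, a, b, c}) k"
  shows cone_integrable: "integrable lborel (\<lambda>e. indicator reftri (fst e) * cone_integrand d a b c k (fst e) (snd e))"
    and cone_integral: "(LINT x:convex hull {d, a, b, c}|lborel. k x) = \<bar>det3 (b - a) (c - a) (a - d)\<bar> *
      (LINT e|lborel. indicator reftri (fst e) * cone_integrand d a b c k (fst e) (snd e))"
proof -
  let ?T = "convex hull {d, a, b, c}"
  let ?A = "comb3 d (b - a) (c - a) (a - d)"
  have [measurable]: "?T \<in> sets borel" by (intro borel_compact compact_convex_hull_4)
  define f where "f = (\<lambda>x. indicator ?T x * k x)"
  have [measurable]: "f \<in> borel_measurable borel" unfolding f_def by measurable
  have [measurable]: "(\<lambda>e. f (?A e)) \<in> borel_measurable borel" by measurable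
  have fi: "integrable lborel f" using k by (simp add: f_def set_integrable_def)
  have fA: "integrable lborel (\<lambda>e. f (?A e))" using fi integrable_comb3[OF D, of f d] by simp
  have [measurable]: "(\<lambda>e::(real \<times> real) \<times> real. indicator {0<..} (snd e) :: real) \<in> borel_measurable borel"
    by (simp add: borel_prod[symmetric])
  \<comment> \<open>For r \<le> 0 the tetrahedron is met only at its apex, which is the origin of
    the parameter space, so the restriction to r > 0 loses one point.\<close>
  have ae: "AE e in lborel. f (?A e) = indicator {0<..} (snd e) * f (?A e)"
    using AE_lborel_singleton[of "0 :: (real \<times> real) \<times> real"]
  proof eventually_elim
    case (elim e)
    obtain s t r where e: "e = ((s, t), r)" by (metis prod.exhaust)
    show ?case
    proof (cases "r > 0")
      case False
      have "\<not> (0 \<le> s \<and> 0 \<le> t \<and> s + t \<le> r \<and> r \<le> 1)"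
      proof
        assume "0 \<le> s \<and> 0 \<le> t \<and> s + t \<le> r \<and> r \<le> 1"
        with False have "s = 0" "t = 0" "r = 0" by linarith+
        with elim e show False by (simp add: zero_prod_def)
      qed
      then have "?A e \<notin> ?T" unfolding e comb3_mem_cone_iff[OF D] .
      then show ?thesis by (simp add: f_def)
    qed (simp add: e)
  qed
  have eq: "cone_weight e * f (?A (dilate e)) = indicator reftri (fst e) * cone_integrand d a b c k (fst e) (snd e)" for e
  proof (cases "snd e > 0")
    case True
    have "f (?A (dilate e)) = indicator reftri (fst e) * indicator {..1} (snd e) * k (cone d a b c (fst e) (snd e))"
      using comb3_dilate[of d b a c "fst e" "snd e"] cone_mem_iff[OF D True, of "fst e"]
      by (auto simp: f_def indicator_def)
    then show ?thesis using True by (simp add: cone_weight_def cone_integrand_def indicator_def)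
  qed (simp add: cone_weight_def cone_integrand_def)
  have "integrable lborel (\<lambda>e. indicator {0<..} (snd e) * f (?A e))"
    using integrable_cong_AE[OF _ _ ae] fA by simp
  then show "integrable lborel (\<lambda>e. indicator reftri (fst e) * cone_integrand d a b c k (fst e) (snd e))"
    using integrable_dilate[of "\<lambda>e. f (?A e)"] unfolding eq by simp
  have "(LINT x:?T|lborel. k x) = integral\<^sup>L lborel f"
    by (simp add: set_lebesgue_integral_def f_def)
  also have "\<dots> = \<bar>det3 (b - a) (c - a) (a - d)\<bar> * (LINT e|lborel. f (?A e))"
    by (rule integral_comb3[OF D]) simp
  also have "(LINT e|lborel. f (?A e)) = (LINT e|lborel. indicator {0<..} (snd e) * f (?A e))"
    by (rule integral_cong_AE[OF _ _ ae]) auto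
  also have "\<dots> = (LINT e|lborel. cone_weight e * f (?A (dilate e)))"
    by (rule integral_dilate) simp
  finally show "(LINT x:?T|lborel. k x) = \<bar>det3 (b - a) (c - a) (a - d)\<bar> *
      (LINT e|lborel. indicator reftri (fst e) * cone_integrand d a b c k (fst e) (snd e))"
    unfolding eq .
qed

text \<open>Central projection from \<open>d\<close> onto the plane of \<open>a\<close>,
  \<open>b\<close>, \<open>c\<close>; the quotient of the two determinants is the radial parameter
  of \<open>x\<close>. It extends functions on the facet to the tetrahedron, constantly along
  rays.\<close>

definition radial_proj :: "pt \<Rightarrow> pt \<Rightarrow> pt \<Rightarrow> pt \<Rightarrow> pt \<Rightarrow> pt" where
  "radial_proj d a b c x =
    d + (1 / ((cross3 (b - a) (c - a) \<bullet> (x - d)) / det3 (b - a) (c - a) (a - d))) *\<^sub>R (x - d)"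

lemma radial_proj_cone:
  assumes D: "det3 (b - a) (c - a) (a - d) \<noteq> 0" and r: "r \<noteq> 0"
  shows "radial_proj d a b c (cone d a b c st r) = tri a b c st"
proof -
  have "cross3 (b - a) (c - a) \<bullet> (tri a b c st - d) = det3 (b - a) (c - a) (a - d)"
    by (simp add: tri_def inner_add_right inner_diff_right dot_cross_self algebra_simps)
      (simp add: cross3_def inner_vec_def sum_3 algebra_simps)
  then show ?thesis
    using assms by (simp add: radial_proj_def cone_def)
qed

lemma radial_proj_measurable [measurable]: "radial_proj d a b c \<in> borel_measurable borel"
  unfolding radial_proj_def by measurable

lemma cone_cases:
  assumes D: "det3 (b - a) (c - a) (a - d) \<noteq> 0" and x: "x \<in> convex hull {d, a, b, c}"
  obtains "x = d" | st r where "st \<in> reftri" "0 < r" "r \<le> 1" "x = cone d a b c st r"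
proof -
  from x obtain s t r where e: "0 \<le> s" "0 \<le> t" "0 \<le> r" "s + t + r \<le> 1" "x = comb3 d (a - d) (b - d) (c - d) ((s, t), r)"
    unfolding mem_convex_hull_4 by blast
  show ?thesis
  proof (cases "s + t + r = 0")
    case True
    then have "s = 0" "t = 0" "r = 0" using e by linarith+
    then show ?thesis using e that(1) by (simp add: comb3_def)
  next
    case False
    define \<rho> where "\<rho> = s + t + r"
    have \<rho>: "\<rho> > 0" using False e by (simp add: \<rho>_def)
    have "x = cone d a b c (t / \<rho>, r / \<rho>) \<rho>"
    proof -
      have "\<rho> *\<^sub>R (tri a b c (t / \<rho>, r / \<rho>) - d) = \<rho> *\<^sub>R (a - d) + t *\<^sub>R (b - a) + r *\<^sub>R (c - a)"
        using \<rho> by (simp add: tri_def scaleR_add_right scaleR_diff_right)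
      then show ?thesis
        unfolding e cone_def by (simp add: comb3_def \<rho>_def algebra_simps)
    qed
    moreover have "(t / \<rho>, r / \<rho>) \<in> reftri"
      using e \<rho> by (auto simp: reftri_def \<rho>_def add_divide_distrib[symmetric])
    moreover have "\<rho> \<le> 1" using e by (simp add: \<rho>_def)
    ultimately show ?thesis using that(2) \<rho> by blast
  qed
qed

lemma radial_proj_mem:
  assumes D: "det3 (b - a) (c - a) (a - d) \<noteq> 0" and x: "x \<in> convex hull {d, a, b, c}"
  shows "radial_proj d a b c x \<in> convex hull {d, a, b, c}"
  using cone_cases[OF D x]
proof cases
  case 1
  then show ?thesis by (simp add: radial_proj_def hull_inc)
next
  case (2 st r)
  have "cone d a b c st 1 \<in> convex hull {d, a, b, c}"
    using 2 by (subst cone_mem_iff[OF D]) auto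
  then show ?thesis
    using 2 radial_proj_cone[OF D, of r st] by (simp add: cone_def)
qed

lemma continuous_at_radial_proj:
  assumes "det3 (b - a) (c - a) (a - d) \<noteq> 0" "cross3 (b - a) (c - a) \<bullet> (x - d) \<noteq> 0"
  shows "isCont (radial_proj d a b c) x"
  unfolding radial_proj_def using assms by (intro continuous_intros) auto

text \<open>Turns a facet integral into a volume integral: composed with the projection,
  \<open>\<phi>\<close> is constant along each ray and leaves the inner radial integral.\<close>

lemma
  assumes D: "det3 (b - a) (c - a) (a - d) \<noteq> 0"
    and km[measurable]: "k \<in> borel_measurable borel"
    and k: "set_integrable lborel (convex hull {d, a, b, c}) k"
    and \<phi>m[measurable]: "\<phi> \<in> borel_measurable borel"
    and \<phi>k: "set_integrable lborel (convex hull {d, a, b, c}) (\<lambda>x. k x * \<phi> (radial_proj d a b c x))"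
  shows cone_mean_integral: "(LINT x:convex hull {d, a, b, c}|lborel. k x * \<phi> (radial_proj d a b c x))
      = \<bar>det3 (b - a) (c - a) (a - d)\<bar> * (LINT st:reftri|lborel. cone_mean d a b c k st * \<phi> (tri a b c st))"
    and cone_mean_integrable: "set_integrable lborel reftri (cone_mean d a b c k)"
proof -
  let ?I = "cone_integrand d a b c"
  let ?p = "radial_proj d a b c"
  have I: "?I (\<lambda>x. k x * \<phi> (?p x)) st r = ?I k st r * \<phi> (tri a b c st)" for st r
    by (simp add: cone_integrand_def radial_proj_cone[OF D] indicator_def)
  have m: "(\<lambda>x. k x * \<phi> (?p x)) \<in> borel_measurable borel" by measurable
  have i: "integrable (lborel \<Otimes>\<^sub>M lborel) (\<lambda>e. indicator reftri (fst e) * (?I k (fst e) (snd e) * \<phi> (tri a b c (fst e))))"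
    using cone_integrable[OF D m \<phi>k] unfolding I lborel_prod .
  have "(LINT e|lborel. indicator reftri (fst e) * (?I k (fst e) (snd e) * \<phi> (tri a b c (fst e))))
     = (LINT st|lborel. LINT r|lborel. indicator reftri st * (?I k st r * \<phi> (tri a b c st)))"
    using lborel_pair.integral_fst'[OF i] by (simp add: lborel_prod)
  also have "\<dots> = (LINT st:reftri|lborel. cone_mean d a b c k st * \<phi> (tri a b c st))"
    by (simp add: set_lebesgue_integral_def cone_mean_def)
  finally show "(LINT x:convex hull {d, a, b, c}|lborel. k x * \<phi> (?p x))
      = \<bar>det3 (b - a) (c - a) (a - d)\<bar> * (LINT st:reftri|lborel. cone_mean d a b c k st * \<phi> (tri a b c st))"
    unfolding cone_integral[OF D m \<phi>k] I by simp
  have "integrable (lborel \<Otimes>\<^sub>M lborel) (\<lambda>e. indicator reftri (fst e) * ?I k (fst e) (snd e))"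
    using cone_integrable[OF D km k] unfolding lborel_prod .
  from lborel_pair.integrable_fst'[OF this]
  show "set_integrable lborel reftri (cone_mean d a b c k)"
    by (simp add: set_integrable_def cone_mean_def)
qed

text \<open>Jensen's inequality along rays, as the weight r^2 has mass at most 1. It is obtained by
  integrating \<open>(r * \<kappa> - r * u)\<^sup>2 \<ge> 0\<close>, where \<open>u\<close> is the
  radial mean, and replacing r^2 u^2 by the larger u^2: what remains on the left is 2 u^2 -
  u^2.\<close>

lemma cone_mean_square_integrable:
  assumes D: "det3 (b - a) (c - a) (a - d) \<noteq> 0"
    and km[measurable]: "k \<in> borel_measurable borel"
    and k: "set_integrable lborel (convex hull {d, a, b, c}) k"
    and k2: "set_integrable lborel (convex hull {d, a, b, c}) (\<lambda>x. (k x)\<^sup>2)"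
  shows "set_integrable lborel reftri (\<lambda>st. (cone_mean d a b c k st)\<^sup>2)"
proof -
  let ?I = "cone_integrand d a b c"
  let ?G = "\<lambda>st. LINT r|lborel. ?I (\<lambda>x. (k x)\<^sup>2) st r"
  have m2: "(\<lambda>x. (k x)\<^sup>2) \<in> borel_measurable borel" by measurable
  have i: "integrable (lborel \<Otimes>\<^sub>M lborel) (\<lambda>e. indicator reftri (fst e) * ?I (\<lambda>x. (k x)\<^sup>2) (fst e) (snd e))"
    using cone_integrable[OF D m2 k2] unfolding lborel_prod .
  have i1: "integrable (lborel \<Otimes>\<^sub>M lborel) (\<lambda>e. indicator reftri (fst e) * ?I k (fst e) (snd e))"
    using cone_integrable[OF D km k] unfolding lborel_prod .
  have G: "integrable lborel (\<lambda>st. indicator reftri st * ?G st)"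
    using lborel_pair.integrable_fst'[OF i] by simp
  have gi: "integrable lborel (\<lambda>st. indicator reftri st * cone_mean d a b c k st)"
    using lborel_pair.integrable_fst'[OF i1] by (simp add: cone_mean_def)
  have sq: "indicator reftri st * (cone_mean d a b c k st)\<^sup>2 = (indicator reftri st * cone_mean d a b c k st)\<^sup>2" for st
    by (simp add: power2_eq_square indicator_def)
  have bound: "(cone_mean d a b c k st)\<^sup>2 \<le> ?G st"
    if a: "integrable lborel (\<lambda>r. ?I k st r)" "integrable lborel (\<lambda>r. ?I (\<lambda>x. (k x)\<^sup>2) st r)" for st
  proof -
    define u where "u = cone_mean d a b c k st"
    have "integrable lborel (\<lambda>r::real. indicator {0<..1} r :: real)"
      by simp
    then have "(LINT r|lborel. 2 * u * ?I k st r - u\<^sup>2 * indicator {0<..1} r) \<le> ?G st"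
    proof (intro integral_mono Bochner_Integration.integrable_diff integrable_mult_right a)
      fix r :: real
      show "2 * u * ?I k st r - u\<^sup>2 * indicator {0<..1} r \<le> ?I (\<lambda>x. (k x)\<^sup>2) st r"
      proof (cases "r \<in> {0<..1}")
        case True
        define \<kappa> where "\<kappa> = k (cone d a b c st r)"
        have "0 \<le> (r * \<kappa> - r * u)\<^sup>2" by simp
        then have "2 * u * (r\<^sup>2 * \<kappa>) - r\<^sup>2 * u\<^sup>2 \<le> r\<^sup>2 * \<kappa>\<^sup>2"
          by (simp add: power2_eq_square algebra_simps)
        moreover have "r\<^sup>2 * u\<^sup>2 \<le> 1 * u\<^sup>2"
          using True by (intro mult_right_mono) (auto simp: power_le_one)
        ultimately show ?thesis using True by (simp add: cone_integrand_def \<kappa>_def)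
      qed (simp add: cone_integrand_def)
    qed
    also have "(LINT r|lborel. 2 * u * ?I k st r - u\<^sup>2 * indicator {0<..1} r) = u\<^sup>2"
      using a by (subst Bochner_Integration.integral_diff)
        (auto simp: u_def cone_mean_def[symmetric] power2_eq_square)
    finally show ?thesis by (simp add: u_def)
  qed
  show ?thesis
    unfolding set_integrable_def real_scaleR_def
  proof (rule Bochner_Integration.integrable_bound[OF G])
    show "(\<lambda>st. indicator reftri st * (cone_mean d a b c k st)\<^sup>2) \<in> borel_measurable lborel"
      unfolding sq using borel_measurable_integrable[OF gi] by measurable
    show "AE st in lborel. norm (indicator reftri st * (cone_mean d a b c k st)\<^sup>2) \<le> norm (indicator reftri st * ?G st)"
      using lborel_pair.AE_integrable_fst'[OF i] lborel_pair.AE_integrable_fst'[OF i1]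
    proof eventually_elim
      case (elim st)
      show ?case
      proof (cases "st \<in> reftri")
        case True
        then show ?thesis
          using elim bound[of st] order_trans[OF zero_le_power2 bound[of st]] by simp
      qed simp
    qed
  qed
qed

text \<open>The integrand is the derivative of r^3 h along the ray, because x - d is r times the
  direction vector. The factor r^3 removes the value at the apex, and r = 1 is the point on the
  facet.\<close>

lemma cone_mean_smooth:
  assumes h: "smooth h"
  shows "cone_mean d a b c (\<lambda>x. 3 * h x + (\<Sum>i\<in>UNIV. cpartial i h x * (x - d) $ i)) st = h (tri a b c st)"
proof -
  let ?C = "cone d a b c st"
  define v where "v = tri a b c st - d"
  define k where "k = (\<lambda>x. 3 * h x + (\<Sum>i\<in>UNIV. cpartial i h x * (x - d) $ i))"
  have C: "?C r = d + r *\<^sub>R v" for r by (simp add: cone_def v_def)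
  have kc: "continuous_on UNIV (\<lambda>r. r\<^sup>2 * k (?C r))"
    unfolding k_def
    by (intro continuous_intros continuous_on_compose2[OF smooth_continuous[OF h, of UNIV] cone_continuous]
        continuous_on_compose2[OF smooth_continuous[OF smooth_cpartial[OF h], of UNIV] cone_continuous]
        cone_continuous) auto
  have "cone_mean d a b c k st = (LINT r|lborel. (r\<^sup>2 * k (?C r)) * indicator {0..1} r)"
    unfolding cone_mean_def
  proof (rule integral_cong_AE)
    have "(\<lambda>r. r\<^sup>2 * k (?C r)) \<in> borel_measurable borel"
      using kc by (rule borel_measurable_continuous_onI)
    then show "(\<lambda>r. cone_integrand d a b c k st r) \<in> borel_measurable lborel"
      "(\<lambda>r. (r\<^sup>2 * k (?C r)) * indicator {0..1} r) \<in> borel_measurable lborel"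
      unfolding cone_integrand_def by auto
    show "AE r in lborel. cone_integrand d a b c k st r = (r\<^sup>2 * k (?C r)) * indicator {0..1} r"
      using AE_lborel_singleton[of "0 :: real"]
      by eventually_elim (auto simp: cone_integrand_def indicator_def)
  qed
  also have "\<dots> = 1 ^ 3 * h (?C 1) - 0 ^ 3 * h (?C 0)"
  proof (rule integral_FTC_Icc_real)
    show "((\<lambda>r. r ^ 3 * h (?C r)) has_real_derivative r\<^sup>2 * k (?C r)) (at r)" for r
      unfolding C k_def
      by (rule derivative_eq_intros smooth_line_derivative[OF h] refl)+
        (simp add: algebra_simps sum_distrib_left power2_eq_square power3_eq_cube)
    show "isCont (\<lambda>r. r\<^sup>2 * k (?C r)) r" for r
      using kc by (simp add: continuous_on_eq_continuous_at)
  qed simp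
  finally have "cone_mean d a b c k st = h (tri a b c st)"
    by (simp add: cone_def)
  then show ?thesis unfolding k_def .
qed

subsection \<open>Tetrahedra and the divergence theorem\<close>

abbreviation tri_integral :: "pt \<Rightarrow> pt \<Rightarrow> pt \<Rightarrow> (pt \<Rightarrow> real) \<Rightarrow> real" where
  "tri_integral a b c h \<equiv> (LINT st:reftri|lborel. h (tri a b c st))"

text \<open>\<open>fvtx\<close> orders the vertices of a facet by choice, so integrals must not
  depend on the order. This transposition is the reflection s \<mapsto> 1 - s - t at fixed t;
  together with the exchange of s and t it generates all six orders.\<close>

lemma tri_integral_swap12:
  assumes [measurable]: "h \<in> borel_measurable borel"
  shows "tri_integral b a c h = tri_integral a b c h"
proof -
  define f where "f = (\<lambda>st. indicator reftri st * h (tri a b c st))"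
  define g where "g = (\<lambda>st. indicator reftri st * h (tri b a c st))"
  have [measurable]: "f \<in> borel_measurable borel" "g \<in> borel_measurable borel"
    unfolding f_def g_def by measurable
  have m: "(\<lambda>st::real \<times> real. (1 - fst st - snd st, snd st)) \<in> borel \<rightarrow>\<^sub>M borel"
    by (intro borel_measurable_continuous_onI continuous_intros)
  have g: "g (s, t) = f (1 - t + (-1) * s, t)" for s t
    by (auto simp: f_def g_def reftri_def tri_def indicator_def algebra_simps)
  have nn: "(\<integral>\<^sup>+ st. ennreal (F (g st)) \<partial>lborel) = (\<integral>\<^sup>+ st. ennreal (F (f st)) \<partial>lborel)"
    if [measurable]: "F \<in> borel_measurable borel" for F :: "real \<Rightarrow> real"
  proof -
    have mf: "(\<lambda>s. f (s, t)) \<in> borel_measurable borel" for t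
      by (rule measurable_compose[of _ _ borel]) (auto intro!: borel_measurable_continuous_onI continuous_intros)
    have "(\<integral>\<^sup>+ st. ennreal (F (g st)) \<partial>lborel) = (\<integral>\<^sup>+ t. \<integral>\<^sup>+ s. ennreal (F (g (s, t))) \<partial>lborel \<partial>lborel)"
      using lborel_pair.nn_integral_snd[of "\<lambda>st. ennreal (F (g st))"] by (simp add: lborel_prod)
    also have "\<dots> = (\<integral>\<^sup>+ t. \<integral>\<^sup>+ s. ennreal (F (f (s, t))) \<partial>lborel \<partial>lborel)"
    proof (rule nn_integral_cong)
      fix t :: real
      show "(\<integral>\<^sup>+ s. ennreal (F (g (s, t))) \<partial>lborel) = (\<integral>\<^sup>+ s. ennreal (F (f (s, t))) \<partial>lborel)"
        unfolding g using mf[of t]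
        by (subst (2) nn_integral_real_affine[where c = "-1" and t = "1 - t"]) auto
    qed
    also have "\<dots> = (\<integral>\<^sup>+ st. ennreal (F (f st)) \<partial>lborel)"
      using lborel_pair.nn_integral_snd[of "\<lambda>st. ennreal (F (f st))"] by (simp add: lborel_prod)
    finally show ?thesis .
  qed
  \<comment> \<open>If one function is not integrable then neither is the other, and both integrals
    have the default value 0.\<close>
  have "integrable lborel g \<longleftrightarrow> integrable lborel f"
    using nn[of norm] by (simp add: integrable_iff_bounded)
  moreover have "integral\<^sup>L lborel g = integral\<^sup>L lborel f" if "integrable lborel g" "integrable lborel f"
    using that nn[of "\<lambda>x. x"] nn[of "\<lambda>x. - x"] by (simp add: real_lebesgue_integral_def)
  ultimately have "integral\<^sup>L lborel g = integral\<^sup>L lborel f"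
    by (metis not_integrable_integral_eq)
  then show ?thesis
    by (simp add: f_def g_def set_lebesgue_integral_def)
qed

lemma tri_integral_swap23:
  assumes [measurable]: "h \<in> borel_measurable borel"
  shows "tri_integral a c b h = tri_integral a b c h"
proof -
  have "(\<lambda>(s, t). indicator reftri (t, s) * h (tri a b c (t, s))) = (\<lambda>st. indicator reftri st * h (tri a c b st))"
    by (auto simp: reftri_def tri_def indicator_def algebra_simps)
  moreover have "integral\<^sup>L (lborel \<Otimes>\<^sub>M lborel) (\<lambda>(s, t). indicator reftri (t, s) * h (tri a b c (t, s)))
      = integral\<^sup>L (lborel \<Otimes>\<^sub>M lborel) (\<lambda>st. indicator reftri st * h (tri a b c st))"
    by (rule lborel_pair.integral_product_swap) (simp add: lborel_prod)
  ultimately show ?thesis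
    by (simp add: set_lebesgue_integral_def lborel_prod)
qed

lemma triangle_reorder:
  assumes "{x, y, z} = {a, b, c}" "card {a, b, c} = 3" and h: "h \<in> borel_measurable borel"
  shows "tri_integral x y z h = tri_integral a b c h
    \<and> (cross3 (y - x) (z - x) = cross3 (b - a) (c - a) \<or> cross3 (y - x) (z - x) = - cross3 (b - a) (c - a))"
proof -
  have d: "a \<noteq> b" "a \<noteq> c" "b \<noteq> c" using assms(2) by (auto simp: card_insert_if split: if_splits)
  have "x \<in> {a, b, c}" "y \<in> {a, b, c}" "z \<in> {a, b, c}" "a \<in> {x, y, z}" "b \<in> {x, y, z}" "c \<in> {x, y, z}"
    using assms(1) by auto
  then consider "x = a" "y = b" "z = c" | "x = a" "y = c" "z = b" | "x = b" "y = a" "z = c"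
    | "x = b" "y = c" "z = a" | "x = c" "y = a" "z = b" | "x = c" "y = b" "z = a"
    using d unfolding insert_iff empty_iff by metis
  moreover note s = tri_integral_swap12[OF h] tri_integral_swap23[OF h]
  moreover have "cross3 (c - a) (b - a) = - cross3 (b - a) (c - a)"
    "cross3 (a - b) (c - b) = - cross3 (b - a) (c - a)"
    "cross3 (c - b) (a - b) = cross3 (b - a) (c - a)"
    "cross3 (a - c) (b - c) = cross3 (b - a) (c - a)"
    "cross3 (b - c) (a - c) = - cross3 (b - a) (c - a)"
    by (simp_all add: vec_eq_iff forall_3 cross3_def algebra_simps)
  ultimately show ?thesis
    by cases (metis s)+
qed

lemma affine_independent_det3:
  assumes ind: "\<not> affine_dependent {a, b, c, d}" and card: "card {a, b, c, d} = 4"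
  shows "det3 (b - a) (c - a) (d - a) \<noteq> 0"
proof
  define u v w where "u = b - a" and "v = c - a" and "w = d - a"
  assume "det3 (b - a) (c - a) (d - a) = 0"
  then have D: "det3 u v w = 0" by (simp add: u_def v_def w_def)
  have dist: "a \<noteq> b" "a \<noteq> c" "a \<noteq> d" "b \<noteq> c" "b \<noteq> d" "c \<noteq> d"
    using card by (auto simp: card_insert_if split: if_splits)
  have z: "\<alpha> = 0 \<and> \<beta> = 0 \<and> \<gamma> = 0" if "\<alpha> *\<^sub>R u + \<beta> *\<^sub>R v + \<gamma> *\<^sub>R w = 0" for \<alpha> \<beta> \<gamma>
  proof (rule ccontr)
    assume nz: "\<not> (\<alpha> = 0 \<and> \<beta> = 0 \<and> \<gamma> = 0)"
    define U where "U x = (if x = a then - \<alpha> - \<beta> - \<gamma> else if x = b then \<alpha> else if x = c then \<beta> else \<gamma>)" for x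
    have "sum U {a, b, c, d} = 0" using dist by (simp add: U_def)
    moreover have "\<exists>x\<in>{a, b, c, d}. U x \<noteq> 0" using nz dist by (auto simp: U_def)
    moreover have "(\<Sum>x\<in>{a, b, c, d}. U x *\<^sub>R x) = 0"
      using that dist by (simp add: U_def u_def v_def w_def algebra_simps)
    ultimately have "affine_dependent {a, b, c, d}"
      by (subst affine_dependent_explicit_finite) auto
    with ind show False ..
  qed
  \<comment> \<open>With zero determinant, Cramer's rule for \<open>cross3 u v\<close> is a linear
    relation whose last coefficient is its squared norm, so it vanishes. The double cross product
    with \<open>v\<close> then yields a relation with first coefficient
    \<open>v \<bullet> v\<close>.\<close>
  have "(cross3 u v \<bullet> cross3 v w) *\<^sub>R u + (cross3 u v \<bullet> cross3 w u) *\<^sub>R v + (cross3 u v \<bullet> cross3 u v) *\<^sub>R w = 0"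
    using det3_expand[of u v w "cross3 u v"] D by simp
  from z[OF this] have "cross3 u v = 0" by simp
  moreover have "cross3 v (cross3 u v) = (v \<bullet> v) *\<^sub>R u + (- (u \<bullet> v)) *\<^sub>R v + 0 *\<^sub>R w"
    by (simp add: vec_eq_iff forall_3 cross3_def inner_vec_def sum_3 algebra_simps)
  ultimately have "(v \<bullet> v) *\<^sub>R u + (- (u \<bullet> v)) *\<^sub>R v + 0 *\<^sub>R w = 0"
    by (simp add: cross3_def vec_eq_iff forall_3)
  from z[OF this] have "v = 0" by simp
  then show False using dist by (simp add: v_def)
qed

section \<open>Vertices, facets and outward normals of a tetrahedron\<close>

lemma tetra_verts:
  assumes "tetra T"
  shows "card (verts T) = 4" "\<not> affine_dependent (verts T)" "convex hull verts T = T"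
proof -
  obtain V where V: "card V = 4" "\<not> affine_dependent V" "T = convex hull V"
    using assms by (auto simp: tetra_def)
  have "verts T = V"
    unfolding verts_def V(3) using extreme_point_of_convex_hull_affine_independent[OF V(2)] by auto
  with V show "card (verts T) = 4" "\<not> affine_dependent (verts T)" "convex hull verts T = T" by auto
qed

lemma tetra_finite_verts: "tetra T \<Longrightarrow> finite (verts T)"
  using tetra_verts(1) by (metis card.infinite zero_neq_numeral)

lemma verts_subset_convex_hull_iff:
  assumes "\<not> affine_dependent V" "W \<subseteq> V" "v \<in> V" "v \<in> convex hull W"
  shows "v \<in> W"
proof (rule ccontr)
  assume "v \<notin> W"
  then have "W \<subseteq> V - {v}" using assms by auto
  then have "v \<in> affine hull (V - {v})"
    using assms(4) convex_hull_subset_affine_hull hull_mono by blast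
  with assms(1,3) show False by (auto simp: affine_dependent_def)
qed

definition opp_facet :: "pt set \<Rightarrow> pt \<Rightarrow> pt set" where
  "opp_facet T v = convex hull (verts T - {v})"

lemma facets_eq:
  assumes T: "tetra T"
  shows "facets T = opp_facet T ` verts T" "inj_on (opp_facet T) (verts T)"
proof -
  show "facets T = opp_facet T ` verts T"
  proof (intro subset_antisym subsetI)
    fix F assume "F \<in> facets T"
    then obtain W where W: "F = convex hull W" "W \<subseteq> verts T" "card W = 3"
      by (auto simp: facets_def)
    have "card (verts T - W) = 1"
      using W tetra_verts(1)[OF T] tetra_finite_verts[OF T] by (simp add: card_Diff_subset finite_subset)
    then obtain v where v: "verts T - W = {v}" by (rule card_1_singletonE)
    then have "W = verts T - {v}" "v \<in> verts T" using W(2) by auto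
    then show "F \<in> opp_facet T ` verts T"
      using W(1) by (auto simp: opp_facet_def)
  next
    fix F assume "F \<in> opp_facet T ` verts T"
    then obtain v where v: "v \<in> verts T" "F = convex hull (verts T - {v})"
      by (auto simp: opp_facet_def)
    then have "card (verts T - {v}) = 3"
      using tetra_verts(1)[OF T] tetra_finite_verts[OF T] by simp
    with v(2) show "F \<in> facets T"
      unfolding facets_def by blast
  qed
  show "inj_on (opp_facet T) (verts T)"
  proof (rule inj_onI, rule ccontr)
    fix v w assume vw: "v \<in> verts T" "w \<in> verts T" "opp_facet T v = opp_facet T w" "v \<noteq> w"
    then have "v \<in> opp_facet T w" by (auto simp: opp_facet_def hull_inc)
    with vw have "v \<in> convex hull (verts T - {v})" by (simp add: opp_facet_def)
    from verts_subset_convex_hull_iff[OF tetra_verts(2)[OF T] _ vw(1) this] show False by auto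
  qed
qed

lemma finite_facets: "tetra T \<Longrightarrow> finite (facets T)"
  by (simp add: facets_eq tetra_finite_verts)

text \<open>The vertices of a nondegenerate triangle are its extreme points, so the choice is
  determined by the point set up to order. As it sees only the set, two tetrahedra give their common
  facet the same parametrisation.\<close>

lemma fvtx_convex_hull:
  assumes ind: "\<not> affine_dependent W" and card: "card W = 3" and f: "fvtx (convex hull W) = (a, b, c)"
  shows "{a, b, c} = W"
proof -
  let ?F = "convex hull W"
  obtain x y z where W: "W = {x, y, z}" "x \<noteq> y" "x \<noteq> z" "y \<noteq> z"
    using card by (metis card_3_iff)
  then have "\<not> collinear {x, y, z}"
    using ind by (simp add: collinear_3_eq_affine_dependent)
  then have "case (x, y, z) of (a, b, c) \<Rightarrow> ?F = convex hull {a, b, c} \<and> \<not> collinear {a, b, c}"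
    using W by simp
  then have "case fvtx ?F of (a, b, c) \<Rightarrow> ?F = convex hull {a, b, c} \<and> \<not> collinear {a, b, c}"
    unfolding fvtx_def by (rule someI)
  then have *: "?F = convex hull {a, b, c}" "\<not> collinear {a, b, c}"
    by (simp_all add: f)
  then have "\<not> affine_dependent {a, b, c}"
    by (simp add: collinear_3_eq_affine_dependent)
  then have "{p. p extreme_point_of ?F} = {a, b, c}"
    unfolding *(1) by (auto simp: extreme_point_of_convex_hull_affine_independent)
  moreover have "{p. p extreme_point_of ?F} = W"
    using ind by (simp add: extreme_point_of_convex_hull_affine_independent)
  ultimately show ?thesis by simp
qed

lemma facet_integral_mult_right: "facet_integral F (\<lambda>x. g x * c) = facet_integral F g * c"
  by (cases "fvtx F") (simp add: facet_integral_def mult.assoc)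

text \<open>The facet of a tetrahedron opposite to the vertex \<open>v\<close>, with the vertices in the order
  chosen by \<^const>\<open>fvtx\<close>.\<close>

locale tetra_facet =
  fixes T :: "pt set" and v a b c :: pt
  assumes T: "tetra T" and v: "v \<in> verts T" and fvtx: "fvtx (opp_facet T v) = (a, b, c)"
begin

abbreviation m :: pt where "m \<equiv> cross3 (b - a) (c - a)"
abbreviation n :: pt where "n \<equiv> onormal T (opp_facet T v)"

lemma abc: "{a, b, c} = verts T - {v}"
proof (rule fvtx_convex_hull)
  show "\<not> affine_dependent (verts T - {v})"
    using tetra_verts(2)[OF T] by (rule affine_independent_subset) auto
  show "card (verts T - {v}) = 3"
    using tetra_verts(1)[OF T] tetra_finite_verts[OF T] v by simp
qed (use fvtx in \<open>simp add: opp_facet_def\<close>)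

lemma verts: "verts T = {v, a, b, c}"
  using abc v by auto

lemma card_abc: "card {a, b, c} = 3"
  unfolding abc using tetra_verts(1)[OF T] tetra_finite_verts[OF T] v by simp

lemma T_eq: "T = convex hull {v, a, b, c}"
  using tetra_verts(3)[OF T] by (simp add: verts)

lemma det: "det3 (b - a) (c - a) (a - v) \<noteq> 0"
proof -
  have "{a, b, c, v} = verts T" by (auto simp: verts)
  then have "det3 (b - a) (c - a) (v - a) \<noteq> 0"
    using affine_independent_det3[of a b c v] tetra_verts[OF T] by simp
  then show ?thesis by (simp add: inner_diff_right)
qed

lemma m_nonzero: "m \<noteq> 0"
  using det by auto

lemma m_orth: "x \<in> {a, b, c} \<Longrightarrow> y \<in> {a, b, c} \<Longrightarrow> m \<bullet> x = m \<bullet> y"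
proof -
  have "m \<bullet> b = m \<bullet> a" "m \<bullet> c = m \<bullet> a"
    using dot_cross_self(3,4)[of "b - a" "c - a"] by (simp_all add: inner_diff_right)
  then show "x \<in> {a, b, c} \<Longrightarrow> y \<in> {a, b, c} \<Longrightarrow> m \<bullet> x = m \<bullet> y" by auto
qed

lemma n_eq: "n = (if m \<bullet> (v - a) > 0 then - ((1 / norm m) *\<^sub>R m) else (1 / norm m) *\<^sub>R m)"
proof -
  have "d \<in> verts T \<and> d \<notin> opp_facet T v \<longleftrightarrow> d = v" for d
  proof
    assume "d \<in> verts T \<and> d \<notin> opp_facet T v"
    then show "d = v"
      unfolding opp_facet_def by (metis Diff_iff hull_inc singletonD)
  next
    assume "d = v"
    then show "d \<in> verts T \<and> d \<notin> opp_facet T v"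
      using v verts_subset_convex_hull_iff[OF tetra_verts(2)[OF T], of "verts T - {v}" v]
      by (auto simp: opp_facet_def)
  qed
  then have "(SOME d. d \<in> verts T \<and> d \<notin> opp_facet T v) = v" by simp
  then show ?thesis
    by (simp add: onormal_def fvtx Let_def)
qed

lemma n_inner_facet: "x \<in> {a, b, c} \<Longrightarrow> y \<in> {a, b, c} \<Longrightarrow> norm m * (n \<bullet> (x - y)) = 0"
  using m_orth[of x y] by (auto simp: n_eq inner_diff_right)

text \<open>Twice the facet area times the height over it. The absolute value records that the
  normal points away from \<open>v\<close>.\<close>

lemma n_inner_vertex:
  assumes "x \<in> {a, b, c}"
  shows "norm m * (n \<bullet> (x - v)) = \<bar>det3 (b - a) (c - a) (a - v)\<bar>"
  using m_nonzero m_orth[OF assms, of a] by (auto simp: n_eq inner_diff_right right_diff_distrib)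

lemma norm_n: "norm n = 1"
  using m_nonzero by (auto simp: n_eq)

lemma facet_integral_eq: "facet_integral (opp_facet T v) g = norm m * tri_integral a b c g"
  by (simp add: facet_integral_def fvtx fparam_def tri_def)

end

section \<open>The divergence theorem on a tetrahedron\<close>

lemma tetra_facet_exists:
  assumes "tetra T" "v \<in> verts T"
  obtains a b c where "tetra_facet T v a b c"
  using assms by (metis tetra_facet.intro prod.exhaust)

text \<open>The facets opposite to \<open>a\<close> and \<open>b\<close> contain the edge, so their
  normals are orthogonal to it. The two facets that remain are the ends of the segments in
  \<open>simplex_edge_integral\<close>, with opposite signs.\<close>

lemma tetra_edge_integral:
  assumes T: "tetra T" and V: "verts T = {q, a, b, p}" and h: "smooth h"
  shows "(LINT x:T|lborel. \<Sum>i\<in>UNIV. cpartial i h x * (p - q) $ i)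
    = (\<Sum>v\<in>verts T. facet_integral (opp_facet T v) h * (onormal T (opp_facet T v) \<bullet> (p - q)))"
proof -
  have card4: "card {q, a, b, p} = 4" using tetra_verts(1)[OF T] by (simp add: V)
  then have dist: "q \<noteq> a" "q \<noteq> b" "q \<noteq> p" "a \<noteq> b" "a \<noteq> p" "b \<noteq> p"
    by (auto simp: card_insert_if split: if_splits)
  have hm: "h \<in> borel_measurable borel" using h by (rule smooth_measurable)
  have D: "det3 (a - q) (b - q) (p - q) \<noteq> 0"
    using affine_independent_det3[of q a b p] tetra_verts(1,2)[OF T] by (simp add: V)
  define I where "I v = facet_integral (opp_facet T v) h * (onormal T (opp_facet T v) \<bullet> (p - q))" for v
  have zero: "I v = 0" if vpq: "v \<in> verts T" "v \<noteq> p" "v \<noteq> q" for v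
  proof -
    obtain x y z where "tetra_facet T v x y z" using tetra_facet_exists[OF T vpq(1)] .
    then interpret tetra_facet T v x y z .
    have "p \<in> {x, y, z}" "q \<in> {x, y, z}"
      unfolding abc using vpq(2,3) by (auto simp: V)
    then have "norm m * (n \<bullet> (p - q)) = 0"
      by (rule n_inner_facet)
    then show ?thesis
      unfolding I_def facet_integral_eq by auto
  qed
  have "I q = \<bar>det3 (a - q) (b - q) (p - q)\<bar> * tri_integral p a b h"
  proof -
    have "q \<in> verts T" by (simp add: V)
    then obtain x y z where "tetra_facet T q x y z" using tetra_facet_exists[OF T] by blast
    then interpret tetra_facet T q x y z .
    have "{x, y, z} = {q, a, b, p} - {q}" using abc unfolding V .
    also have "\<dots> = {p, a, b}" using dist by auto
    finally have s: "{x, y, z} = {p, a, b}" .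
    have c: "card {p, a, b} = 3" using dist by simp
    have e: "norm m * (n \<bullet> (p - q)) = \<bar>det3 (y - x) (z - x) (x - q)\<bar>"
      by (rule n_inner_vertex) (simp add: s)
    have "det3 (y - x) (z - x) (x - q) = m \<bullet> (p - q)"
      using m_orth[of x p, unfolded s] s by (auto simp: inner_diff_right)
    moreover have "det3 (a - p) (b - p) (p - q) = det3 (a - q) (b - q) (p - q)"
      by (simp add: cross3_def inner_vec_def sum_3 algebra_simps)
    ultimately have "\<bar>det3 (y - x) (z - x) (x - q)\<bar> = \<bar>det3 (a - q) (b - q) (p - q)\<bar>"
      using triangle_reorder[OF s c hm] by auto
    moreover have "I q = tri_integral x y z h * (norm m * (n \<bullet> (p - q)))"
      unfolding I_def facet_integral_eq by (simp add: mult_ac)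
    ultimately show ?thesis
      using e triangle_reorder[OF s c hm] by simp
  qed
  moreover have "I p = - \<bar>det3 (a - q) (b - q) (p - q)\<bar> * tri_integral q a b h"
  proof -
    have "p \<in> verts T" by (simp add: V)
    then obtain x y z where "tetra_facet T p x y z" using tetra_facet_exists[OF T] by blast
    then interpret tetra_facet T p x y z .
    have "{x, y, z} = {q, a, b, p} - {p}" using abc unfolding V .
    also have "\<dots> = {q, a, b}" using dist by auto
    finally have s: "{x, y, z} = {q, a, b}" .
    have c: "card {q, a, b} = 3" using dist by simp
    have e: "norm m * (n \<bullet> (q - p)) = \<bar>det3 (y - x) (z - x) (x - p)\<bar>"
      by (rule n_inner_vertex) (simp add: s)
    have e': "norm m * (n \<bullet> (p - q)) = - \<bar>det3 (y - x) (z - x) (x - p)\<bar>"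
      unfolding e[symmetric] by (simp add: inner_diff_right algebra_simps)
    have "det3 (y - x) (z - x) (x - p) = - (m \<bullet> (p - q))"
      using m_orth[of x q, unfolded s] s by (auto simp: inner_diff_right)
    then have "\<bar>det3 (y - x) (z - x) (x - p)\<bar> = \<bar>det3 (a - q) (b - q) (p - q)\<bar>"
      using triangle_reorder[OF s c hm] by auto
    moreover have "I p = tri_integral x y z h * (norm m * (n \<bullet> (p - q)))"
      unfolding I_def facet_integral_eq by (simp add: mult_ac)
    ultimately show ?thesis
      using e' triangle_reorder[OF s c hm] by simp
  qed
  moreover have "(\<Sum>v\<in>verts T. I v) = I q + I p"
    using zero dist by (simp add: V)
  moreover have "T = convex hull {q, a, b, p}" using tetra_verts(3)[OF T] V by simp
  ultimately show ?thesis
    unfolding I_def[symmetric] using simplex_edge_integral[OF D h]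
    by (simp add: algebra_simps)
qed

lemma compact_tetra: "tetra T \<Longrightarrow> compact T"
  by (metis tetra_verts(3) tetra_finite_verts finite_imp_compact_convex_hull)

lemma convex_tetra: "tetra T \<Longrightarrow> convex T"
  by (metis tetra_verts(3) convex_convex_hull)

lemma smooth_integrable_tetra: "tetra T \<Longrightarrow> continuous_on T g \<Longrightarrow> set_integrable lborel T (g :: pt \<Rightarrow> real)"
  unfolding set_integrable_def by (intro borel_integrable_compact compact_tetra)

text \<open>Both sides are components of vectors, and the difference of these vectors is orthogonal
  to the three edges at one vertex, which span the space.\<close>

theorem tetra_divergence:
  assumes T: "tetra T" and h: "smooth h"
  shows "(LINT x:T|lborel. cpartial i h x) = (\<Sum>F\<in>facets T. facet_integral F (\<lambda>x. h x * onormal T F $ i))"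
proof -
  define g :: pt where "g = (\<chi> i. LINT x:T|lborel. cpartial i h x)"
  define s where "s = (\<Sum>v\<in>verts T. facet_integral (opp_facet T v) h *\<^sub>R onormal T (opp_facet T v))"
  have ci: "set_integrable lborel T (cpartial i h)" for i
    by (intro smooth_integrable_tetra T smooth_continuous smooth_cpartial h)
  have g_inner: "g \<bullet> w = (LINT x:T|lborel. \<Sum>i\<in>UNIV. cpartial i h x * w $ i)" for w
  proof -
    have "(LINT x:T|lborel. \<Sum>i\<in>UNIV. cpartial i h x * w $ i) = (\<Sum>i\<in>UNIV. LINT x:T|lborel. cpartial i h x * w $ i)"
      using ci unfolding set_lebesgue_integral_def set_integrable_def scaleR_sum_right
      by (intro Bochner_Integration.integral_sum) (simp add: mult.assoc[symmetric])
    then show ?thesis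
      by (simp add: g_def inner_vec_def)
  qed
  have edge: "(g - s) \<bullet> (p - q) = 0" if "verts T = {q, a, b, p}" for q a b p
    using tetra_edge_integral[OF T that h]
    by (simp add: g_inner inner_diff_left s_def inner_sum_left)
  obtain a b c d where V: "verts T = {a, b, c, d}" "card {a, b, c, d} = 4"
  proof -
    have "card (verts T) = Suc 3" using tetra_verts(1)[OF T] by simp
    from card_eq_SucD[OF this]
    obtain a W where W: "verts T = insert a W" "a \<notin> W" "card W = 3"
      by blast
    then obtain b c d where "W = {b, c, d}" "b \<noteq> c" "b \<noteq> d" "c \<noteq> d"
      by (auto simp: card_3_iff)
    with W show ?thesis by (intro that[of a b c d]) auto
  qed
  have "g - s = 0"
  proof (rule det3_orthogonal_zero)
    show "det3 (b - a) (c - a) (d - a) \<noteq> 0"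
      using affine_independent_det3[of a b c d] tetra_verts(2)[OF T] V by simp
    show "(g - s) \<bullet> (b - a) = 0" by (rule edge[of _ c d]) (use V in auto)
    show "(g - s) \<bullet> (c - a) = 0" by (rule edge[of _ b d]) (use V in auto)
    show "(g - s) \<bullet> (d - a) = 0" by (rule edge[of _ b c]) (use V in auto)
  qed
  then have "g $ i = s $ i" by simp
  also have "s $ i = (\<Sum>v\<in>verts T. facet_integral (opp_facet T v) h * onormal T (opp_facet T v) $ i)"
    by (simp add: s_def)
  also have "\<dots> = (\<Sum>F\<in>facets T. facet_integral F h * onormal T F $ i)"
    using facets_eq[OF T] by (simp add: sum.reindex)
  also have "\<dots> = (\<Sum>F\<in>facets T. facet_integral F (\<lambda>x. h x * onormal T F $ i))"
    by (simp add: facet_integral_mult_right)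
  finally show ?thesis by (simp add: g_def)
qed

subsection \<open>Lebesgue integrals up to null sets\<close>

text \<open>Completeness of Lebesgue measure carries measurability across null sets. This allows
  chosen functions to be replaced under integrals by representatives that agree almost
  everywhere.\<close>

lemma lebesgue_measurable_cong_AE:
  fixes f g :: "'a::euclidean_space \<Rightarrow> real"
  assumes ae: "AE x in lebesgue. f x = g x" and f: "f \<in> borel_measurable lebesgue"
  shows "g \<in> borel_measurable lebesgue"
proof (rule measurableI)
  fix A :: "real set" assume "A \<in> sets borel"
  then have m: "f -` A \<in> sets lebesgue" using measurable_sets[OF f] by simp
  from ae have ae': "AE x in lebesgue. x \<in> f -` A \<longleftrightarrow> x \<in> g -` A"
    by eventually_elim simp
  have "g -` A \<in> sets lebesgue"
    by (rule completion.in_sets_AE[OF ae' m]) simp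
  then show "g -` A \<inter> space lebesgue \<in> sets lebesgue" by simp
qed simp

lemma
  fixes f g :: "'a::euclidean_space \<Rightarrow> real"
  assumes ae: "AE x in lebesgue. f x = g x"
  shows lebesgue_integrable_cong_AE: "integrable lebesgue f \<longleftrightarrow> integrable lebesgue g"
    and lebesgue_integral_cong_AE: "integral\<^sup>L lebesgue f = integral\<^sup>L lebesgue g"
proof -
  have ae': "AE x in lebesgue. g x = f x" using ae by eventually_elim simp
  show i: "integrable lebesgue f \<longleftrightarrow> integrable lebesgue g"
  proof
    assume f: "integrable lebesgue f"
    then have "g \<in> borel_measurable lebesgue"
      by (intro lebesgue_measurable_cong_AE[OF ae]) simp
    then show "integrable lebesgue g"
      using f by (subst integrable_cong_AE[OF _ _ ae']) simp_all
  next
    assume g: "integrable lebesgue g"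
    then have "f \<in> borel_measurable lebesgue"
      by (intro lebesgue_measurable_cong_AE[OF ae']) simp
    then show "integrable lebesgue f"
      using g by (subst integrable_cong_AE[OF _ _ ae]) simp_all
  qed
  show "integral\<^sup>L lebesgue f = integral\<^sup>L lebesgue g"
  proof (cases "integrable lebesgue f")
    case True
    then show ?thesis using i ae by (intro integral_cong_AE) auto
  next
    case False
    then show ?thesis using i by (simp add: not_integrable_integral_eq)
  qed
qed

lemma set_lebesgue_integral_cong_AE2:
  fixes f g :: "'a::euclidean_space \<Rightarrow> real"
  assumes "AE x in lebesgue. (x \<in> U \<longleftrightarrow> x \<in> V) \<and> (x \<in> U \<longrightarrow> f x = g x)"
  shows "(LINT x:U|lebesgue. f x) = (LINT x:V|lebesgue. g x)"
  unfolding set_lebesgue_integral_def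
  by (rule lebesgue_integral_cong_AE, use assms in eventually_elim) (auto simp: indicator_def)

lemma set_integrable_cong_AE2:
  fixes f g :: "'a::euclidean_space \<Rightarrow> real"
  assumes "AE x in lebesgue. (x \<in> U \<longleftrightarrow> x \<in> V) \<and> (x \<in> U \<longrightarrow> f x = g x)"
  shows "set_integrable lebesgue U f \<longleftrightarrow> set_integrable lebesgue V g"
  unfolding set_integrable_def
  by (rule lebesgue_integrable_cong_AE, use assms in eventually_elim) (auto simp: indicator_def)

lemma set_measurable_cong_AE2:
  fixes f g :: "'a::euclidean_space \<Rightarrow> real"
  assumes "AE x in lebesgue. (x \<in> U \<longleftrightarrow> x \<in> V) \<and> (x \<in> U \<longrightarrow> f x = g x)" "set_borel_measurable lebesgue U f"
  shows "set_borel_measurable lebesgue V g"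
  unfolding set_borel_measurable_def
  by (rule lebesgue_measurable_cong_AE[OF _ assms(2)[unfolded set_borel_measurable_def]],
      use assms(1) in eventually_elim) (auto simp: indicator_def)

text \<open>The spaces are defined over the completed measure, whereas Fubini and the changes of
  variables are carried out for Borel functions over \<open>lborel\<close>; representatives pass
  from one to the other.\<close>

lemma borel_representative:
  fixes f :: "'a::euclidean_space \<Rightarrow> real"
  assumes "set_borel_measurable lebesgue U f"
  obtains g where "g \<in> borel_measurable borel" "AE x in lebesgue. indicator U x * f x = g x"
proof -
  have "(\<lambda>x. indicator U x * f x) \<in> borel_measurable (completion lborel)"
    using assms by (simp add: set_borel_measurable_def)
  from completion_ex_borel_measurable_real[OF this]
  obtain g where "g \<in> borel_measurable lborel" "AE x in lborel. indicator U x * f x = g x"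
    by blast
  then show ?thesis by (intro that[of g]) (auto simp: AE_completion)
qed

subsection \<open>Smooth functions are weakly dense in the Sobolev space of a convex body\<close>

lemma test_fun_bounded:
  assumes "test_fun U S"
  obtains C where "\<And>x. \<bar>S x\<bar> \<le> C"
proof -
  let ?K = "closure {x. S x \<noteq> 0}"
  have "compact (S ` ?K)"
    using assms by (intro compact_continuous_image smooth_continuous) (auto simp: test_fun_def)
  then have "bounded (S ` ?K)" by (rule compact_imp_bounded)
  then obtain C where C: "\<And>y. y \<in> ?K \<Longrightarrow> \<bar>S y\<bar> \<le> C"
    unfolding bounded_iff by auto
  have "\<bar>S x\<bar> \<le> max C 0" for x
  proof (cases "S x = 0")
    case False
    then have "x \<in> ?K" using closure_subset[of "{x. S x \<noteq> 0}"] by auto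
    then show ?thesis using C[of x] by simp
  qed simp
  then show ?thesis using that by blast
qed

lemma test_fun_cpartial:
  assumes "test_fun U S"
  shows "test_fun U (cpartial i S)"
proof (rule test_funI)
  let ?K = "closure {x. S x \<noteq> 0}"
  show "smooth (cpartial i S)" using assms by (intro smooth_cpartial test_fun_smooth)
  show "{x. cpartial i S x \<noteq> 0} \<subseteq> ?K"
  proof (rule subsetI, rule ccontr)
    fix x assume x: "x \<in> {x. cpartial i S x \<noteq> 0}" "x \<notin> ?K"
    have zero: "S y = 0" if "y \<in> - ?K" for y
      using that subsetD[OF closure_subset, of y "{x. S x \<noteq> 0}"] by blast
    have "(S has_derivative (\<lambda>_. 0)) (at x)"
    proof (rule has_derivative_transform_within_open)
      show "((\<lambda>_. 0) has_derivative (\<lambda>_. 0 :: real)) (at x)" by simp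
      show "open (- ?K)" by (rule open_Compl) (rule closed_closure)
      show "x \<in> - ?K" using x(2) by blast
      show "0 = S y" if "y \<in> - ?K" for y using zero[OF that] by simp
    qed
    then have "cpartial i S x = 0" by (rule cpartial_eqI)
    then show False using x by simp
  qed
qed (use assms in \<open>auto simp: test_fun_def\<close>)

lemma integrable_bounded_mult:
  fixes f g :: "'a::euclidean_space \<Rightarrow> real"
  assumes g: "integrable lborel g" and f: "f \<in> borel_measurable borel" "\<And>x. \<bar>f x\<bar> \<le> C"
  shows "integrable lborel (\<lambda>x. f x * g x)"
proof (rule Bochner_Integration.integrable_bound[OF integrable_mult_right[OF g, of C]])
  show "(\<lambda>x. f x * g x) \<in> borel_measurable lborel"
    using f(1) borel_measurable_integrable[OF g] by simp
  show "AE x in lborel. norm (f x * g x) \<le> norm (C * g x)"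
  proof (rule AE_I2)
    show "norm (f x * g x) \<le> norm (C * g x)" for x
      using f(2)[of x] by (auto simp: abs_mult intro!: mult_right_mono)
  qed
qed

lemma kernel_integrable:
  fixes f g :: "pt \<Rightarrow> real" and K :: "pt \<times> pt \<Rightarrow> real"
  assumes f: "integrable lborel f" and g: "integrable lborel g"
    and K: "continuous_on UNIV K" "\<And>z. \<bar>K z\<bar> \<le> C"
  shows "integrable (lborel \<Otimes>\<^sub>M lborel) (\<lambda>z. f (fst z) * K z * g (snd z))"
proof -
  have [measurable]: "f \<in> borel_measurable borel" "g \<in> borel_measurable borel"
    using f g by (auto dest: borel_measurable_integrable)
  have "K \<in> borel_measurable borel" using K(1) by (rule borel_measurable_continuous_onI)
  then have [measurable]: "K \<in> borel_measurable (borel \<Otimes>\<^sub>M borel)" by (simp add: borel_prod)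
  have pg: "integrable (lborel \<Otimes>\<^sub>M lborel) (\<lambda>z. f (fst z) * g (snd z))"
  proof (rule lborel_pair.Fubini_integrable)
    have "(LINT y|lborel. norm (f (fst (x, y)) * g (snd (x, y)))) = \<bar>f x\<bar> * (LINT y|lborel. \<bar>g y\<bar>)" for x
      by (simp add: abs_mult)
    then show "integrable lborel (\<lambda>x. LINT y|lborel. norm (f (fst (x, y)) * g (snd (x, y))))"
      using f by simp
  qed (use g in simp_all)
  show ?thesis
  proof (rule Bochner_Integration.integrable_bound[OF integrable_mult_right[OF pg, of C]])
    show "AE z in lborel \<Otimes>\<^sub>M lborel. norm (f (fst z) * K z * g (snd z)) \<le> norm (C * (f (fst z) * g (snd z)))"
    proof (rule AE_I2)
      fix z
      have "\<bar>K z\<bar> * (\<bar>f (fst z)\<bar> * \<bar>g (snd z)\<bar>) \<le> \<bar>C\<bar> * (\<bar>f (fst z)\<bar> * \<bar>g (snd z)\<bar>)"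
        using K(2)[of z] by (intro mult_right_mono) auto
      then show "norm (f (fst z) * K z * g (snd z)) \<le> norm (C * (f (fst z) * g (snd z)))"
        by (simp add: abs_mult mult_ac)
    qed
  qed simp
qed

lemma
  fixes f g :: "pt \<Rightarrow> real" and K :: "pt \<times> pt \<Rightarrow> real"
  assumes f: "integrable lborel f" and g: "integrable lborel g"
    and K: "continuous_on UNIV K" "\<And>z. \<bar>K z\<bar> \<le> C"
  shows kernel_fubini: "(LINT y|lborel. f y * (LINT x|lborel. K (y, x) * g x)) = (LINT x|lborel. g x * (LINT y|lborel. f y * K (y, x)))"
    and kernel_integrable1: "integrable lborel (\<lambda>y. f y * (LINT x|lborel. K (y, x) * g x))"
proof -
  have i: "integrable (lborel \<Otimes>\<^sub>M lborel) (case_prod (\<lambda>y x. f y * K (y, x) * g x))"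
    using kernel_integrable[OF assms] by (simp add: case_prod_beta')
  have "(LINT y|lborel. LINT x|lborel. f y * K (y, x) * g x) = (LINT x|lborel. LINT y|lborel. f y * K (y, x) * g x)"
    using lborel_pair.integral_fst[OF i] lborel_pair.integral_snd[OF i] by simp
  then show "(LINT y|lborel. f y * (LINT x|lborel. K (y, x) * g x)) = (LINT x|lborel. g x * (LINT y|lborel. f y * K (y, x)))"
    by (simp add: mult.commute[of "g _"]) (simp add: mult.assoc)
  show "integrable lborel (\<lambda>y. f y * (LINT x|lborel. K (y, x) * g x))"
    using lborel_pair.integrable_fst[OF i] by (simp add: mult.assoc)
qed

text \<open>Averages of \<open>\<Psi>\<close> over a small set near \<open>y\<close>: the substitution \<open>x = (l y - z) / (l - 1)\<close>.\<close>

lemma kernel_average: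
  fixes S \<Psi> :: "pt \<Rightarrow> real" and l :: real
  assumes l: "l > 1" and [measurable]: "S \<in> borel_measurable borel" "\<Psi> \<in> borel_measurable borel"
  shows "(l - 1) ^ 3 * (LINT x|lborel. S ((1 - l) *\<^sub>R x + l *\<^sub>R y) * \<Psi> x)
    = (LINT z|lborel. S z * \<Psi> ((l / (l - 1)) *\<^sub>R y - (1 / (l - 1)) *\<^sub>R z))"
proof -
  let ?h = "\<lambda>z. S z * \<Psi> ((l / (l - 1)) *\<^sub>R y - (1 / (l - 1)) *\<^sub>R z)"
  have [measurable]: "?h \<in> borel_measurable borel" by measurable
  have arg: "(l / (l - 1)) *\<^sub>R y - (1 / (l - 1)) *\<^sub>R (l *\<^sub>R y + (1 - l) *\<^sub>R x) = x" for x
  proof -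
    have "(1 / (l - 1)) *\<^sub>R ((1 - l) *\<^sub>R x) = - x"
    proof -
      have "(1 - l) / (l - 1) = -1" using l by (simp add: field_simps)
      then show ?thesis by simp
    qed
    then show ?thesis by (simp add: scaleR_add_right)
  qed
  have "integral\<^sup>L lborel ?h
      = integral\<^sup>L (density (distr lborel borel (\<lambda>x. l *\<^sub>R y + (1 - l) *\<^sub>R x)) (\<lambda>_. \<bar>1 - l\<bar> ^ DIM(pt))) ?h"
    using l by (subst lborel_affine[of "1 - l" "l *\<^sub>R y"]) auto
  also have "\<dots> = \<bar>1 - l\<bar> ^ DIM(pt) * (LINT x|lborel. ?h (l *\<^sub>R y + (1 - l) *\<^sub>R x))"
    by (subst integral_density) (auto simp: integral_distr)
  also have "\<dots> = (l - 1) ^ 3 * (LINT x|lborel. S ((1 - l) *\<^sub>R x + l *\<^sub>R y) * \<Psi> x)"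
    using l unfolding arg by (simp add: add.commute power3_eq_cube)
  finally show ?thesis by simp
qed

text \<open>The identity \<open>id\<close> is applied to the smooth functions x \<mapsto> S((1 - l)
  x + l y), weighted with \<open>w y\<close> and integrated over \<open>y\<close>. Fubini moves the
  averages onto \<open>\<Psi>0\<close> and \<open>\<Psi> i\<close>, which are bounded and continuous
  in the interior, so as l tends to infinity dominated convergence recovers the claim times the
  integral of \<open>S\<close>. The approximants of \<open>w\<close> themselves are never shown to
  converge.\<close>

lemma weak_density_core:
  fixes w \<Psi>0 :: "pt \<Rightarrow> real" and W \<Psi> :: "3 \<Rightarrow> pt \<Rightarrow> real"
  assumes T: "convex T" "compact T" "interior T \<noteq> {}"
    and w: "integrable lborel w" "\<And>x. x \<notin> interior T \<Longrightarrow> w x = 0"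
    and W: "\<And>i. integrable lborel (W i)" "\<And>i x. x \<notin> interior T \<Longrightarrow> W i x = 0"
    and wW: "\<And>i \<phi>. test_fun (interior T) \<phi> \<Longrightarrow> (LINT x|lborel. w x * cpartial i \<phi> x) = - (LINT x|lborel. W i x * \<phi> x)"
    and \<Psi>0: "\<Psi>0 \<in> borel_measurable borel" "\<And>x. \<bar>\<Psi>0 x\<bar> \<le> B" "\<And>x. x \<notin> T \<Longrightarrow> \<Psi>0 x = 0"
       "\<And>x. x \<in> interior T \<Longrightarrow> isCont \<Psi>0 x"
    and \<Psi>: "\<And>i. \<Psi> i \<in> borel_measurable borel" "\<And>i x. \<bar>\<Psi> i x\<bar> \<le> B" "\<And>i x. x \<notin> T \<Longrightarrow> \<Psi> i x = 0"
       "\<And>i x. x \<in> interior T \<Longrightarrow> isCont (\<Psi> i) x"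
    and id: "\<And>h. smooth h \<Longrightarrow> (LINT x|lborel. h x * \<Psi>0 x + (\<Sum>i\<in>UNIV. cpartial i h x * \<Psi> i x)) = 0"
  shows "(LINT x|lborel. w x * \<Psi>0 x + (\<Sum>i\<in>UNIV. W i x * \<Psi> i x)) = 0"
proof -
  obtain z0 where z0: "z0 \<in> interior T" using T by auto
  obtain S where S: "test_fun (interior T) S" "\<And>x. S x \<ge> 0" "S z0 > 0"
    using test_fun_positive_on_compact[of "{z0}" "interior T"] z0 by auto
  note Ss = test_fun_smooth[OF S(1)]
  have Sm[measurable]: "S \<in> borel_measurable borel" using Ss by (rule smooth_measurable)
  obtain C where C: "\<And>x. \<bar>S x\<bar> \<le> C" using test_fun_bounded[OF S(1)] by blast
  obtain C' where C': "\<And>i x. \<bar>cpartial i S x\<bar> \<le> C' i"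
  proof -
    have "\<exists>C. \<forall>x. \<bar>cpartial i S x\<bar> \<le> C" for i
      using test_fun_bounded[OF test_fun_cpartial[OF S(1)]] by metis
    then show ?thesis using that by metis
  qed
  let ?K = "closure {x. S x \<noteq> 0}"
  have K: "compact ?K" "?K \<subseteq> interior T" using S(1) by (auto simp: test_fun_def)
  have Si: "integrable lborel S"
  proof -
    have "integrable lborel (\<lambda>x. indicator ?K x *\<^sub>R S x)"
      by (intro borel_integrable_compact K smooth_continuous Ss)
    moreover have "(\<lambda>x. indicator ?K x *\<^sub>R S x) = S"
    proof
      show "indicator ?K x *\<^sub>R S x = S x" for x
        using closure_subset[of "{x. S x \<noteq> 0}"] by (cases "x \<in> ?K") auto
    qed
    ultimately show ?thesis by (simp only:)
  qed
  have Spos: "integral\<^sup>L lborel S \<noteq> 0"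
  proof
    assume "integral\<^sup>L lborel S = 0"
    then have ae: "AE x in lborel. S x = 0"
      using integral_nonneg_eq_0_iff_AE[OF Si] S(2) by simp
    have op: "open {x. S x > 0}"
      by (intro open_Collect_less continuous_on_const smooth_continuous Ss)
    have "AE x in lborel. x \<notin> {x. S x > 0}" using ae by eventually_elim simp
    then have "{x. S x > 0} \<in> null_sets lborel"
      using op by (subst (asm) AE_iff_null_sets[symmetric]) auto
    then have "negligible {x. S x > 0}"
      by (simp add: negligible_iff_null_sets null_sets_completionI)
    with op S(3) show False
      using open_not_negligible by blast
  qed
  have Tb: "T \<in> sets borel" using T by (intro borel_compact)
  have bi: "integrable lborel P" if P: "P \<in> borel_measurable borel" "\<And>x. \<bar>P x\<bar> \<le> B" "\<And>x. x \<notin> T \<Longrightarrow> P x = 0"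
    for P :: "pt \<Rightarrow> real"
  proof (rule Bochner_Integration.integrable_bound)
    show "integrable lborel (\<lambda>x. indicator T x *\<^sub>R B)"
      using T by (intro borel_integrable_compact) auto
    show "AE x in lborel. norm (P x) \<le> norm (indicator T x *\<^sub>R B)"
    proof (rule AE_I2)
      show "norm (P x) \<le> norm (indicator T x *\<^sub>R B)" for x
        using P(2,3)[of x] by (cases "x \<in> T") auto
    qed
  qed (use P in simp)
  note \<Psi>0i = bi[OF \<Psi>0(1-3)] and \<Psi>i = bi[OF \<Psi>(1-3)]
  \<comment> \<open>One kernel in two variables. Its partials in \<open>x\<close> and in
    \<open>y\<close> are the same function \<open>\<kappa>'\<close> times 1 - l and l, which is how
    a derivative in \<open>x\<close> is traded for one in \<open>y\<close>.\<close>
  define \<kappa> where "\<kappa> l z = S ((1 - l) *\<^sub>R snd z + l *\<^sub>R fst z)" for l z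
  define \<kappa>' where "\<kappa>' i l z = cpartial i S ((1 - l) *\<^sub>R snd z + l *\<^sub>R fst z)" for i l z
  have \<kappa>c: "continuous_on UNIV (\<kappa> l)" "\<And>z. \<bar>\<kappa> l z\<bar> \<le> C" for l
    unfolding \<kappa>_def using C
    by (auto intro!: continuous_on_compose2[OF smooth_continuous[OF Ss, of UNIV]] continuous_intros)
  have \<kappa>'c: "continuous_on UNIV (\<kappa>' i l)" "\<And>z. \<bar>\<kappa>' i l z\<bar> \<le> C' i" for i l
    unfolding \<kappa>'_def using C'
    by (auto intro!: continuous_on_compose2[OF smooth_continuous[OF smooth_cpartial[OF Ss], of UNIV]] continuous_intros)
  have meas_y: "(\<lambda>y. \<kappa>' i l (y, x)) \<in> borel_measurable borel" "(\<lambda>x. \<kappa>' i l (y, x)) \<in> borel_measurable borel"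
     "(\<lambda>x. \<kappa> l (y, x)) \<in> borel_measurable borel" for i l x y
    by (auto intro!: borel_measurable_continuous_onI continuous_intros
        continuous_on_compose2[OF \<kappa>'c(1)] continuous_on_compose2[OF \<kappa>c(1)])
  have smx: "smooth (\<lambda>x. \<kappa> l (y, x))" "cpartial i (\<lambda>x. \<kappa> l (y, x)) x = (1 - l) * \<kappa>' i l (y, x)" for l y x i
    unfolding \<kappa>_def \<kappa>'_def fst_conv snd_conv by (intro smooth_affine Ss, intro cpartial_affine Ss)
  have smy: "smooth (\<lambda>y. \<kappa> l (y, x))" "cpartial i (\<lambda>y. \<kappa> l (y, x)) y = l * \<kappa>' i l (y, x)" for l y x i
    using smooth_affine[OF Ss, of l "(1 - l) *\<^sub>R x"] cpartial_affine[OF Ss, of i l "(1 - l) *\<^sub>R x" y]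
    unfolding \<kappa>_def \<kappa>'_def fst_conv snd_conv by (simp_all add: add.commute)
  \<comment> \<open>In \<open>y\<close> the support is the image of the support of \<open>S\<close>
    under the contraction with centre \<open>x\<close> and ratio 1/l; convexity keeps it in the
    interior even when \<open>x\<close> lies on the boundary.\<close>
  have test: "test_fun (interior T) (\<lambda>y. \<kappa> l (y, x))" if l: "l > 1" and x: "x \<in> T" for l x
  proof (rule test_funI[OF smy(1)])
    let ?f = "\<lambda>z. x - (1 / l) *\<^sub>R (x - z)"
    show "compact (?f ` ?K)"
      by (intro compact_continuous_image K continuous_intros)
    show "?f ` ?K \<subseteq> interior T"
      using K l x T(1) by (auto intro!: mem_interior_convex_shrink)
    show "{y. \<kappa> l (y, x) \<noteq> 0} \<subseteq> ?f ` ?K"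
    proof
      fix y assume "y \<in> {y. \<kappa> l (y, x) \<noteq> 0}"
      then have "(1 - l) *\<^sub>R x + l *\<^sub>R y \<in> ?K"
        using closure_subset[of "{x. S x \<noteq> 0}"] by (auto simp: \<kappa>_def)
      moreover have "y = ?f ((1 - l) *\<^sub>R x + l *\<^sub>R y)"
      proof -
        have "x - ((1 - l) *\<^sub>R x + l *\<^sub>R y) = l *\<^sub>R (x - y)" by (simp add: algebra_simps)
        then show ?thesis using l by simp
      qed
      ultimately show "y \<in> ?f ` ?K" by blast
    qed
  qed
  define R where "R l P y = (LINT x|lborel. \<kappa> l (y, x) * P x)" for l P y
  \<comment> \<open>The factor (l - 1)/l is 1 - l from the derivative in \<open>x\<close> times -1/l
    from passing to the weak derivative in \<open>y\<close>; it tends to 1.\<close>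
  have key: "(LINT y|lborel. w y * R l \<Psi>0 y) + (\<Sum>i\<in>UNIV. (l - 1) / l * (LINT y|lborel. W i y * R l (\<Psi> i) y)) = 0"
    if l: "l > 1" for l
  proof -
    have i0: "integrable lborel (\<lambda>x. \<kappa> l (y, x) * \<Psi>0 x)" for y
      by (rule integrable_bounded_mult[OF \<Psi>0i meas_y(3) \<kappa>c(2)])
    have i1: "integrable lborel (\<lambda>x. \<kappa>' i l (y, x) * \<Psi> i x)" for y i
      by (rule integrable_bounded_mult[OF \<Psi>i meas_y(2) \<kappa>'c(2)])
    have "0 = w y * R l \<Psi>0 y + (\<Sum>i\<in>UNIV. (1 - l) * (w y * (LINT x|lborel. \<kappa>' i l (y, x) * \<Psi> i x)))" for y
    proof -
      have "0 = (LINT x|lborel. \<kappa> l (y, x) * \<Psi>0 x + (\<Sum>i\<in>UNIV. (1 - l) * (\<kappa>' i l (y, x) * \<Psi> i x)))"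
        using id[OF smx(1)] by (simp add: smx mult.assoc)
      also have "\<dots> = R l \<Psi>0 y + (\<Sum>i\<in>UNIV. (1 - l) * (LINT x|lborel. \<kappa>' i l (y, x) * \<Psi> i x))"
        unfolding R_def using i0 i1
        by (subst Bochner_Integration.integral_add) (simp_all add: Bochner_Integration.integral_sum)
      finally have "w y * 0 = w y * (R l \<Psi>0 y + (\<Sum>i\<in>UNIV. (1 - l) * (LINT x|lborel. \<kappa>' i l (y, x) * \<Psi> i x)))"
        by simp
      then show ?thesis by (simp add: distrib_left sum_distrib_left mult_ac)
    qed
    then have "0 = (LINT y|lborel. w y * R l \<Psi>0 y + (\<Sum>i\<in>UNIV. (1 - l) * (w y * (LINT x|lborel. \<kappa>' i l (y, x) * \<Psi> i x))))"
      by simp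
    also have "\<dots> = (LINT y|lborel. w y * R l \<Psi>0 y)
        + (\<Sum>i\<in>UNIV. (1 - l) * (LINT y|lborel. w y * (LINT x|lborel. \<kappa>' i l (y, x) * \<Psi> i x)))"
      unfolding R_def using kernel_integrable1[OF w(1) \<Psi>0i \<kappa>c] kernel_integrable1[OF w(1) \<Psi>i \<kappa>'c]
      by (subst Bochner_Integration.integral_add) (simp_all add: Bochner_Integration.integral_sum)
    also have "\<dots> = (LINT y|lborel. w y * R l \<Psi>0 y) + (\<Sum>i\<in>UNIV. (l - 1) / l * (LINT y|lborel. W i y * R l (\<Psi> i) y))"
    proof (intro arg_cong2[where f = "(+)"] sum.cong refl)
      fix i
      show "(1 - l) * (LINT y|lborel. w y * (LINT x|lborel. \<kappa>' i l (y, x) * \<Psi> i x))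
       = (l - 1) / l * (LINT y|lborel. W i y * R l (\<Psi> i) y)"
      proof -
      have "(LINT y|lborel. w y * (LINT x|lborel. \<kappa>' i l (y, x) * \<Psi> i x))
          = (LINT x|lborel. \<Psi> i x * (LINT y|lborel. w y * \<kappa>' i l (y, x)))"
        by (rule kernel_fubini[OF w(1) \<Psi>i \<kappa>'c])
      also have "\<dots> = (LINT x|lborel. - (1 / l) * (\<Psi> i x * (LINT y|lborel. W i y * \<kappa> l (y, x))))"
      proof (rule Bochner_Integration.integral_cong[OF refl])
        fix x
        show "\<Psi> i x * (LINT y|lborel. w y * \<kappa>' i l (y, x)) = - (1 / l) * (\<Psi> i x * (LINT y|lborel. W i y * \<kappa> l (y, x)))"
        proof (cases "x \<in> T")
          case True
          have "(LINT y|lborel. w y * (l * \<kappa>' i l (y, x))) = - (LINT y|lborel. W i y * \<kappa> l (y, x))"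
            using wW[OF test[OF l True], of i] by (simp add: smy)
          moreover have "(LINT y|lborel. w y * (l * \<kappa>' i l (y, x))) = l * (LINT y|lborel. w y * \<kappa>' i l (y, x))"
            by (subst integral_mult_right_zero[symmetric]) (simp add: mult_ac)
          ultimately have "(LINT y|lborel. w y * \<kappa>' i l (y, x)) = - (1 / l) * (LINT y|lborel. W i y * \<kappa> l (y, x))"
            using l by (simp add: field_simps)
          then show ?thesis by simp
        qed (simp add: \<Psi>(3))
      qed
      also have "\<dots> = - (1 / l) * (LINT x|lborel. \<Psi> i x * (LINT y|lborel. W i y * \<kappa> l (y, x)))"
        by (rule integral_mult_right_zero)
      also have "(LINT x|lborel. \<Psi> i x * (LINT y|lborel. W i y * \<kappa> l (y, x))) = (LINT y|lborel. W i y * R l (\<Psi> i) y)"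
        unfolding R_def by (rule kernel_fubini[OF W(1) \<Psi>i \<kappa>c, symmetric])
      finally show ?thesis using l by (simp add: field_simps)
      qed
    qed
    finally show ?thesis by simp
  qed
  \<comment> \<open>The limit is taken along l = n + 2, which exceeds 1 for every n.\<close>
  have lim0: "(\<lambda>n. 1 / (real n + 2 - 1)) \<longlonglongrightarrow> 0"
    using LIMSEQ_inverse_real_of_nat by (simp add: inverse_eq_divide add.commute)
  have "(\<lambda>n. 1 + 1 / (real n + 2 - 1)) \<longlonglongrightarrow> 1 + 0"
    by (intro tendsto_intros lim0)
  moreover have "1 + 1 / (real n + 2 - 1) = (real n + 2) / (real n + 2 - 1)" for n
    by (simp add: field_simps)
  ultimately have lim1: "(\<lambda>n. (real n + 2) / (real n + 2 - 1)) \<longlonglongrightarrow> 1"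
    by simp
  have lim2: "(\<lambda>n. (real n + 2 - 1) / (real n + 2)) \<longlonglongrightarrow> 1"
    using tendsto_inverse[OF lim1] by simp
  define s where "s = integral\<^sup>L lborel S"
  \<comment> \<open>Multiplied by (l - 1)^3, \<open>R\<close> becomes an average of \<open>P\<close>
    with total weight \<open>s\<close> over points that approach \<open>y\<close>, by
    \<open>kernel_average\<close>. It is bounded by \<open>B * s\<close> throughout, so the integral
    over \<open>y\<close> is dominated by a multiple of the absolute value of
    \<open>u\<close>.\<close>
  have lim: "(\<lambda>n. LINT y|lborel. u y * ((real n + 2 - 1) ^ 3 * R (real n + 2) P y)) \<longlonglongrightarrow> (LINT y|lborel. u y * (s * P y))"
    if u: "integrable lborel u" "\<And>x. x \<notin> interior T \<Longrightarrow> u x = 0"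
      and P: "P \<in> borel_measurable borel" "\<And>x. \<bar>P x\<bar> \<le> B" "\<And>x. x \<in> interior T \<Longrightarrow> isCont P x"
      and Pi: "integrable lborel P"
    for u P :: "pt \<Rightarrow> real"
  proof -
    have [measurable]: "P \<in> borel_measurable borel" "u \<in> borel_measurable borel"
      using P(1) borel_measurable_integrable[OF u(1)] by auto
    define A where "A n y = (LINT z|lborel. S z * P (((real n + 2) / (real n + 2 - 1)) *\<^sub>R y - (1 / (real n + 2 - 1)) *\<^sub>R z))" for n y
    have RA: "(real n + 2 - 1) ^ 3 * R (real n + 2) P y = A n y" for n y
      unfolding R_def A_def \<kappa>_def fst_conv snd_conv by (rule kernel_average) (use P(1) in auto)
    have Abound: "\<bar>A n y\<bar> \<le> B * s" for n y
    proof -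
      have "\<bar>A n y\<bar> \<le> (LINT z|lborel. B * S z)"
        unfolding A_def real_norm_def[symmetric]
      proof (rule Bochner_Integration.integral_norm_bound_integral)
        show "integrable lborel (\<lambda>z. S z * P (((real n + 2) / (real n + 2 - 1)) *\<^sub>R y - (1 / (real n + 2 - 1)) *\<^sub>R z))"
          using integrable_bounded_mult[OF Si, of "\<lambda>z. P (((real n + 2) / (real n + 2 - 1)) *\<^sub>R y - (1 / (real n + 2 - 1)) *\<^sub>R z)" B]
          by (simp add: P(2) mult.commute)
      qed (auto simp: abs_mult S(2) mult.commute[of B] Si intro!: mult_left_mono P(2))
      then show ?thesis by (simp add: s_def)
    qed
    have Alim: "(\<lambda>n. A n y) \<longlonglongrightarrow> s * P y" if y: "y \<in> interior T" for y
    proof -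
      have "(\<lambda>n. A n y) \<longlonglongrightarrow> (LINT z|lborel. S z * P y)"
        unfolding A_def
      proof (rule integral_dominated_convergence[where w = "\<lambda>z. B * S z"])
        show "AE z in lborel. (\<lambda>n. S z * P (((real n + 2) / (real n + 2 - 1)) *\<^sub>R y - (1 / (real n + 2 - 1)) *\<^sub>R z)) \<longlonglongrightarrow> S z * P y"
        proof (rule AE_I2)
          fix z
          have "(\<lambda>n. ((real n + 2) / (real n + 2 - 1)) *\<^sub>R y - (1 / (real n + 2 - 1)) *\<^sub>R z) \<longlonglongrightarrow> 1 *\<^sub>R y - 0 *\<^sub>R z"
            by (intro tendsto_intros lim0 lim1)
          then show "(\<lambda>n. S z * P (((real n + 2) / (real n + 2 - 1)) *\<^sub>R y - (1 / (real n + 2 - 1)) *\<^sub>R z)) \<longlonglongrightarrow> S z * P y"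
            by (intro tendsto_intros isCont_tendsto_compose[OF P(3)[OF y]]) simp
        qed
      qed (auto simp: abs_mult S(2) mult.commute[of B] Si intro!: mult_left_mono P(2))
      then show ?thesis by (simp add: s_def mult.commute)
    qed
    have Am: "(\<lambda>y. A n y) \<in> borel_measurable borel" for n
      unfolding A_def by (intro lborel.borel_measurable_lebesgue_integral) simp
    show ?thesis
      unfolding RA
    proof (rule integral_dominated_convergence[where w = "\<lambda>y. (B * s) * \<bar>u y\<bar>"])
      show "integrable lborel (\<lambda>y. B * s * \<bar>u y\<bar>)" using u(1) by simp
      show "(\<lambda>y. u y * (s * P y)) \<in> borel_measurable lborel" by measurable
      show "(\<lambda>y. u y * A n y) \<in> borel_measurable lborel" for n using Am[of n] by measurable
      show "AE y in lborel. norm (u y * A n y) \<le> B * s * \<bar>u y\<bar>" for n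
        using Abound[of n] by (auto simp: abs_mult mult.commute[of "\<bar>u _\<bar>"] intro!: mult_right_mono)
      show "AE y in lborel. (\<lambda>n. u y * A n y) \<longlonglongrightarrow> u y * (s * P y)"
      proof (rule AE_I2)
        fix y
        show "(\<lambda>n. u y * A n y) \<longlonglongrightarrow> u y * (s * P y)"
        proof (cases "y \<in> interior T")
          case True
          then show ?thesis by (intro tendsto_intros Alim)
        qed (simp add: u(2))
      qed
    qed
  qed
  have "(\<lambda>n. (LINT y|lborel. w y * ((real n + 2 - 1) ^ 3 * R (real n + 2) \<Psi>0 y)) +
      (\<Sum>i\<in>UNIV. (real n + 2 - 1) / (real n + 2) * (LINT y|lborel. W i y * ((real n + 2 - 1) ^ 3 * R (real n + 2) (\<Psi> i) y))))
    \<longlonglongrightarrow> (LINT y|lborel. w y * (s * \<Psi>0 y)) + (\<Sum>i\<in>UNIV. 1 * (LINT y|lborel. W i y * (s * \<Psi> i y)))"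
    by (intro tendsto_add tendsto_sum tendsto_mult lim lim2 w W \<Psi>0 \<Psi> \<Psi>0i \<Psi>i)
  moreover have "(LINT y|lborel. w y * ((real n + 2 - 1) ^ 3 * R (real n + 2) \<Psi>0 y)) +
      (\<Sum>i\<in>UNIV. (real n + 2 - 1) / (real n + 2) * (LINT y|lborel. W i y * ((real n + 2 - 1) ^ 3 * R (real n + 2) (\<Psi> i) y))) = 0" for n
  proof -
    define \<rho> where "\<rho> = (real n + 2 - 1) ^ 3"
    have f: "(LINT y|lborel. u y * (\<rho> * R (real n + 2) P y)) = \<rho> * (LINT y|lborel. u y * R (real n + 2) P y)" for u P
      by (subst integral_mult_right_zero[symmetric]) (simp add: mult_ac)
    have "\<rho> * ((LINT y|lborel. w y * R (real n + 2) \<Psi>0 y) + (\<Sum>i\<in>UNIV. (real n + 2 - 1) / (real n + 2) * (LINT y|lborel. W i y * R (real n + 2) (\<Psi> i) y))) = 0"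
      using key[of "real n + 2"] by simp
    then show ?thesis
      unfolding \<rho>_def[symmetric] f by (simp add: distrib_left sum_distrib_left mult_ac)
  qed
  ultimately have z: "(LINT y|lborel. w y * (s * \<Psi>0 y)) + (\<Sum>i\<in>UNIV. (LINT y|lborel. W i y * (s * \<Psi> i y))) = 0"
    by (simp add: LIMSEQ_const_iff)
  have prod_i: "integrable lborel (\<lambda>y. u y * P y)"
    if "integrable lborel u" "P \<in> borel_measurable borel" "\<And>x. \<bar>P x\<bar> \<le> B" for u P :: "pt \<Rightarrow> real"
    using integrable_bounded_mult[OF that] by (simp add: mult.commute)
  have f: "(LINT y|lborel. u y * (s * P y)) = s * (LINT y|lborel. u y * P y)" for u P :: "pt \<Rightarrow> real"
    by (subst integral_mult_right_zero[symmetric]) (simp add: mult_ac)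
  have "s * ((LINT y|lborel. w y * \<Psi>0 y) + (\<Sum>i\<in>UNIV. (LINT y|lborel. W i y * \<Psi> i y))) = 0"
    using z unfolding f by (simp add: distrib_left sum_distrib_left)
  then have "(LINT y|lborel. w y * \<Psi>0 y) + (\<Sum>i\<in>UNIV. (LINT y|lborel. W i y * \<Psi> i y)) = 0"
    using Spos by (simp add: s_def)
  then show ?thesis
    using prod_i[OF w(1) \<Psi>0(1,2)] prod_i[OF W(1) \<Psi>(1,2)]
    by (subst Bochner_Integration.integral_add) (simp_all add: Bochner_Integration.integral_sum)
qed

subsection \<open>Existence of traces on tetrahedra\<close>

text \<open>Without the edges the facets of a tetrahedron become disjoint, so that one function on
  the boundary can be prescribed facet by facet.\<close>

definition open_reftri :: "(real \<times> real) set" where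
  "open_reftri = {st. 0 < fst st \<and> 0 < snd st \<and> fst st + snd st < 1}"

lemma open_open_reftri: "open open_reftri"
  unfolding open_reftri_def
  by (intro open_Collect_conj open_Collect_less continuous_intros)

lemma open_reftri_subset: "open_reftri \<subseteq> reftri"
  by (auto simp: open_reftri_def reftri_def)

lemma AE_open_reftri: "AE st in lborel. st \<in> reftri \<longrightarrow> st \<in> open_reftri"
proof -
  have "AE st in lborel. a \<bullet> st \<noteq> b" if "a \<noteq> 0" for a :: "real \<times> real" and b
  proof -
    have "closed {st. a \<bullet> st = b}" by (rule closed_hyperplane)
    moreover have "negligible {st. a \<bullet> st = b}" by (rule negligible_hyperplane) (use that in auto)
    ultimately have "{st. a \<bullet> st = b} \<in> null_sets lborel"
      by (simp add: negligible_iff_null_sets null_sets_completion_iff borel_closed)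
    then show ?thesis using AE_not_in by fastforce
  qed
  from this[of "(1, 0)" 0] this[of "(0, 1)" 0] this[of "(1, 1)" 1]
  have "AE st::real \<times> real in lborel. fst st \<noteq> 0" "AE st::real \<times> real in lborel. snd st \<noteq> 0"
    "AE st::real \<times> real in lborel. fst st + snd st \<noteq> 1"
    by (simp_all add: zero_prod_def inner_prod_def)
  then show ?thesis
    by eventually_elim (auto simp: reftri_def open_reftri_def)
qed

context tetra_facet
begin

lemma fparam_eq: "fparam (opp_facet T v) = tri a b c"
  by (simp add: fparam_def fvtx tri_def fun_eq_iff)

lemma opp_facet_eq: "opp_facet T v = tri a b c ` reftri"
  by (simp add: opp_facet_def abc[symmetric] convex_hull_tri)

lemma tri_inj: "tri a b c st = tri a b c st' \<Longrightarrow> st = st'"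
  using comb3_inj[OF det, of a "(st, 0)" "(st', 0)"] by (simp add: comb3_def tri_def)

lemma n_tri: "m \<bullet> (tri a b c st - a) = 0"
  by (simp add: tri_def inner_add_right dot_cross_self)

text \<open>An affine function that vanishes on the facet opposite to \<open>v'\<close> is zero at
  every other vertex. At a relatively interior point of the facet opposite to \<open>v\<close> it is
  therefore a positive multiple of its nonzero value at \<open>v'\<close>.\<close>

lemma tri_mem_opp_facetD:
  assumes v': "v' \<in> verts T" "v' \<noteq> v" and st: "st \<in> open_reftri"
  shows "tri a b c st \<notin> opp_facet T v'"
proof
  assume mem: "tri a b c st \<in> opp_facet T v'"
  obtain a' b' c' where "tetra_facet T v' a' b' c'" using tetra_facet_exists[OF T v'(1)] .
  then interpret V': tetra_facet T v' a' b' c' .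
  define \<Lambda> where "\<Lambda> x = V'.m \<bullet> (x - a')" for x
  have 0: "\<Lambda> x = 0" if "x \<in> verts T" "x \<noteq> v'" for x
    using V'.m_orth[of x a'] V'.abc that by (auto simp: \<Lambda>_def inner_diff_right)
  have nz: "\<Lambda> v' \<noteq> 0"
    using V'.det by (simp add: \<Lambda>_def inner_diff_right)
  have "\<Lambda> (tri a b c st) = 0"
    using mem V'.n_tri unfolding V'.opp_facet_eq \<Lambda>_def by auto
  moreover have "\<Lambda> (tri a b c st) = (1 - fst st - snd st) * \<Lambda> a + fst st * \<Lambda> b + snd st * \<Lambda> c"
    by (simp add: \<Lambda>_def tri_def inner_diff_right inner_add_right algebra_simps)
  moreover have "v' \<in> {a, b, c}" using abc v' by auto
  moreover have "card {a, b, c} = 3" by (rule card_abc)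
  then have "a \<noteq> b" "a \<noteq> c" "b \<noteq> c" by (auto simp: card_insert_if split: if_splits)
  ultimately show False
    using nz 0[of a] 0[of b] 0[of c] st by (auto simp: verts open_reftri_def)
qed

lemma vertex_not_interior: "v \<notin> interior T"
proof
  assume "v \<in> interior T"
  moreover have "v extreme_point_of T" using v unfolding verts_def by simp
  ultimately show False using extreme_point_not_in_interior by blast
qed

lemma interior_off_vertex:
  assumes "x \<in> interior T"
  shows "m \<bullet> (x - v) \<noteq> 0"
proof -
  have "x \<in> convex hull {v, a, b, c}" using assms interior_subset T_eq by blast
  from cone_cases[OF det this] show ?thesis
  proof cases
    case 1
    then show ?thesis using assms vertex_not_interior by simp
  next
    case (2 st r)
    have "m \<bullet> (x - v) = r * (m \<bullet> (tri a b c st - a) + m \<bullet> (a - v))"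
      unfolding 2(4) cone_def by (simp add: inner_diff_right algebra_simps)
    then show ?thesis using 2 det n_tri by simp
  qed
qed

lemma isCont_radial_proj: "x \<in> interior T \<Longrightarrow> isCont (radial_proj v a b c) x"
  by (intro continuous_at_radial_proj det interior_off_vertex)

lemma radial_proj_in: "x \<in> T \<Longrightarrow> radial_proj v a b c x \<in> T"
  using radial_proj_mem[OF det] T_eq by simp

end

lemma isCont_indicator_mult:
  fixes f :: "'a::t2_space \<Rightarrow> real"
  assumes "x \<in> interior T" "isCont f x"
  shows "isCont (\<lambda>x. indicator T x * f x) x"
proof -
  have "\<forall>\<^sub>F y in nhds x. indicator T y * f y = f y"
    using assms(1) interior_subset[of T]
    by (auto simp: eventually_nhds intro!: exI[of _ "interior T"])
  then show ?thesis using assms(2) isCont_cong by fast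
qed

section \<open>Bounds and square integrability\<close>

definition bdd_on :: "'a set \<Rightarrow> ('a \<Rightarrow> real) \<Rightarrow> bool" where
  "bdd_on T f \<longleftrightarrow> (\<exists>B. \<forall>x\<in>T. \<bar>f x\<bar> \<le> B)"

lemma bdd_on_const: "bdd_on T (\<lambda>_. c)"
  unfolding bdd_on_def by blast

lemma bdd_on_add: "bdd_on T f \<Longrightarrow> bdd_on T g \<Longrightarrow> bdd_on T (\<lambda>x. f x + g x)"
  unfolding bdd_on_def by (meson abs_triangle_ineq add_mono order_trans)

lemma bdd_on_mult: "bdd_on T f \<Longrightarrow> bdd_on T g \<Longrightarrow> bdd_on T (\<lambda>x. f x * g x)"
  unfolding bdd_on_def abs_mult by (meson abs_ge_zero mult_mono order_trans)

lemma bdd_on_diff: "bdd_on T f \<Longrightarrow> bdd_on T g \<Longrightarrow> bdd_on T (\<lambda>x. f x - g x)"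
  using bdd_on_add[of T f "\<lambda>x. -1 * g x"] bdd_on_mult[OF bdd_on_const[of T "-1"]] by simp

lemma bdd_on_sum: "(\<And>i. i \<in> I \<Longrightarrow> bdd_on T (f i)) \<Longrightarrow> bdd_on T (\<lambda>x. \<Sum>i\<in>I. f i x)"
  by (induction I rule: infinite_finite_induct) (auto intro: bdd_on_const bdd_on_add)

lemma bdd_on_continuous: "compact T \<Longrightarrow> continuous_on T f \<Longrightarrow> bdd_on T f"
  unfolding bdd_on_def using compact_imp_bounded[OF compact_continuous_image]
  by (metis bounded_iff imageI real_norm_def)

lemma sq_integrable_add:
  fixes f g :: "'a \<Rightarrow> real"
  assumes [measurable]: "f \<in> borel_measurable M" "g \<in> borel_measurable M"
    and "integrable M (\<lambda>x. (f x)\<^sup>2)" "integrable M (\<lambda>x. (g x)\<^sup>2)"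
  shows "integrable M (\<lambda>x. (f x + g x)\<^sup>2)"
proof (rule Bochner_Integration.integrable_bound)
  show "integrable M (\<lambda>x. 2 * (f x)\<^sup>2 + 2 * (g x)\<^sup>2)" using assms by simp
  show "AE x in M. norm ((f x + g x)\<^sup>2) \<le> norm (2 * (f x)\<^sup>2 + 2 * (g x)\<^sup>2)"
  proof (rule AE_I2)
    fix x
    have "0 \<le> (f x - g x)\<^sup>2" by simp
    then have "(f x + g x)\<^sup>2 \<le> 2 * (f x)\<^sup>2 + 2 * (g x)\<^sup>2"
      by (simp add: power2_sum power2_diff)
    then show "norm ((f x + g x)\<^sup>2) \<le> norm (2 * (f x)\<^sup>2 + 2 * (g x)\<^sup>2)"
      by simp
  qed
qed measurable

lemma sq_integrable_sum:
  fixes f :: "'i \<Rightarrow> 'a \<Rightarrow> real"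
  assumes "\<And>i. f i \<in> borel_measurable M" "\<And>i. integrable M (\<lambda>x. (f i x)\<^sup>2)"
  shows "integrable M (\<lambda>x. (\<Sum>i\<in>I. f i x)\<^sup>2)"
  by (induction I rule: infinite_finite_induct) (auto intro!: sq_integrable_add borel_measurable_sum assms)

lemma sq_integrable_imp_integrable:
  fixes f :: "pt \<Rightarrow> real"
  assumes T: "compact T" and f: "f \<in> borel_measurable borel" "integrable lborel (\<lambda>x. (f x)\<^sup>2)" "\<And>x. x \<notin> T \<Longrightarrow> f x = 0"
  shows "integrable lborel f"
proof (rule Bochner_Integration.integrable_bound)
  have "integrable lborel (\<lambda>x. indicator T x *\<^sub>R (1::real))"
    using T by (intro borel_integrable_compact) auto
  then show "integrable lborel (\<lambda>x. indicator T x + (f x)\<^sup>2)"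
    using f(2) by simp
  show "AE x in lborel. norm (f x) \<le> norm (indicator T x + (f x)\<^sup>2)"
  proof (rule AE_I2)
    fix x
    have "0 \<le> (\<bar>f x\<bar> - 1)\<^sup>2" by simp
    then have "\<bar>f x\<bar> \<le> 1 + (f x)\<^sup>2"
      by (simp add: power2_diff)
    then show "norm (f x) \<le> norm (indicator T x + (f x)\<^sup>2)"
      using f(3)[of x] by (cases "x \<in> T") auto
  qed
qed (use f in simp)

lemma L2_borel_representative:
  fixes f :: "pt \<Rightarrow> real"
  assumes f: "L2 U f" and U: "U \<in> sets borel" "U \<subseteq> T" "compact T"
  obtains g where "g \<in> borel_measurable borel" "AE x in lebesgue. indicator U x * f x = g x"
    "\<And>x. x \<notin> U \<Longrightarrow> g x = 0" "integrable lborel g" "integrable lborel (\<lambda>x. (g x)\<^sup>2)"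
proof -
  obtain g0 where g0: "g0 \<in> borel_measurable borel" "AE x in lebesgue. indicator U x * f x = g0 x"
    using borel_representative f by (auto simp: L2_def)
  define g where "g x = indicator U x * g0 x" for x
  have m: "g \<in> borel_measurable borel" unfolding g_def using g0(1) U(1) by measurable
  have ae: "AE x in lebesgue. indicator U x * f x = g x"
    using g0(2) by eventually_elim (auto simp: g_def indicator_def)
  have i: "integrable lebesgue (\<lambda>x. indicator U x * (f x)\<^sup>2)"
    using f by (simp add: L2_def set_integrable_def)
  have ae2: "AE x in lebesgue. indicator U x * (f x)\<^sup>2 = (g x)\<^sup>2"
    using ae
  proof eventually_elim
    case (elim x)
    then show ?case
      unfolding elim[symmetric] by (cases "x \<in> U") simp_all
  qed
  have "integrable lebesgue (\<lambda>x. (g x)\<^sup>2)"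
    using i unfolding lebesgue_integrable_cong_AE[OF ae2] .
  then have g2: "integrable lborel (\<lambda>x. (g x)\<^sup>2)"
    using m by (subst (asm) integrable_completion) auto
  have "g x = 0" if "x \<notin> T" for x
  proof -
    have "x \<notin> U" using that U(2) by auto
    then show ?thesis by (simp add: g_def)
  qed
  from sq_integrable_imp_integrable[OF U(3) m g2 this] have "integrable lborel g" .
  then show ?thesis using that[of g] m ae g2 by (simp add: g_def)
qed

text \<open>Glues the radial integrals of the four facets into a single function of the boundary
  point. The integrand \<open>k\<close> depends on the vertex, since each facet is reached from the
  vertex opposite to it. On edges the value is 0, which affects a null set of every facet.\<close>

definition cone_trace :: "pt set \<Rightarrow> (pt \<Rightarrow> pt \<Rightarrow> real) \<Rightarrow> pt \<Rightarrow> real" where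
  "cone_trace T k x =
    (if \<exists>v\<in>verts T. \<exists>st\<in>open_reftri. x = fparam (opp_facet T v) st
     then case SOME (v, st). v \<in> verts T \<and> st \<in> open_reftri \<and> x = fparam (opp_facet T v) st of
       (v, st) \<Rightarrow> (case fvtx (opp_facet T v) of (a, b, c) \<Rightarrow> cone_mean v a b c (k v) st)
     else 0)"

lemma (in tetra_facet) cone_trace_tri:
  assumes "st \<in> reftri"
  shows "cone_trace T k (tri a b c st) = indicator open_reftri st * cone_mean v a b c (k v) st"
proof -
  have uniq: "w = v \<and> st' = st" if w: "w \<in> verts T" "st' \<in> open_reftri" "tri a b c st = fparam (opp_facet T w) st'" for w st'
  proof -
    obtain a' b' c' where "tetra_facet T w a' b' c'" using tetra_facet_exists[OF T w(1)] .
    then interpret W: tetra_facet T w a' b' c' .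
    have eq: "tri a b c st = tri a' b' c' st'" using w(3) by (simp add: W.fparam_eq)
    have "tri a' b' c' st' \<in> opp_facet T v" unfolding eq[symmetric] opp_facet_eq using assms by blast
    then have "w = v" using W.tri_mem_opp_facetD[OF v _ w(2)] by blast
    moreover from this have "fparam (opp_facet T w) st' = tri a b c st'" by (simp add: fparam_eq)
    ultimately show ?thesis using w(3) tri_inj by simp
  qed
  show ?thesis
  proof (cases "st \<in> open_reftri")
    case True
    have "(\<lambda>(w, st'). w \<in> verts T \<and> st' \<in> open_reftri \<and> tri a b c st = fparam (opp_facet T w) st') = (\<lambda>p. p = (v, st))"
    proof (intro ext)
      fix p :: "pt \<times> real \<times> real"
      obtain w st' where p: "p = (w, st')" by (cases p) auto
      have "w \<in> verts T \<and> st' \<in> open_reftri \<and> tri a b c st = fparam (opp_facet T w) st' \<longleftrightarrow> w = v \<and> st' = st"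
        using uniq[of w st'] v True fparam_eq by metis
      then show "(case p of (w, st') \<Rightarrow> w \<in> verts T \<and> st' \<in> open_reftri \<and> tri a b c st = fparam (opp_facet T w) st')
          \<longleftrightarrow> p = (v, st)"
        by (simp add: p)
    qed
    then have "(SOME (w, st'). w \<in> verts T \<and> st' \<in> open_reftri \<and> tri a b c st = fparam (opp_facet T w) st') = (v, st)"
      by simp
    moreover have "\<exists>w\<in>verts T. \<exists>st'\<in>open_reftri. tri a b c st = fparam (opp_facet T w) st'"
      using v True by (auto simp: fparam_eq intro!: bexI[of _ v] bexI[of _ st])
    ultimately show ?thesis
      using True by (simp add: cone_trace_def fvtx)
  next
    case False
    then have "\<not> (\<exists>w\<in>verts T. \<exists>st'\<in>open_reftri. tri a b c st = fparam (opp_facet T w) st')"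
      using uniq by blast
    then show ?thesis using False by (simp add: cone_trace_def)
  qed
qed

lemma interior_tetra_nonempty:
  assumes "tetra T"
  shows "interior T \<noteq> {}"
  using interior_convex_hull_eq_empty[of "verts T"] tetra_verts[OF assms] by simp

lemma AE_tetra_interior:
  assumes "tetra T"
  shows "AE x in lebesgue. x \<in> T \<longleftrightarrow> x \<in> interior T"
proof -
  have "negligible (frontier T)"
    by (intro negligible_convex_frontier convex_tetra assms)
  then have "AE x in lebesgue. x \<notin> frontier T"
    by (simp add: AE_not_in negligible_iff_null_sets)
  then show ?thesis
    by eventually_elim
      (use compact_tetra[OF assms] interior_subset in \<open>auto simp: frontier_def compact_imp_closed\<close>)
qed

lemma wpartial_is_wpartial: "H1 U w \<Longrightarrow> is_wpartial U i w (wpartial U i w)"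
  unfolding wpartial_def H1_def by (metis someI_ex)

lemma bdd_on_indicator:
  assumes "bdd_on T f"
  shows "\<exists>B. \<forall>x. \<bar>indicator T x * f x\<bar> \<le> \<bar>B\<bar>"
proof -
  from assms obtain B where B: "\<And>x. x \<in> T \<Longrightarrow> \<bar>f x\<bar> \<le> B" by (auto simp: bdd_on_def)
  have "\<bar>indicator T x * f x\<bar> \<le> \<bar>B\<bar>" for x
    using B[of x] by (cases "x \<in> T") auto
  then show ?thesis by blast
qed

lemma (in tetra_facet) proj_integrable:
  fixes \<phi> :: "pt \<Rightarrow> real"
  assumes k: "k \<in> borel_measurable borel" "set_integrable lborel T k" and \<phi>: "continuous_on UNIV \<phi>"
  shows "set_integrable lborel T (\<lambda>x. k x * \<phi> (radial_proj v a b c x))"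
proof -
  have [measurable]: "\<phi> \<in> borel_measurable borel" using \<phi> by (rule borel_measurable_continuous_onI)
  have [measurable]: "T \<in> sets borel" using compact_tetra[OF T] by (rule borel_compact)
  have "bdd_on T \<phi>"
    using \<phi> by (intro bdd_on_continuous compact_tetra T) (rule continuous_on_subset, auto)
  then obtain B where B: "\<And>x. x \<in> T \<Longrightarrow> \<bar>\<phi> x\<bar> \<le> B" by (auto simp: bdd_on_def)
  have "integrable lborel (\<lambda>x. (indicator T x * \<phi> (radial_proj v a b c x)) * (indicator T x * k x))"
  proof (rule integrable_bounded_mult)
    show "\<bar>indicator T x * \<phi> (radial_proj v a b c x)\<bar> \<le> \<bar>B\<bar>" for x
      using B[OF radial_proj_in, of x] by (cases "x \<in> T") auto
  qed (use k in \<open>simp_all add: set_integrable_def\<close>)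
  moreover have "(indicator T x * \<phi> (radial_proj v a b c x)) * (indicator T x * k x)
     = indicator T x * (k x * \<phi> (radial_proj v a b c x))" for x
    by (simp add: indicator_def)
  ultimately show ?thesis by (simp add: set_integrable_def)
qed

lemma (in tetra_facet) proj_integral:
  fixes \<phi> :: "pt \<Rightarrow> real"
  assumes k: "k \<in> borel_measurable borel" "set_integrable lborel T k" and \<phi>: "continuous_on UNIV \<phi>"
  shows "(LINT x:T|lborel. k x * \<phi> (radial_proj v a b c x))
    = \<bar>det3 (b - a) (c - a) (a - v)\<bar> * (LINT st:reftri|lborel. cone_mean v a b c k st * \<phi> (tri a b c st))"
  using cone_mean_integral[OF det k(1) _ borel_measurable_continuous_onI[OF \<phi>]] k(2) proj_integrable[OF assms]
  by (simp add: T_eq[symmetric])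

text \<open>The candidate is \<open>cone_trace\<close> for
  \<open>k v x = 3 w + \<nabla>w \<bullet> (x - v)\<close>, built from Borel representatives.
  Written with volume integrals, its Green formula has the shape of
  \<open>weak_density_core\<close>; the smooth case is the divergence theorem for
  \<open>h * \<phi>\<close> combined with \<open>cone_mean_smooth\<close>.\<close>

theorem trace_exists:
  assumes T: "tetra T" and w: "H1 (interior T) w"
  shows "\<exists>g. is_trace T w g"
proof -
  let ?U = "interior T"
  have Tc: "compact T" using T by (rule compact_tetra)
  have Tm[measurable]: "T \<in> sets borel" using Tc by (rule borel_compact)
  have U: "?U \<in> sets borel" "?U \<subseteq> T" by (auto simp: interior_subset)
  define W where "W i = wpartial ?U i w" for i
  have W: "is_wpartial ?U i w (W i)" for i
    unfolding W_def by (rule wpartial_is_wpartial[OF w])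
  obtain w' where w': "w' \<in> borel_measurable borel" "AE x in lebesgue. indicator ?U x * w x = w' x"
    "\<And>x. x \<notin> ?U \<Longrightarrow> w' x = 0" "integrable lborel w'" "integrable lborel (\<lambda>x. (w' x)\<^sup>2)"
  proof -
    have "L2 ?U w" using w by (simp add: H1_def)
    from L2_borel_representative[OF this U Tc] show ?thesis using that .
  qed
  define Rep where "Rep i g \<longleftrightarrow> g \<in> borel_measurable borel \<and> (AE x in lebesgue. indicator ?U x * W i x = g x) \<and>
    (\<forall>x. x \<notin> ?U \<longrightarrow> g x = 0) \<and> integrable lborel g \<and> integrable lborel (\<lambda>x. (g x)\<^sup>2)" for i g
  have "\<exists>g. Rep i g" for i
  proof -
    have "L2 ?U (W i)" using W[of i] by (simp add: is_wpartial_def)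
    then obtain g where
      "g \<in> borel_measurable borel" "AE x in lebesgue. indicator ?U x * W i x = g x"
      "\<And>x. x \<notin> ?U \<Longrightarrow> g x = 0" "integrable lborel g" "integrable lborel (\<lambda>x. (g x)\<^sup>2)"
      by (rule L2_borel_representative[OF _ U Tc]) blast
    then show ?thesis by (intro exI[of _ g]) (simp add: Rep_def)
  qed
  then obtain W' where "\<And>i. Rep i (W' i)" by metis
  then have W': "\<And>i. W' i \<in> borel_measurable borel" "\<And>i. AE x in lebesgue. indicator ?U x * W i x = W' i x"
    "\<And>i x. x \<notin> ?U \<Longrightarrow> W' i x = 0" "\<And>i. integrable lborel (W' i)" "\<And>i. integrable lborel (\<lambda>x. (W' i x)\<^sup>2)"
    unfolding Rep_def by simp_all
  note [measurable] = w'(1) W'(1)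
  have wz: "w' x = 0" "W' i x = 0" if "x \<notin> T" for x i
    using that U(2) w'(3) W'(3) by blast+
  have part: "(LINT x|lborel. w' x * cpartial i \<phi> x) = - (LINT x|lborel. W' i x * \<phi> x)"
    if \<phi>: "test_fun ?U \<phi>" for i \<phi>
  proof -
    have [measurable]: "\<phi> \<in> borel_measurable borel" "cpartial i \<phi> \<in> borel_measurable borel"
      using test_fun_smooth[OF \<phi>] by (auto intro!: smooth_measurable smooth_cpartial)
    have "(LINT x:?U|lebesgue. w x * cpartial i \<phi> x) = (LINT x|lebesgue. w' x * cpartial i \<phi> x)"
      unfolding set_lebesgue_integral_def
      by (rule lebesgue_integral_cong_AE, use w'(2) in eventually_elim) (simp add: mult.assoc[symmetric])
    also have "\<dots> = (LINT x|lborel. w' x * cpartial i \<phi> x)"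
      by (rule integral_completion) measurable
    finally have 1: "(LINT x|lborel. w' x * cpartial i \<phi> x) = (LINT x:?U|lebesgue. w x * cpartial i \<phi> x)" ..
    have "(LINT x:?U|lebesgue. W i x * \<phi> x) = (LINT x|lebesgue. W' i x * \<phi> x)"
      unfolding set_lebesgue_integral_def
      by (rule lebesgue_integral_cong_AE, use W'(2)[of i] in eventually_elim) (simp add: mult.assoc[symmetric])
    also have "\<dots> = (LINT x|lborel. W' i x * \<phi> x)"
      by (rule integral_completion) measurable
    finally show ?thesis
      using W[of i] \<phi> 1 by (simp add: is_wpartial_def)
  qed
  define k where "k v x = 3 * w' x + (\<Sum>j\<in>UNIV. W' j x * (x - v) $ j)" for v x
  have kz: "k v x = 0" if "x \<notin> T" for v x
    using wz[OF that] by (simp add: k_def)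
  have [measurable]: "(\<lambda>x :: pt. (x - v) $ j) \<in> borel_measurable borel" for v j
    by (intro borel_measurable_continuous_onI continuous_intros)
  have km[measurable]: "k v \<in> borel_measurable borel" for v
    unfolding k_def by measurable
  have kT: "indicator T x * k v x = k v x" "indicator T x * (k v x)\<^sup>2 = (k v x)\<^sup>2" for v x
    using kz[of x v] by (cases "x \<in> T"; simp)+
  have k2: "integrable lborel (\<lambda>x. (k v x)\<^sup>2)" for v
  proof -
    have "integrable lborel (\<lambda>x. (W' j x * (x - v) $ j)\<^sup>2)" for j
    proof -
      have "bdd_on T (\<lambda>x. (x - v) $ j)"
        by (intro bdd_on_continuous Tc continuous_intros)
      then obtain B where B: "\<And>x. x \<in> T \<Longrightarrow> \<bar>(x - v) $ j\<bar> \<le> B" by (auto simp: bdd_on_def)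
      define q where "q x = indicator T x * ((x - v) $ j)\<^sup>2" for x
      have "\<bar>q x\<bar> \<le> B\<^sup>2" for x
        using B[of x] power_mono[OF B[of x], of 2] by (cases "x \<in> T") (simp_all add: q_def)
      moreover have "q \<in> borel_measurable borel" unfolding q_def by measurable
      ultimately have "integrable lborel (\<lambda>x. q x * (W' j x)\<^sup>2)"
        using integrable_bounded_mult[OF W'(5)] by blast
      moreover have "q x * (W' j x)\<^sup>2 = (W' j x * (x - v) $ j)\<^sup>2" for x
        using wz[of x] by (cases "x \<in> T") (simp_all add: q_def power_mult_distrib mult.commute)
      ultimately show ?thesis by simp
    qed
    then have "integrable lborel (\<lambda>x. (\<Sum>j\<in>UNIV. W' j x * (x - v) $ j)\<^sup>2)"
      by (intro sq_integrable_sum) auto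
    moreover have "integrable lborel (\<lambda>x. (3 * w' x)\<^sup>2)"
      using w'(5) by (simp add: power_mult_distrib)
    ultimately show ?thesis
      unfolding k_def by (intro sq_integrable_add) auto
  qed
  have ki: "integrable lborel (k v)" for v
    by (rule sq_integrable_imp_integrable[OF Tc km k2 kz])
  define g where "g = cone_trace T k"
  have "\<exists>a b c. \<forall>v\<in>verts T. tetra_facet T v (a v) (b v) (c v)"
  proof -
    have "\<forall>v\<in>verts T. \<exists>a b c. tetra_facet T v a b c"
      using tetra_facet_exists[OF T] by blast
    then show ?thesis by metis
  qed
  then obtain a b c where abc: "\<And>v. v \<in> verts T \<Longrightarrow> tetra_facet T v (a v) (b v) (c v)" by blast
  have facet_L2: "facet_L2 F g" if "F \<in> facets T" for F
  proof -
    obtain v where vF: "v \<in> verts T" "F = opp_facet T v" using \<open>F \<in> facets T\<close> facets_eq(1)[OF T] by auto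
    interpret tetra_facet T v "a v" "b v" "c v" by (rule abc[OF vF(1)])
    let ?c = "cone_mean v (a v) (b v) (c v) (k v)"
    have Teq: "convex hull {v, a v, b v, c v} = T" by (rule T_eq[symmetric])
    have i2: "integrable lborel (\<lambda>st. indicator reftri st * (?c st)\<^sup>2)"
      using cone_mean_square_integrable[OF det km] ki k2
      by (simp add: Teq set_integrable_def kT)
    have i1: "integrable lborel (\<lambda>st. indicator reftri st * ?c st)"
      using cone_mean_integrable[OF det km, where \<phi> = "\<lambda>_. 1"] ki by (simp add: Teq set_integrable_def kT)
    have om: "open_reftri \<in> sets borel" using open_open_reftri by (rule borel_open)
    have s1: "indicator reftri st * g (fparam F st) = indicator open_reftri st * (indicator reftri st * ?c st)" for st
      using cone_trace_tri[of st k] by (cases "st \<in> reftri") (simp_all add: vF(2) fparam_eq g_def)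
    have s2: "indicator reftri st * (g (fparam F st))\<^sup>2 = indicator open_reftri st * (indicator reftri st * (?c st)\<^sup>2)" for st
      using cone_trace_tri[of st k]
      by (cases "st \<in> reftri"; cases "st \<in> open_reftri") (simp_all add: vF(2) fparam_eq g_def)
    have "(\<lambda>st. indicator open_reftri st * (indicator reftri st * ?c st)) \<in> borel_measurable lborel"
      using om borel_measurable_integrable[OF i1] by measurable
    moreover have "integrable lborel (\<lambda>st. indicator open_reftri st * (indicator reftri st * (?c st)\<^sup>2))"
      using integrable_bounded_mult[OF i2, of "indicator open_reftri" 1] om by (simp add: indicator_def)
    ultimately show ?thesis
      by (simp add: facet_L2_def set_borel_measurable_def set_integrable_def s1 s2)
  qed
  have green: "(LINT x:T|lebesgue. wpartial ?U i w x * \<phi> x + w x * cpartial i \<phi> x)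
      = (\<Sum>F\<in>facets T. facet_integral F (\<lambda>x. g x * \<phi> x * onormal T F $ i))" if \<phi>: "smooth \<phi>" for \<phi> i
  proof -
    have [measurable]: "\<phi> \<in> borel_measurable borel" "cpartial i \<phi> \<in> borel_measurable borel"
      using \<phi> by (auto intro!: smooth_measurable smooth_cpartial)
    define D where "D v = \<bar>det3 (b v - a v) (c v - a v) (a v - v)\<bar>" for v
    define M where "M v = norm (cross3 (b v - a v) (c v - a v)) * onormal T (opp_facet T v) $ i" for v
    define \<phi>' where "\<phi>' v x = \<phi> (radial_proj v (a v) (b v) (c v) x)" for v x
    have [measurable]: "\<phi>' v \<in> borel_measurable borel" for v unfolding \<phi>'_def by measurable
    have Dnz: "D v \<noteq> 0" if "v \<in> verts T" for v
      using tetra_facet.det[OF abc[OF that]] by (simp add: D_def)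
    \<comment> \<open>The coefficients of the function and of its partials in "volume side minus
      facet side" of Green's formula. \<open>M v\<close> is twice the facet area times the normal
      component, division by the Jacobian \<open>D v\<close> passes from facet to volume integrals,
      and 3 and \<open>(x - v) $ j\<close> come from \<open>k v\<close>.\<close>
    define \<Psi>0 where "\<Psi>0 x = indicator T x * (cpartial i \<phi> x - (\<Sum>v\<in>verts T. M v / D v * (3 * \<phi>' v x)))" for x
    define \<Psi> where "\<Psi> j x = indicator T x * ((if j = i then \<phi> x else 0) - (\<Sum>v\<in>verts T. M v / D v * ((x - v) $ j * \<phi>' v x)))" for j x
    \<comment> \<open>Stated for arbitrary values \<open>h\<close> and \<open>d\<close>, so that it
      serves both a smooth function with its gradient and the pair \<open>w'\<close>,
      \<open>W'\<close>.\<close>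
    have comb: "h * \<Psi>0 x + (\<Sum>j\<in>UNIV. d j * \<Psi> j x) = indicator T x * (h * cpartial i \<phi> x + d i * \<phi> x)
        - (\<Sum>v\<in>verts T. M v / D v * (indicator T x * ((3 * h + (\<Sum>j\<in>UNIV. d j * (x - v) $ j)) * \<phi>' v x)))" for h d x
    proof (cases "x \<in> T")
      case True
      have "(\<Sum>j\<in>UNIV. d j * \<Psi> j x) = (\<Sum>j\<in>UNIV. d j * (if j = i then \<phi> x else 0))
          - (\<Sum>j\<in>UNIV. \<Sum>v\<in>verts T. d j * (M v / D v * ((x - v) $ j * \<phi>' v x)))"
        using True by (simp only: \<Psi>_def indicator_simps mult_1 right_diff_distrib sum_subtractf sum_distrib_left)
      also have "(\<Sum>j\<in>UNIV. d j * (if j = i then \<phi> x else 0)) = d i * \<phi> x"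
        by (simp add: if_distrib cong: if_cong)
      also have "(\<Sum>j\<in>UNIV. \<Sum>v\<in>verts T. d j * (M v / D v * ((x - v) $ j * \<phi>' v x)))
          = (\<Sum>v\<in>verts T. M v / D v * ((\<Sum>j\<in>UNIV. d j * (x - v) $ j) * \<phi>' v x))"
        by (subst sum.swap) (simp add: sum_distrib_left sum_distrib_right mult_ac)
      finally show ?thesis
        using True by (simp add: \<Psi>0_def algebra_simps sum.distrib sum_distrib_left)
    qed (simp add: \<Psi>0_def \<Psi>_def)
    have \<phi>c: "continuous_on S \<phi>" "continuous_on S (cpartial i \<phi>)" for S
      using \<phi> by (auto intro: smooth_continuous smooth_cpartial)
    have split: "(LINT x|lborel. F x - (\<Sum>v\<in>verts T. M v / D v * (indicator T x * (K v x * \<phi>' v x))))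
        = (LINT x|lborel. F x) - (\<Sum>v\<in>verts T. M v * (LINT st:reftri|lborel. cone_mean v (a v) (b v) (c v) (K v) st * \<phi> (tri (a v) (b v) (c v) st)))"
      if F: "integrable lborel F" and K: "\<And>v. K v \<in> borel_measurable borel" "\<And>v. set_integrable lborel T (K v)"
      for F :: "pt \<Rightarrow> real" and K
    proof -
      have i: "integrable lborel (\<lambda>x. indicator T x * (K v x * \<phi>' v x))" if "v \<in> verts T" for v
        using tetra_facet.proj_integrable[OF abc[OF that] K \<phi>c(1)] by (simp add: set_integrable_def \<phi>'_def)
      have "(LINT x|lborel. indicator T x * (K v x * \<phi>' v x))
          = D v * (LINT st:reftri|lborel. cone_mean v (a v) (b v) (c v) (K v) st * \<phi> (tri (a v) (b v) (c v) st))" if "v \<in> verts T" for v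
        using tetra_facet.proj_integral[OF abc[OF that] K \<phi>c(1)]
        by (simp add: set_lebesgue_integral_def \<phi>'_def D_def)
      then show ?thesis
        using i F Dnz by (subst Bochner_Integration.integral_diff) (simp_all add: Bochner_Integration.integral_sum)
    qed
    have facet_sum: "(\<Sum>F\<in>facets T. facet_integral F (\<lambda>x. G x * onormal T F $ i)) = (\<Sum>v\<in>verts T. M v * tri_integral (a v) (b v) (c v) G)" for G
    proof -
      have "facet_integral (opp_facet T v) (\<lambda>x. G x * onormal T (opp_facet T v) $ i) = M v * tri_integral (a v) (b v) (c v) G"
        if "v \<in> verts T" for v
        unfolding facet_integral_mult_right tetra_facet.facet_integral_eq[OF abc[OF that]] by (simp add: M_def)
      then show ?thesis
        using facets_eq[OF T] by (simp add: sum.reindex)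
    qed
    have id: "(LINT x|lborel. h x * \<Psi>0 x + (\<Sum>j\<in>UNIV. cpartial j h x * \<Psi> j x)) = 0" if h: "smooth h" for h
    proof -
      let ?F = "\<lambda>x. indicator T x * (h x * cpartial i \<phi> x + cpartial i h x * \<phi> x)"
      let ?K = "\<lambda>v x. 3 * h x + (\<Sum>j\<in>UNIV. cpartial j h x * (x - v) $ j)"
      have hc: "continuous_on S h" "continuous_on S (cpartial j h)" for S j
        using h by (auto intro: smooth_continuous smooth_cpartial)
      have Kc: "continuous_on S (?K v)" for S v
        by (intro continuous_intros hc)
      have "set_integrable lborel T (\<lambda>x. h x * cpartial i \<phi> x + cpartial i h x * \<phi> x)"
        by (intro smooth_integrable_tetra T continuous_intros hc \<phi>c)
      then have Fi: "integrable lborel ?F" by (simp add: set_integrable_def)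
      have "(LINT x|lborel. ?F x) = (LINT x:T|lborel. cpartial i (\<lambda>x. h x * \<phi> x) x)"
        by (simp add: cpartial_mult[OF h \<phi>] set_lebesgue_integral_def)
      also have "\<dots> = (\<Sum>v\<in>verts T. M v * tri_integral (a v) (b v) (c v) (\<lambda>x. h x * \<phi> x))"
        using tetra_divergence[OF T smooth_mult[OF h \<phi>], of i] facet_sum[of "\<lambda>x. h x * \<phi> x"] by simp
      finally have 1: "(LINT x|lborel. ?F x) = (\<Sum>v\<in>verts T. M v * tri_integral (a v) (b v) (c v) (\<lambda>x. h x * \<phi> x))" .
      show ?thesis
        unfolding comb
        by (subst split[OF Fi borel_measurable_continuous_onI[OF Kc] smooth_integrable_tetra[OF T Kc]])
          (simp add: cone_mean_smooth[OF h, unfolded vector_minus_component] 1)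
    qed
    \<comment> \<open>The projected \<open>\<phi>' v\<close> is in general discontinuous at the
      vertex \<open>v\<close>. In the interior the denominator of the projection does not vanish,
      and this is all that the approximation asks for besides a bound.\<close>
    have cont: "isCont \<Psi>0 x" "isCont (\<Psi> j) x" if x: "x \<in> interior T" for x j
    proof -
      have \<phi>at: "isCont \<phi> y" "isCont (cpartial i \<phi>) y" for y
        using \<phi>c[of UNIV] by (auto simp: continuous_on_eq_continuous_at)
      have c: "isCont (\<phi>' v) x" if "v \<in> verts T" for v
        unfolding \<phi>'_def
        by (intro isCont_o2[OF tetra_facet.isCont_radial_proj[OF abc[OF that] x]] \<phi>at)
      show "isCont \<Psi>0 x"
        unfolding \<Psi>0_def by (rule isCont_indicator_mult[OF x], intro continuous_intros)
          (use c \<phi>at Dnz in auto)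
      have "isCont (\<lambda>y. if j = i then \<phi> y else 0) x" for j
        by (cases "j = i") (simp_all add: \<phi>at)
      then show "isCont (\<Psi> j) x"
        unfolding \<Psi>_def by (intro isCont_indicator_mult[OF x] continuous_intros) (use c Dnz in auto)
    qed
    have \<phi>'b: "bdd_on T (\<phi>' v)" if "v \<in> verts T" for v
    proof -
      have "bdd_on T \<phi>" by (intro bdd_on_continuous Tc \<phi>c)
      then show ?thesis
        unfolding bdd_on_def \<phi>'_def using tetra_facet.radial_proj_in[OF abc[OF that]] by meson
    qed
    have "bdd_on T (\<lambda>x. cpartial i \<phi> x - (\<Sum>v\<in>verts T. M v / D v * (3 * \<phi>' v x)))"
      by (intro bdd_on_diff bdd_on_sum bdd_on_mult bdd_on_const \<phi>'b bdd_on_continuous Tc \<phi>c)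
    then obtain B0 where B0: "\<And>x. \<bar>\<Psi>0 x\<bar> \<le> \<bar>B0\<bar>"
      unfolding \<Psi>0_def using bdd_on_indicator by blast
    have "bdd_on T (\<lambda>x. (if j = i then \<phi> x else 0) - (\<Sum>v\<in>verts T. M v / D v * ((x - v) $ j * \<phi>' v x)))" for j
      by (intro bdd_on_diff bdd_on_sum bdd_on_mult bdd_on_const \<phi>'b bdd_on_continuous Tc continuous_intros)
        (cases "j = i"; simp add: \<phi>c)
    then have "\<exists>B. \<forall>x. \<bar>\<Psi> j x\<bar> \<le> \<bar>B\<bar>" for j
      unfolding \<Psi>_def by (rule bdd_on_indicator)
    then obtain B1 where B1: "\<And>j x. \<bar>\<Psi> j x\<bar> \<le> \<bar>B1 j\<bar>" by metis
    define B where "B = \<bar>B0\<bar> + (\<Sum>j\<in>UNIV. \<bar>B1 j\<bar>)"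
    have bounds: "\<bar>\<Psi>0 x\<bar> \<le> B" "\<bar>\<Psi> j x\<bar> \<le> B" for x j
    proof -
      have "0 \<le> (\<Sum>j\<in>UNIV. \<bar>B1 j\<bar>)" by (intro sum_nonneg) auto
      then show "\<bar>\<Psi>0 x\<bar> \<le> B" using B0[of x] unfolding B_def by linarith
      have "\<bar>B1 j\<bar> \<le> (\<Sum>j\<in>UNIV. \<bar>B1 j\<bar>)" by (rule member_le_sum) auto
      then show "\<bar>\<Psi> j x\<bar> \<le> B" using B1[of j x] unfolding B_def by linarith
    qed
    have meas: "\<Psi>0 \<in> borel_measurable borel" "\<Psi> j \<in> borel_measurable borel" for j
      unfolding \<Psi>0_def \<Psi>_def by measurable
    have zero: "(LINT x|lborel. w' x * \<Psi>0 x + (\<Sum>j\<in>UNIV. W' j x * \<Psi> j x)) = 0"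
      by (rule weak_density_core[OF convex_tetra[OF T] Tc interior_tetra_nonempty[OF T] w'(4,3) W'(4,3) part
            meas(1) bounds(1) _ cont(1) meas(2) bounds(2) _ cont(2) id])
        (simp_all add: \<Psi>0_def \<Psi>_def)
    let ?F = "\<lambda>x. indicator T x * (w' x * cpartial i \<phi> x + W' i x * \<phi> x)"
    have Fi: "integrable lborel ?F"
    proof -
      have "bdd_on T \<phi>" "bdd_on T (cpartial i \<phi>)" by (intro bdd_on_continuous Tc \<phi>c)+
      then obtain C C' where C: "\<And>x. \<bar>indicator T x * \<phi> x\<bar> \<le> \<bar>C\<bar>" "\<And>x. \<bar>indicator T x * cpartial i \<phi> x\<bar> \<le> \<bar>C'\<bar>"
        using bdd_on_indicator by metis
      have "integrable lborel (\<lambda>x. (indicator T x * cpartial i \<phi> x) * w' x + (indicator T x * \<phi> x) * W' i x)"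
        by (intro Bochner_Integration.integrable_add integrable_bounded_mult[OF w'(4) _ C(2)]
            integrable_bounded_mult[OF W'(4) _ C(1)]) measurable
      then show ?thesis by (simp add: algebra_simps)
    qed
    have "0 = (LINT x|lborel. ?F x) - (\<Sum>v\<in>verts T. M v * (LINT st:reftri|lborel. cone_mean v (a v) (b v) (c v) (k v) st * \<phi> (tri (a v) (b v) (c v) st)))"
      using zero unfolding comb k_def[symmetric]
      by (subst (asm) split[OF Fi km]) (use ki in \<open>simp_all add: set_integrable_def kT\<close>)
    moreover have "(LINT st:reftri|lborel. cone_mean v (a v) (b v) (c v) (k v) st * \<phi> (tri (a v) (b v) (c v) st))
        = tri_integral (a v) (b v) (c v) (\<lambda>x. g x * \<phi> x)" if v: "v \<in> verts T" for v
    proof -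
      interpret tetra_facet T v "a v" "b v" "c v" by (rule abc[OF v])
      let ?c = "cone_mean v (a v) (b v) (c v) (k v)"
      have i1: "integrable lborel (\<lambda>st. indicator reftri st * ?c st)"
        using cone_mean_integrable[OF det km, where \<phi> = "\<lambda>_. 1"] ki by (simp add: T_eq[symmetric] set_integrable_def kT)
      have om: "open_reftri \<in> sets borel" using open_open_reftri by (rule borel_open)
      have e1: "indicator reftri st * (?c st * \<phi> (tri (a v) (b v) (c v) st)) = (indicator reftri st * ?c st) * \<phi> (tri (a v) (b v) (c v) st)" for st
        by simp
      have e2: "indicator reftri st * (g (tri (a v) (b v) (c v) st) * \<phi> (tri (a v) (b v) (c v) st))
          = indicator open_reftri st * ((indicator reftri st * ?c st) * \<phi> (tri (a v) (b v) (c v) st))" for st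
        using cone_trace_tri[of st k] by (cases "st \<in> reftri") (simp_all add: g_def)
      show ?thesis
        unfolding set_lebesgue_integral_def real_scaleR_def e1 e2
      proof (rule integral_cong_AE)
        show "(\<lambda>st. indicator reftri st * ?c st * \<phi> (tri (a v) (b v) (c v) st)) \<in> borel_measurable lborel"
          "(\<lambda>st. indicator open_reftri st * (indicator reftri st * ?c st * \<phi> (tri (a v) (b v) (c v) st))) \<in> borel_measurable lborel"
          using om borel_measurable_integrable[OF i1] by measurable
        show "AE st in lborel. indicator reftri st * ?c st * \<phi> (tri (a v) (b v) (c v) st)
           = indicator open_reftri st * (indicator reftri st * ?c st * \<phi> (tri (a v) (b v) (c v) st))"
          using AE_open_reftri by eventually_elim (auto simp: indicator_def)
      qed
    qed
    ultimately have "(LINT x|lborel. ?F x) = (\<Sum>v\<in>verts T. M v * tri_integral (a v) (b v) (c v) (\<lambda>x. g x * \<phi> x))"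
      by simp
    then have "(LINT x|lborel. ?F x) = (\<Sum>F\<in>facets T. facet_integral F (\<lambda>x. g x * \<phi> x * onormal T F $ i))"
      using facet_sum[of "\<lambda>x. g x * \<phi> x"] by simp
    moreover have "(LINT x:T|lebesgue. wpartial ?U i w x * \<phi> x + w x * cpartial i \<phi> x) = (LINT x|lebesgue. ?F x)"
      unfolding set_lebesgue_integral_def
    proof (rule lebesgue_integral_cong_AE)
      show "AE x in lebesgue. indicator T x *\<^sub>R (wpartial ?U i w x * \<phi> x + w x * cpartial i \<phi> x) = ?F x"
        using AE_tetra_interior[OF T] w'(2) W'(2)[of i]
        by eventually_elim (auto simp: indicator_def W_def split: if_splits)
    qed
    moreover have "(LINT x|lebesgue. ?F x) = (LINT x|lborel. ?F x)"
      by (rule integral_completion) measurable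
    ultimately show ?thesis by simp
  qed
  show ?thesis
    unfolding is_trace_def using facet_L2 green by blast
qed

subsection \<open>Facet integrals and uniqueness of traces\<close>

definition facet_int :: "pt set \<Rightarrow> (pt \<Rightarrow> real) \<Rightarrow> bool" where
  "facet_int F g \<longleftrightarrow> set_integrable lborel reftri (\<lambda>st. g (fparam F st))"

definition facet_AE :: "pt set \<Rightarrow> (pt \<Rightarrow> bool) \<Rightarrow> bool" where
  "facet_AE F P \<longleftrightarrow> (AE st in lborel. st \<in> reftri \<longrightarrow> P (fparam F st))"

definition facet_meas :: "pt set \<Rightarrow> (pt \<Rightarrow> real) \<Rightarrow> bool" where
  "facet_meas F g \<longleftrightarrow> set_borel_measurable lborel reftri (\<lambda>st. g (fparam F st))"

lemma fparam_continuous: "continuous_on S (fparam F)"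
  unfolding fparam_def by (cases "fvtx F") (auto intro!: continuous_intros)

lemma facet_int_meas: "facet_int F g \<Longrightarrow> facet_meas F g"
  unfolding facet_int_def facet_meas_def set_integrable_def set_borel_measurable_def by auto

lemma facet_meas_add: "facet_meas F f \<Longrightarrow> facet_meas F g \<Longrightarrow> facet_meas F (\<lambda>x. f x + g x)"
  unfolding facet_meas_def set_borel_measurable_def scaleR_add_right by (rule borel_measurable_add)

lemma facet_meas_diff: "facet_meas F f \<Longrightarrow> facet_meas F g \<Longrightarrow> facet_meas F (\<lambda>x. f x - g x)"
  unfolding facet_meas_def set_borel_measurable_def scaleR_diff_right by (rule borel_measurable_diff)

lemma facet_meas_mult:
  assumes "facet_meas F f" "facet_meas F g"
  shows "facet_meas F (\<lambda>x. f x * g x)"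
proof -
  have "(\<lambda>st. (indicator reftri st *\<^sub>R f (fparam F st)) * (indicator reftri st *\<^sub>R g (fparam F st))) \<in> borel_measurable lborel"
    using assms unfolding facet_meas_def set_borel_measurable_def by (rule borel_measurable_times)
  moreover have eq: "(indicator reftri st *\<^sub>R f (fparam F st)) * (indicator reftri st *\<^sub>R g (fparam F st))
      = indicator reftri st *\<^sub>R (f (fparam F st) * g (fparam F st))" for st
    by (cases "st \<in> reftri") simp_all
  ultimately show ?thesis unfolding facet_meas_def set_borel_measurable_def eq by blast
qed

lemma facet_int_continuous:
  assumes "continuous_on UNIV g"
  shows "facet_int F g"
  unfolding facet_int_def
  by (intro continuous_reftri_integrable continuous_on_compose2[OF assms fparam_continuous]) auto

lemma facet_meas_continuous: "continuous_on UNIV g \<Longrightarrow> facet_meas F g"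
  by (intro facet_int_meas facet_int_continuous)

lemma facet_meas_const: "facet_meas F (\<lambda>_. c)"
  by (intro facet_meas_continuous) auto

lemma facet_meas_sum: "(\<And>i. i \<in> I \<Longrightarrow> facet_meas F (f i)) \<Longrightarrow> facet_meas F (\<lambda>x. \<Sum>i\<in>I. f i x)"
  by (induction I rule: infinite_finite_induct) (auto intro: facet_meas_add facet_meas_const)

lemma facet_int_add: "facet_int F f \<Longrightarrow> facet_int F g \<Longrightarrow> facet_int F (\<lambda>x. f x + g x)"
  unfolding facet_int_def by (rule set_integral_add)

lemma facet_int_diff: "facet_int F f \<Longrightarrow> facet_int F g \<Longrightarrow> facet_int F (\<lambda>x. f x - g x)"
  unfolding facet_int_def by (rule set_integral_diff)

lemma facet_int_zero: "facet_int F (\<lambda>_. 0)"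
  by (intro facet_int_continuous) auto

lemma facet_int_sum: "(\<And>i. i \<in> I \<Longrightarrow> facet_int F (f i)) \<Longrightarrow> facet_int F (\<lambda>x. \<Sum>i\<in>I. f i x)"
  by (induction I rule: infinite_finite_induct) (auto intro: facet_int_add facet_int_zero)

lemma facet_int_mult_continuous:
  assumes g: "facet_int F g" and \<phi>: "continuous_on UNIV \<phi>"
  shows "facet_int F (\<lambda>x. g x * \<phi> x)"
proof -
  have c: "continuous_on UNIV (\<lambda>st. \<phi> (fparam F st))"
    by (rule continuous_on_compose2[OF \<phi> fparam_continuous]) auto
  then have m: "(\<lambda>st. \<phi> (fparam F st)) \<in> borel_measurable borel" by (rule borel_measurable_continuous_onI)
  have "bdd_on reftri (\<lambda>st. \<phi> (fparam F st))"
    by (intro bdd_on_continuous compact_reftri continuous_on_subset[OF c]) auto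
  then obtain B where B: "\<And>st. \<bar>indicator reftri st * \<phi> (fparam F st)\<bar> \<le> \<bar>B\<bar>"
    using bdd_on_indicator by metis
  have "integrable lborel (\<lambda>st. (indicator reftri st * \<phi> (fparam F st)) * (indicator reftri st * g (fparam F st)))"
    by (rule integrable_bounded_mult[OF _ _ B]) (use g m in \<open>simp_all add: facet_int_def set_integrable_def\<close>)
  moreover have "(indicator reftri st * \<phi> (fparam F st)) * (indicator reftri st * g (fparam F st))
     = indicator reftri st * (g (fparam F st) * \<phi> (fparam F st))" for st
    by (simp add: indicator_def)
  ultimately show ?thesis by (simp add: facet_int_def set_integrable_def)
qed

lemma facet_int_cmult: "facet_int F g \<Longrightarrow> facet_int F (\<lambda>x. g x * c)"
  by (intro facet_int_mult_continuous) auto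

lemma facet_integral_add:
  "facet_int F f \<Longrightarrow> facet_int F g \<Longrightarrow> facet_integral F (\<lambda>x. f x + g x) = facet_integral F f + facet_integral F g"
  unfolding facet_int_def by (cases "fvtx F") (simp add: facet_integral_def set_integral_add distrib_left)

lemma facet_integral_diff:
  "facet_int F f \<Longrightarrow> facet_int F g \<Longrightarrow> facet_integral F (\<lambda>x. f x - g x) = facet_integral F f - facet_integral F g"
  unfolding facet_int_def by (cases "fvtx F") (simp add: facet_integral_def set_integral_diff right_diff_distrib)

lemma facet_integral_zero [simp]: "facet_integral F (\<lambda>_. 0) = 0"
  by (cases "fvtx F") (simp add: facet_integral_def)

lemma facet_integral_sum:
  "(\<And>i. i \<in> I \<Longrightarrow> facet_int F (f i)) \<Longrightarrow> facet_integral F (\<lambda>x. \<Sum>i\<in>I. f i x) = (\<Sum>i\<in>I. facet_integral F (f i))"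
  by (induction I rule: infinite_finite_induct) (auto simp: facet_integral_add facet_int_sum)

lemma facet_integral_cong_AE:
  assumes "facet_AE F (\<lambda>x. f x = g x)" "facet_meas F f" "facet_meas F g"
  shows "facet_integral F f = facet_integral F g"
proof -
  have "(LINT st:reftri|lborel. f (fparam F st)) = (LINT st:reftri|lborel. g (fparam F st))"
    unfolding set_lebesgue_integral_def
  proof (rule integral_cong_AE)
    show "AE st in lborel. indicator reftri st *\<^sub>R f (fparam F st) = indicator reftri st *\<^sub>R g (fparam F st)"
      using assms(1) unfolding facet_AE_def by eventually_elim (auto simp: indicator_def)
  qed (use assms(2,3) in \<open>simp_all add: facet_meas_def set_borel_measurable_def\<close>)
  then show ?thesis by (simp add: facet_integral_def)
qed

lemma facet_integral_AE_zero:
  assumes "facet_AE F (\<lambda>x. f x = 0)"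
  shows "facet_integral F f = 0"
proof -
  have "(LINT st:reftri|lborel. f (fparam F st)) = 0"
    unfolding set_lebesgue_integral_def
  proof (rule integral_eq_zero_AE)
    show "AE st in lborel. indicator reftri st *\<^sub>R f (fparam F st) = 0"
      using assms unfolding facet_AE_def by eventually_elim (auto simp: indicator_def)
  qed
  then show ?thesis by (cases "fvtx F") (simp add: facet_integral_def)
qed

lemma facet_AE_mp: "facet_AE F P \<Longrightarrow> (\<And>x. P x \<Longrightarrow> Q x) \<Longrightarrow> facet_AE F Q"
  unfolding facet_AE_def by (erule AE_mp) auto

lemma facet_AE_conj:
  assumes "facet_AE F P" "facet_AE F Q"
  shows "facet_AE F (\<lambda>x. P x \<and> Q x)"
  using assms unfolding facet_AE_def by eventually_elim auto

lemma facet_AE_all: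
  assumes "\<And>i::'i::finite. facet_AE F (P i)"
  shows "facet_AE F (\<lambda>x. \<forall>i. P i x)"
proof -
  have "AE st in lborel. \<forall>i. st \<in> reftri \<longrightarrow> P i (fparam F st)"
    by (rule eventually_all_finite) (use assms in \<open>simp add: facet_AE_def\<close>)
  then show ?thesis
    unfolding facet_AE_def by eventually_elim auto
qed

lemma facet_L2_int:
  assumes "facet_L2 F g"
  shows "facet_int F g"
proof -
  have m: "(\<lambda>st. indicator reftri st * g (fparam F st)) \<in> borel_measurable lborel"
    and i: "integrable lborel (\<lambda>st. indicator reftri st * (g (fparam F st))\<^sup>2)"
    using assms by (simp_all add: facet_L2_def set_borel_measurable_def set_integrable_def)
  have "set_integrable lborel reftri (\<lambda>_. 1 :: real)" by (rule continuous_reftri_integrable) auto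
  then have "integrable lborel (\<lambda>st. indicator reftri st + indicator reftri st * (g (fparam F st))\<^sup>2)"
    using i by (simp add: set_integrable_def)
  then have "integrable lborel (\<lambda>st. indicator reftri st * g (fparam F st))"
  proof (rule Bochner_Integration.integrable_bound[OF _ m])
    show "AE st in lborel. norm (indicator reftri st * g (fparam F st))
        \<le> norm (indicator reftri st + indicator reftri st * (g (fparam F st))\<^sup>2)"
    proof (rule AE_I2)
      fix st
      have "0 \<le> (\<bar>g (fparam F st)\<bar> - 1)\<^sup>2" by simp
      then have "\<bar>g (fparam F st)\<bar> \<le> 1 + (g (fparam F st))\<^sup>2"
        by (simp add: power2_diff)
      then show "norm (indicator reftri st * g (fparam F st))
        \<le> norm (indicator reftri st + indicator reftri st * (g (fparam F st))\<^sup>2)"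
        by (cases "st \<in> reftri") auto
    qed
  qed
  then show ?thesis by (simp add: facet_int_def set_integrable_def)
qed

text \<open>The fundamental lemma on a triangle in space with test functions of three variables: a
  compact part of the open triangle has compact image, and test functions that tend to the indicator
  of the image restrict to functions that tend to the indicator of the part.\<close>

lemma (in tetra_facet) triangle_localization:
  assumes f: "set_integrable lborel reftri f"
    and V: "open V" "tri a b c ` open_reftri \<subseteq> V"
    and z: "\<And>\<phi>. test_fun V \<phi> \<Longrightarrow> (LINT st:reftri|lborel. f st * \<phi> (tri a b c st)) = 0"
  shows "AE st in lborel. st \<in> reftri \<longrightarrow> f st = 0"
proof -
  have om: "open_reftri \<in> sets borel" using open_open_reftri by (rule borel_open)
  have fo: "set_integrable lborel open_reftri f"
    by (rule set_integrable_subset[OF f _ open_reftri_subset]) (use om in simp)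
  have leb: "set_integrable lebesgue S f" if "set_integrable lborel S f" for S
    using that borel_measurable_integrable unfolding set_integrable_def
    by (subst integrable_completion) auto
  have "AE st in lebesgue. st \<in> open_reftri \<longrightarrow> f st = 0"
  proof (rule AE_zero_if_compact_integrals_zero[OF open_open_reftri leb[OF fo]])
    fix K assume K: "compact K" "K \<subseteq> open_reftri"
    have Km: "K \<in> sets borel" using K(1) by (rule borel_compact)
    have "compact (tri a b c ` K)" using K(1) tri_continuous by (rule compact_continuous_image[rotated])
    moreover have "tri a b c ` K \<subseteq> V" using K(2) V(2) by blast
    ultimately obtain \<phi> :: "nat \<Rightarrow> pt \<Rightarrow> real" where p: "\<And>n. test_fun V (\<phi> n)" "\<And>n x. 0 \<le> \<phi> n x \<and> \<phi> n x \<le> 1"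
      "\<And>x. (\<lambda>n. \<phi> n x) \<longlonglongrightarrow> indicator (tri a b c ` K) x"
      using test_fun_indicator_limit[of "tri a b c ` K" V] V(1) by blast
    have [measurable]: "\<phi> n \<in> borel_measurable borel" for n
      using smooth_measurable[OF test_fun_smooth[OF p(1)]] .
    have ri: "integrable lborel (\<lambda>st. indicator reftri st * f st)" using f by (simp add: set_integrable_def)
    note [measurable] = borel_measurable_integrable[OF ri]
    have KR: "K \<subseteq> reftri" using K(2) open_reftri_subset by blast
    have ki: "integrable lborel (\<lambda>st. indicator K st * f st)"
      using set_integrable_subset[OF f _ KR] Km by (simp add: set_integrable_def)
    have "(\<lambda>n. LINT st|lborel. (indicator reftri st * f st) * \<phi> n (tri a b c st)) \<longlonglongrightarrow> (LINT st|lborel. indicator K st * f st)"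
    proof (rule integral_dominated_convergence[where w = "\<lambda>st. \<bar>indicator reftri st * f st\<bar>"])
      show "(\<lambda>st. indicator K st * f st) \<in> borel_measurable lborel"
        using ki by (rule borel_measurable_integrable)
      show "integrable lborel (\<lambda>st. \<bar>indicator reftri st * f st\<bar>)" using ri by (rule integrable_abs)
      show "AE st in lborel. norm (indicator reftri st * f st * \<phi> n (tri a b c st)) \<le> \<bar>indicator reftri st * f st\<bar>" for n
        using p(2)[of n] by (intro AE_I2) (simp add: abs_mult mult_left_le)
      show "AE st in lborel. (\<lambda>n. indicator reftri st * f st * \<phi> n (tri a b c st)) \<longlonglongrightarrow> indicator K st * f st"
      proof (rule AE_I2)
        fix st
        have "tri a b c st \<in> tri a b c ` K \<longleftrightarrow> st \<in> K"
          using tri_inj by blast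
        then have "indicator (tri a b c ` K) (tri a b c st) = (indicator K st :: real)"
          by (simp add: indicator_def)
        then have "(\<lambda>n. indicator reftri st * f st * \<phi> n (tri a b c st)) \<longlonglongrightarrow> indicator reftri st * f st * indicator K st"
          using p(3)[of "tri a b c st"] by (intro tendsto_intros) simp
        moreover have "indicator reftri st * f st * indicator K st = indicator K st * f st"
          using KR by (auto simp: indicator_def)
        ultimately show "(\<lambda>n. indicator reftri st * f st * \<phi> n (tri a b c st)) \<longlonglongrightarrow> indicator K st * f st"
          by simp
      qed
    qed measurable
    moreover have "(LINT st|lborel. (indicator reftri st * f st) * \<phi> n (tri a b c st)) = 0" for n
      using z[OF p(1)] by (simp add: set_lebesgue_integral_def mult.assoc)
    ultimately have "(LINT st|lborel. indicator K st * f st) = 0"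
      by (simp add: LIMSEQ_const_iff)
    then show "(LINT st:K|lebesgue. f st) = 0"
      using borel_measurable_integrable[OF ki] by (simp add: set_lebesgue_integral_def integral_completion)
  qed
  then have "AE st in lborel. st \<in> open_reftri \<longrightarrow> f st = 0"
    by (simp add: AE_completion_iff)
  with AE_open_reftri show ?thesis by eventually_elim auto
qed

lemma (in tetra_facet) compact_opp_facet: "compact (opp_facet T v)"
  unfolding opp_facet_def abc[symmetric] by (intro finite_imp_compact_convex_hull) auto

lemma fparam_in_facet:
  assumes "tetra T" "F \<in> facets T" "st \<in> reftri"
  shows "fparam F st \<in> F"
proof -
  obtain v where vF: "v \<in> verts T" "F = opp_facet T v" using assms facets_eq(1) by blast
  obtain a b c where "tetra_facet T v a b c" using tetra_facet_exists[OF assms(1) vF(1)] .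
  then interpret tetra_facet T v a b c .
  have "fparam F st = tri a b c st" by (simp add: vF(2) fparam_eq)
  moreover have "F = tri a b c ` reftri" by (simp add: vF(2) opp_facet_eq)
  ultimately show ?thesis using assms(3) by blast
qed

text \<open>The other facets are finitely many closed sets. Removing them from \<open>U\<close>
  leaves an open set that still contains the relative interior of \<open>F0\<close>, and test
  functions on it see no other facet. Taking the domain for \<open>U\<close> reaches inner facets,
  taking the whole space reaches boundary facets as well.\<close>

lemma facet_sum_zero:
  assumes fin: "finite \<F>" and tet: "\<And>F. F \<in> \<F> \<Longrightarrow> \<exists>T. tetra T \<and> F \<in> facets T"
    and H: "\<And>F. F \<in> \<F> \<Longrightarrow> facet_int F (H F)" and U: "open U"
    and z: "\<And>\<phi>. test_fun U \<phi> \<Longrightarrow> (\<Sum>F\<in>\<F>. facet_integral F (\<lambda>x. H F x * \<phi> x)) = 0"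
    and F0: "F0 \<in> \<F>" "fparam F0 ` open_reftri \<subseteq> U"
    and disj: "\<And>F. F \<in> \<F> \<Longrightarrow> F \<noteq> F0 \<Longrightarrow> fparam F0 ` open_reftri \<inter> F = {}"
  shows "facet_AE F0 (\<lambda>x. H F0 x = 0)"
proof -
  have facet: "\<exists>T v a b c. tetra_facet T v a b c \<and> F = opp_facet T v" if F: "F \<in> \<F>" for F
  proof -
    obtain T where T: "tetra T" "F \<in> facets T" using tet[OF F] by blast
    then obtain v where v: "v \<in> verts T" "F = opp_facet T v" using facets_eq(1) by blast
    show ?thesis using tetra_facet_exists[OF T(1) v(1)] v(2) by metis
  qed
  obtain T v a b c where tf: "tetra_facet T v a b c" "F0 = opp_facet T v" using facet[OF F0(1)] by blast
  interpret tetra_facet T v a b c by (rule tf(1))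
  define V where "V = U - \<Union>(\<F> - {F0})"
  have "closed F" if "F \<in> \<F>" for F
    using facet[OF that] tetra_facet.compact_opp_facet compact_imp_closed by metis
  then have V: "open V" unfolding V_def using U fin by (intro open_Diff closed_Union) auto
  have sub: "tri a b c ` open_reftri \<subseteq> V"
    using F0(2) disj unfolding V_def tf(2) fparam_eq by blast
  have "AE st in lborel. st \<in> reftri \<longrightarrow> H F0 (fparam F0 st) = 0"
  proof (rule triangle_localization[OF _ V sub])
    show "set_integrable lborel reftri (\<lambda>st. H F0 (fparam F0 st))"
      using H[OF F0(1)] by (simp add: facet_int_def)
    fix \<phi> assume \<phi>: "test_fun V \<phi>"
    have zero: "facet_integral F (\<lambda>x. H F x * \<phi> x) = 0" if F: "F \<in> \<F>" "F \<noteq> F0" for F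
    proof -
      have "\<phi> (fparam F st) = 0" if "st \<in> reftri" for st
      proof -
        have "fparam F st \<in> F" using tet[OF F(1)] fparam_in_facet that by blast
        then have "fparam F st \<notin> V" using F by (auto simp: V_def)
        then show ?thesis using test_fun_outside[OF \<phi>] by blast
      qed
      then show ?thesis by (intro facet_integral_AE_zero) (simp add: facet_AE_def)
    qed
    have "test_fun U \<phi>" using \<phi> by (rule test_fun_mono) (auto simp: V_def)
    from z[OF this] have "0 = (\<Sum>F\<in>\<F>. facet_integral F (\<lambda>x. H F x * \<phi> x))" by simp
    also have "\<dots> = facet_integral F0 (\<lambda>x. H F0 x * \<phi> x)"
      using zero fin F0(1) by (subst sum.remove[of _ F0]) auto
    also have "\<dots> = norm m * (LINT st:reftri|lborel. H F0 (fparam F0 st) * \<phi> (tri a b c st))"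
      unfolding tf(2) facet_integral_eq fparam_eq ..
    finally show "(LINT st:reftri|lborel. H F0 (fparam F0 st) * \<phi> (tri a b c st)) = 0"
      using m_nonzero by simp
  qed
  then show ?thesis by (simp add: facet_AE_def)
qed

lemma relint_facet_disjoint:
  assumes T: "tetra T" and F: "F \<in> facets T" "F0 \<in> facets T" "F \<noteq> F0"
  shows "fparam F0 ` open_reftri \<inter> F = {}"
proof -
  obtain v v0 where vF: "v \<in> verts T" "F = opp_facet T v" "v0 \<in> verts T" "F0 = opp_facet T v0"
    using F(1,2) unfolding facets_eq(1)[OF T] by (elim imageE)
  obtain a b c where "tetra_facet T v0 a b c" using tetra_facet_exists[OF T vF(3)] .
  then interpret tetra_facet T v0 a b c .
  have "v \<noteq> v0" using vF F(3) by auto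
  then show ?thesis
    unfolding vF(2,4) fparam_eq using tri_mem_opp_facetD[OF vF(1)] by blast
qed

lemma norm_onormal:
  assumes "tetra T" "F \<in> facets T"
  shows "norm (onormal T F) = 1"
proof -
  obtain v where v: "v \<in> verts T" "F = opp_facet T v" using assms facets_eq(1) by blast
  obtain a b c where "tetra_facet T v a b c" using tetra_facet_exists[OF assms(1) v(1)] .
  from tetra_facet.norm_n[OF this] show ?thesis by (simp add: v(2))
qed

text \<open>Green's formula determines the products of the trace with the normal components, and
  some component of a unit normal is nonzero.\<close>

lemma trace_unique:
  assumes T: "tetra T" and g: "is_trace T w g" "is_trace T w g'" and F0: "F0 \<in> facets T"
  shows "facet_AE F0 (\<lambda>x. g x = g' x)"
proof -
  have gi: "facet_int F g" "facet_int F g'" if "F \<in> facets T" for F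
    using g that by (auto simp: is_trace_def intro: facet_L2_int)
  have "facet_AE F0 (\<lambda>x. (g x - g' x) * onormal T F0 $ i = 0)" for i
  proof (rule facet_sum_zero[where \<F> = "facets T" and U = UNIV])
    show "facet_int F (\<lambda>x. (g x - g' x) * onormal T F $ i)" if "F \<in> facets T" for F
      by (intro facet_int_cmult facet_int_diff gi that)
    fix \<phi> assume \<phi>: "test_fun UNIV \<phi>"
    note s = test_fun_smooth[OF this]
    have c: "continuous_on UNIV \<phi>" using s by (rule smooth_continuous)
    have "facet_integral F (\<lambda>x. (g x - g' x) * onormal T F $ i * \<phi> x)
      = facet_integral F (\<lambda>x. g x * \<phi> x * onormal T F $ i) - facet_integral F (\<lambda>x. g' x * \<phi> x * onormal T F $ i)"
      if "F \<in> facets T" for F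
    proof -
      have "facet_int F (\<lambda>x. g x * \<phi> x * onormal T F $ i)" "facet_int F (\<lambda>x. g' x * \<phi> x * onormal T F $ i)"
        by (rule facet_int_cmult, rule facet_int_mult_continuous[OF _ c], rule gi[OF that])+
      from facet_integral_diff[OF this] show ?thesis by (simp add: algebra_simps)
    qed
    then have "(\<Sum>F\<in>facets T. facet_integral F (\<lambda>x. (g x - g' x) * onormal T F $ i * \<phi> x))
      = (\<Sum>F\<in>facets T. facet_integral F (\<lambda>x. g x * \<phi> x * onormal T F $ i)) - (\<Sum>F\<in>facets T. facet_integral F (\<lambda>x. g' x * \<phi> x * onormal T F $ i))"
      by (simp add: sum_subtractf)
    also have "\<dots> = 0"
      using g s unfolding is_trace_def by simp
    finally show "(\<Sum>F\<in>facets T. facet_integral F (\<lambda>x. (g x - g' x) * onormal T F $ i * \<phi> x)) = 0" .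
  qed (use T F0 finite_facets[OF T] relint_facet_disjoint[OF T _ F0] in auto)
  from facet_AE_all[OF this] show ?thesis
  proof (rule facet_AE_mp)
    fix x assume x: "\<forall>i. (g x - g' x) * onormal T F0 $ i = 0"
    have "onormal T F0 \<noteq> 0" using norm_onormal[OF T F0] by auto
    then obtain i where "onormal T F0 $ i \<noteq> 0" by (auto simp: vec_eq_iff)
    then show "g x = g' x" using x by auto
  qed
qed

subsection \<open>Conforming meshes\<close>

lemma facet_tetra_facet:
  assumes "tetra T" "F \<in> facets T" "fvtx F = (a, b, c)"
  obtains v where "tetra_facet T v a b c" "F = opp_facet T v"
proof -
  obtain v where "v \<in> verts T" "F = opp_facet T v"
    using assms(2) unfolding facets_eq(1)[OF assms(1)] by (elim imageE)
  with assms show ?thesis by (intro that[of v]) (auto intro: tetra_facet.intro)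
qed

section \<open>Two tetrahedra with a common facet\<close>

context
  fixes T1 T2 :: "pt set" and v1 v2 a b c :: pt
  assumes tf1: "tetra_facet T1 v1 a b c" and tf2: "tetra_facet T2 v2 a b c" and ne: "T1 \<noteq> T2"
    and conf: "T1 \<inter> T2 = convex hull (verts T1 \<inter> verts T2)"
begin

interpretation A: tetra_facet T1 v1 a b c by (rule tf1)
interpretation B: tetra_facet T2 v2 a b c by (rule tf2)

lemma shared_facet_inter: "T1 \<inter> T2 = tri a b c ` reftri"
proof -
  have v: "v1 \<notin> {a, b, c}" "v2 \<notin> {a, b, c}" using A.abc B.abc by auto
  have "v1 \<noteq> v2"
  proof
    assume "v1 = v2"
    then have "T1 = T2" using A.T_eq B.T_eq by simp
    with ne show False ..
  qed
  then have "verts T1 \<inter> verts T2 = {a, b, c}"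
    unfolding A.verts B.verts using v by auto
  then show ?thesis by (simp add: conf convex_hull_tri)
qed

text \<open>If both apexes lay on one side, a short step from the barycentre of the facet towards
  \<open>v1\<close> would stay in both tetrahedra while leaving the plane of the facet, although
  their intersection is the facet.\<close>

lemma shared_facet_opposite: "det3 (b - a) (c - a) (v1 - a) * det3 (b - a) (c - a) (v2 - a) < 0"
proof (rule ccontr)
  define u v w where "u = b - a" and "v = c - a" and "w = v2 - a"
  define D1 D2 where "D1 = det3 u v (v1 - a)" and "D2 = det3 u v w"
  have nz: "D1 \<noteq> 0" "D2 \<noteq> 0"
    using A.det B.det by (auto simp: D1_def D2_def u_def v_def w_def inner_diff_right)
  assume "\<not> det3 (b - a) (c - a) (v1 - a) * det3 (b - a) (c - a) (v2 - a) < 0"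
  then have "\<not> D1 * D2 < 0" by (simp add: D1_def D2_def u_def v_def w_def)
  then have pos: "D1 / D2 > 0" using nz by (auto simp: not_less zero_le_mult_iff zero_less_divide_iff)
  define y where "y = tri a b c (1/3, 1/3)"
  define z where "z = v1 - y"
  define \<alpha> \<beta> where "\<alpha> = (z \<bullet> cross3 v w) / D2" and "\<beta> = (z \<bullet> cross3 w u) / D2"
  have zm: "z \<bullet> cross3 u v = D1"
  proof -
    have "cross3 u v \<bullet> (y - a) = 0" using A.n_tri by (simp add: y_def u_def v_def)
    then have "cross3 u v \<bullet> z = D1" by (simp add: z_def D1_def inner_diff_right)
    then show ?thesis by (simp add: inner_commute)
  qed
  have "D2 *\<^sub>R z = D2 *\<^sub>R (\<alpha> *\<^sub>R u + \<beta> *\<^sub>R v + (D1 / D2) *\<^sub>R w)"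
    using det3_expand[of u v w z] nz unfolding zm
    by (simp add: D2_def[symmetric] \<alpha>_def \<beta>_def scaleR_add_right)
  then have z: "z = \<alpha> *\<^sub>R u + \<beta> *\<^sub>R v + (D1 / D2) *\<^sub>R w" using nz by simp
  \<comment> \<open>\<open>K\<close> bounds the coordinates of the step and their sum. With e = 1/(3
    K) the two coordinates that are 1/3 at the barycentre stay nonnegative and the total, 2/3 there,
    stays at most 1; K \<ge> 1 gives e \<le> 1, so the point lies on the segment from
    \<open>y\<close> to \<open>v1\<close>.\<close>
  define K where "K = 1 + \<bar>\<alpha>\<bar> + \<bar>\<beta>\<bar> + \<bar>D1 / D2\<bar>"
  define e where "e = 1 / (3 * K)"
  have K: "K \<ge> 1" by (simp add: K_def)
  have e: "e > 0" "e \<le> 1" "e * K = 1/3" using K by (auto simp: e_def)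
  have ab: "\<bar>e * \<alpha>\<bar> \<le> 1/3" "\<bar>e * \<beta>\<bar> \<le> 1/3" "e * (\<alpha> + \<beta> + D1 / D2) \<le> 1/3"
  proof -
    have "e * x \<le> 1/3" if "x \<le> K" for x
      using mult_left_mono[OF that, of e] e by simp
    note le = this
    show "\<bar>e * \<alpha>\<bar> \<le> 1/3" "\<bar>e * \<beta>\<bar> \<le> 1/3"
      using le[of "\<bar>\<alpha>\<bar>"] le[of "\<bar>\<beta>\<bar>"] e by (simp_all add: abs_mult K_def)
    show "e * (\<alpha> + \<beta> + D1 / D2) \<le> 1/3"
      by (rule le) (unfold K_def, linarith)
  qed
  define x where "x = y + e *\<^sub>R z"
  have "x = comb3 a u v w ((1/3 + e * \<alpha>, 1/3 + e * \<beta>), e * (D1 / D2))"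
    unfolding x_def z by (simp add: y_def tri_def comb3_def u_def v_def scaleR_add_right scaleR_add_left)
  moreover have "1/3 + e * \<alpha> + (1/3 + e * \<beta>) + e * (D1 / D2) \<le> 1"
    using ab(3) by (simp only: distrib_left)
  moreover have "0 \<le> 1/3 + e * \<alpha>" using ab(1) by linarith
  moreover have "0 \<le> 1/3 + e * \<beta>" using ab(2) by linarith
  moreover have "0 \<le> e * (D1 / D2)" using e(1) pos by (intro mult_nonneg_nonneg) linarith+
  ultimately have "x \<in> convex hull {a, b, c, v2}"
    unfolding mem_convex_hull_4 u_def v_def w_def by blast
  then have "x \<in> T2" unfolding B.T_eq by (simp add: insert_commute)
  moreover have "x \<in> T1"
  proof -
    have "y \<in> opp_facet T1 v1" unfolding A.opp_facet_eq y_def by (auto simp: reftri_def)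
    moreover have "opp_facet T1 v1 \<subseteq> T1"
      unfolding opp_facet_def by (subst (2) tetra_verts(3)[OF A.T, symmetric]) (rule hull_mono, auto)
    ultimately have "y \<in> T1" by blast
    moreover have "v1 \<in> T1" unfolding A.T_eq by (simp add: hull_inc)
    moreover have "x = (1 - e) *\<^sub>R y + e *\<^sub>R v1" by (simp add: x_def z_def algebra_simps)
    ultimately show ?thesis using convexD[OF convex_tetra[OF A.T]] e by simp
  qed
  ultimately have "x \<in> tri a b c ` reftri" using shared_facet_inter by blast
  then have "cross3 u v \<bullet> (x - a) = 0" using A.n_tri by (auto simp: u_def v_def)
  moreover have "cross3 u v \<bullet> (x - a) = cross3 u v \<bullet> (y - a) + e * (z \<bullet> cross3 u v)"
    by (simp add: x_def inner_diff_right inner_add_right inner_commute)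
  moreover have "cross3 u v \<bullet> (y - a) = 0" using A.n_tri by (simp add: y_def u_def v_def)
  ultimately show False using e nz by (simp add: zm)
qed

lemma shared_facet_normal: "onormal T2 (opp_facet T2 v2) = - onormal T1 (opp_facet T1 v1)"
  using shared_facet_opposite unfolding A.n_eq B.n_eq
  by (auto simp: mult_less_0_iff)

text \<open>Near such a point the strict inequalities on the coordinates persist in both frames. The
  coordinates \<open>r\<close> along the two apexes have opposite signs, so one of them is
  nonnegative and places the point in its tetrahedron.\<close>

lemma shared_facet_interior:
  assumes st: "st \<in> open_reftri"
  shows "tri a b c st \<in> interior (T1 \<union> T2)"
proof -
  define u v where "u = b - a" and "v = c - a"
  define D where "D w = det3 u v w" for w
  define s t r where "s w x = ((x - a) \<bullet> cross3 v w) / D w"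
    and "t w x = ((x - a) \<bullet> cross3 w u) / D w" and "r w x = ((x - a) \<bullet> cross3 u v) / D w" for w x
  define N where "N w = {x. s w x > 0 \<and> t w x > 0 \<and> s w x + t w x + r w x < 1}" for w
  define w1 w2 where "w1 = v1 - a" and "w2 = v2 - a"
  have nz: "D w1 \<noteq> 0" "D w2 \<noteq> 0"
    using A.det B.det by (auto simp: D_def u_def v_def w1_def w2_def inner_diff_right)
  have op: "open (N w)" for w
    unfolding N_def s_def t_def r_def divide_inverse
    by (intro open_Collect_conj open_Collect_less continuous_intros)
  have y: "tri a b c st \<in> N w" if "D w \<noteq> 0" for w
  proof -
    have e: "tri a b c st - a = fst st *\<^sub>R u + snd st *\<^sub>R v" by (simp add: tri_def u_def v_def)
    have "u \<bullet> cross3 v w = D w" "v \<bullet> cross3 v w = 0" "u \<bullet> cross3 w u = 0" "v \<bullet> cross3 w u = D w"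
      "u \<bullet> cross3 u v = 0" "v \<bullet> cross3 u v = 0"
      by (simp_all add: D_def cross3_def inner_vec_def sum_3 algebra_simps)
    then show ?thesis
      using that st by (simp add: N_def s_def t_def r_def e inner_add_left open_reftri_def)
  qed
  have x: "x = comb3 a u v w ((s w x, t w x), r w x)" if "D w \<noteq> 0" for w x
  proof -
    have "D w *\<^sub>R (x - a) = D w *\<^sub>R (s w x *\<^sub>R u + t w x *\<^sub>R v + r w x *\<^sub>R w)"
      using det3_expand[of u v w "x - a"] that by (simp add: D_def s_def t_def r_def scaleR_add_right)
    then have "x - a = s w x *\<^sub>R u + t w x *\<^sub>R v + r w x *\<^sub>R w" using that by simp
    then show ?thesis by (simp add: comb3_def algebra_simps)
  qed
  have mem: "x \<in> convex hull {a, b, c, a + w}" if "D w \<noteq> 0" "x \<in> N w" "r w x \<ge> 0" for x w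
    unfolding mem_convex_hull_4
    using that x[OF that(1), of x]
    by (intro exI[of _ "s w x"] exI[of _ "t w x"] exI[of _ "r w x"]) (simp add: N_def u_def v_def)
  have "N w1 \<inter> N w2 \<subseteq> T1 \<union> T2"
  proof
    fix x assume x: "x \<in> N w1 \<inter> N w2"
    have "D w1 * D w2 < 0"
      using shared_facet_opposite by (simp add: D_def u_def v_def w1_def w2_def)
    then have "r w1 x \<ge> 0 \<or> r w2 x \<ge> 0"
      by (auto simp: r_def zero_le_divide_iff mult_less_0_iff)
    then have "x \<in> convex hull {a, b, c, v1} \<or> x \<in> convex hull {a, b, c, v2}"
      using mem[OF nz(1), of x] mem[OF nz(2), of x] x by (auto simp: w1_def w2_def)
    then show "x \<in> T1 \<union> T2"
      unfolding A.T_eq B.T_eq by (auto simp: insert_commute)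
  qed
  then show ?thesis
    using y nz op by (intro interiorI[of "N w1 \<inter> N w2"]) auto
qed

end

section \<open>Incidence and orientation of facets in a mesh\<close>

lemma mesh_conforming:
  assumes "mesh \<T> \<Omega>" "T1 \<in> \<T>" "T2 \<in> \<T>" "T1 \<noteq> T2"
  shows "T1 \<inter> T2 = convex hull (verts T1 \<inter> verts T2)"
  using assms unfolding mesh_def by blast

lemma mesh_tetra: "mesh \<T> \<Omega> \<Longrightarrow> T \<in> \<T> \<Longrightarrow> tetra T"
  by (simp add: mesh_def)

lemma mesh_finite: "mesh \<T> \<Omega> \<Longrightarrow> finite \<T>"
  unfolding mesh_def by blast

lemma mesh_opposite_normals:
  assumes m: "mesh \<T> \<Omega>" and T: "T1 \<in> \<T>" "T2 \<in> \<T>" "T1 \<noteq> T2" and F: "F \<in> facets T1" "F \<in> facets T2"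
  shows "onormal T2 F = - onormal T1 F"
proof -
  obtain a b c where f: "fvtx F = (a, b, c)" by (metis prod.exhaust)
  obtain v1 where v1: "tetra_facet T1 v1 a b c" "F = opp_facet T1 v1"
    using facet_tetra_facet[OF mesh_tetra[OF m T(1)] F(1) f] .
  obtain v2 where v2: "tetra_facet T2 v2 a b c" "F = opp_facet T2 v2"
    using facet_tetra_facet[OF mesh_tetra[OF m T(2)] F(2) f] .
  show ?thesis
    using shared_facet_normal[OF v1(1) v2(1) T(3) mesh_conforming[OF m T]] v1(2) v2(2) by simp
qed

text \<open>Three tetrahedra at one facet would have pairwise opposite normals, which forces n = -n
  for a unit vector.\<close>

lemma mesh_facet_at_most_two:
  assumes m: "mesh \<T> \<Omega>" and T: "T1 \<in> \<T>" "T2 \<in> \<T>" "T3 \<in> \<T>"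
    and F: "F \<in> facets T1" "F \<in> facets T2" "F \<in> facets T3" and ne: "T1 \<noteq> T2" "T1 \<noteq> T3"
  shows "T2 = T3"
proof (rule ccontr)
  assume ne': "T2 \<noteq> T3"
  have "onormal T2 F = - onormal T1 F" "onormal T3 F = - onormal T1 F" "onormal T3 F = - onormal T2 F"
    using mesh_opposite_normals[OF m] T F ne ne' by blast+
  then have "onormal T1 F $ i = - (onormal T1 F $ i)" for i
    by (metis vector_uminus_component minus_minus)
  then have "onormal T1 F = 0" by (simp add: vec_eq_iff)
  with norm_onormal[OF mesh_tetra[OF m T(1)] F(1)] show False by simp
qed

lemma mesh_shared_facet_interior:
  assumes m: "mesh \<T> \<Omega>" and T: "T1 \<in> \<T>" "T2 \<in> \<T>" "T1 \<noteq> T2" and F: "F \<in> facets T1" "F \<in> facets T2"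
  shows "fparam F ` open_reftri \<subseteq> interior (closure \<Omega>)"
proof -
  obtain a b c where f: "fvtx F = (a, b, c)" by (metis prod.exhaust)
  obtain v1 where v1: "tetra_facet T1 v1 a b c" "F = opp_facet T1 v1"
    using facet_tetra_facet[OF mesh_tetra[OF m T(1)] F(1) f] .
  obtain v2 where v2: "tetra_facet T2 v2 a b c" "F = opp_facet T2 v2"
    using facet_tetra_facet[OF mesh_tetra[OF m T(2)] F(2) f] .
  have "T1 \<union> T2 \<subseteq> closure \<Omega>" using m T unfolding mesh_def by blast
  then have "interior (T1 \<union> T2) \<subseteq> interior (closure \<Omega>)" by (rule interior_mono)
  then show ?thesis
    using shared_facet_interior[OF v1(1) v2(1) T(3) mesh_conforming[OF m T]] tetra_facet.fparam_eq[OF v1(1)] v1(2)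
    by auto
qed

text \<open>If \<open>F0\<close> is not a facet of \<open>T\<close>, some vertex \<open>w\<close> of
  \<open>F0\<close> is not a vertex of \<open>T\<close>. Conformity then confines the intersection
  of \<open>T0\<close> and \<open>T\<close> to the facet of \<open>T0\<close> opposite to
  \<open>w\<close>, which the relative interior of \<open>F0\<close> avoids.\<close>

lemma mesh_relint_disjoint:
  assumes m: "mesh \<T> \<Omega>" and F: "F0 \<in> mfacets \<T>" "F \<in> mfacets \<T>" "F \<noteq> F0"
  shows "fparam F0 ` open_reftri \<inter> F = {}"
proof -
  obtain T0 T where Ts: "T0 \<in> \<T>" "T \<in> \<T>" "F0 \<in> facets T0" "F \<in> facets T"
    using F by (auto simp: mfacets_def)
  note tet = mesh_tetra[OF m Ts(1)] mesh_tetra[OF m Ts(2)]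
  show ?thesis
  proof (cases "F0 \<in> facets T")
    case True
    then show ?thesis using relint_facet_disjoint[OF tet(2) Ts(4) _ F(3)] by blast
  next
    case False
    then have "T \<noteq> T0" using Ts by auto
    obtain v0 where v0: "v0 \<in> verts T0" "F0 = opp_facet T0 v0"
      using Ts(3) unfolding facets_eq(1)[OF tet(1)] by (elim imageE)
    obtain a b c where "tetra_facet T0 v0 a b c" using tetra_facet_exists[OF tet(1) v0(1)] .
    then interpret tetra_facet T0 v0 a b c .
    have "card (verts T0 - {v0}) = 3"
      using tetra_verts(1)[OF tet(1)] tetra_finite_verts[OF tet(1)] v0 by simp
    then have "\<not> verts T0 - {v0} \<subseteq> verts T"
      using False unfolding facets_def v0(2) opp_facet_def by blast
    then obtain w where w: "w \<in> verts T0" "w \<noteq> v0" "w \<notin> verts T" by blast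
    have "F \<subseteq> T"
      using Ts(4) hull_mono[of _ "verts T" convex] tetra_verts(3)[OF tet(2)] unfolding facets_def by blast
    moreover have "fparam F0 st \<in> T0" if "st \<in> open_reftri" for st
    proof -
      have "F0 \<subseteq> T0"
        using Ts(3) hull_mono[of _ "verts T0" convex] tetra_verts(3)[OF tet(1)] unfolding facets_def by blast
      then show ?thesis using fparam_in_facet[OF tet(1) Ts(3)] that open_reftri_subset by blast
    qed
    moreover have "T0 \<inter> T \<subseteq> opp_facet T0 w"
      unfolding mesh_conforming[OF m Ts(1,2) \<open>T \<noteq> T0\<close>[symmetric]] opp_facet_def
      by (rule hull_mono) (use w in auto)
    moreover have "fparam F0 st \<notin> opp_facet T0 w" if "st \<in> open_reftri" for st
      using tri_mem_opp_facetD[OF w(1,2) that] v0(2) fparam_eq by simp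
    ultimately show ?thesis by blast
  qed
qed

text \<open>This excludes slits. The mesh covers only the closure of the domain; the equality places
  the relative interior of a shared facet inside the domain itself, where test functions can detect
  it.\<close>

lemma lipschitz_interior_closure:
  assumes "lipschitz_domain \<Omega>"
  shows "interior (closure \<Omega>) = \<Omega>"
proof
  have op: "open \<Omega>" using assms by (simp add: lipschitz_domain_def)
  show "\<Omega> \<subseteq> interior (closure \<Omega>)"
    by (rule interior_maximal[OF closure_subset op])
  show "interior (closure \<Omega>) \<subseteq> \<Omega>"
  proof
    fix x0 assume x0: "x0 \<in> interior (closure \<Omega>)"
    show "x0 \<in> \<Omega>"
    proof (rule ccontr)
      assume "x0 \<notin> \<Omega>"
      then have "x0 \<in> frontier \<Omega>"
        using x0 op interior_subset by (auto simp: frontier_def interior_open)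
      then obtain R :: "pt \<Rightarrow> pt" and L :: real and g :: "real \<times> real \<Rightarrow> real" and r h :: real where
        loc: "orthogonal_transformation R \<and> r > 0 \<and> h > 0 \<and> L-lipschitz_on UNIV g \<and> g (0, 0) = 0 \<and>
        (\<forall>x. let y = R (x - x0) in
             ((y $ 1)\<^sup>2 + (y $ 2)\<^sup>2 < r\<^sup>2 \<and> \<bar>y $ 3\<bar> < h) \<longrightarrow>
             (x \<in> \<Omega> \<longleftrightarrow> y $ 3 < g (y $ 1, y $ 2)))"
        using assms unfolding lipschitz_domain_def by blast
      then have R: "orthogonal_transformation R" "r > 0" "h > 0" "L-lipschitz_on UNIV g" "g (0, 0) = 0"
        and chart: "\<And>x. (R (x - x0) $ 1)\<^sup>2 + (R (x - x0) $ 2)\<^sup>2 < r\<^sup>2 \<and> \<bar>R (x - x0) $ 3\<bar> < h \<Longrightarrow>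
           x \<in> \<Omega> \<longleftrightarrow> R (x - x0) $ 3 < g (R (x - x0) $ 1, R (x - x0) $ 2)"
        by (simp_all add: Let_def)
      have lin: "linear R" using R(1) by (rule orthogonal_transformation_linear)
      have "surj R" using R(1) by (rule orthogonal_transformation_surj)
      then obtain e where e: "R e = axis 3 1" by (metis surjD)
      have cR: "continuous_on UNIV (\<lambda>x. R (x - x0))"
        by (intro continuous_on_compose2[OF linear_continuous_on[OF lin[unfolded linear_conv_bounded_linear], of UNIV]] continuous_intros) auto
      have cg: "continuous_on UNIV g" using R(4) by (rule lipschitz_on_continuous_on)
      \<comment> \<open>The part of the chart above the graph is open and disjoint from the domain,
        hence from its closure. Because g (0, 0) = 0, the points \<open>x0 + s *\<^sub>R e\<close>
        enter it for every small s > 0.\<close>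
      define N where "N = {x. (R (x - x0) $ 1)\<^sup>2 + (R (x - x0) $ 2)\<^sup>2 < r\<^sup>2 \<and> \<bar>R (x - x0) $ 3\<bar> < h
          \<and> g (R (x - x0) $ 1, R (x - x0) $ 2) < R (x - x0) $ 3}"
      have "open N"
        unfolding N_def
        by (intro open_Collect_conj open_Collect_less continuous_intros cR
            continuous_on_compose2[OF cg]) auto
      moreover have "N \<inter> \<Omega> = {}" using chart by (fastforce simp: N_def)
      ultimately have dis: "N \<inter> closure \<Omega> = {}" by (simp add: open_Int_closure_eq_empty)
      have "\<forall>\<^sub>F s in at_right 0. x0 + s *\<^sub>R e \<in> interior (closure \<Omega>)"
      proof -
        have "((\<lambda>s. x0 + s *\<^sub>R e) \<longlongrightarrow> x0 + 0 *\<^sub>R e) (at_right 0)" by (intro tendsto_intros)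
        then show ?thesis using x0 by (intro topological_tendstoD) auto
      qed
      moreover have "\<forall>\<^sub>F s in at_right 0. s < h" by (rule eventually_at_rightI[of 0 h]) (use R in auto)
      moreover have "\<forall>\<^sub>F s in at_right (0::real). s > 0" by (rule eventually_at_right_less)
      ultimately have "\<forall>\<^sub>F s in at_right 0. x0 + s *\<^sub>R e \<in> N \<inter> closure \<Omega>"
      proof eventually_elim
        case (elim s)
        have "R (s *\<^sub>R e) = s *\<^sub>R axis 3 1" using linear_scale[OF lin] e by simp
        then show ?case
          using elim R interior_subset by (auto simp: N_def axis_def)
      qed
      then have "\<forall>\<^sub>F s in at_right (0::real). False" using dis by simp
      then show False by simp
    qed
  qed
qed

section \<open>Splitting integrals over the mesh\<close>

context
  fixes \<T> :: "pt set set" and \<Omega> :: "pt set"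
  assumes m: "mesh \<T> \<Omega>" and dom: "lipschitz_domain \<Omega>"
begin

lemma mesh_interior_subset: "T \<in> \<T> \<Longrightarrow> interior T \<subseteq> \<Omega>"
  using m interior_mono[of T "closure \<Omega>"] lipschitz_interior_closure[OF dom]
  by (metis Union_upper mesh_def)

lemma mesh_facet_subset:
  assumes "T1 \<in> \<T>" "T2 \<in> \<T>" "T1 \<noteq> T2" "F \<in> facets T1" "F \<in> facets T2"
  shows "fparam F ` open_reftri \<subseteq> \<Omega>"
  using mesh_shared_facet_interior[OF m assms] lipschitz_interior_closure[OF dom] by simp

lemma mesh_inter_negligible:
  assumes T: "T1 \<in> \<T>" "T2 \<in> \<T>" "T1 \<noteq> T2"
  shows "negligible (T1 \<inter> T2)"
proof -
  note tet = mesh_tetra[OF m T(1)] mesh_tetra[OF m T(2)]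
  have "\<not> verts T1 \<subseteq> verts T2"
  proof
    assume "verts T1 \<subseteq> verts T2"
    then have "verts T1 = verts T2"
      by (rule card_subset_eq[OF tetra_finite_verts[OF tet(2)]])
        (simp add: tetra_verts(1)[OF tet(1)] tetra_verts(1)[OF tet(2)])
    then have "convex hull verts T1 = convex hull verts T2" by (rule arg_cong)
    then have "T1 = T2" unfolding tetra_verts(3)[OF tet(1)] tetra_verts(3)[OF tet(2)] .
    with T(3) show False ..
  qed
  then have "card (verts T1 \<inter> verts T2) < card (verts T1)"
    using tetra_finite_verts[OF tet(1)] by (intro psubset_card_mono) auto
  then have "card (verts T1 \<inter> verts T2) \<le> DIM(pt)"
    using tetra_verts(1)[OF tet(1)] by simp
  then have "interior (convex hull (verts T1 \<inter> verts T2)) = {}"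
    using tetra_finite_verts[OF tet(1)] by (intro empty_interior_convex_hull) auto
  then show ?thesis
    unfolding mesh_conforming[OF m T] by (simp add: negligible_convex_interior)
qed

lemma AE_mesh:
  "AE x in lebesgue. (x \<in> \<Omega> \<longleftrightarrow> (\<exists>T\<in>\<T>. x \<in> T)) \<and> (\<forall>T\<in>\<T>. x \<in> T \<longrightarrow> x \<in> interior T)
     \<and> (\<forall>T1\<in>\<T>. \<forall>T2\<in>\<T>. T1 \<noteq> T2 \<longrightarrow> \<not> (x \<in> T1 \<and> x \<in> T2))"
proof -
  have "AE x in lebesgue. \<forall>T\<in>\<T>. x \<in> T \<longleftrightarrow> x \<in> interior T"
    using mesh_finite[OF m] AE_tetra_interior[OF mesh_tetra[OF m]] by (intro AE_finite_allI) auto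
  moreover have "AE x in lebesgue. \<forall>T1\<in>\<T>. \<forall>T2\<in>\<T>. T1 \<noteq> T2 \<longrightarrow> \<not> (x \<in> T1 \<and> x \<in> T2)"
  proof (intro AE_finite_allI mesh_finite[OF m])
    fix T1 T2 assume T: "T1 \<in> \<T>" "T2 \<in> \<T>"
    show "AE x in lebesgue. T1 \<noteq> T2 \<longrightarrow> \<not> (x \<in> T1 \<and> x \<in> T2)"
    proof (cases "T1 = T2")
      case False
      have "T1 \<inter> T2 \<in> null_sets lebesgue"
        using mesh_inter_negligible[OF T False] by (simp add: negligible_iff_null_sets)
      from AE_not_in[OF this] show ?thesis by eventually_elim auto
    qed simp
  qed
  ultimately show ?thesis
  proof eventually_elim
    case (elim x)
    have "\<Omega> \<subseteq> \<Union>\<T>" using m closure_subset unfolding mesh_def by auto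
    then have "x \<in> \<Omega> \<longleftrightarrow> (\<exists>T\<in>\<T>. x \<in> T)" using elim(1) mesh_interior_subset by blast
    with elim show ?case by blast
  qed
qed

lemma mesh_integrable:
  assumes f: "set_integrable lebesgue \<Omega> f" and T: "T \<in> \<T>"
  shows "set_integrable lebesgue T (f :: pt \<Rightarrow> real)"
proof -
  have "set_integrable lebesgue (interior T) f"
    by (rule set_integrable_subset[OF f]) (auto simp: mesh_interior_subset[OF T])
  moreover have ae: "AE x in lebesgue. (x \<in> interior T \<longleftrightarrow> x \<in> T) \<and> (x \<in> interior T \<longrightarrow> f x = f x)"
    using AE_tetra_interior[OF mesh_tetra[OF m T]] by eventually_elim auto
  ultimately show ?thesis by (simp only: set_integrable_cong_AE2[OF ae])
qed

lemma AE_mesh_sum: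
  fixes f :: "pt \<Rightarrow> real"
  shows "AE x in lebesgue. indicator \<Omega> x *\<^sub>R f x = (\<Sum>T\<in>\<T>. indicator T x *\<^sub>R f x)"
  using AE_mesh
proof eventually_elim
  case (elim x)
  have cov: "x \<in> \<Omega> \<longleftrightarrow> (\<exists>T\<in>\<T>. x \<in> T)" using elim by (elim conjE)
  have disj: "\<forall>T1\<in>\<T>. \<forall>T2\<in>\<T>. T1 \<noteq> T2 \<longrightarrow> \<not> (x \<in> T1 \<and> x \<in> T2)" using elim by (elim conjE)
  show ?case
  proof (cases "x \<in> \<Omega>")
    case True
    then obtain T where T: "T \<in> \<T>" "x \<in> T" using cov by auto
    have "(\<Sum>T\<in>\<T>. indicator T x *\<^sub>R f x) = indicator T x *\<^sub>R f x + (\<Sum>T\<in>\<T> - {T}. indicator T x *\<^sub>R f x)"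
      by (rule sum.remove[OF mesh_finite[OF m] T(1)])
    also have "(\<Sum>T\<in>\<T> - {T}. indicator T x *\<^sub>R f x) = 0"
    proof (intro sum.neutral ballI)
      fix T' assume "T' \<in> \<T> - {T}"
      then have "x \<notin> T'" using disj[rule_format, of T' T] T by auto
      then show "indicator T' x *\<^sub>R f x = 0" by simp
    qed
    finally show ?thesis using True T by simp
  next
    case False
    then have "(\<Sum>T\<in>\<T>. indicator T x *\<^sub>R f x) = 0" using cov by (intro sum.neutral) auto
    then show ?thesis using False by simp
  qed
qed

lemma
  fixes f :: "pt \<Rightarrow> real"
  assumes f: "\<And>T. T \<in> \<T> \<Longrightarrow> set_integrable lebesgue T f"
  shows mesh_integrable_pieces: "set_integrable lebesgue \<Omega> f"
    and mesh_integral: "(LINT x:\<Omega>|lebesgue. f x) = (\<Sum>T\<in>\<T>. LINT x:T|lebesgue. f x)"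
proof -
  have i: "integrable lebesgue (\<lambda>x. indicator T x *\<^sub>R f x)" if "T \<in> \<T>" for T
    using f[OF that] by (simp add: set_integrable_def)
  show "set_integrable lebesgue \<Omega> f"
    unfolding set_integrable_def lebesgue_integrable_cong_AE[OF AE_mesh_sum]
    by (intro Bochner_Integration.integrable_sum i)
  show "(LINT x:\<Omega>|lebesgue. f x) = (\<Sum>T\<in>\<T>. LINT x:T|lebesgue. f x)"
    unfolding set_lebesgue_integral_def lebesgue_integral_cong_AE[OF AE_mesh_sum]
    by (rule Bochner_Integration.integral_sum[OF i])
qed

end

subsection \<open>Weak derivatives\<close>

lemma L2_mult_integrable:
  fixes f g :: "pt \<Rightarrow> real"
  assumes f: "L2 U f" and g: "L2 U g"
  shows "set_integrable lebesgue U (\<lambda>x. f x * g x)"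
proof -
  have i: "integrable lebesgue (\<lambda>x. indicator U x * (f x)\<^sup>2 + indicator U x * (g x)\<^sup>2)"
    using f g by (simp add: L2_def set_integrable_def)
  have "(\<lambda>x. (indicator U x *\<^sub>R f x) * (indicator U x *\<^sub>R g x)) \<in> borel_measurable lebesgue"
    using f g unfolding L2_def set_borel_measurable_def by (intro borel_measurable_times) blast+
  moreover have eq: "(indicator U x *\<^sub>R f x) * (indicator U x *\<^sub>R g x) = indicator U x *\<^sub>R (f x * g x)" for x
    by (cases "x \<in> U") auto
  ultimately have m: "(\<lambda>x. indicator U x *\<^sub>R (f x * g x)) \<in> borel_measurable lebesgue" by (simp only: eq)
  show ?thesis
    unfolding set_integrable_def
  proof (rule Bochner_Integration.integrable_bound[OF i m], rule AE_I2)
    fix x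
    have "0 \<le> (\<bar>f x\<bar> - \<bar>g x\<bar>)\<^sup>2" by simp
    then have "2 * \<bar>f x * g x\<bar> \<le> (f x)\<^sup>2 + (g x)\<^sup>2" by (simp add: power2_diff abs_mult)
    then have "\<bar>f x * g x\<bar> \<le> (f x)\<^sup>2 + (g x)\<^sup>2" using abs_ge_zero[of "f x * g x"] by linarith
    then show "norm (indicator U x *\<^sub>R (f x * g x)) \<le> norm (indicator U x * (f x)\<^sup>2 + indicator U x * (g x)\<^sup>2)"
      by (cases "x \<in> U") auto
  qed
qed

lemma L2_I:
  fixes f :: "pt \<Rightarrow> real"
  assumes "set_borel_measurable lebesgue U f" "set_integrable lebesgue U (\<lambda>x. (f x)\<^sup>2)"
  shows "L2 U f"
  using assms by (simp add: L2_def)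

lemma L2_cmult:
  fixes f :: "pt \<Rightarrow> real"
  assumes "L2 U f"
  shows "L2 U (\<lambda>x. c * f x)"
proof (rule L2_I)
  have "(\<lambda>x. c * (indicator U x *\<^sub>R f x)) \<in> borel_measurable lebesgue"
    using assms unfolding L2_def set_borel_measurable_def by (intro borel_measurable_times) auto
  then show "set_borel_measurable lebesgue U (\<lambda>x. c * f x)"
    by (simp add: set_borel_measurable_def mult.left_commute)
  show "set_integrable lebesgue U (\<lambda>x. (c * f x)\<^sup>2)"
    using assms by (simp add: L2_def power_mult_distrib)
qed

lemma L2_add:
  fixes f g :: "pt \<Rightarrow> real"
  assumes f: "L2 U f" and g: "L2 U g"
  shows "L2 U (\<lambda>x. f x + g x)"
proof (rule L2_I)
  show "set_borel_measurable lebesgue U (\<lambda>x. f x + g x)"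
    using f g unfolding L2_def set_borel_measurable_def scaleR_add_right by (intro borel_measurable_add) blast+
  have "set_integrable lebesgue U (\<lambda>x. f x * f x + g x * g x + 2 * (f x * g x))"
    by (intro set_integral_add set_integrable_mult_right L2_mult_integrable f g)
  then show "set_integrable lebesgue U (\<lambda>x. (f x + g x)\<^sup>2)"
    by (simp add: power2_eq_square algebra_simps)
qed

lemma L2_diff: "L2 U f \<Longrightarrow> L2 U g \<Longrightarrow> L2 U (\<lambda>x. f x - g x :: real)"
  using L2_add[of U f "\<lambda>x. -1 * g x"] L2_cmult[of U g "-1"] by simp

lemma L2_zero: "L2 U (\<lambda>x. 0 :: real)"
  by (rule L2_I) (simp_all add: set_borel_measurable_def set_integrable_def)

lemma L2_sum: "(\<And>i. i \<in> I \<Longrightarrow> L2 U (f i)) \<Longrightarrow> L2 U (\<lambda>x. \<Sum>i\<in>I. f i x :: real)"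
  by (induction I rule: infinite_finite_induct) (auto intro: L2_add L2_zero)

lemma L2_smooth:
  assumes U: "open U" "bounded U" and g: "smooth g"
  shows "L2 U g"
proof (rule L2_I)
  have K: "compact (closure U)" using U by simp
  have "set_integrable lborel (closure U) (\<lambda>x. (g x)\<^sup>2)"
    unfolding set_integrable_def
    by (intro borel_integrable_compact K continuous_intros smooth_continuous g)
  from set_integrable_subset[OF this _ closure_subset] have "set_integrable lborel U (\<lambda>x. (g x)\<^sup>2)"
    using U(1) by (simp add: borel_open)
  then show "set_integrable lebesgue U (\<lambda>x. (g x)\<^sup>2)"
    unfolding set_integrable_def using borel_measurable_integrable by (subst integrable_completion) auto
  have "(\<lambda>x. indicator U x *\<^sub>R g x) \<in> borel_measurable borel"
    using smooth_measurable[OF g] borel_open[OF U(1)] by measurable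
  then show "set_borel_measurable lebesgue U g"
    unfolding set_borel_measurable_def by (intro measurable_completion) simp
qed

lemma L2_integrable:
  fixes f :: "pt \<Rightarrow> real"
  assumes "open U" "bounded U" "L2 U f"
  shows "set_integrable lebesgue U f"
  using L2_mult_integrable[OF assms(3) L2_smooth[OF assms(1,2) smooth_const[of 1]]] by simp

lemma L2_subset:
  fixes f :: "pt \<Rightarrow> real"
  assumes f: "L2 U f" and V: "open V" "V \<subseteq> U"
  shows "L2 V f"
proof (rule L2_I)
  have Vm: "V \<in> sets lebesgue" using V(1) by (simp add: borel_open)
  show "set_integrable lebesgue V (\<lambda>x. (f x)\<^sup>2)"
    using f by (intro set_integrable_subset[OF _ Vm V(2)]) (simp add: L2_def)
  have "(\<lambda>x. indicator V x * (indicator U x *\<^sub>R f x)) \<in> borel_measurable lebesgue"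
    using f Vm unfolding L2_def set_borel_measurable_def by (intro borel_measurable_times) auto
  moreover have eq: "indicator V x * (indicator U x *\<^sub>R f x) = indicator V x *\<^sub>R f x" for x
    using V(2) by (auto simp: indicator_def)
  ultimately show "set_borel_measurable lebesgue V f" by (simp only: set_borel_measurable_def eq)
qed

lemma L2_cong:
  fixes f g :: "pt \<Rightarrow> real"
  assumes "L2 U f" and ae: "AE x in lebesgue. x \<in> U \<longrightarrow> f x = g x"
  shows "L2 U g"
proof (rule L2_I)
  have 1: "AE x in lebesgue. (x \<in> U \<longleftrightarrow> x \<in> U) \<and> (x \<in> U \<longrightarrow> f x = g x)" using ae by eventually_elim simp
  have 2: "AE x in lebesgue. (x \<in> U \<longleftrightarrow> x \<in> U) \<and> (x \<in> U \<longrightarrow> (f x)\<^sup>2 = (g x)\<^sup>2)" using ae by eventually_elim simp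
  show "set_borel_measurable lebesgue U g"
    using set_measurable_cong_AE2[OF 1] assms(1) by (simp add: L2_def)
  show "set_integrable lebesgue U (\<lambda>x. (g x)\<^sup>2)"
    using set_integrable_cong_AE2[OF 2] assms(1) by (simp add: L2_def)
qed

lemma L2_component:
  fixes f :: "pt \<Rightarrow> real^3"
  assumes "L2 U f"
  shows "L2 U (\<lambda>x. f x $ i)"
proof (rule L2_I)
  have m0: "(\<lambda>x. indicator U x *\<^sub>R f x) \<in> borel_measurable lebesgue"
    using assms by (simp add: L2_def set_borel_measurable_def)
  have "(\<lambda>y :: real^3. y $ i) \<in> borel_measurable borel"
    by (intro borel_measurable_continuous_onI continuous_intros)
  from measurable_compose[OF m0 this]
  have m: "(\<lambda>x. indicator U x *\<^sub>R f x $ i) \<in> borel_measurable lebesgue" by simp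
  then show "set_borel_measurable lebesgue U (\<lambda>x. f x $ i)" by (simp add: set_borel_measurable_def)
  have n: "integrable lebesgue (\<lambda>x. indicator U x *\<^sub>R (norm (f x))\<^sup>2)"
    using assms by (simp add: L2_def set_integrable_def)
  have sq: "(indicator U x *\<^sub>R f x $ i)\<^sup>2 = indicator U x *\<^sub>R (f x $ i)\<^sup>2" for x
    by (cases "x \<in> U") auto
  have m2: "(\<lambda>x. indicator U x *\<^sub>R (f x $ i)\<^sup>2) \<in> borel_measurable lebesgue"
    using borel_measurable_power[OF m, of 2] unfolding sq .
  show "set_integrable lebesgue U (\<lambda>x. (f x $ i)\<^sup>2)"
    unfolding set_integrable_def
  proof (rule Bochner_Integration.integrable_bound[OF n m2], rule AE_I2)
    fix x
    have "(f x $ i)\<^sup>2 \<le> (norm (f x))\<^sup>2"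
      using power_mono[OF component_le_norm_cart[of "f x" i], of 2] by simp
    then show "norm (indicator U x *\<^sub>R (f x $ i)\<^sup>2) \<le> norm (indicator U x *\<^sub>R (norm (f x))\<^sup>2)"
      by (cases "x \<in> U") auto
  qed
qed

text \<open>Cauchy-Schwarz without square roots: the squared norm of \<open>f n + t \<psi>\<close>
  is nonnegative for every t. Taking t of the order of the tolerance makes the term with
  \<open>C\<close> small, after which a large n makes \<open>A n / (2 * t)\<close> small.\<close>

lemma L2_weak_limit:
  fixes f :: "nat \<Rightarrow> pt \<Rightarrow> real"
  assumes \<psi>: "L2 U \<psi>" and f: "\<And>n. L2 U (f n)" and lim: "(\<lambda>n. LINT x:U|lebesgue. (f n x)\<^sup>2) \<longlonglongrightarrow> 0"
  shows "(\<lambda>n. LINT x:U|lebesgue. f n x * \<psi> x) \<longlonglongrightarrow> 0"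
proof -
  define A where "A n = (LINT x:U|lebesgue. (f n x)\<^sup>2)" for n
  define B where "B n = (LINT x:U|lebesgue. f n x * \<psi> x)" for n
  define C where "C = (LINT x:U|lebesgue. (\<psi> x)\<^sup>2)"
  have C: "C \<ge> 0" unfolding C_def set_lebesgue_integral_def by (intro integral_nonneg_AE) auto
  have quad: "0 \<le> A n + 2 * t * B n + t\<^sup>2 * C" for n t
  proof -
    have i: "set_integrable lebesgue U (\<lambda>x. f n x * f n x)" "set_integrable lebesgue U (\<lambda>x. (2 * t) * (f n x * \<psi> x))"
      "set_integrable lebesgue U (\<lambda>x. t\<^sup>2 * (\<psi> x * \<psi> x))"
      by (intro L2_mult_integrable f \<psi> set_integrable_mult_right)+
    have "0 \<le> (LINT x:U|lebesgue. (f n x + t * \<psi> x)\<^sup>2)"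
      unfolding set_lebesgue_integral_def by (intro integral_nonneg_AE) auto
    also have "(LINT x:U|lebesgue. (f n x + t * \<psi> x)\<^sup>2)
        = (LINT x:U|lebesgue. f n x * f n x + (2 * t) * (f n x * \<psi> x) + t\<^sup>2 * (\<psi> x * \<psi> x))"
      by (simp add: power2_eq_square algebra_simps)
    also have "\<dots> = A n + 2 * t * B n + t\<^sup>2 * C"
      using i by (simp add: set_integral_add A_def B_def C_def power2_eq_square)
    finally show ?thesis .
  qed
  have bound: "\<bar>B n\<bar> \<le> A n / (2 * t) + t * C / 2" if t: "t > 0" for n t
  proof -
    have "2 * t * \<bar>B n\<bar> \<le> A n + t\<^sup>2 * C"
      using quad[of n t] quad[of n "-t"] by (cases "B n \<ge> 0") auto
    then have "\<bar>B n\<bar> \<le> (A n + t\<^sup>2 * C) / (2 * t)"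
      using t by (simp add: pos_le_divide_eq mult.commute)
    also have "\<dots> = A n / (2 * t) + t * C / 2"
      using t by (simp add: add_divide_distrib power2_eq_square)
    finally show ?thesis .
  qed
  have "B \<longlonglongrightarrow> 0"
  proof (rule LIMSEQ_I)
    fix e :: real assume e: "e > 0"
    define t where "t = e / (C + 1)"
    have t: "t > 0" using e C by (simp add: t_def)
    have "t * C \<le> e" using e C by (simp add: t_def field_simps)
    have "A \<longlonglongrightarrow> 0" using lim by (simp add: A_def[abs_def])
    from LIMSEQ_D[OF this, of "e * t"] e t
    obtain N where N: "\<And>n. n \<ge> N \<Longrightarrow> norm (A n) < e * t" by auto
    have "norm (B n - 0) < e" if "n \<ge> N" for n
    proof -
      have "A n / (2 * t) < e / 2" using N[OF that] t by (simp add: field_simps)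
      then show ?thesis using bound[OF t, of n] \<open>t * C \<le> e\<close> by simp
    qed
    then show "\<exists>N. \<forall>n\<ge>N. norm (B n - 0) < e" by blast
  qed
  then show ?thesis by (simp add: B_def[abs_def])
qed

section \<open>Locality and uniqueness of weak derivatives\<close>

lemma is_wpartial_cong:
  assumes "AE x in lebesgue. x \<in> U \<longrightarrow> w x = w' x"
  shows "is_wpartial U i w d \<longleftrightarrow> is_wpartial U i w' d"
proof -
  have "(LINT x:U|lebesgue. w x * g x) = (LINT x:U|lebesgue. w' x * g x)" for g
    by (rule set_lebesgue_integral_cong_AE2, use assms in eventually_elim) simp
  then show ?thesis by (simp add: is_wpartial_def)
qed

lemma wpartial_cong:
  assumes "AE x in lebesgue. x \<in> U \<longrightarrow> w x = w' x"
  shows "wpartial U i w = wpartial U i w'"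
  unfolding wpartial_def is_wpartial_cong[OF assms] ..

lemma is_wpartial_unique:
  assumes U: "open U" "bounded U" and d: "is_wpartial U i w d" "is_wpartial U i w d'"
  shows "AE x in lebesgue. x \<in> U \<longrightarrow> d x = d' x"
proof -
  have L: "L2 U d" "L2 U d'" using d by (auto simp: is_wpartial_def)
  have "AE x in lebesgue. x \<in> U \<longrightarrow> d x - d' x = 0"
  proof (rule fundamental_lemma[OF U(1)])
    show "set_integrable lebesgue U (\<lambda>x. d x - d' x)"
      by (intro L2_integrable U L2_diff L)
    fix \<phi> assume \<phi>: "test_fun U \<phi>"
    have p: "L2 U \<phi>" by (intro L2_smooth U test_fun_smooth[OF \<phi>])
    have "(LINT x:U|lebesgue. (d x - d' x) * \<phi> x) = (LINT x:U|lebesgue. d x * \<phi> x) - (LINT x:U|lebesgue. d' x * \<phi> x)"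
      unfolding left_diff_distrib by (intro set_integral_diff L2_mult_integrable L p)
    then show "(LINT x:U|lebesgue. (d x - d' x) * \<phi> x) = 0"
      using d \<phi> by (simp add: is_wpartial_def)
  qed
  then show ?thesis by simp
qed

lemma integral_test_fun_subset:
  assumes "test_fun V \<phi>" "V \<subseteq> U"
  shows "(LINT x:V|lebesgue. w x * \<phi> x) = (LINT x:U|lebesgue. w x * \<phi> x :: real)"
proof -
  have eq: "indicator V x *\<^sub>R (w x * \<phi> x) = indicator U x *\<^sub>R (w x * \<phi> x)" for x
    using test_fun_outside[OF assms(1), of x] assms(2) by (auto simp: indicator_def)
  show ?thesis unfolding set_lebesgue_integral_def eq ..
qed

lemma is_wpartial_subset:
  assumes d: "is_wpartial U i w d" and V: "open V" "V \<subseteq> U"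
  shows "is_wpartial V i w d"
  unfolding is_wpartial_def
proof (intro conjI allI impI)
  show "L2 V d" using d V by (auto simp: is_wpartial_def intro: L2_subset)
  fix \<phi> assume \<phi>: "test_fun V \<phi>"
  show "(LINT x:V|lebesgue. w x * cpartial i \<phi> x) = - (LINT x:V|lebesgue. d x * \<phi> x)"
    unfolding integral_test_fun_subset[OF \<phi> V(2)] integral_test_fun_subset[OF test_fun_cpartial[OF \<phi>] V(2)]
    using d test_fun_mono[OF \<phi> V(2)] by (simp add: is_wpartial_def)
qed

lemma H1_subset: "H1 U w \<Longrightarrow> open V \<Longrightarrow> V \<subseteq> U \<Longrightarrow> H1 V w"
  unfolding H1_def by (meson L2_subset is_wpartial_subset)

lemma wgrad_cong:
  assumes "AE x in lebesgue. x \<in> U \<longrightarrow> v x = v' x"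
  shows "wgrad U v = wgrad U v'"
proof -
  have "AE x in lebesgue. x \<in> U \<longrightarrow> v x $ i = v' x $ i" for i
    using assms by eventually_elim simp
  from is_wpartial_cong[OF this] show ?thesis unfolding wgrad_def by simp
qed

lemma wgrad_is_wpartial:
  assumes "\<And>i j. is_wpartial U j (\<lambda>x. v x $ i) (d i j)"
  shows "is_wpartial U j (\<lambda>x. v x $ i) (\<lambda>x. wgrad U v x $ i $ j)"
proof -
  have "\<exists>G :: pt \<Rightarrow> mat3. \<forall>i j. is_wpartial U j (\<lambda>x. v x $ i) (\<lambda>x. G x $ i $ j)"
    by (rule exI[of _ "\<lambda>x. \<chi> i j. d i j x"]) (simp add: assms)
  from someI_ex[OF this] show ?thesis unfolding wgrad_def by blast
qed

lemma wgrad_eq: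
  assumes U: "open U" "bounded U" and d: "\<And>i j. is_wpartial U j (\<lambda>x. v x $ i) (d i j)"
  shows "AE x in lebesgue. x \<in> U \<longrightarrow> (\<forall>i j. wgrad U v x $ i $ j = d i j x)"
proof -
  have "AE x in lebesgue. \<forall>i. \<forall>j. x \<in> U \<longrightarrow> wgrad U v x $ i $ j = d i j x"
    by (intro eventually_all_finite is_wpartial_unique[OF U wgrad_is_wpartial[OF d] d])
  then show ?thesis by eventually_elim blast
qed

text \<open>\<open>is_trace\<close> sees the function only through integrals and chosen weak
  derivatives. Functions that agree almost everywhere therefore give the same predicate, and the
  choice returns the same trace at every point.\<close>

lemma trace_s_cong:
  assumes T: "tetra T" and ae: "AE x in lebesgue. x \<in> interior T \<longrightarrow> w x = w' x"
  shows "trace_s T w = trace_s T w'"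
proof -
  have "(LINT x:T|lebesgue. wpartial (interior T) i w x * \<phi> x + w x * cpartial i \<phi> x)
    = (LINT x:T|lebesgue. wpartial (interior T) i w' x * \<phi> x + w' x * cpartial i \<phi> x)" for \<phi> i
    by (rule set_lebesgue_integral_cong_AE2, use ae AE_tetra_interior[OF T] in eventually_elim)
      (auto simp: wpartial_cong[OF ae])
  then have "is_trace T w = is_trace T w'"
    by (simp add: is_trace_def fun_eq_iff)
  then show ?thesis by (simp add: trace_s_def)
qed

lemma bounded_tetra_interior: "tetra T \<Longrightarrow> bounded (interior T)"
  using compact_tetra compact_imp_bounded bounded_subset interior_subset by metis

lemma trace_s_is_trace:
  assumes "tetra T" "H1 (interior T) w"
  shows "is_trace T w (trace_s T w)"
  unfolding trace_s_def using trace_exists[OF assms] by (rule someI_ex)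

text \<open>The outward normal supports the tetrahedron: it lies in a half-space whose boundary
  contains the facet, and a step along the normal from a facet point leaves that half-space.\<close>

lemma facet_not_interior:
  assumes T: "tetra T" and F: "F \<in> facets T"
  shows "F \<inter> interior T = {}"
proof -
  obtain v where v: "v \<in> verts T" "F = opp_facet T v"
    using F unfolding facets_eq(1)[OF T] by (elim imageE)
  obtain a b c where "tetra_facet T v a b c" using tetra_facet_exists[OF T v(1)] .
  then interpret V: tetra_facet T v a b c .
  have "convex hull {v, a, b, c} \<subseteq> {x. V.n \<bullet> x \<le> V.n \<bullet> a}"
  proof (rule hull_minimal)
    have "norm V.m > 0" using V.m_nonzero by simp
    moreover have "norm V.m * (V.n \<bullet> (a - v)) \<ge> 0" using V.n_inner_vertex[of a] by simp
    ultimately have "V.n \<bullet> v \<le> V.n \<bullet> a" by (simp add: zero_le_mult_iff inner_diff_right)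
    moreover have "V.n \<bullet> b = V.n \<bullet> a" "V.n \<bullet> c = V.n \<bullet> a"
      using V.n_inner_facet[of b a] V.n_inner_facet[of c a] V.m_nonzero by (auto simp: inner_diff_right)
    ultimately show "{v, a, b, c} \<subseteq> {x. V.n \<bullet> x \<le> V.n \<bullet> a}" by auto
  qed (rule convex_halfspace_le)
  then have half: "T \<subseteq> {x. V.n \<bullet> x \<le> V.n \<bullet> a}" unfolding V.T_eq[symmetric] .
  have flat: "V.n \<bullet> x = V.n \<bullet> a" if xF: "x \<in> F" for x
  proof -
    obtain st where "x = tri a b c st" using xF unfolding v(2) V.opp_facet_eq by blast
    then have "V.m \<bullet> (x - a) = 0" using V.n_tri by simp
    then have "V.n \<bullet> (x - a) = 0" by (simp add: V.n_eq)
    then show ?thesis by (simp add: inner_diff_right)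
  qed
  have False if x: "x \<in> F" "x \<in> interior T" for x
  proof -
    obtain e where e: "e > 0" "cball x e \<subseteq> T"
      using x(2) by (auto simp: mem_interior_cball)
    then have "x + e *\<^sub>R V.n \<in> T" using V.norm_n by (auto simp: dist_norm intro!: subsetD[OF e(2)])
    then have "V.n \<bullet> (x + e *\<^sub>R V.n) \<le> V.n \<bullet> a" using half by auto
    moreover have "V.n \<bullet> V.n = 1" using V.norm_n by (simp add: dot_square_norm)
    ultimately show False using flat[OF x(1)] e(1) by (simp add: inner_add_right)
  qed
  then show ?thesis by blast
qed

section \<open>Integration by parts and traces for smooth functions\<close>

lemma integral_cpartial_test_tetra:
  assumes T: "tetra T" and g: "test_fun (interior T) g"
  shows "(LINT x|lborel. cpartial i g x) = 0"
proof -
  have eq: "indicator T x *\<^sub>R cpartial i g x = cpartial i g x" for x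
    using test_fun_outside[OF test_fun_cpartial[OF g], of x] interior_subset[of T] by (auto simp: indicator_def)
  have "(LINT x|lborel. cpartial i g x) = (LINT x:T|lborel. cpartial i g x)"
    unfolding set_lebesgue_integral_def eq ..
  also have "\<dots> = (\<Sum>F\<in>facets T. facet_integral F (\<lambda>x. g x * onormal T F $ i))"
    by (rule tetra_divergence[OF T test_fun_smooth[OF g]])
  also have "\<dots> = 0"
  proof (intro sum.neutral ballI facet_integral_AE_zero)
    fix F assume F: "F \<in> facets T"
    have "g (fparam F st) = 0" if "st \<in> reftri" for st
      using fparam_in_facet[OF T F that] facet_not_interior[OF T F] test_fun_outside[OF g] by blast
    then show "facet_AE F (\<lambda>x. g x * onormal T F $ i = 0)" by (simp add: facet_AE_def)
  qed
  finally show ?thesis .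
qed

text \<open>A dilation by B/r carries the support into a ball inside the tetrahedron, where the
  divergence theorem has no facet terms. The dilation changes the integral only by a nonzero
  factor.\<close>

lemma integral_cpartial_test:
  assumes T: "tetra T" and g: "test_fun UNIV g"
  shows "(LINT x|lborel. cpartial i g x) = 0"
proof -
  note gs = test_fun_smooth[OF g]
  obtain z r where r: "r > 0" "cball z r \<subseteq> interior T"
    using interior_tetra_nonempty[OF T] open_interior by (metis ex_in_conv open_contains_cball)
  have "compact (closure {x. g x \<noteq> 0})" using g by (simp add: test_fun_def)
  then obtain B where B: "B > 0" "\<And>x. x \<in> closure {x. g x \<noteq> 0} \<Longrightarrow> norm x \<le> B"
    using compact_imp_bounded bounded_pos by metis
  define c where "c = B / r"
  have c: "c > 0" using B r by (simp add: c_def)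
  define h where "h x = g (c *\<^sub>R x + - c *\<^sub>R z)" for x
  have "test_fun (interior T) h"
  proof (rule test_funI[OF _ _ compact_cball r(2)])
    show "smooth h" unfolding h_def by (rule smooth_affine[OF gs])
    show "{x. h x \<noteq> 0} \<subseteq> cball z r"
    proof
      fix x assume "x \<in> {x. h x \<noteq> 0}"
      then have "c *\<^sub>R x + - c *\<^sub>R z \<in> {x. g x \<noteq> 0}" by (simp add: h_def)
      then have "norm (c *\<^sub>R x + - c *\<^sub>R z) \<le> B" by (intro B(2) subsetD[OF closure_subset])
      moreover have "c *\<^sub>R x + - c *\<^sub>R z = c *\<^sub>R (x - z)" by (simp add: algebra_simps)
      ultimately have "c * norm (x - z) \<le> B" using c by simp
      then have "norm (x - z) \<le> r" using B r by (simp add: c_def field_simps)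
      then show "x \<in> cball z r" by (simp add: dist_norm norm_minus_commute)
    qed
  qed
  from integral_cpartial_test_tetra[OF T this, of i]
  have "(LINT x|lborel. c * cpartial i g (c *\<^sub>R x + - c *\<^sub>R z)) = 0"
    unfolding h_def cpartial_affine[OF gs] .
  then have 0: "(LINT x|lborel. cpartial i g (- c *\<^sub>R z + c *\<^sub>R x)) = 0"
    using c by (simp add: add.commute)
  have [measurable]: "cpartial i g \<in> borel_measurable borel" using gs by (intro smooth_measurable smooth_cpartial)
  have "(LINT x|lborel. cpartial i g x)
      = integral\<^sup>L (density (distr lborel borel (\<lambda>x. - c *\<^sub>R z + c *\<^sub>R x)) (\<lambda>_. \<bar>c\<bar> ^ DIM(pt))) (cpartial i g)"
    using c by (subst lborel_affine[of c "- c *\<^sub>R z"]) auto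
  also have "\<dots> = \<bar>c\<bar> ^ DIM(pt) * (LINT x|lborel. cpartial i g (- c *\<^sub>R z + c *\<^sub>R x))"
    by (subst integral_density) (auto simp: integral_distr)
  finally show ?thesis using 0 by simp
qed

lemma set_integral_test_mult:
  assumes T: "tetra T" and U: "open U" "bounded U" and g: "smooth g" and \<phi>: "test_fun U \<phi>"
  shows "(LINT x:U|lebesgue. g x * cpartial i \<phi> x) = - (LINT x:U|lebesgue. cpartial i g x * \<phi> x)"
proof -
  note \<phi>s = test_fun_smooth[OF \<phi>]
  have t: "test_fun UNIV (\<lambda>x. g x * \<phi> x)"
  proof (rule test_funI)
    show "{x. g x * \<phi> x \<noteq> 0} \<subseteq> closure {x. \<phi> x \<noteq> 0}"
      using closure_subset[of "{x. \<phi> x \<noteq> 0}"] by auto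
  qed (use g \<phi> \<phi>s in \<open>auto simp: test_fun_def\<close>)
  have sm: "smooth (cpartial i (\<lambda>x. g x * \<phi> x))" by (intro smooth_cpartial smooth_mult g \<phi>s)
  have i: "set_integrable lebesgue U (\<lambda>x. g x * cpartial i \<phi> x)" "set_integrable lebesgue U (\<lambda>x. cpartial i g x * \<phi> x)"
    by (intro L2_mult_integrable L2_smooth U g \<phi>s smooth_cpartial)+
  have eq: "indicator U x *\<^sub>R (g x * cpartial i \<phi> x + cpartial i g x * \<phi> x) = cpartial i (\<lambda>x. g x * \<phi> x) x" for x
    using test_fun_outside[OF \<phi>, of x] test_fun_outside[OF test_fun_cpartial[OF \<phi>], of x]
    by (cases "x \<in> U") (simp_all add: cpartial_mult[OF g \<phi>s])
  have "(LINT x:U|lebesgue. g x * cpartial i \<phi> x) + (LINT x:U|lebesgue. cpartial i g x * \<phi> x)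
      = (LINT x:U|lebesgue. g x * cpartial i \<phi> x + cpartial i g x * \<phi> x)"
    using i by (simp add: set_integral_add)
  also have "\<dots> = (LINT x|lborel. cpartial i (\<lambda>x. g x * \<phi> x) x)"
    unfolding set_lebesgue_integral_def eq
    using smooth_measurable[OF sm] by (simp add: integral_completion)
  also have "\<dots> = 0" by (rule integral_cpartial_test[OF T t])
  finally show ?thesis by simp
qed

lemma smooth_is_wpartial:
  assumes "tetra T" "open U" "bounded U" "smooth g"
  shows "is_wpartial U i g (cpartial i g)"
  unfolding is_wpartial_def using set_integral_test_mult[OF assms] L2_smooth[OF assms(2,3) smooth_cpartial[OF assms(4)]]
  by blast

lemma smooth_H1: "tetra T \<Longrightarrow> open U \<Longrightarrow> bounded U \<Longrightarrow> smooth g \<Longrightarrow> H1 U g"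
  unfolding H1_def using smooth_is_wpartial L2_smooth by blast

lemma facet_L2_continuous:
  assumes "continuous_on UNIV g"
  shows "facet_L2 F g"
proof -
  have "facet_meas F g" using assms by (rule facet_meas_continuous)
  moreover have "facet_int F (\<lambda>x. (g x)\<^sup>2)" using assms by (intro facet_int_continuous continuous_intros)
  ultimately show ?thesis by (simp add: facet_L2_def facet_meas_def facet_int_def)
qed

lemma is_trace_smooth:
  assumes T: "tetra T" and g: "smooth g"
  shows "is_trace T g g"
  unfolding is_trace_def
proof (intro conjI ballI allI impI)
  show "facet_L2 F g" for F using g by (intro facet_L2_continuous smooth_continuous)
  fix \<phi> i assume \<phi>: "smooth \<phi>"
  let ?U = "interior T"
  note U = open_interior[of T] bounded_tetra_interior[OF T]
  have ae: "AE x in lebesgue. x \<in> ?U \<longrightarrow> wpartial ?U i g x = cpartial i g x"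
    by (rule is_wpartial_unique[OF U wpartial_is_wpartial[OF smooth_H1[OF T U g]] smooth_is_wpartial[OF T U g]])
  have "(LINT x:T|lebesgue. wpartial ?U i g x * \<phi> x + g x * cpartial i \<phi> x) = (LINT x:T|lebesgue. cpartial i (\<lambda>x. g x * \<phi> x) x)"
    by (rule set_lebesgue_integral_cong_AE2, use ae AE_tetra_interior[OF T] in eventually_elim)
      (auto simp: cpartial_mult[OF g \<phi>])
  also have "\<dots> = (LINT x:T|lborel. cpartial i (\<lambda>x. g x * \<phi> x) x)"
    unfolding set_lebesgue_integral_def
    using smooth_measurable[OF smooth_cpartial[OF smooth_mult[OF g \<phi>]]] borel_compact[OF compact_tetra[OF T]]
    by (intro integral_completion) simp
  also have "\<dots> = (\<Sum>F\<in>facets T. facet_integral F (\<lambda>x. g x * \<phi> x * onormal T F $ i))"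
    by (rule tetra_divergence[OF T smooth_mult[OF g \<phi>]])
  finally show "(LINT x:T|lebesgue. wpartial ?U i g x * \<phi> x + g x * cpartial i \<phi> x)
    = (\<Sum>F\<in>facets T. facet_integral F (\<lambda>x. g x * \<phi> x * onormal T F $ i))" .
qed

lemma tetra_green:
  assumes T: "tetra T" and w: "H1 (interior T) w" and d: "is_wpartial (interior T) i w d" and \<phi>: "smooth \<phi>"
  shows "(LINT x:T|lebesgue. d x * \<phi> x + w x * cpartial i \<phi> x)
    = (\<Sum>F\<in>facets T. facet_integral F (\<lambda>x. trace_s T w x * \<phi> x * onormal T F $ i))"
proof -
  note U = open_interior[of T] bounded_tetra_interior[OF T]
  have ae: "AE x in lebesgue. x \<in> interior T \<longrightarrow> wpartial (interior T) i w x = d x"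
    by (rule is_wpartial_unique[OF U wpartial_is_wpartial[OF w] d])
  have "(LINT x:T|lebesgue. d x * \<phi> x + w x * cpartial i \<phi> x) = (LINT x:T|lebesgue. wpartial (interior T) i w x * \<phi> x + w x * cpartial i \<phi> x)"
    by (rule set_lebesgue_integral_cong_AE2, use ae AE_tetra_interior[OF T] in eventually_elim) auto
  then show ?thesis
    using trace_s_is_trace[OF T w] \<phi> by (simp add: is_trace_def)
qed

subsection \<open>Jumps of traces on a mesh\<close>

definition adj :: "pt set set \<Rightarrow> pt set \<Rightarrow> pt set set" where
  "adj \<T> F = {T \<in> \<T>. F \<in> facets T}"

lemma ball_all_components_zero:
  assumes "norm (n :: real^3) = 1" "\<forall>i. c * n $ i = 0"
  shows "c = 0"
proof -
  have "n \<noteq> 0" using assms(1) by auto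
  then obtain i where "n $ i \<noteq> 0" by (auto simp: vec_eq_iff)
  then show ?thesis using assms(2) by auto
qed

lemma tetra_integrable:
  fixes f :: "pt \<Rightarrow> real"
  assumes T: "tetra T" and f: "set_integrable lebesgue (interior T) f"
  shows "set_integrable lebesgue T f"
proof -
  have ae: "AE x in lebesgue. (x \<in> interior T \<longleftrightarrow> x \<in> T) \<and> (x \<in> interior T \<longrightarrow> f x = f x)"
    using AE_tetra_interior[OF T] by eventually_elim auto
  show ?thesis using f by (simp only: set_integrable_cong_AE2[OF ae])
qed

section \<open>Green's formula summed over the mesh\<close>

context
  fixes \<T> :: "pt set set" and \<Omega> :: "pt set"
  assumes m: "mesh \<T> \<Omega>" and dom: "lipschitz_domain \<Omega>"
begin

lemma Omega_open: "open \<Omega>" and Omega_bounded: "bounded \<Omega>"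
  using dom by (auto simp: lipschitz_domain_def)

lemma mesh_has_tetra: "\<exists>T. tetra T"
proof -
  have "\<Omega> \<noteq> {}" using dom by (simp add: lipschitz_domain_def)
  then have "closure \<Omega> \<noteq> {}" by simp
  then have "\<Union>\<T> \<noteq> {}" using m by (simp add: mesh_def)
  then show ?thesis using mesh_tetra[OF m] by blast
qed

lemma mfacets_finite: "finite (mfacets \<T>)"
  unfolding mfacets_def using mesh_finite[OF m] mesh_tetra[OF m] finite_facets by blast

lemma mfacets_tetra: "F \<in> mfacets \<T> \<Longrightarrow> \<exists>T. tetra T \<and> F \<in> facets T"
  unfolding mfacets_def using mesh_tetra[OF m] by blast

lemma adj_finite: "finite (adj \<T> F)"
  unfolding adj_def using mesh_finite[OF m] by simp

lemma adjD: "T \<in> adj \<T> F \<Longrightarrow> T \<in> \<T> \<and> F \<in> facets T \<and> tetra T"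
  using mesh_tetra[OF m] by (simp add: adj_def)

lemma sum_facets_swap:
  "(\<Sum>T\<in>\<T>. \<Sum>F\<in>facets T. X T F) = (\<Sum>F\<in>mfacets \<T>. \<Sum>T\<in>adj \<T> F. X T F :: real)"
proof -
  have "(\<Sum>T\<in>\<T>. \<Sum>F\<in>facets T. X T F) = (\<Sum>T\<in>\<T>. \<Sum>F | F \<in> mfacets \<T> \<and> F \<in> facets T. X T F)"
    by (intro sum.cong refl) (auto simp: mfacets_def)
  also have "\<dots> = (\<Sum>F\<in>mfacets \<T>. \<Sum>T | T \<in> \<T> \<and> F \<in> facets T. X T F)"
    by (rule sum.swap_restrict[OF mesh_finite[OF m] mfacets_finite])
  finally show ?thesis by (simp add: adj_def)
qed

lemma adj_cases:
  assumes F: "F \<in> mfacets \<T>"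
  obtains (boundary) "adj \<T> F = {fT1 \<T> F}" "\<And>v x. fjump \<T> v F x = trvec (fT1 \<T> F) v x"
  | (inner) T2 where "T2 \<noteq> fT1 \<T> F" "adj \<T> F = {fT1 \<T> F, T2}" "onormal T2 F = - fnormal \<T> F"
     "\<And>v x. fjump \<T> v F x = trvec (fT1 \<T> F) v x - trvec T2 v x"
proof -
  let ?T = "fT1 \<T> F"
  have "\<exists>T. T \<in> \<T> \<and> F \<in> facets T" using F by (auto simp: mfacets_def)
  then have T1: "?T \<in> \<T> \<and> F \<in> facets ?T" unfolding fT1_def by (rule someI_ex)
  show ?thesis
  proof (cases "\<exists>T. T \<in> \<T> \<and> F \<in> facets T \<and> T \<noteq> ?T")
    case False
    then have "adj \<T> F = {?T}" using T1 by (auto simp: adj_def)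
    moreover have "fjump \<T> v F x = trvec ?T v x" for v x unfolding fjump_def by (simp only: False if_False)
    ultimately show ?thesis by (rule boundary)
  next
    case True
    define T2 where "T2 = (SOME T. T \<in> \<T> \<and> F \<in> facets T \<and> T \<noteq> ?T)"
    have T2: "T2 \<in> \<T> \<and> F \<in> facets T2 \<and> T2 \<noteq> ?T" unfolding T2_def using True by (rule someI_ex)
    have "T = T2" if "T \<in> \<T>" "F \<in> facets T" "T \<noteq> ?T" for T
      using mesh_facet_at_most_two[OF m, of ?T T T2 F] T1 T2 that by metis
    then have "adj \<T> F = {?T, T2}" using T1 T2 by (auto simp: adj_def)
    moreover have "onormal T2 F = - fnormal \<T> F"
      unfolding fnormal_def using mesh_opposite_normals[OF m, of ?T T2 F] T1 T2 by metis
    moreover have "fjump \<T> v F x = trvec ?T v x - trvec T2 v x" for v x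
      unfolding fjump_def T2_def using True by (simp only: if_True)
    ultimately show ?thesis using inner T2 by blast
  qed
qed

lemma fT1_adj: "F \<in> mfacets \<T> \<Longrightarrow> fT1 \<T> F \<in> adj \<T> F"
  by (erule adj_cases) auto

lemma norm_fnormal: "F \<in> mfacets \<T> \<Longrightarrow> norm (fnormal \<T> F) = 1"
  unfolding fnormal_def using fT1_adj adjD norm_onormal by blast

lemma mesh_H1: "H1 \<Omega> w \<Longrightarrow> T \<in> \<T> \<Longrightarrow> H1 (interior T) w"
  by (rule H1_subset[OF _ open_interior mesh_interior_subset[OF m dom]])

lemma mesh_wpartial: "is_wpartial \<Omega> i w d \<Longrightarrow> T \<in> \<T> \<Longrightarrow> is_wpartial (interior T) i w d"
  by (rule is_wpartial_subset[OF _ open_interior mesh_interior_subset[OF m dom]])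

lemma trace_facet_int: "tetra T \<Longrightarrow> F \<in> facets T \<Longrightarrow> H1 (interior T) w \<Longrightarrow> facet_int F (trace_s T w)"
  using trace_s_is_trace[of T w] by (auto simp: is_trace_def intro: facet_L2_int)

text \<open>Facet terms are regrouped by facet. Summing over \<open>adj\<close> with outward normals
  gives the jump times the normal component on an inner facet, whose two normals are opposite, and
  the trace times the normal component on a boundary facet.\<close>

lemma mesh_green:
  assumes w: "H1 \<Omega> w" and d: "is_wpartial \<Omega> i w d" and \<phi>: "smooth \<phi>"
  shows "(LINT x:\<Omega>|lebesgue. d x * \<phi> x + w x * cpartial i \<phi> x)
    = (\<Sum>F\<in>mfacets \<T>. facet_integral F (\<lambda>x. (\<Sum>T\<in>adj \<T> F. trace_s T w x * onormal T F $ i) * \<phi> x))"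
proof -
  have L: "L2 \<Omega> w" "L2 \<Omega> d" "L2 \<Omega> \<phi>" "L2 \<Omega> (cpartial i \<phi>)"
    using w d \<phi> by (auto simp: H1_def is_wpartial_def intro!: L2_smooth Omega_open Omega_bounded smooth_cpartial)
  have "set_integrable lebesgue \<Omega> (\<lambda>x. d x * \<phi> x + w x * cpartial i \<phi> x)"
    by (intro set_integral_add L2_mult_integrable L)
  from mesh_integral[OF m dom mesh_integrable[OF m dom this]]
  have "(LINT x:\<Omega>|lebesgue. d x * \<phi> x + w x * cpartial i \<phi> x)
      = (\<Sum>T\<in>\<T>. \<Sum>F\<in>facets T. facet_integral F (\<lambda>x. trace_s T w x * \<phi> x * onormal T F $ i))"
    using tetra_green[OF mesh_tetra[OF m] mesh_H1[OF w] mesh_wpartial[OF d] \<phi>] by simp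
  also have "\<dots> = (\<Sum>F\<in>mfacets \<T>. \<Sum>T\<in>adj \<T> F. facet_integral F (\<lambda>x. trace_s T w x * \<phi> x * onormal T F $ i))"
    by (rule sum_facets_swap)
  also have "\<dots> = (\<Sum>F\<in>mfacets \<T>. facet_integral F (\<lambda>x. (\<Sum>T\<in>adj \<T> F. trace_s T w x * onormal T F $ i) * \<phi> x))"
  proof (intro sum.cong refl)
    fix F
    have i: "facet_int F (\<lambda>x. trace_s T w x * \<phi> x * onormal T F $ i)" if "T \<in> adj \<T> F" for T
      using adjD[OF that] by (intro facet_int_cmult facet_int_mult_continuous trace_facet_int mesh_H1[OF w] smooth_continuous \<phi>) auto
    have "(\<Sum>T\<in>adj \<T> F. facet_integral F (\<lambda>x. trace_s T w x * \<phi> x * onormal T F $ i))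
        = facet_integral F (\<lambda>x. \<Sum>T\<in>adj \<T> F. trace_s T w x * \<phi> x * onormal T F $ i)"
      using i by (rule facet_integral_sum[symmetric])
    also have "(\<lambda>x. \<Sum>T\<in>adj \<T> F. trace_s T w x * \<phi> x * onormal T F $ i)
        = (\<lambda>x. (\<Sum>T\<in>adj \<T> F. trace_s T w x * onormal T F $ i) * \<phi> x)"
      by (simp add: sum_distrib_left mult_ac)
    finally show "(\<Sum>T\<in>adj \<T> F. facet_integral F (\<lambda>x. trace_s T w x * \<phi> x * onormal T F $ i))
        = facet_integral F (\<lambda>x. (\<Sum>T\<in>adj \<T> F. trace_s T w x * onormal T F $ i) * \<phi> x)" .
  qed
  finally show ?thesis .
qed

lemma mesh_facet_zero:
  assumes H: "\<And>F. F \<in> mfacets \<T> \<Longrightarrow> facet_int F (H F)" and U: "open U"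
    and z: "\<And>\<phi>. test_fun U \<phi> \<Longrightarrow> (\<Sum>F\<in>mfacets \<T>. facet_integral F (\<lambda>x. H F x * \<phi> x)) = 0"
    and F0: "F0 \<in> mfacets \<T>" "fparam F0 ` open_reftri \<subseteq> U"
  shows "facet_AE F0 (\<lambda>x. H F0 x = 0)"
  using mesh_relint_disjoint[OF m F0(1)]
  by (intro facet_sum_zero[OF mfacets_finite mfacets_tetra H U z F0]) auto

lemma trace_jump_facet_int:
  assumes "H1 \<Omega> w"
  shows "facet_int F (\<lambda>x. \<Sum>T\<in>adj \<T> F. trace_s T w x * onormal T F $ i)"
  using adjD by (intro facet_int_sum facet_int_cmult trace_facet_int mesh_H1[OF assms]) blast+

text \<open>Against test functions of the domain the volume side of \<open>mesh_green\<close>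
  vanishes, by the definition of the weak derivative on the whole domain. Localisation to an inner
  facet then kills its jump.\<close>

lemma H1_trace_continuous:
  assumes w: "H1 \<Omega> w" and T: "T1 \<in> adj \<T> F" "T2 \<in> adj \<T> F"
  shows "facet_AE F (\<lambda>x. trace_s T1 w x = trace_s T2 w x)"
proof (cases "T1 = T2")
  case False
  have T': "T1 \<in> \<T>" "T2 \<in> \<T>" "F \<in> facets T1" "F \<in> facets T2" "tetra T1" using T adjD by blast+
  have F: "F \<in> mfacets \<T>" using T' by (auto simp: mfacets_def)
  have "T = T2" if "T \<in> adj \<T> F" "T \<noteq> T1" for T
    using mesh_facet_at_most_two[OF m, of T1 T T2 F] T' False adjD[OF that(1)] that(2) by metis
  then have adj: "adj \<T> F = {T1, T2}" using T by blast
  have "facet_AE F (\<lambda>x. (\<Sum>T\<in>adj \<T> F. trace_s T w x * onormal T F $ i) = 0)" for i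
  proof (rule mesh_facet_zero[where H = "\<lambda>F x. \<Sum>T\<in>adj \<T> F. trace_s T w x * onormal T F $ i", OF trace_jump_facet_int[OF w] Omega_open _ F])
    show "fparam F ` open_reftri \<subseteq> \<Omega>" by (rule mesh_facet_subset[OF m dom T'(1,2) False T'(3,4)])
    fix \<phi> assume \<phi>: "test_fun \<Omega> \<phi>"
    note s = test_fun_smooth[OF \<phi>]
    obtain d where d: "is_wpartial \<Omega> i w d" using w by (auto simp: H1_def)
    have L: "L2 \<Omega> w" "L2 \<Omega> d" "L2 \<Omega> \<phi>" "L2 \<Omega> (cpartial i \<phi>)"
      using w d s by (auto simp: H1_def is_wpartial_def intro!: L2_smooth Omega_open Omega_bounded smooth_cpartial)
    have "(LINT x:\<Omega>|lebesgue. d x * \<phi> x + w x * cpartial i \<phi> x) = (LINT x:\<Omega>|lebesgue. d x * \<phi> x) + (LINT x:\<Omega>|lebesgue. w x * cpartial i \<phi> x)"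
      by (intro set_integral_add L2_mult_integrable L)
    then show "(\<Sum>F\<in>mfacets \<T>. facet_integral F (\<lambda>x. (\<Sum>T\<in>adj \<T> F. trace_s T w x * onormal T F $ i) * \<phi> x)) = 0"
      using mesh_green[OF w d s] d \<phi> by (simp add: is_wpartial_def)
  qed
  from facet_AE_all[OF this] show ?thesis
  proof (rule facet_AE_mp)
    fix x assume "\<forall>i. (\<Sum>T\<in>adj \<T> F. trace_s T w x * onormal T F $ i) = 0"
    then have "\<forall>i. (trace_s T1 w x - trace_s T2 w x) * onormal T1 F $ i = 0"
      unfolding adj using False mesh_opposite_normals[OF m T'(1,2) False T'(3,4)] by (simp add: left_diff_distrib)
    from ball_all_components_zero[OF norm_onormal[OF T'(5,3)] this]
    show "trace_s T1 w x = trace_s T2 w x" by simp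
  qed
qed (simp add: facet_AE_def)

text \<open>For a test function \<open>s n\<close> the volume side of Green's formula is zero
  against every smooth \<open>\<phi>\<close>, whatever its boundary values. This survives the limit
  to \<open>w\<close>, so localisation may use the whole space and reaches boundary facets.\<close>

lemma H10_trace_jump:
  assumes w: "H10 \<Omega> w" and F: "F \<in> mfacets \<T>"
  shows "facet_AE F (\<lambda>x. \<forall>i. (\<Sum>T\<in>adj \<T> F. trace_s T w x * onormal T F $ i) = 0)"
proof (rule facet_AE_all)
  fix i
  have w1: "H1 \<Omega> w" using w by (simp add: H10_def)
  define d where "d = wpartial \<Omega> i w"
  have d: "is_wpartial \<Omega> i w d" unfolding d_def by (rule wpartial_is_wpartial[OF w1])
  obtain s where s: "\<And>n. test_fun \<Omega> (s n)" "(\<lambda>n. LINT x:\<Omega>|lebesgue. (s n x - w x)\<^sup>2) \<longlonglongrightarrow> 0"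
    "(\<lambda>n. LINT x:\<Omega>|lebesgue. (cpartial i (s n) x - d x)\<^sup>2) \<longlonglongrightarrow> 0"
    using w unfolding H10_def d_def by blast
  obtain T0 where T0: "tetra T0" using mesh_has_tetra by blast
  show "facet_AE F (\<lambda>x. (\<Sum>T\<in>adj \<T> F. trace_s T w x * onormal T F $ i) = 0)"
  proof (rule mesh_facet_zero[where H = "\<lambda>F x. \<Sum>T\<in>adj \<T> F. trace_s T w x * onormal T F $ i", OF trace_jump_facet_int[OF w1] open_UNIV _ F])
    fix \<phi> assume "test_fun UNIV \<phi>"
    then have \<phi>: "smooth \<phi>" by (rule test_fun_smooth)
    have L: "L2 \<Omega> w" "L2 \<Omega> d" "L2 \<Omega> \<phi>" "L2 \<Omega> (cpartial i \<phi>)"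
      using w1 d \<phi> by (auto simp: H1_def is_wpartial_def intro!: L2_smooth Omega_open Omega_bounded smooth_cpartial)
    have Ls: "L2 \<Omega> (s n)" "L2 \<Omega> (cpartial i (s n))" for n
      using test_fun_smooth[OF s(1)] by (auto intro!: L2_smooth Omega_open Omega_bounded smooth_cpartial)
    have "(\<lambda>n. (LINT x:\<Omega>|lebesgue. (cpartial i (s n) x - d x) * \<phi> x) + (LINT x:\<Omega>|lebesgue. (s n x - w x) * cpartial i \<phi> x)) \<longlonglongrightarrow> 0 + 0"
      by (intro tendsto_add L2_weak_limit L L2_diff Ls s)
    moreover have "(LINT x:\<Omega>|lebesgue. (cpartial i (s n) x - d x) * \<phi> x) + (LINT x:\<Omega>|lebesgue. (s n x - w x) * cpartial i \<phi> x)
        = - (LINT x:\<Omega>|lebesgue. d x * \<phi> x + w x * cpartial i \<phi> x)" for n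
    proof -
      have 1: "(LINT x:\<Omega>|lebesgue. (cpartial i (s n) x - d x) * \<phi> x) = (LINT x:\<Omega>|lebesgue. cpartial i (s n) x * \<phi> x) - (LINT x:\<Omega>|lebesgue. d x * \<phi> x)"
        unfolding left_diff_distrib by (intro set_integral_diff L2_mult_integrable L Ls)
      have 2: "(LINT x:\<Omega>|lebesgue. (s n x - w x) * cpartial i \<phi> x) = (LINT x:\<Omega>|lebesgue. s n x * cpartial i \<phi> x) - (LINT x:\<Omega>|lebesgue. w x * cpartial i \<phi> x)"
        unfolding left_diff_distrib by (intro set_integral_diff L2_mult_integrable L Ls)
      have 3: "(LINT x:\<Omega>|lebesgue. d x * \<phi> x + w x * cpartial i \<phi> x) = (LINT x:\<Omega>|lebesgue. d x * \<phi> x) + (LINT x:\<Omega>|lebesgue. w x * cpartial i \<phi> x)"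
        by (intro set_integral_add L2_mult_integrable L)
      have "(LINT x:\<Omega>|lebesgue. cpartial i (s n) x * \<phi> x) = - (LINT x:\<Omega>|lebesgue. s n x * cpartial i \<phi> x)"
        using set_integral_test_mult[OF T0 Omega_open Omega_bounded \<phi> s(1), of i n] by (simp add: mult.commute)
      then show ?thesis unfolding 1 2 3 by simp
    qed
    ultimately have "(LINT x:\<Omega>|lebesgue. d x * \<phi> x + w x * cpartial i \<phi> x) = 0"
      by (simp add: LIMSEQ_const_iff)
    then show "(\<Sum>F\<in>mfacets \<T>. facet_integral F (\<lambda>x. (\<Sum>T\<in>adj \<T> F. trace_s T w x * onormal T F $ i) * \<phi> x)) = 0"
      using mesh_green[OF w1 d \<phi>] by simp
  qed auto
qed

end

subsection \<open>Weak curls\<close>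

lemma testvec_single: "test_fun U g \<Longrightarrow> testvec U (\<lambda>x. \<chi> j. if j = i then g x else 0)"
proof -
  assume g: "test_fun U g"
  have "test_fun U (\<lambda>x. 0)" by (rule test_funI[where C = "{}"]) auto
  then have "test_fun U (\<lambda>x. if j = i then g x else 0)" for j
    using g by (cases "j = i") simp_all
  then show ?thesis by (simp add: testvec_def)
qed

lemma inner_single: "(c :: real^3) \<bullet> (\<chi> j. if j = i then y else 0) = c $ i * y"
  by (simp add: inner_vec_def if_distrib cong: if_cong)

lemma testvec_smoothvec: "testvec U w \<Longrightarrow> smoothvec w"
  unfolding testvec_def smoothvec_def using test_fun_smooth by blast

lemma wcurl_is_wcurl: "is_wcurl U \<phi> c \<Longrightarrow> is_wcurl U \<phi> (wcurl U \<phi>)"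
  unfolding wcurl_def by (rule someI[of "is_wcurl U \<phi>"])

lemma vector_fundamental_lemma:
  fixes c c' :: "pt \<Rightarrow> real^3"
  assumes U: "open U" "bounded U" and c: "L2 U c" "L2 U c'"
    and eq: "\<And>w. testvec U w \<Longrightarrow> (LINT x:U|lebesgue. c x \<bullet> w x) = (LINT x:U|lebesgue. c' x \<bullet> w x)"
  shows "AE x in lebesgue. x \<in> U \<longrightarrow> c x = c' x"
proof -
  have "AE x in lebesgue. x \<in> U \<longrightarrow> c x $ i - c' x $ i = 0" for i
  proof (rule fundamental_lemma[OF U(1)])
    note L = L2_component[OF c(1), of i] L2_component[OF c(2), of i]
    show "set_integrable lebesgue U (\<lambda>x. c x $ i - c' x $ i)" by (intro L2_integrable U L2_diff L)
    fix g assume g: "test_fun U g"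
    have Lg: "L2 U g" by (intro L2_smooth U test_fun_smooth[OF g])
    have "(LINT x:U|lebesgue. (c x $ i - c' x $ i) * g x) = (LINT x:U|lebesgue. c x $ i * g x) - (LINT x:U|lebesgue. c' x $ i * g x)"
      unfolding left_diff_distrib by (intro set_integral_diff L2_mult_integrable L Lg)
    also have "\<dots> = 0" using eq[OF testvec_single[OF g, of i]] by (simp add: inner_single)
    finally show "(LINT x:U|lebesgue. (c x $ i - c' x $ i) * g x) = 0" .
  qed
  then have "AE x in lebesgue. \<forall>i. x \<in> U \<longrightarrow> c x $ i - c' x $ i = 0" by (rule eventually_all_finite)
  then show ?thesis by eventually_elim (auto simp: vec_eq_iff)
qed

lemma is_wcurl_unique:
  assumes "open U" "bounded U" "is_wcurl U \<phi> c" "is_wcurl U \<phi> c'"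
  shows "AE x in lebesgue. x \<in> U \<longrightarrow> c x = c' x"
  using assms by (intro vector_fundamental_lemma) (auto simp: is_wcurl_def)

lemma smooth_curl_parts:
  assumes T: "tetra T" and U: "open U" "bounded U" and P: "smoothvec P" and w: "testvec U w"
  shows "(LINT x:U|lebesgue. P x \<bullet> ccurl w x) = (LINT x:U|lebesgue. ccurl P x \<bullet> w x)"
proof -
  have Ps: "smooth (\<lambda>x. P x $ a)" for a using P by (simp add: smoothvec_def)
  have wt: "test_fun U (\<lambda>x. w x $ a)" for a using w by (simp add: testvec_def)
  define p where "p a = (\<lambda>x. P x $ a)" for a
  define q where "q a = (\<lambda>x. w x $ a)" for a
  note ps = Ps[folded p_def] and qt = wt[folded q_def]
  note qs = test_fun_smooth[OF qt]
  have part: "(LINT x:U|lebesgue. p a x * cpartial b (q c) x) = - (LINT x:U|lebesgue. cpartial b (p a) x * q c x)" for a b c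
    by (rule set_integral_test_mult[OF T U ps qt])
  have i: "set_integrable lebesgue U (\<lambda>x. p a x * cpartial b (q c) x)" "set_integrable lebesgue U (\<lambda>x. cpartial b (p a) x * q c x)" for a b c
    by (intro L2_mult_integrable L2_smooth U ps qs smooth_cpartial)+
  have e1: "P x \<bullet> ccurl w x = (p 1 x * cpartial 2 (q 3) x - p 1 x * cpartial 3 (q 2) x) + (p 2 x * cpartial 3 (q 1) x - p 2 x * cpartial 1 (q 3) x)
      + (p 3 x * cpartial 1 (q 2) x - p 3 x * cpartial 2 (q 1) x)" for x
    by (simp add: inner_vec_def sum_3 ccurl_nth p_def q_def right_diff_distrib)
  have e2: "ccurl P x \<bullet> w x = (cpartial 2 (p 3) x * q 1 x - cpartial 3 (p 2) x * q 1 x) + (cpartial 3 (p 1) x * q 2 x - cpartial 1 (p 3) x * q 2 x)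
      + (cpartial 1 (p 2) x * q 3 x - cpartial 2 (p 1) x * q 3 x)" for x
    by (simp add: inner_vec_def sum_3 ccurl_nth p_def q_def left_diff_distrib)
  show ?thesis
    unfolding e1 e2 by (simp add: set_integral_add set_integral_diff i part)
qed

lemma ccurl_outside:
  assumes w: "testvec V w" and x: "x \<notin> V"
  shows "ccurl w x = 0"
proof -
  have "cpartial b (\<lambda>y. w y $ a) x = 0" for a b
    using w x by (intro test_fun_outside[OF test_fun_cpartial]) (auto simp: testvec_def)
  then show ?thesis by (simp add: vec_eq_iff forall_3 ccurl_nth)
qed

lemma testvec_outside:
  assumes "testvec V w" "x \<notin> V"
  shows "w x = 0"
proof -
  have "w x $ i = 0" for i
    using test_fun_outside[of V "\<lambda>x. w x $ i" x] assms by (simp add: testvec_def)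
  then show ?thesis by (simp add: vec_eq_iff)
qed

lemma testvec_mono: "testvec V w \<Longrightarrow> V \<subseteq> U \<Longrightarrow> testvec U w"
  unfolding testvec_def using test_fun_mono by blast

text \<open>A single \<open>c\<close> serves two purposes: tested with compactly supported fields it
  is a weak curl, and tested with all smooth fields it encodes the vanishing tangential
  trace.\<close>

lemma H0curl_is_wcurl:
  assumes "H0curl \<Omega> \<phi>"
  shows "\<exists>c. is_wcurl \<Omega> \<phi> c \<and> (\<forall>w. smoothvec w \<longrightarrow> (LINT x:\<Omega>|lebesgue. \<phi> x \<bullet> ccurl w x) = (LINT x:\<Omega>|lebesgue. c x \<bullet> w x))"
  using assms testvec_smoothvec unfolding H0curl_def is_wcurl_def by blast

lemma L2_smoothvec:
  fixes g :: "pt \<Rightarrow> real^3"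
  assumes "open U" "bounded U" "smoothvec g"
  shows "L2 U g"
proof -
  have L: "L2 U (\<lambda>x. g x $ i)" for i using assms by (intro L2_smooth) (auto simp: smoothvec_def)
  have "continuous_on UNIV g"
    using assms(3) by (auto simp: continuous_on_componentwise[of UNIV g] Basis_vec_def inner_axis smoothvec_def intro!: smooth_continuous)
  then have "g \<in> borel_measurable borel" by (rule borel_measurable_continuous_onI)
  then have "(\<lambda>x. indicator U x *\<^sub>R g x) \<in> borel_measurable borel"
    using borel_open[OF assms(1)] by measurable
  then have "set_borel_measurable lebesgue U g"
    unfolding set_borel_measurable_def by (intro measurable_completion) simp
  moreover have "set_integrable lebesgue U (\<lambda>x. \<Sum>i\<in>UNIV. g x $ i * g x $ i)"
    using L2_mult_integrable[OF L L] by (simp add: sum_3 set_integral_add)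
  moreover have "(norm (g x))\<^sup>2 = (\<Sum>i\<in>UNIV. g x $ i * g x $ i)" for x
    by (simp add: power2_norm_eq_inner inner_vec_def)
  ultimately show ?thesis by (simp add: L2_def)
qed

text \<open>Fields supported inside one tetrahedron see only the smooth piece \<open>P\<close>, for
  which the weak curl is the classical one by integration by parts.\<close>

lemma piecewise_curl:
  assumes m: "mesh \<T> \<Omega>" and dom: "lipschitz_domain \<Omega>" and T: "T \<in> \<T>"
    and P: "smoothvec P" "\<And>x. x \<in> interior T \<Longrightarrow> \<phi> x = P x" and c: "is_wcurl \<Omega> \<phi> c"
  shows "AE x in lebesgue. x \<in> interior T \<longrightarrow> c x = ccurl P x"
proof (rule vector_fundamental_lemma)
  note tet = mesh_tetra[OF m T]
  have sub: "interior T \<subseteq> \<Omega>" by (rule mesh_interior_subset[OF m dom T])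
  show "bounded (interior T)" by (rule bounded_tetra_interior[OF tet])
  then show "L2 (interior T) (ccurl P)" by (intro L2_smoothvec smoothvec_ccurl P) auto
  have Lc: "L2 \<Omega> c" using c by (simp add: is_wcurl_def)
  have om: "interior T \<in> sets lebesgue" by (simp add: borel_open)
  show "L2 (interior T) c"
    unfolding L2_def
  proof
    show "set_integrable lebesgue (interior T) (\<lambda>x. (norm (c x))\<^sup>2)"
      using Lc by (intro set_integrable_subset[OF _ om sub]) (simp add: L2_def)
    have "(\<lambda>x. indicator (interior T) x *\<^sub>R (indicator \<Omega> x *\<^sub>R c x)) \<in> borel_measurable lebesgue"
      by (rule borel_measurable_scaleR[OF borel_measurable_indicator[OF om]])
        (use Lc in \<open>simp add: L2_def set_borel_measurable_def\<close>)
    moreover have eq: "indicator (interior T) x *\<^sub>R (indicator \<Omega> x *\<^sub>R c x) = indicator (interior T) x *\<^sub>R c x" for x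
      using sub by (auto simp: indicator_def)
    ultimately show "set_borel_measurable lebesgue (interior T) c" by (simp only: set_borel_measurable_def eq)
  qed
  fix w assume w: "testvec (interior T) w"
  have e1: "indicator (interior T) x *\<^sub>R (c x \<bullet> w x) = indicator \<Omega> x *\<^sub>R (c x \<bullet> w x)" for x
    using sub testvec_outside[OF w, of x] by (auto simp: indicator_def)
  have e2: "indicator \<Omega> x *\<^sub>R (\<phi> x \<bullet> ccurl w x) = indicator (interior T) x *\<^sub>R (P x \<bullet> ccurl w x)" for x
    using sub ccurl_outside[OF w, of x] P(2)[of x] by (auto simp: indicator_def)
  have "(LINT x:interior T|lebesgue. c x \<bullet> w x) = (LINT x:\<Omega>|lebesgue. c x \<bullet> w x)"
    unfolding set_lebesgue_integral_def e1 ..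
  also have "\<dots> = (LINT x:\<Omega>|lebesgue. \<phi> x \<bullet> ccurl w x)"
    using c testvec_mono[OF w sub] by (simp add: is_wcurl_def)
  also have "\<dots> = (LINT x:interior T|lebesgue. P x \<bullet> ccurl w x)"
    unfolding set_lebesgue_integral_def e2 ..
  also have "\<dots> = (LINT x:interior T|lebesgue. ccurl P x \<bullet> w x)"
    by (rule smooth_curl_parts[OF tet open_interior bounded_tetra_interior[OF tet] P(1) w])
  finally show "(LINT x:interior T|lebesgue. c x \<bullet> w x) = (LINT x:interior T|lebesgue. ccurl P x \<bullet> w x)" .
qed simp

subsection \<open>The two parts of the discrete equation\<close>

lemma mtr_inner: "(mat 1 :: mat3) \<bullet> B = mtr B"
  by (simp add: mtr_def inner_vec_def mat_def sum_3)

lemma dev_inner_tracefree: "mtr B = 0 \<Longrightarrow> dev A \<bullet> B = A \<bullet> B"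
  by (simp add: dev_def inner_diff_left mtr_inner)

lemma inner_mat3: "(A :: mat3) \<bullet> B = (\<Sum>i\<in>UNIV. \<Sum>j\<in>UNIV. A $ i $ j * B $ i $ j)"
  by (simp add: inner_vec_def)

lemma ntc_tang:
  assumes "norm n = 1"
  shows "ntc n A \<bullet> tang n J = (A *v n) \<bullet> J - (n \<bullet> (A *v n)) * (J \<bullet> n)"
proof -
  have "n \<bullet> n = 1" using assms by (simp add: dot_square_norm)
  then show ?thesis
    by (simp add: ntc_def tang_def inner_diff_left inner_diff_right inner_commute algebra_simps)
qed

lemma matrix_vector_inner: "((A :: mat3) *v n) \<bullet> J = (\<Sum>i\<in>UNIV. \<Sum>j\<in>UNIV. A $ i $ j * n $ j * J $ i)"
  by (simp add: inner_vec_def matrix_vector_mult_def sum_distrib_right)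

lemma poly_fields_smooth: "polyvec k P \<Longrightarrow> smoothvec P" "polymat k A \<Longrightarrow> smooth (\<lambda>x. A x $ i $ j)"
  unfolding polyvec_def smoothvec_def polymat_def using poly3_smooth by blast+

context
  fixes \<T> :: "pt set set" and \<Omega> :: "pt set"
  assumes m: "mesh \<T> \<Omega>" and dom: "lipschitz_domain \<Omega>"
begin

lemma fjump_zero:
  assumes F: "F \<in> mfacets \<T>"
    and z: "\<And>l. \<forall>i. (\<Sum>T\<in>adj \<T> F. trvec T v x $ l * onormal T F $ i) = 0"
  shows "fjump \<T> v F x = 0"
proof -
  note nn = norm_fnormal[OF m dom F]
  show ?thesis
    using F
  proof (cases rule: adj_cases[OF m dom, consumes 1, case_names boundary inner])
    case boundary
    have "trvec (fT1 \<T> F) v x $ l = 0" for l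
      by (rule ball_all_components_zero[OF nn]) (use z[of l] in \<open>simp add: boundary(1) fnormal_def\<close>)
    then show ?thesis by (simp add: boundary(2) vec_eq_iff)
  next
    case (inner T2)
    have "trvec (fT1 \<T> F) v x $ l - trvec T2 v x $ l = 0" for l
      by (rule ball_all_components_zero[OF nn])
        (use z[of l] inner(1,3) in \<open>simp add: inner(2) fnormal_def[symmetric] left_diff_distrib\<close>)
    then show ?thesis by (simp add: inner(4) vec_eq_iff)
  qed
qed

lemma consistency_sigma:
  assumes nu: "\<nu> > 0" and u: "H10vec \<Omega> u" and sig: "H1mat \<Omega> \<sigma>"
    and eq1: "AE x in lebesgue. x \<in> \<Omega> \<longrightarrow> (1 / \<nu>) *\<^sub>R dev (\<sigma> x) - wgrad \<Omega> u x = 0"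
    and y: "AE x in lebesgue. x \<in> \<Omega> \<longrightarrow> y x = u x"
    and \<tau>: "Sigmah \<T> k \<tau>"
  shows "aform \<nu> \<Omega> \<sigma> \<tau> + bform \<T> \<tau> y = 0"
proof -
  obtain P where P: "\<And>T. T \<in> \<T> \<Longrightarrow> polymat k (P T)" "\<And>T x. T \<in> \<T> \<Longrightarrow> x \<in> interior T \<Longrightarrow> \<tau> x = P T x"
    "\<And>T x. T \<in> \<T> \<Longrightarrow> mtr (P T x) = 0"
    using \<tau> unfolding Sigmah_def by metis
  have u10: "H10 \<Omega> (\<lambda>x. u x $ i)" for i using u by (simp add: H10vec_def)
  then have u1: "H1 \<Omega> (\<lambda>x. u x $ i)" for i by (simp add: H10_def)
  define d where "d i j = wpartial \<Omega> j (\<lambda>x. u x $ i)" for i j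
  have d: "is_wpartial \<Omega> j (\<lambda>x. u x $ i) (d i j)" for i j
    unfolding d_def by (rule wpartial_is_wpartial[OF u1])
  have Ls: "L2 \<Omega> (\<lambda>x. \<sigma> x $ i $ j)" for i j using sig by (simp add: H1mat_def H1_def)
  have yT: "AE x in lebesgue. x \<in> interior T \<longrightarrow> y x = u x" if "T \<in> \<T>" for T
    using y by eventually_elim (use mesh_interior_subset[OF m dom that] in auto)
  have vol: "AE x in lebesgue. (x \<in> T \<longleftrightarrow> x \<in> T) \<and> (x \<in> T \<longrightarrow> \<tau> x \<bullet> wgrad (interior T) y x = (1 / \<nu>) * (\<sigma> x \<bullet> \<tau> x))"
    if T: "T \<in> \<T>" for T
  proof -
    note tet = mesh_tetra[OF m T]
    note U = open_interior[of T] bounded_tetra_interior[OF tet]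
    have wg: "wgrad (interior T) y = wgrad (interior T) u" by (rule wgrad_cong[OF yT[OF T]])
    show ?thesis
      using AE_tetra_interior[OF tet] eq1 wgrad_eq[OF Omega_open[OF m dom] Omega_bounded[OF m dom] d]
        wgrad_eq[OF U mesh_wpartial[OF m dom d T]]
    proof eventually_elim
      case (elim x)
      show ?case
      proof (intro conjI impI refl)
        assume "x \<in> T"
        then have x: "x \<in> interior T" using elim(1) by blast
        then have xO: "x \<in> \<Omega>" using mesh_interior_subset[OF m dom T] by blast
        have "wgrad (interior T) u x = wgrad \<Omega> u x"
          using elim(3,4) x xO by (simp add: vec_eq_iff)
        also have "\<dots> = (1 / \<nu>) *\<^sub>R dev (\<sigma> x)" using elim(2) xO by simp
        finally have "wgrad (interior T) y x = (1 / \<nu>) *\<^sub>R dev (\<sigma> x)" by (simp add: wg)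
        then show "\<tau> x \<bullet> wgrad (interior T) y x = (1 / \<nu>) * (\<sigma> x \<bullet> \<tau> x)"
          using dev_inner_tracefree[of "\<tau> x" "\<sigma> x"] P(2)[OF T x] P(3)[OF T] by (simp add: inner_commute)
      qed
    qed
  qed
  have int: "set_integrable lebesgue T (\<lambda>x. (1 / \<nu>) * (\<sigma> x \<bullet> \<tau> x))" if T: "T \<in> \<T>" for T
  proof (rule tetra_integrable[OF mesh_tetra[OF m T]])
    note tet = mesh_tetra[OF m T]
    have L: "L2 (interior T) (\<lambda>x. \<sigma> x $ i $ j)" "L2 (interior T) (\<lambda>x. P T x $ i $ j)" for i j
      using L2_subset[OF Ls open_interior mesh_interior_subset[OF m dom T]]
        L2_smooth[OF open_interior bounded_tetra_interior[OF tet] poly_fields_smooth(2)[OF P(1)[OF T]]] by auto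
    have "set_integrable lebesgue (interior T) (\<lambda>x. (1 / \<nu>) * (\<Sum>i\<in>UNIV. \<Sum>j\<in>UNIV. \<sigma> x $ i $ j * P T x $ i $ j))"
      unfolding sum_3 by (intro set_integrable_mult_right set_integral_add L2_mult_integrable L)
    moreover have ae: "AE x in lebesgue. (x \<in> interior T \<longleftrightarrow> x \<in> interior T) \<and>
       (x \<in> interior T \<longrightarrow> (1 / \<nu>) * (\<Sum>i\<in>UNIV. \<Sum>j\<in>UNIV. \<sigma> x $ i $ j * P T x $ i $ j) = (1 / \<nu>) * (\<sigma> x \<bullet> \<tau> x))"
      using P(2)[OF T] by (intro AE_I2) (simp add: inner_mat3)
    ultimately show "set_integrable lebesgue (interior T) (\<lambda>x. (1 / \<nu>) * (\<sigma> x \<bullet> \<tau> x))"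
      by (simp only: set_integrable_cong_AE2[OF ae])
  qed
  have "(\<Sum>T\<in>\<T>. LINT x:T|lebesgue. \<tau> x \<bullet> wgrad (interior T) y x) = (\<Sum>T\<in>\<T>. LINT x:T|lebesgue. (1 / \<nu>) * (\<sigma> x \<bullet> \<tau> x))"
    by (intro sum.cong refl set_lebesgue_integral_cong_AE2 vol)
  also have "\<dots> = (LINT x:\<Omega>|lebesgue. (1 / \<nu>) * (\<sigma> x \<bullet> \<tau> x))"
    by (rule mesh_integral[OF m dom int, symmetric])
  also have "\<dots> = aform \<nu> \<Omega> \<sigma> \<tau>" by (simp add: aform_def)
  finally have V: "(\<Sum>T\<in>\<T>. LINT x:T|lebesgue. \<tau> x \<bullet> wgrad (interior T) y x) = aform \<nu> \<Omega> \<sigma> \<tau>" .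
  \<comment> \<open>\<open>y\<close> equals \<open>u\<close> only almost everywhere in the domain,
    which says nothing about facets; the traces agree at every point because the choices
    coincide.\<close>
  have tr: "trvec T y x $ l = trace_s T (\<lambda>x. u x $ l) x" if "T \<in> \<T>" for T x l
  proof -
    have "AE x in lebesgue. x \<in> interior T \<longrightarrow> y x $ l = u x $ l" using yT[OF that] by eventually_elim simp
    from trace_s_cong[OF mesh_tetra[OF m that] this] show ?thesis by (simp add: trvec_def)
  qed
  have "facet_integral F (\<lambda>x. ntc (fnormal \<T> F) (trmat (fT1 \<T> F) \<tau> x) \<bullet> tang (fnormal \<T> F) (fjump \<T> y F x)) = 0"
    if F: "F \<in> mfacets \<T>" for F
  proof (rule facet_integral_AE_zero)
    have "facet_AE F (\<lambda>x. \<forall>l. \<forall>i. (\<Sum>T\<in>adj \<T> F. trace_s T (\<lambda>x. u x $ l) x * onormal T F $ i) = 0)"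
      by (rule facet_AE_all, rule H10_trace_jump[OF m dom u10 F])
    then show "facet_AE F (\<lambda>x. ntc (fnormal \<T> F) (trmat (fT1 \<T> F) \<tau> x) \<bullet> tang (fnormal \<T> F) (fjump \<T> y F x) = 0)"
    proof (rule facet_AE_mp)
      fix x assume x: "\<forall>l. \<forall>i. (\<Sum>T\<in>adj \<T> F. trace_s T (\<lambda>x. u x $ l) x * onormal T F $ i) = 0"
      have "fjump \<T> y F x = 0"
      proof (rule fjump_zero[OF F])
        fix l
        show "\<forall>i. (\<Sum>T\<in>adj \<T> F. trvec T y x $ l * onormal T F $ i) = 0"
          using x tr adjD[OF m dom] by (simp cong: sum.cong)
      qed
      then show "ntc (fnormal \<T> F) (trmat (fT1 \<T> F) \<tau> x) \<bullet> tang (fnormal \<T> F) (fjump \<T> y F x) = 0"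
        by (simp add: tang_def)
    qed
  qed
  then show ?thesis by (simp add: bform_def V)
qed

text \<open>In row \<open>i\<close> of the weak momentum equation the derivatives on the test
  function are moved to \<open>\<sigma>\<close>, which has weak partials. What remains is the
  defining identity of a weak partial of \<open>p\<close>.\<close>

lemma pressure_H1:
  assumes fL2: "L2 \<Omega> f" and sig: "H1mat \<Omega> \<sigma>" and p: "L2 \<Omega> p"
    and eq2: "\<forall>g i. test_fun \<Omega> g \<longrightarrow>
       - (LINT x:\<Omega>|lebesgue. (\<Sum>j\<in>UNIV. \<sigma> x $ i $ j * cpartial j g x))
       + (LINT x:\<Omega>|lebesgue. p x * cpartial i g x)
       = - (LINT x:\<Omega>|lebesgue. f x $ i * g x)"
  shows "is_wpartial \<Omega> i p (\<lambda>x. (\<Sum>j\<in>UNIV. wpartial \<Omega> j (\<lambda>x. \<sigma> x $ i $ j) x) + f x $ i)"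
proof -
  define W where "W j = wpartial \<Omega> j (\<lambda>x. \<sigma> x $ i $ j)" for j
  have s1: "H1 \<Omega> (\<lambda>x. \<sigma> x $ i $ j)" for j using sig by (simp add: H1mat_def)
  have W: "is_wpartial \<Omega> j (\<lambda>x. \<sigma> x $ i $ j) (W j)" for j unfolding W_def by (rule wpartial_is_wpartial[OF s1])
  have L: "L2 \<Omega> (W j)" "L2 \<Omega> (\<lambda>x. \<sigma> x $ i $ j)" "L2 \<Omega> (\<lambda>x. f x $ i)" for j
    using W[of j] s1[of j] L2_component[OF fL2] by (auto simp: is_wpartial_def H1_def)
  have "is_wpartial \<Omega> i p (\<lambda>x. (\<Sum>j\<in>UNIV. W j x) + f x $ i)"
    unfolding is_wpartial_def
  proof (intro conjI allI impI)
    show "L2 \<Omega> (\<lambda>x. (\<Sum>j\<in>UNIV. W j x) + f x $ i)" by (intro L2_add L2_sum L)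
    fix g assume g: "test_fun \<Omega> g"
    have Lg: "L2 \<Omega> g" "L2 \<Omega> (cpartial j g)" for j
      using test_fun_smooth[OF g] by (auto intro!: L2_smooth Omega_open[OF m dom] Omega_bounded[OF m dom] smooth_cpartial)
    have "(LINT x:\<Omega>|lebesgue. (\<Sum>j\<in>UNIV. \<sigma> x $ i $ j * cpartial j g x)) = (\<Sum>j\<in>UNIV. LINT x:\<Omega>|lebesgue. \<sigma> x $ i $ j * cpartial j g x)"
      unfolding sum_3 by (simp add: set_integral_add L2_mult_integrable L Lg)
    also have "\<dots> = - (\<Sum>j\<in>UNIV. LINT x:\<Omega>|lebesgue. W j x * g x)"
      using W g by (simp add: is_wpartial_def sum_negf)
    finally have 1: "(LINT x:\<Omega>|lebesgue. (\<Sum>j\<in>UNIV. \<sigma> x $ i $ j * cpartial j g x)) = - (\<Sum>j\<in>UNIV. LINT x:\<Omega>|lebesgue. W j x * g x)" .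
    have 2: "- (LINT x:\<Omega>|lebesgue. (\<Sum>j\<in>UNIV. \<sigma> x $ i $ j * cpartial j g x)) + (LINT x:\<Omega>|lebesgue. p x * cpartial i g x)
        = - (LINT x:\<Omega>|lebesgue. f x $ i * g x)" using eq2 g by blast
    have "(LINT x:\<Omega>|lebesgue. ((\<Sum>j\<in>UNIV. W j x) + f x $ i) * g x)
        = (\<Sum>j\<in>UNIV. LINT x:\<Omega>|lebesgue. W j x * g x) + (LINT x:\<Omega>|lebesgue. f x $ i * g x)"
      unfolding sum_3 distrib_right by (simp add: set_integral_add L2_mult_integrable L Lg)
    then show "(LINT x:\<Omega>|lebesgue. p x * cpartial i g x) = - (LINT x:\<Omega>|lebesgue. ((\<Sum>j\<in>UNIV. W j x) + f x $ i) * g x)"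
      using 1 2 by linarith
  qed
  then show ?thesis by (simp add: W_def)
qed

text \<open>On each tetrahedron the divergence of \<open>g * Q T\<close> is
  \<open>Q T \<bullet> cgrad g\<close>, as \<open>Q T\<close> is divergence free. The divergence
  theorem and summation express the vanishing integral \<open>orth\<close> through the normal jumps
  weighted by \<open>g\<close>, and these are localised facet by facet.\<close>

lemma normal_jump_zero:
  assumes q: "\<And>T. T \<in> \<T> \<Longrightarrow> smoothvec (Q T)" and div: "\<And>T x. T \<in> \<T> \<Longrightarrow> (\<Sum>i\<in>UNIV. cpartial i (\<lambda>x. Q T x $ i) x) = 0"
    and c: "\<And>T. T \<in> \<T> \<Longrightarrow> AE x in lebesgue. x \<in> interior T \<longrightarrow> c x = Q T x"
    and orth: "\<And>g. smooth g \<Longrightarrow> (LINT x:\<Omega>|lebesgue. c x \<bullet> cgrad g x) = 0"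
    and F0: "F0 \<in> mfacets \<T>"
  shows "facet_AE F0 (\<lambda>x. (\<Sum>T\<in>adj \<T> F0. Q T x \<bullet> onormal T F0) = 0)"
proof -
  have qs: "smooth (\<lambda>x. Q T x $ i)" if "T \<in> \<T>" for T i using q[OF that] by (simp add: smoothvec_def)
  have qi: "facet_int F (\<lambda>x. Q T x \<bullet> onormal T F * g x)" if "T \<in> \<T>" "smooth g" for T F g
    unfolding inner_vec_def inner_real_def
    by (intro facet_int_continuous continuous_intros smooth_continuous qs that)
  have qi1: "facet_int F (\<lambda>x. Q T x \<bullet> onormal T F)" if "T \<in> \<T>" for T F
    using qi[OF that smooth_const[of 1]] by simp
  show ?thesis
  proof (rule mesh_facet_zero[OF m dom, where H = "\<lambda>F x. \<Sum>T\<in>adj \<T> F. Q T x \<bullet> onormal T F" and U = UNIV])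
    show "facet_int F (\<lambda>x. \<Sum>T\<in>adj \<T> F. Q T x \<bullet> onormal T F)" for F
      using adjD[OF m dom] by (intro facet_int_sum qi1) blast
    fix g assume "test_fun UNIV g"
    then have g: "smooth g" by (rule test_fun_smooth)
    have loc: "(LINT x:T|lebesgue. c x \<bullet> cgrad g x) = (\<Sum>F\<in>facets T. facet_integral F (\<lambda>x. Q T x \<bullet> onormal T F * g x))"
      and locint: "set_integrable lebesgue T (\<lambda>x. c x \<bullet> cgrad g x)" if T: "T \<in> \<T>" for T
    proof -
      note tet = mesh_tetra[OF m T]
      let ?D = "\<lambda>x. \<Sum>i\<in>UNIV. cpartial i (\<lambda>x. g x * Q T x $ i) x"
      have eq: "?D x = Q T x \<bullet> cgrad g x" for x
      proof -
        have "?D x = (\<Sum>i\<in>UNIV. g x * cpartial i (\<lambda>x. Q T x $ i) x) + (\<Sum>i\<in>UNIV. cpartial i g x * Q T x $ i)"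
          by (simp add: cpartial_mult[OF g qs[OF T]] sum.distrib)
        also have "(\<Sum>i\<in>UNIV. g x * cpartial i (\<lambda>x. Q T x $ i) x) = 0"
          using div[OF T] by (simp add: sum_distrib_left[symmetric])
        finally show ?thesis by (simp add: inner_vec_def cgrad_def mult.commute)
      qed
      have sm: "smooth (\<lambda>x. g x * Q T x $ i)" "smooth ?D" for i
        by (intro smooth_mult g qs[OF T] smooth_sum smooth_cpartial)+
      have ae: "AE x in lebesgue. (x \<in> T \<longleftrightarrow> x \<in> T) \<and> (x \<in> T \<longrightarrow> ?D x = c x \<bullet> cgrad g x)"
        using AE_tetra_interior[OF tet] c[OF T] by eventually_elim (simp add: eq)
      have Tm: "T \<in> sets borel" using compact_tetra[OF tet] by (rule borel_compact)
      have si: "set_integrable lborel T (cpartial i (\<lambda>x. g x * Q T x $ i))" for i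
        by (intro smooth_integrable_tetra tet smooth_continuous smooth_cpartial sm)
      have Dm: "(\<lambda>x. indicator T x *\<^sub>R ?D x) \<in> borel_measurable lborel"
        using smooth_measurable[OF sm(2)] Tm by simp
      have "set_integrable lborel T ?D" by (intro smooth_integrable_tetra tet smooth_continuous sm)
      then have "set_integrable lebesgue T ?D"
        unfolding set_integrable_def integrable_completion[OF Dm] .
      then show "set_integrable lebesgue T (\<lambda>x. c x \<bullet> cgrad g x)"
        by (simp only: set_integrable_cong_AE2[OF ae])
      have "(LINT x:T|lebesgue. c x \<bullet> cgrad g x) = (LINT x:T|lebesgue. ?D x)"
        by (rule set_lebesgue_integral_cong_AE2[OF ae, symmetric])
      also have "\<dots> = (LINT x:T|lborel. ?D x)"
        unfolding set_lebesgue_integral_def by (rule integral_completion[OF Dm])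
      also have "\<dots> = (\<Sum>i\<in>UNIV. LINT x:T|lborel. cpartial i (\<lambda>x. g x * Q T x $ i) x)"
        using si unfolding sum_3 by (simp add: set_integral_add)
      also have "\<dots> = (\<Sum>i\<in>UNIV. \<Sum>F\<in>facets T. facet_integral F (\<lambda>x. g x * Q T x $ i * onormal T F $ i))"
        by (simp add: tetra_divergence[OF tet sm(1)])
      also have "\<dots> = (\<Sum>F\<in>facets T. \<Sum>i\<in>UNIV. facet_integral F (\<lambda>x. g x * Q T x $ i * onormal T F $ i))"
        by (rule sum.swap)
      also have "\<dots> = (\<Sum>F\<in>facets T. facet_integral F (\<lambda>x. \<Sum>i\<in>UNIV. g x * Q T x $ i * onormal T F $ i))"
        by (intro sum.cong refl facet_integral_sum[symmetric] facet_int_cmult facet_int_continuous smooth_continuous sm)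
      finally show "(LINT x:T|lebesgue. c x \<bullet> cgrad g x) = (\<Sum>F\<in>facets T. facet_integral F (\<lambda>x. Q T x \<bullet> onormal T F * g x))"
        by (simp add: inner_vec_def sum_distrib_left mult_ac)
    qed
    have "0 = (LINT x:\<Omega>|lebesgue. c x \<bullet> cgrad g x)" using orth[OF g] by simp
    also have "\<dots> = (\<Sum>T\<in>\<T>. \<Sum>F\<in>facets T. facet_integral F (\<lambda>x. Q T x \<bullet> onormal T F * g x))"
      using mesh_integral[OF m dom locint] loc by simp
    also have "\<dots> = (\<Sum>F\<in>mfacets \<T>. \<Sum>T\<in>adj \<T> F. facet_integral F (\<lambda>x. Q T x \<bullet> onormal T F * g x))"
      by (rule sum_facets_swap[OF m dom])
    also have "\<dots> = (\<Sum>F\<in>mfacets \<T>. facet_integral F (\<lambda>x. \<Sum>T\<in>adj \<T> F. Q T x \<bullet> onormal T F * g x))"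
      using adjD[OF m dom] by (intro sum.cong refl facet_integral_sum[symmetric] qi[OF _ g]) blast
    finally show "(\<Sum>F\<in>mfacets \<T>. facet_integral F (\<lambda>x. (\<Sum>T\<in>adj \<T> F. Q T x \<bullet> onormal T F) * g x)) = 0"
      by (simp add: sum_distrib_right)
  qed (use F0 in auto)
qed

text \<open>For single-valued \<open>S\<close> and \<open>p\<close> the sum on the right is
  \<open>(S n) \<bullet> J - p (J \<bullet> n)\<close> with the jump \<open>J\<close>. Since
  \<open>J \<bullet> n = 0\<close>, the pressure term drops, and subtracting the normal-normal part
  of \<open>S\<close> changes nothing.\<close>

lemma facet_pairing:
  fixes S :: mat3 and q :: "pt set \<Rightarrow> real^3" and r :: "pt set \<Rightarrow> real" and s :: "pt set \<Rightarrow> mat3"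
  assumes F: "F \<in> mfacets \<T>"
    and s: "\<And>T. T \<in> adj \<T> F \<Longrightarrow> s T = S" and r: "\<And>T. T \<in> adj \<T> F \<Longrightarrow> r T = p"
    and q: "\<And>T. T \<in> adj \<T> F \<Longrightarrow> trvec T v x = q T"
    and n: "(\<Sum>T\<in>adj \<T> F. q T \<bullet> onormal T F) = 0"
  shows "ntc (fnormal \<T> F) S \<bullet> tang (fnormal \<T> F) (fjump \<T> v F x)
    = (\<Sum>T\<in>adj \<T> F. (s T *v onormal T F) \<bullet> q T - r T * (q T \<bullet> onormal T F))"
proof -
  let ?n = "fnormal \<T> F"
  note nn = norm_fnormal[OF m dom F]
  show ?thesis
    using F
  proof (cases rule: adj_cases[OF m dom, consumes 1, case_names boundary inner])
    case boundary
    have J: "fjump \<T> v F x = q (fT1 \<T> F)" using boundary q by simp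
    have "q (fT1 \<T> F) \<bullet> ?n = 0" using n by (simp add: boundary(1) fnormal_def)
    then show ?thesis
      using s r by (simp add: ntc_tang[OF nn] J boundary(1) fnormal_def[symmetric])
  next
    case (inner T2)
    have J: "fjump \<T> v F x = q (fT1 \<T> F) - q T2" using inner q by simp
    have z: "q T2 \<bullet> ?n = q (fT1 \<T> F) \<bullet> ?n"
      using n inner(1) by (simp add: inner(2) inner(3) fnormal_def[symmetric])
    have "S *v (- ?n) = - (S *v ?n)"
      by (simp add: matrix_vector_mult_def vec_eq_iff sum_negf)
    then show ?thesis
      using s r inner(1) by (simp add: ntc_tang[OF nn] J inner(2,3) fnormal_def[symmetric] inner_diff_left inner_diff_right z)
  qed
qed

lemma consistency_curl:
  assumes fL2: "L2 \<Omega> f" and sig: "H1mat \<Omega> \<sigma>" and p: "L2 \<Omega> p"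
    and eq2: "\<forall>g i. test_fun \<Omega> g \<longrightarrow>
       - (LINT x:\<Omega>|lebesgue. (\<Sum>j\<in>UNIV. \<sigma> x $ i $ j * cpartial j g x))
       + (LINT x:\<Omega>|lebesgue. p x * cpartial i g x)
       = - (LINT x:\<Omega>|lebesgue. f x $ i * g x)"
    and \<phi>: "Wh \<T> \<Omega> k \<phi>"
  shows "bform \<T> \<sigma> (wcurl \<Omega> \<phi>) = - (LINT x:\<Omega>|lebesgue. f x \<bullet> wcurl \<Omega> \<phi> x)"
proof -
  define v where "v = wcurl \<Omega> \<phi>"
  obtain P where P: "\<And>T. T \<in> \<T> \<Longrightarrow> polyvec k (P T)" "\<And>T x. T \<in> \<T> \<Longrightarrow> x \<in> interior T \<Longrightarrow> \<phi> x = P T x"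
    and h0: "H0curl \<Omega> \<phi>"
    using \<phi> unfolding Wh_def by metis
  obtain c where c: "is_wcurl \<Omega> \<phi> c" "\<And>w. smoothvec w \<Longrightarrow> (LINT x:\<Omega>|lebesgue. \<phi> x \<bullet> ccurl w x) = (LINT x:\<Omega>|lebesgue. c x \<bullet> w x)"
    using H0curl_is_wcurl[OF h0] by blast
  have vc: "is_wcurl \<Omega> \<phi> v" unfolding v_def by (rule wcurl_is_wcurl[OF c(1)])
  define Q where "Q T = ccurl (P T)" for T
  have Qs: "smoothvec (Q T)" if "T \<in> \<T>" for T
    unfolding Q_def by (intro smoothvec_ccurl poly_fields_smooth(1)[OF P(1)[OF that]])
  then have qs: "smooth (\<lambda>x. Q T x $ i)" if "T \<in> \<T>" for T i using that by (simp add: smoothvec_def)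
  have divQ: "(\<Sum>i\<in>UNIV. cpartial i (\<lambda>x. Q T x $ i) x) = 0" if "T \<in> \<T>" for T x
    unfolding Q_def by (rule div_ccurl[OF poly_fields_smooth(1)[OF P(1)[OF that]]])
  have vQ: "AE x in lebesgue. x \<in> interior T \<longrightarrow> v x = Q T x" if T: "T \<in> \<T>" for T
    unfolding Q_def by (rule piecewise_curl[OF m dom T poly_fields_smooth(1)[OF P(1)[OF T]] P(2)[OF T] vc])
  \<comment> \<open>Two weak curls are in play: \<open>v\<close> is the chosen one in the claim,
    while the formula against all smooth fields, hence the orthogonality to gradients, is known for
    \<open>c\<close>. Both agree with \<open>Q T\<close> on each tetrahedron.\<close>
  have cQ: "AE x in lebesgue. x \<in> interior T \<longrightarrow> c x = Q T x" if T: "T \<in> \<T>" for T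
    unfolding Q_def by (rule piecewise_curl[OF m dom T poly_fields_smooth(1)[OF P(1)[OF T]] P(2)[OF T] c(1)])
  have orth: "(LINT x:\<Omega>|lebesgue. c x \<bullet> cgrad g x) = 0" if "smooth g" for g
    using c(2)[OF smoothvec_cgrad[OF that]] by (simp add: ccurl_cgrad[OF that])
  define W where "W i j = wpartial \<Omega> j (\<lambda>x. \<sigma> x $ i $ j)" for i j
  have s1: "H1 \<Omega> (\<lambda>x. \<sigma> x $ i $ j)" for i j using sig by (simp add: H1mat_def)
  have W: "is_wpartial \<Omega> j (\<lambda>x. \<sigma> x $ i $ j) (W i j)" for i j unfolding W_def by (rule wpartial_is_wpartial[OF s1])
  define d where "d i x = (\<Sum>j\<in>UNIV. W i j x) + f x $ i" for i x
  have d: "is_wpartial \<Omega> i p (d i)" for i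
    using pressure_H1[OF fL2 sig p eq2, of i] by (simp add: d_def[abs_def] W_def)
  have p1: "H1 \<Omega> p" using p d by (auto simp: H1_def)
  \<comment> \<open>The facet integrand \<open>(\<sigma> n) \<bullet> Q - p (Q \<bullet> n)\<close>,
    expanded so that each summand is a trace times a continuous function times a constant, which
    makes it integrable on the facet.\<close>
  define X where "X T F x = (\<Sum>i\<in>UNIV. \<Sum>j\<in>UNIV. trace_s T (\<lambda>x. \<sigma> x $ i $ j) x * Q T x $ i * onormal T F $ j)
      - (\<Sum>i\<in>UNIV. trace_s T p x * Q T x $ i * onormal T F $ i)" for T F x
  have Xi: "facet_int F (X T F)" if T: "T \<in> adj \<T> F" for T F
    unfolding X_def using adjD[OF m dom T]
    by (intro facet_int_diff facet_int_sum facet_int_cmult facet_int_mult_continuous trace_facet_int[OF m dom]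
        mesh_H1[OF m dom] s1 p1 smooth_continuous qs) auto
  have loc: "(LINT x:T|lebesgue. \<sigma> x \<bullet> wgrad (interior T) v x) = (LINT x:T|lebesgue. f x \<bullet> v x) + (\<Sum>F\<in>facets T. facet_integral F (X T F))"
    and locint: "set_integrable lebesgue T (\<lambda>x. f x \<bullet> v x)" if T: "T \<in> \<T>" for T
  proof -
    note tet = mesh_tetra[OF m T]
    let ?U = "interior T"
    note U = open_interior[of T] bounded_tetra_interior[OF tet]
    note sub = mesh_interior_subset[OF m dom T]
    have LQ: "L2 ?U (\<lambda>x. Q T x $ i)" "L2 ?U (cpartial j (\<lambda>x. Q T x $ i))" for i j
      by (intro L2_smooth U smooth_cpartial qs[OF T])+
    have Lo: "L2 \<Omega> (\<lambda>x. \<sigma> x $ i $ j)" "L2 \<Omega> (W i j)" "L2 \<Omega> (\<lambda>x. f x $ i)" "L2 \<Omega> (d i)" for i j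
      using s1 W d L2_component[OF fL2] by (auto simp: H1_def is_wpartial_def)
    note L = Lo[THEN L2_subset, OF U(1) sub] p[THEN L2_subset, OF U(1) sub]
    have wg: "AE x in lebesgue. x \<in> ?U \<longrightarrow> (\<forall>i j. wgrad ?U v x $ i $ j = cpartial j (\<lambda>x. Q T x $ i) x)"
    proof (rule wgrad_eq[OF U])
      fix i j
      have ae: "AE x in lebesgue. x \<in> ?U \<longrightarrow> v x $ i = Q T x $ i" using vQ[OF T] by eventually_elim simp
      show "is_wpartial ?U j (\<lambda>x. v x $ i) (cpartial j (\<lambda>x. Q T x $ i))"
        unfolding is_wpartial_cong[OF ae] by (rule smooth_is_wpartial[OF tet U qs[OF T]])
    qed
    \<comment> \<open>\<open>A\<close> is
      \<open>div \<sigma> \<bullet> Q + \<sigma> : \<nabla>Q\<close> and \<open>B\<close> is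
      \<open>\<nabla>p \<bullet> Q + p div Q\<close>, the two volume sides of Green's formula. With
      \<open>\<nabla>p = div \<sigma> + f\<close> and \<open>div Q = 0\<close>, the sum of
      \<open>f \<bullet> Q\<close> and \<open>A - B\<close> is
      \<open>\<sigma> : \<nabla>Q\<close>.\<close>
    define A where "A x = (\<Sum>i\<in>UNIV. \<Sum>j\<in>UNIV. W i j x * Q T x $ i + \<sigma> x $ i $ j * cpartial j (\<lambda>x. Q T x $ i) x)" for x
    define B where "B x = (\<Sum>i\<in>UNIV. d i x * Q T x $ i + p x * cpartial i (\<lambda>x. Q T x $ i) x)" for x
    have Gi: "set_integrable lebesgue T (\<lambda>x. W i j x * Q T x $ i + \<sigma> x $ i $ j * cpartial j (\<lambda>x. Q T x $ i) x)"
      "set_integrable lebesgue T (\<lambda>x. d i x * Q T x $ i + p x * cpartial i (\<lambda>x. Q T x $ i) x)"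
      "set_integrable lebesgue T (\<lambda>x. f x $ i * Q T x $ i)" for i j
      by (intro tetra_integrable[OF tet] set_integral_add L2_mult_integrable L LQ)+
    have Ai: "set_integrable lebesgue T A" and Aint: "(LINT x:T|lebesgue. A x)
        = (\<Sum>i\<in>UNIV. \<Sum>j\<in>UNIV. LINT x:T|lebesgue. W i j x * Q T x $ i + \<sigma> x $ i $ j * cpartial j (\<lambda>x. Q T x $ i) x)"
      unfolding A_def[abs_def] sum_3 using Gi(1) by (simp_all only: set_integral_add)
    have Bi: "set_integrable lebesgue T B" and Bint: "(LINT x:T|lebesgue. B x)
        = (\<Sum>i\<in>UNIV. LINT x:T|lebesgue. d i x * Q T x $ i + p x * cpartial i (\<lambda>x. Q T x $ i) x)"
      unfolding B_def[abs_def] sum_3 using Gi(2) by (simp_all only: set_integral_add)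
    have fi: "set_integrable lebesgue T (\<lambda>x. f x \<bullet> Q T x)"
      unfolding inner_vec_def inner_real_def sum_3 by (intro set_integral_add Gi)
    have aef: "AE x in lebesgue. (x \<in> T \<longleftrightarrow> x \<in> T) \<and> (x \<in> T \<longrightarrow> f x \<bullet> Q T x = f x \<bullet> v x)"
      using AE_tetra_interior[OF tet] vQ[OF T] by eventually_elim simp
    show "set_integrable lebesgue T (\<lambda>x. f x \<bullet> v x)"
      using fi by (simp only: set_integrable_cong_AE2[OF aef])
    have "(LINT x:T|lebesgue. \<sigma> x \<bullet> wgrad ?U v x) = (LINT x:T|lebesgue. f x \<bullet> Q T x + (A x - B x))"
    proof (rule set_lebesgue_integral_cong_AE2, use AE_tetra_interior[OF tet] wg in eventually_elim)
      case (elim x)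
      have "B x = (\<Sum>i\<in>UNIV. d i x * Q T x $ i) + p x * (\<Sum>i\<in>UNIV. cpartial i (\<lambda>x. Q T x $ i) x)"
        by (simp add: B_def sum.distrib sum_distrib_left)
      also have "\<dots> = (\<Sum>i\<in>UNIV. \<Sum>j\<in>UNIV. W i j x * Q T x $ i) + f x \<bullet> Q T x"
        using divQ[OF T, of x] by (simp add: d_def inner_vec_def distrib_right sum.distrib sum_distrib_right)
      finally have "f x \<bullet> Q T x + (A x - B x) = (\<Sum>i\<in>UNIV. \<Sum>j\<in>UNIV. \<sigma> x $ i $ j * cpartial j (\<lambda>x. Q T x $ i) x)"
        by (simp add: A_def sum.distrib)
      then show ?case using elim by (simp add: inner_mat3)
    qed
    also have "\<dots> = (LINT x:T|lebesgue. f x \<bullet> Q T x) + ((LINT x:T|lebesgue. A x) - (LINT x:T|lebesgue. B x))"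
      using fi Ai Bi by (simp add: set_integral_add set_integral_diff)
    also have "(LINT x:T|lebesgue. f x \<bullet> Q T x) = (LINT x:T|lebesgue. f x \<bullet> v x)"
      by (rule set_lebesgue_integral_cong_AE2[OF aef])
    also have "(LINT x:T|lebesgue. A x) - (LINT x:T|lebesgue. B x) = (\<Sum>F\<in>facets T. facet_integral F (X T F))"
    proof -
      have tw: "H1 ?U (\<lambda>x. \<sigma> x $ i $ j)" "H1 ?U p" for i j by (intro mesh_H1[OF m dom _ T] s1 p1)+
      have fi1: "facet_int F (\<lambda>x. trace_s T (\<lambda>x. \<sigma> x $ i $ j) x * Q T x $ i * onormal T F $ j)"
        "facet_int F (\<lambda>x. trace_s T p x * Q T x $ i * onormal T F $ i)" if "F \<in> facets T" for F i j
        by (intro facet_int_cmult facet_int_mult_continuous trace_facet_int[OF m dom tet that] tw smooth_continuous qs[OF T])+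
      have "(LINT x:T|lebesgue. A x) = (\<Sum>i\<in>UNIV. \<Sum>j\<in>UNIV. \<Sum>F\<in>facets T. facet_integral F (\<lambda>x. trace_s T (\<lambda>x. \<sigma> x $ i $ j) x * Q T x $ i * onormal T F $ j))"
        unfolding Aint by (simp add: tetra_green[OF tet tw(1) mesh_wpartial[OF m dom W T] qs[OF T]])
      also have "\<dots> = (\<Sum>F\<in>facets T. \<Sum>i\<in>UNIV. \<Sum>j\<in>UNIV. facet_integral F (\<lambda>x. trace_s T (\<lambda>x. \<sigma> x $ i $ j) x * Q T x $ i * onormal T F $ j))"
        by (simp add: sum_3 sum.distrib)
      finally have 1: "(LINT x:T|lebesgue. A x) = (\<Sum>F\<in>facets T. \<Sum>i\<in>UNIV. \<Sum>j\<in>UNIV. facet_integral F (\<lambda>x. trace_s T (\<lambda>x. \<sigma> x $ i $ j) x * Q T x $ i * onormal T F $ j))" .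
      have "(LINT x:T|lebesgue. B x) = (\<Sum>i\<in>UNIV. \<Sum>F\<in>facets T. facet_integral F (\<lambda>x. trace_s T p x * Q T x $ i * onormal T F $ i))"
        unfolding Bint by (simp add: tetra_green[OF tet tw(2) mesh_wpartial[OF m dom d T] qs[OF T]])
      also have "\<dots> = (\<Sum>F\<in>facets T. \<Sum>i\<in>UNIV. facet_integral F (\<lambda>x. trace_s T p x * Q T x $ i * onormal T F $ i))"
        by (rule sum.swap)
      finally have 2: "(LINT x:T|lebesgue. B x) = (\<Sum>F\<in>facets T. \<Sum>i\<in>UNIV. facet_integral F (\<lambda>x. trace_s T p x * Q T x $ i * onormal T F $ i))" .
      have "facet_integral F (X T F) = (\<Sum>i\<in>UNIV. \<Sum>j\<in>UNIV. facet_integral F (\<lambda>x. trace_s T (\<lambda>x. \<sigma> x $ i $ j) x * Q T x $ i * onormal T F $ j))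
          - (\<Sum>i\<in>UNIV. facet_integral F (\<lambda>x. trace_s T p x * Q T x $ i * onormal T F $ i))" if F: "F \<in> facets T" for F
        unfolding X_def[abs_def] using fi1[OF F]
        by (subst facet_integral_diff) (simp_all add: facet_int_sum facet_integral_sum)
      then show ?thesis unfolding 1 2 by (simp add: sum_subtractf)
    qed
    finally show "(LINT x:T|lebesgue. \<sigma> x \<bullet> wgrad ?U v x) = (LINT x:T|lebesgue. f x \<bullet> v x) + (\<Sum>F\<in>facets T. facet_integral F (X T F))" .
  qed
  have vol: "(\<Sum>T\<in>\<T>. LINT x:T|lebesgue. \<sigma> x \<bullet> wgrad (interior T) v x)
      = (LINT x:\<Omega>|lebesgue. f x \<bullet> v x) + (\<Sum>F\<in>mfacets \<T>. facet_integral F (\<lambda>x. \<Sum>T\<in>adj \<T> F. X T F x))"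
  proof -
    have "(\<Sum>T\<in>\<T>. LINT x:T|lebesgue. \<sigma> x \<bullet> wgrad (interior T) v x)
        = (LINT x:\<Omega>|lebesgue. f x \<bullet> v x) + (\<Sum>T\<in>\<T>. \<Sum>F\<in>facets T. facet_integral F (X T F))"
      by (simp add: loc sum.distrib mesh_integral[OF m dom locint])
    also have "(\<Sum>T\<in>\<T>. \<Sum>F\<in>facets T. facet_integral F (X T F)) = (\<Sum>F\<in>mfacets \<T>. \<Sum>T\<in>adj \<T> F. facet_integral F (X T F))"
      by (rule sum_facets_swap[OF m dom])
    also have "\<dots> = (\<Sum>F\<in>mfacets \<T>. facet_integral F (\<lambda>x. \<Sum>T\<in>adj \<T> F. X T F x))"
      by (intro sum.cong refl facet_integral_sum[symmetric] Xi)
    finally show ?thesis .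
  qed
  \<comment> \<open>The chosen trace of \<open>v\<close> is literally that of \<open>Q T\<close>,
    and a smooth function is one of its own traces, so uniqueness gives equality almost everywhere
    on the facet.\<close>
  have tr: "facet_AE F (\<lambda>x. trvec T v x = Q T x)" if F: "T \<in> adj \<T> F" for T F
  proof -
    note T = adjD[OF m dom F, THEN conjunct1] and FT = adjD[OF m dom F, THEN conjunct2, THEN conjunct1]
    note tet = mesh_tetra[OF m T]
    have ae: "AE x in lebesgue. x \<in> interior T \<longrightarrow> v x $ i = Q T x $ i" for i using vQ[OF T] by eventually_elim simp
    have "facet_AE F (\<lambda>x. trace_s T (\<lambda>x. Q T x $ i) x = Q T x $ i)" for i
      by (rule trace_unique[OF tet trace_s_is_trace[OF tet] is_trace_smooth[OF tet qs[OF T]] FT])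
        (rule smooth_H1[OF tet open_interior bounded_tetra_interior[OF tet] qs[OF T]])
    then have "facet_AE F (\<lambda>x. \<forall>i. trace_s T (\<lambda>x. Q T x $ i) x = Q T x $ i)" by (rule facet_AE_all)
    then show ?thesis
      by (rule facet_AE_mp) (simp add: trvec_def trace_s_cong[OF tet ae] vec_eq_iff)
  qed
  have "facet_integral F (\<lambda>x. ntc (fnormal \<T> F) (trmat (fT1 \<T> F) \<sigma> x) \<bullet> tang (fnormal \<T> F) (fjump \<T> v F x))
      = facet_integral F (\<lambda>x. \<Sum>T\<in>adj \<T> F. X T F x)" if F: "F \<in> mfacets \<T>" for F
  proof (rule facet_integral_cong_AE)
    let ?T1 = "fT1 \<T> F"
    note T1 = fT1_adj[OF m dom F]
    have all: "facet_AE F (\<lambda>x. \<forall>T. T \<in> adj \<T> F \<longrightarrow> Z T x)" if "\<And>T. T \<in> adj \<T> F \<Longrightarrow> facet_AE F (Z T)" for Z :: "pt set \<Rightarrow> pt \<Rightarrow> bool"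
    proof -
      have "AE st in lborel. \<forall>T\<in>adj \<T> F. st \<in> reftri \<longrightarrow> Z T (fparam F st)"
        using that by (intro AE_finite_allI adj_finite[OF m dom]) (simp add: facet_AE_def)
      then show ?thesis unfolding facet_AE_def by eventually_elim blast
    qed
    have sAE: "facet_AE F (\<lambda>x. \<forall>T. T \<in> adj \<T> F \<longrightarrow> trmat T \<sigma> x = trmat ?T1 \<sigma> x)"
    proof (rule all)
      fix T assume T: "T \<in> adj \<T> F"
      have "facet_AE F (\<lambda>x. \<forall>i. \<forall>j. trace_s T (\<lambda>x. \<sigma> x $ i $ j) x = trace_s ?T1 (\<lambda>x. \<sigma> x $ i $ j) x)"
        by (intro facet_AE_all H1_trace_continuous[OF m dom s1 T T1])
      then show "facet_AE F (\<lambda>x. trmat T \<sigma> x = trmat ?T1 \<sigma> x)"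
        by (rule facet_AE_mp) (simp add: trmat_def vec_eq_iff)
    qed
    have pAE: "facet_AE F (\<lambda>x. \<forall>T. T \<in> adj \<T> F \<longrightarrow> trace_s T p x = trace_s ?T1 p x)"
      by (rule all) (rule H1_trace_continuous[OF m dom p1 _ T1])
    have tAE: "facet_AE F (\<lambda>x. \<forall>T. T \<in> adj \<T> F \<longrightarrow> trvec T v x = Q T x)"
      by (rule all) (rule tr)
    have nAE: "facet_AE F (\<lambda>x. (\<Sum>T\<in>adj \<T> F. Q T x \<bullet> onormal T F) = 0)"
      by (rule normal_jump_zero[OF Qs divQ cQ orth F])
    show "facet_AE F (\<lambda>x. ntc (fnormal \<T> F) (trmat ?T1 \<sigma> x) \<bullet> tang (fnormal \<T> F) (fjump \<T> v F x) = (\<Sum>T\<in>adj \<T> F. X T F x))"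
    proof (rule facet_AE_mp[OF facet_AE_conj[OF sAE facet_AE_conj[OF pAE facet_AE_conj[OF tAE nAE]]]])
      fix x
      assume x: "(\<forall>T. T \<in> adj \<T> F \<longrightarrow> trmat T \<sigma> x = trmat ?T1 \<sigma> x) \<and> (\<forall>T. T \<in> adj \<T> F \<longrightarrow> trace_s T p x = trace_s ?T1 p x) \<and>
          (\<forall>T. T \<in> adj \<T> F \<longrightarrow> trvec T v x = Q T x) \<and> (\<Sum>T\<in>adj \<T> F. Q T x \<bullet> onormal T F) = 0"
      have "ntc (fnormal \<T> F) (trmat ?T1 \<sigma> x) \<bullet> tang (fnormal \<T> F) (fjump \<T> v F x)
        = (\<Sum>T\<in>adj \<T> F. (trmat T \<sigma> x *v onormal T F) \<bullet> Q T x - trace_s T p x * (Q T x \<bullet> onormal T F))"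
        by (rule facet_pairing[OF F, where s = "\<lambda>T. trmat T \<sigma> x" and r = "\<lambda>T. trace_s T p x" and q = "\<lambda>T. Q T x"])
          (use x in blast)+
      also have "\<dots> = (\<Sum>T\<in>adj \<T> F. X T F x)"
      proof (intro sum.cong refl)
        fix T
        have e1: "(trmat T \<sigma> x *v onormal T F) \<bullet> Q T x
            = (\<Sum>i\<in>UNIV. \<Sum>j\<in>UNIV. trace_s T (\<lambda>x. \<sigma> x $ i $ j) x * Q T x $ i * onormal T F $ j)"
          by (simp only: matrix_vector_inner trmat_def vec_lambda_beta mult_ac)
        have e2: "trace_s T p x * (Q T x \<bullet> onormal T F) = (\<Sum>i\<in>UNIV. trace_s T p x * Q T x $ i * onormal T F $ i)"
          by (simp add: inner_vec_def sum_distrib_left mult.assoc)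
        show "(trmat T \<sigma> x *v onormal T F) \<bullet> Q T x - trace_s T p x * (Q T x \<bullet> onormal T F) = X T F x"
          by (simp only: X_def e1 e2)
      qed
      finally show "ntc (fnormal \<T> F) (trmat ?T1 \<sigma> x) \<bullet> tang (fnormal \<T> F) (fjump \<T> v F x) = (\<Sum>T\<in>adj \<T> F. X T F x)" .
    qed
    show "facet_meas F (\<lambda>x. \<Sum>T\<in>adj \<T> F. X T F x)" by (intro facet_int_meas facet_int_sum Xi)
    \<comment> \<open>\<open>v\<close> agrees with a smooth field only almost everywhere, but this
      puts its components into \<open>H1\<close> of the tetrahedron, so their traces exist and are
      measurable on facets.\<close>
    have vH1: "H1 (interior T) (\<lambda>x. v x $ i)" if T: "T \<in> \<T>" for T i
    proof -
      note tet = mesh_tetra[OF m T]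
      have ae: "AE x in lebesgue. x \<in> interior T \<longrightarrow> Q T x $ i = v x $ i" using vQ[OF T] by eventually_elim simp
      have "H1 (interior T) (\<lambda>x. Q T x $ i)" by (rule smooth_H1[OF tet open_interior bounded_tetra_interior[OF tet] qs[OF T]])
      then show ?thesis
        unfolding H1_def is_wpartial_cong[OF ae] using L2_cong[OF _ ae] by blast
    qed
    have tm: "facet_meas F (\<lambda>x. trvec T v x $ i)" if "T \<in> adj \<T> F" for T i
      using adjD[OF m dom that] trace_facet_int[OF m dom _ _ vH1, of T F i] by (auto simp: trvec_def intro!: facet_int_meas)
    have jm: "facet_meas F (\<lambda>x. fjump \<T> v F x $ i)" for i
      using F
    proof (cases rule: adj_cases[OF m dom, consumes 1, case_names boundary inner])
      case boundary
      then show ?thesis using tm by simp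
    next
      case (inner T2)
      then show ?thesis using tm by (simp add: facet_meas_diff)
    qed
    have sm: "facet_meas F (\<lambda>x. trmat ?T1 \<sigma> x $ i $ j)" for i j
      using adjD[OF m dom T1] trace_facet_int[OF m dom _ _ mesh_H1[OF m dom s1], of ?T1 F i j]
      by (auto simp: trmat_def intro!: facet_int_meas)
    show "facet_meas F (\<lambda>x. ntc (fnormal \<T> F) (trmat ?T1 \<sigma> x) \<bullet> tang (fnormal \<T> F) (fjump \<T> v F x))"
      unfolding ntc_tang[OF norm_fnormal[OF m dom F]] inner_commute[of "fnormal \<T> F"] matrix_vector_inner
      unfolding inner_vec_def inner_real_def
      by (intro facet_meas_diff facet_meas_sum facet_meas_mult facet_meas_const sm jm)
  qed
  then show ?thesis
    unfolding v_def[symmetric] bform_def vol by simp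
qed

end

theorem theorem5p6:
  fixes \<Omega> :: "(real^3) set" and \<T> :: "(real^3) set set" and \<nu> :: real and k :: nat
    and f u \<psi> :: "real^3 \<Rightarrow> real^3" and \<sigma> :: "real^3 \<Rightarrow> real^3^3" and p :: "real^3 \<Rightarrow> real"
  assumes dom: "lipschitz_domain \<Omega>" and sc: "simply_connected \<Omega>"
    and nu: "\<nu> > 0" and fL2: "L2 \<Omega> f"
    and mesh: "mesh \<T> \<Omega>" and k: "k \<ge> 2"
    and u: "H10vec \<Omega> u" and sig: "H1mat \<Omega> \<sigma>"
    and p: "L2 \<Omega> p" "(LINT x:\<Omega>|lebesgue. p x) = 0"
    and eq1: "AE x in lebesgue. x \<in> \<Omega> \<longrightarrow> (1 / \<nu>) *\<^sub>R dev (\<sigma> x) - wgrad \<Omega> u x = 0"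
    and eq2: "\<forall>g i. test_fun \<Omega> g \<longrightarrow>
       - (LINT x:\<Omega>|lebesgue. (\<Sum>j\<in>UNIV. \<sigma> x $ i $ j * cpartial j g x))
       + (LINT x:\<Omega>|lebesgue. p x * cpartial i g x)
       = - (LINT x:\<Omega>|lebesgue. f x $ i * g x)"
    and eq3: "is_wdiv \<Omega> u (\<lambda>x. 0)"
    and psi: "Psi \<Omega> \<psi>" and curlpsi: "is_wcurl \<Omega> \<psi> u"
  shows "\<forall>\<tau>h \<phi>h. Sigmah \<T> (k - 1) \<tau>h \<and> Wh \<T> \<Omega> k \<phi>h \<longrightarrow>
      aform \<nu> \<Omega> \<sigma> \<tau>h + bform \<T> \<tau>h (wcurl \<Omega> \<psi>) + bform \<T> \<sigma> (wcurl \<Omega> \<phi>h)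
      = - (LINT x:\<Omega>|lebesgue. f x \<bullet> wcurl \<Omega> \<phi>h x)"
proof (intro allI impI)
  fix \<tau>h \<phi>h
  assume h: "Sigmah \<T> (k - 1) \<tau>h \<and> Wh \<T> \<Omega> k \<phi>h"
  \<comment> \<open>\<open>wcurl\<close> selects some weak curl of \<open>\<psi>\<close>; uniqueness
    identifies it with the velocity almost everywhere.\<close>
  have y: "AE x in lebesgue. x \<in> \<Omega> \<longrightarrow> wcurl \<Omega> \<psi> x = u x"
    by (rule is_wcurl_unique[OF Omega_open[OF mesh dom] Omega_bounded[OF mesh dom] wcurl_is_wcurl[OF curlpsi] curlpsi])
  show "aform \<nu> \<Omega> \<sigma> \<tau>h + bform \<T> \<tau>h (wcurl \<Omega> \<psi>) + bform \<T> \<sigma> (wcurl \<Omega> \<phi>h)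
      = - (LINT x:\<Omega>|lebesgue. f x \<bullet> wcurl \<Omega> \<phi>h x)"
    using consistency_sigma[OF mesh dom nu u sig eq1 y conjunct1[OF h]]
      consistency_curl[OF mesh dom fL2 sig p(1) eq2 conjunct2[OF h]] by simp
qed

end
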